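(* Let $k$ be a perfect field of characteristic $p\ge5$ and $R_{p,4}=k[x_0,\dots,x_4]/(x_0^2+\cdots+x_4^2)$. Then the HK density function $f=f_{R_{p,4},\mathbf m}$ is: $f(x)=x^3/3$ for $0\le x<1$; $f(x)=\frac{x^3}{3}-\frac53(x-1)^3$ for $1\le x<2$; $f(x)=\frac{x^3}3-\frac53(x-1)^3+\frac{11}3(x-2)^3$ for $2\le x<2+P_1$; for every $j\ge1$ and $2+P_j\le x<2+P_{j+1}$: $$f(x)=\frac{(3-x)^3}{3}+\frac43\sum_{i=1}^{j}\Big[\frac1{p^i}+P_i+2-x\Big]^3\mu_{-1}\overline{\mu}_{-1}^{\,i-1}+\Big[\frac83(x-2-P_j)^3-\frac4{p^j}(x-2-P_j)^2+\frac{2}{3p^{3j}}\Big]\overline{\mu}_{-1}^{\,j};$$ for every $j\ge1$ and $2+P_{j+1}+\frac1{p^{j+1}}\le x<2+P_j+\frac1{p^j}$: $$f(x)=\frac{(3-x)^3}{3}+\frac43\sum_{i=1}^{j}\Big[\frac1{p^i}+P_i+2-x\Big]^3\mu_{-1}\overline{\mu}_{-1}^{\,i-1};$$ $f(x)=\frac{(3-x)^3}3$ for $2+P_1+\frac1p\le x<3$; and $f(x)=0$ for $x\ge3$.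
   Context: $\mathbf m=(x_0,\dots,x_4)$, $\mathbf m^{[q]}=(x_0^q,\dots,x_4^q)$, and $f_{R_{p,4},\mathbf m}(x)=\lim_{s\to\infty}q^{-3}\dim_k(R_{p,4}/\mathbf m^{[q]})_{\lfloor xq\rfloor}$, $q=p^s$. Put $P_0=\frac{p-1}2$ and $P_i=\frac{p-1}{2p}\big(1+\frac1p+\cdots+\frac1{p^{i-1}}\big)$ for $i\ge1$. Let $Q_3=\mathrm{Proj}\,R_{p,4}$ over $\bar k$, $\mathcal O(m)=\mathcal O_{Q_3}(m)$, $\mathcal S$ the (rank 2) spinor bundle on $Q_3$, $F$ the absolute Frobenius of $Q_3$. Define $\mu_{-1}$ as the multiplicity of $\mathcal S(-1)$ in the (Krull–Schmidt) decomposition of $F_*\mathcal O(P_0-2)$ into line bundles $\mathcal O(t)$ and twisted spinor bundles $\mathcal S(t)$, and $\overline\mu_{-1}$ as the multiplicity of $\mathcal S(-1)$ in the decomposition of $F_*\mathcal S(P_0-1)$. Explicitly, with $Y_m=\binom{m+4}{4}-\binom{m+2}{4}$ ($m\ge0$) and $h^0(\mathcal S(m))=4\big(\binom{m+3}{4}-\binom{m+2}{4}\big)$: $4\mu_{-1}=Y_{a+2p}-5Y_{a+p}+11Y_a-Y_{p-a-3}$ with $a=P_0-2$, and $4\overline\mu_{-1}=h^0(\mathcal S(b+2p))-5h^0(\mathcal S(b+p))+11h^0(\mathcal S(b))-h^0(\mathcal S(p-b-2))$ with $b=P_0-1$. *)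

theory Defs
  imports Complex_Main "HOL-Library.Function_Algebras"
begin

text \<open>Monomials of degree n in x_0,...,x_4 with all exponents < q: the monomial
basis of the degree-n piece of k[x_0..x_4]/(x_0^q,...,x_4^q).\<close>
definition mon_deg :: "nat \<Rightarrow> nat \<Rightarrow> (nat \<Rightarrow> nat) set" where
  "mon_deg q n = {e. (\<forall>i<5. e i < q) \<and> (\<forall>i\<ge>5. e i = 0) \<and> (\<Sum>i<5. e i) = n}"

text \<open>Coordinate vector (in the monomial basis of degree n) of the image of the
monomial e (of degree n-2) under multiplication by x_0^2+...+x_4^2.\<close>
definition quad_image :: "nat \<Rightarrow> nat \<Rightarrow> (nat \<Rightarrow> nat) \<Rightarrow> ((nat \<Rightarrow> nat) \<Rightarrow> 'k::field)" where
  "quad_image q n e = (\<lambda>d. if d \<in> mon_deg q n \<and> (\<exists>i<5. d = e(i := e i + 2)) then 1 else 0)"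

text \<open>dim_k of the degree-n piece of R_{p,4}/m^[q] = k[x]/(x_i^q, x_0^2+...+x_4^2),
computed over the field 'k: dim A_n - dim (Q * A_{n-2}) where A = k[x]/(x_i^q).\<close>
definition hk_piece_dim :: "'k::field itself \<Rightarrow> nat \<Rightarrow> nat \<Rightarrow> nat" where
  "hk_piece_dim _ q n =
     card (mon_deg q n) -
     (if n < 2 then 0 else
       vector_space.dim (\<lambda>(c::'k) (f :: (nat \<Rightarrow> nat) \<Rightarrow> 'k) x. c * f x)
         ((\<lambda>e. (quad_image q n e :: (nat \<Rightarrow> nat) \<Rightarrow> 'k)) ` mon_deg q (n - 2)))"

definition hk_seq :: "'k::field itself \<Rightarrow> nat \<Rightarrow> real \<Rightarrow> nat \<Rightarrow> real" where
  "hk_seq K p x s = real (hk_piece_dim K (p ^ s) (nat \<lfloor>x * real (p ^ s)\<rfloor>)) / real (p ^ s) ^ 3"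

definition P0 :: "nat \<Rightarrow> nat" where "P0 p = (p - 1) div 2"

definition Pj :: "nat \<Rightarrow> nat \<Rightarrow> real" where
  "Pj p i = (real p - 1) / (2 * real p) * (\<Sum>t<i. 1 / real p ^ t)"

definition Ynum :: "nat \<Rightarrow> nat" where
  "Ynum m = ((m + 4) choose 4) - ((m + 2) choose 4)"

definition h0S :: "nat \<Rightarrow> nat" where
  "h0S m = 4 * (((m + 3) choose 4) - ((m + 2) choose 4))"

definition mu_m1 :: "nat \<Rightarrow> real" where
  "mu_m1 p = (let a = P0 p - 2 in
     (real (Ynum (a + 2*p)) - 5 * real (Ynum (a + p)) + 11 * real (Ynum a)
       - real (Ynum (p - a - 3))) / 4)"

definition mubar_m1 :: "nat \<Rightarrow> real" where
  "mubar_m1 p = (let b = P0 p - 1 in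
     (real (h0S (b + 2*p)) - 5 * real (h0S (b + p)) + 11 * real (h0S b)
       - real (h0S (p - b - 2))) / 4)"

end

theory Submission
  imports Defs "HOL-Library.Poly_Mapping" "HOL-Computational_Algebra.Computational_Algebra"
begin

text \<open>Let q = p^s and A = k[x_0,...,x_4]/(x_i^q). A linear substitution that preserves the Frobenius
power of the maximal ideal turns the sum of squares into Q = x_0 x_1 + x_2 x_3 + x_4^2. The differences of
the exponents of x_0, x_1 and of x_2, x_3 are a grading (j, l) which Q respects, and it splits the kernel of
Q on A into kernels of X + Y + Z on k[X,Y,Z]/(X^a, Y^b, Z^c) with a = q - |j|, b = q - |l| and c next to q/2.
As in Han's theorem on syzygies, such a kernel has dimension (p^k - 2 D - 2 G)/4 up to a bounded error, or
is zero up to a bounded error if this is negative: D is the taxicab distance from (j, l) to the closest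
point of p^k Z^2, with k maximal subject to 2 D < p^k, and G depends only on the degree. The points that
belong to a given k form a self-similar pattern whose counting numbers are mu (p^2+1)^i/2^i with
mu = (p^2-1)/2; this is the origin of the powers in the density. Above x = 5/2 the pairing on A identifies
the density with that of the kernel; below x = 5/2 rank and nullity add the Hilbert function of A.\<close>

section \<open>Self-similar tilings of the plane\<close>

text \<open>All strings of one degree share the gap \<open>G = a + b + c - 2 e\<close>, so the
  question is how large a gap a syzygy of \<open>X^a\<close>, \<open>Y^b\<close>,
  \<open>(X+Y)^c\<close> can have. Since \<open>2 c\<close> is \<open>q - 1\<close> or
  \<open>q + 1\<close> and \<open>q\<close> is an odd multiple of \<open>p^k\<close>, the exponent
  \<open>c\<close> stays at distance about \<open>p^k / 2\<close> from the nearest multiples of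
  \<open>p^k\<close>, one on either side. This halves the bound that a general third exponent would
  allow, and it leaves the parity of the third multiple free, so that a syzygy of gap one above a
  suitable point \<open>(u1, u2)\<close> always exists. Hence only \<open>(j, l)\<close> decides.

  Estimates suffice: there are about \<open>4 q^2\<close> strings, and bounded errors vanish against
  \<open>q^3\<close>.

  In the coordinates \<open>j + l\<close>, \<open>j - l\<close> taxicab balls become squares, and
  \<open>p^k Z^2\<close> becomes the set of square centres whose indices have even sum. At the top
  level the strings fill one even square, parts of four odd squares, and parts of even squares
  around nonzero points, where the kernel vanishes. The four odd squares give the factor 4 in the
  density, and the weights are the numbers of even and odd subsquares of an odd square.\<close>

definition tile :: "nat \<Rightarrow> nat \<Rightarrow> int \<Rightarrow> int set" where
  "tile p k a = {X. 2 * \<bar>X - int p ^ k * a\<bar> < int p ^ k}"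

lemma double_abs_less: "2 * \<bar>z\<bar> < N \<Longrightarrow> \<bar>z\<bar> \<le> N" for z N :: int
  by linarith

lemma double_abs_less_one: "2 * \<bar>z\<bar> < 1 \<Longrightarrow> z = 0" for z :: int
  by linarith

lemma double_abs_triangle: "2 * \<bar>X - u\<bar> < A \<Longrightarrow> 2 * \<bar>X - c\<bar> < B \<Longrightarrow> 2 * \<bar>c - u\<bar> < A + B" for X u c A B :: int
  by (auto simp: abs_if split: if_splits)

lemma double_abs_triangle_le: "2 * \<bar>X - c\<bar> < A \<Longrightarrow> \<bar>c - u\<bar> = B \<Longrightarrow> 2 * \<bar>X - u\<bar> < A + 2 * B" for X u c A B :: int
  by (auto simp: abs_if split: if_splits)

lemma double_abs_mem: "2 * \<bar>z\<bar> < 1 + P \<Longrightarrow> P = 2 * m + 1 \<Longrightarrow> z \<in> {- m..m}" for z P m :: int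
  by (auto simp: abs_if split: if_splits)

lemma card_int_interval: "real (card {- int m..int m}) = real (2 * m + 1)"
  by simp

lemma tile_eq:
  assumes "int p ^ k = 2 * h + 1"
  shows "tile p k a = {int p ^ k * a - h..int p ^ k * a + h}"
  unfolding tile_def assms by auto

lemma finite_tile: "finite (tile p k a)"
proof (rule finite_subset)
  show "tile p k a \<subseteq> {int p ^ k * a - int p ^ k..int p ^ k * a + int p ^ k}"
  proof
    fix X assume "X \<in> tile p k a"
    then have "2 * \<bar>X - int p ^ k * a\<bar> < int p ^ k" unfolding tile_def by simp
    then have "\<bar>X - int p ^ k * a\<bar> \<le> int p ^ k" by (rule double_abs_less)
    then show "X \<in> {int p ^ k * a - int p ^ k..int p ^ k * a + int p ^ k}" by (simp add: abs_le_iff)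
  qed
qed simp

lemma tile_unique:
  assumes "X \<in> tile p k a" "X \<in> tile p k b"
  shows "a = b"
proof (rule ccontr)
  assume "a \<noteq> b"
  then have "int p ^ k * 1 \<le> int p ^ k * \<bar>a - b\<bar>" by (intro mult_left_mono) auto
  also have "\<dots> = \<bar>int p ^ k * a - int p ^ k * b\<bar>"
    using abs_mult[of "int p ^ k" "a - b"] by (simp add: right_diff_distrib)
  finally show False using assms unfolding tile_def by (simp add: abs_if split: if_splits)
qed

lemma tile_exists:
  assumes "odd p"
  shows "\<exists>a. X \<in> tile p k a"
proof -
  define N where "N = int p ^ k"
  have "odd N" unfolding N_def using assms by simp
  then obtain h where h: "N = 2 * h + 1" by (rule oddE)
  have N0: "N > 0" unfolding N_def using assms by (simp add: odd_pos)
  \<comment> \<open>Rounding of \<open>X / N\<close> to the nearest integer; since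
    \<open>N = 2 h + 1\<close> is odd there are no ties.\<close>
  define a where "a = (X + h) div N"
  have "X + h = N * a + (X + h) mod N" unfolding a_def by simp
  moreover have "0 \<le> (X + h) mod N" "(X + h) mod N < N" using N0 by simp_all
  ultimately have "\<bar>X - N * a\<bar> \<le> h" using h by linarith
  then have "2 * \<bar>X - N * a\<bar> < N" using h by simp
  then show ?thesis unfolding tile_def N_def by blast
qed

text \<open>Because \<open>p\<close> is odd, the ends of a large tile are ends of small ones: a
  small tile that meets the large one has its centre index within \<open>m\<close> of
  \<open>p a\<close>, and then it lies inside completely.\<close>

lemma tile_Suc:
  assumes p: "p = 2 * m + 1"
  shows "tile p (Suc k) a = (\<Union>i\<in>{- int m..int m}. tile p k (int p * a + i))"
proof
  define N where "N = int p ^ k"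
  have N0: "N > 0" unfolding N_def using p by simp
  have ab: "\<bar>N * x - N * (int p * a)\<bar> = N * \<bar>x - int p * a\<bar>" for x
    using abs_mult[of N "x - int p * a"] N0 by (simp add: right_diff_distrib)
  have NS: "int p ^ Suc k * a = N * (int p * a)" "int p ^ Suc k = N * int p" unfolding N_def by simp_all
  show "tile p (Suc k) a \<subseteq> (\<Union>i\<in>{- int m..int m}. tile p k (int p * a + i))"
  proof
    fix X assume "X \<in> tile p (Suc k) a"
    then have X: "2 * \<bar>X - N * (int p * a)\<bar> < N * int p" unfolding tile_def unfolding NS(1) unfolding NS(2) by (simp only: mem_Collect_eq)
    obtain c where "X \<in> tile p k c" using tile_exists[of p X k] p by auto
    then have c: "2 * \<bar>X - N * c\<bar> < N" unfolding tile_def N_def by simp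
    have "2 * \<bar>N * c - N * (int p * a)\<bar> < N * int p + N" by (rule double_abs_triangle[OF X c])
    then have "N * (2 * \<bar>c - int p * a\<bar>) < N * (1 + int p)" unfolding ab by (simp add: algebra_simps)
    then have "2 * \<bar>c - int p * a\<bar> < 1 + int p" using N0 by simp
    then have "c - int p * a \<in> {- int m..int m}" by (rule double_abs_mem) (simp add: p)
    moreover have "X \<in> tile p k (int p * a + (c - int p * a))" using \<open>X \<in> tile p k c\<close> by simp
    ultimately show "X \<in> (\<Union>i\<in>{- int m..int m}. tile p k (int p * a + i))" by blast
  qed
  show "(\<Union>i\<in>{- int m..int m}. tile p k (int p * a + i)) \<subseteq> tile p (Suc k) a"
  proof
    fix X assume "X \<in> (\<Union>i\<in>{- int m..int m}. tile p k (int p * a + i))"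
    then obtain i where i: "i \<in> {- int m..int m}" "X \<in> tile p k (int p * a + i)" by blast
    have c: "2 * \<bar>X - N * (int p * a + i)\<bar> < N" using i(2) unfolding tile_def N_def by simp
    have "\<bar>i\<bar> \<le> int m" using i(1) by auto
    then have im: "N * \<bar>i\<bar> \<le> N * int m" using N0 by (intro mult_left_mono) auto
    have "\<bar>N * (int p * a + i) - N * (int p * a)\<bar> = N * \<bar>i\<bar>" unfolding ab by simp
    from double_abs_triangle_le[OF c this] have "2 * \<bar>X - N * (int p * a)\<bar> < N + 2 * (N * \<bar>i\<bar>)" .
    also have "\<dots> \<le> N + 2 * (N * int m)" using im by simp
    also have "\<dots> = N * int p" using p by (simp add: algebra_simps)
    finally show "X \<in> tile p (Suc k) a" unfolding tile_def unfolding NS(1) unfolding NS(2) by (simp only: mem_Collect_eq)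
  qed
qed

lemma sum_tile_Suc:
  fixes f :: "int \<Rightarrow> real"
  assumes p: "p = 2 * m + 1"
  shows "(\<Sum>X\<in>tile p (Suc k) a. f X) = (\<Sum>i\<in>{- int m..int m}. \<Sum>X\<in>tile p k (int p * a + i). f X)"
  unfolding tile_Suc[OF p]
proof (rule sum.UNION_disjoint)
  show "\<forall>i\<in>{- int m..int m}. finite (tile p k (int p * a + i))" by (simp add: finite_tile)
  show "\<forall>i\<in>{- int m..int m}. \<forall>j\<in>{- int m..int m}. i \<noteq> j \<longrightarrow> tile p k (int p * a + i) \<inter> tile p k (int p * a + j) = {}"
  proof (intro ballI impI)
    fix i j :: int assume "i \<noteq> j"
    then show "tile p k (int p * a + i) \<inter> tile p k (int p * a + j) = {}"
      using tile_unique[of _ p k "int p * a + i" "int p * a + j"] by auto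
  qed
qed simp

lemma sum_tile2_Suc:
  fixes F :: "int \<Rightarrow> int \<Rightarrow> real"
  assumes p: "p = 2 * m + 1"
  shows "(\<Sum>X\<in>tile p (Suc k) a. \<Sum>Y\<in>tile p (Suc k) b. F X Y) =
    (\<Sum>i\<in>{- int m..int m}. \<Sum>j\<in>{- int m..int m}. \<Sum>X\<in>tile p k (int p * a + i). \<Sum>Y\<in>tile p k (int p * b + j). F X Y)"
  unfolding sum_tile_Suc[OF p]
  by (rule sum.cong[OF refl]) (rule sum.swap)

section \<open>Counting even and odd points of a square\<close>

lemma sum_sign: "(\<Sum>i\<in>{- int m..int m}. if even i then 1 else (- 1 :: real)) = (if even m then 1 else - 1)"
proof (induction m)
  case (Suc m)
  have "{- int (Suc m)..int (Suc m)} = insert (- int (Suc m)) (insert (int (Suc m)) {- int m..int m})" by auto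
  then show ?case using Suc by simp
qed simp

lemma sum_half_affine:
  fixes f :: "'a \<Rightarrow> real"
  shows "(\<Sum>i\<in>I. (c + x * f i) / 2) = (real (card I) * c + x * (\<Sum>i\<in>I. f i)) / 2"
proof -
  have "(\<Sum>i\<in>I. (c + x * f i) / 2) = (\<Sum>i\<in>I. c + x * f i) / 2" by (rule sum_divide_distrib[symmetric])
  also have "(\<Sum>i\<in>I. c + x * f i) = (\<Sum>i\<in>I. c) + (\<Sum>i\<in>I. x * f i)" by (rule sum.distrib)
  also have "(\<Sum>i\<in>I. x * f i) = x * (\<Sum>i\<in>I. f i)" by (rule sum_distrib_left[symmetric])
  finally show ?thesis by simp
qed

text \<open>With the sign \<open>s i = (-1)^i\<close> the indicator of an even sum is
  \<open>(1 + s i * s j) / 2\<close>. The signs on a symmetric interval add up to 1 or -1, so the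
  square of that sum is 1. For \<open>p = 2 m + 1\<close> the count is
  \<open>(p^2 + 1) / 2\<close>.\<close>

lemma sum_even_square:
  "(\<Sum>i\<in>{- int m..int m}. \<Sum>j\<in>{- int m..int m}. if even (i + j) then 1 else (0 :: real)) = 2 * real m ^ 2 + 2 * real m + 1"
proof -
  define s :: "int \<Rightarrow> real" where "s = (\<lambda>i. if even i then 1 else - 1)"
  let ?I = "{- int m..int m}"
  have S: "(\<Sum>i\<in>?I. s i) * (\<Sum>i\<in>?I. s i) = 1" unfolding s_def sum_sign by simp
  have pt: "(if even (i + j) then 1 else (0 :: real)) = (1 + s i * s j) / 2" for i j
    unfolding s_def by simp
  have "(\<Sum>i\<in>?I. \<Sum>j\<in>?I. if even (i + j) then 1 else (0 :: real)) = (\<Sum>i\<in>?I. (real (2 * m + 1) * 1 + (\<Sum>j\<in>?I. s j) * s i) / 2)"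
    by (rule sum.cong[OF refl]) (simp only: pt sum_half_affine card_int_interval mult.commute)
  also have "\<dots> = (real (2 * m + 1) * (real (2 * m + 1) * 1) + (\<Sum>j\<in>?I. s j) * (\<Sum>i\<in>?I. s i)) / 2"
    unfolding sum_half_affine card_int_interval ..
  also have "\<dots> = 2 * real m ^ 2 + 2 * real m + 1" unfolding S by (simp add: field_simps power2_eq_square)
  finally show ?thesis .
qed

lemma sum_odd_square:
  "(\<Sum>i\<in>{- int m..int m}. \<Sum>j\<in>{- int m..int m}. if odd (i + j) then 1 else (0 :: real)) = 2 * real m ^ 2 + 2 * real m"
proof -
  let ?I = "{- int m..int m}"
  have pt: "(if odd (i + j) then 1 else (0 :: real)) = 1 - (if even (i + j) then 1 else 0)" for i j :: int by simp
  have "(\<Sum>i\<in>?I. \<Sum>j\<in>?I. if odd (i + j) then 1 else (0 :: real))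
      = (\<Sum>i\<in>?I. \<Sum>j\<in>?I. 1) - (\<Sum>i\<in>?I. \<Sum>j\<in>?I. if even (i + j) then 1 else 0)"
    unfolding pt sum_subtractf ..
  also have "(\<Sum>i\<in>?I. \<Sum>j\<in>?I. (1 :: real)) = real (2 * m + 1) * (real (2 * m + 1) * 1)"
    unfolding sum_constant card_int_interval ..
  finally show ?thesis unfolding sum_even_square by (simp add: field_simps power2_eq_square)
qed

text \<open>The ring of points with \<open>max |X| |Y| = d\<close> has \<open>8 d\<close> points,
  half of them even; the number \<open>4 d\<close> is read off as a difference of two consecutive
  square counts.\<close>

lemma sum_even_square_max:
  fixes f :: "int \<Rightarrow> real"
  shows "(\<Sum>X\<in>{- int h..int h}. \<Sum>Y\<in>{- int h..int h}. if even (X + Y) then f (max \<bar>X\<bar> \<bar>Y\<bar>) else 0)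
    = f 0 + (\<Sum>d=1..h. 4 * real d * f (int d))"
proof (induction h)
  case (Suc h)
  let ?S = "\<lambda>h. {- int h..int h} \<times> {- int h..int h}"
  let ?B = "?S (Suc h) - ?S h"
  have sub: "?S h \<subseteq> ?S (Suc h)" by auto
  have split: "sum G (?S (Suc h)) = sum G ?B + sum G (?S h)" for G :: "int \<times> int \<Rightarrow> real"
    by (rule sum.subset_diff[OF sub]) simp
  have cnt: "(\<Sum>(X, Y)\<in>?S m. if even (X + Y) then 1 else (0::real)) = 2 * real m ^ 2 + 2 * real m + 1" for m
    unfolding sum.cartesian_product[symmetric] by (rule sum_even_square)
  have b: "(\<Sum>(X, Y)\<in>?B. if even (X + Y) then 1 else (0::real)) = 4 * real (Suc h)"
    using split[of "\<lambda>(X, Y). if even (X + Y) then 1 else (0::real)"] unfolding cnt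
    by (simp add: power2_eq_square algebra_simps)
  have "(\<Sum>(X, Y)\<in>?B. if even (X + Y) then f (max \<bar>X\<bar> \<bar>Y\<bar>) else 0)
      = (\<Sum>(X, Y)\<in>?B. f (int (Suc h)) * (if even (X + Y) then 1 else 0))"
  proof (rule sum.cong[OF refl])
    fix v assume v: "v \<in> ?B"
    obtain X Y where v': "v = (X, Y)" by (cases v)
    have "max \<bar>X\<bar> \<bar>Y\<bar> = int (Suc h)" using v unfolding v' by auto
    then show "(case v of (X, Y) \<Rightarrow> if even (X + Y) then f (max \<bar>X\<bar> \<bar>Y\<bar>) else 0)
       = (case v of (X, Y) \<Rightarrow> f (int (Suc h)) * (if even (X + Y) then 1 else 0))" unfolding v' by simp
  qed
  also have "\<dots> = f (int (Suc h)) * (\<Sum>(X, Y)\<in>?B. if even (X + Y) then 1 else 0)"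
    unfolding sum_distrib_left by (rule sum.cong) auto
  finally have B: "(\<Sum>(X, Y)\<in>?B. if even (X + Y) then f (max \<bar>X\<bar> \<bar>Y\<bar>) else 0) = 4 * real (Suc h) * f (int (Suc h))"
    unfolding b by simp
  have "(\<Sum>(X, Y)\<in>?S (Suc h). if even (X + Y) then f (max \<bar>X\<bar> \<bar>Y\<bar>) else 0)
     = 4 * real (Suc h) * f (int (Suc h)) + (f 0 + (\<Sum>d=1..h. 4 * real d * f (int d)))"
    unfolding split B Suc[unfolded sum.cartesian_product] ..
  then show ?case unfolding sum.cartesian_product by simp
qed simp

section \<open>Sums over even and odd squares\<close>

definition diamond_sum :: "nat \<Rightarrow> nat \<Rightarrow> (int \<Rightarrow> real) \<Rightarrow> real" where
  "diamond_sum p k f = (\<Sum>X\<in>tile p k 0. \<Sum>Y\<in>tile p k 0. if even (X + Y) then f (max \<bar>X\<bar> \<bar>Y\<bar>) else 0)"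

lemma tile_shift: "tile p k a = (\<lambda>x. int p ^ k * a + x) ` tile p k 0"
proof
  show "tile p k a \<subseteq> (\<lambda>x. int p ^ k * a + x) ` tile p k 0"
  proof
    fix X assume "X \<in> tile p k a"
    then have "X - int p ^ k * a \<in> tile p k 0" unfolding tile_def by simp
    then show "X \<in> (\<lambda>x. int p ^ k * a + x) ` tile p k 0" by (rule rev_image_eqI) simp
  qed
qed (auto simp: tile_def)

lemma sum_tile_shift: "(\<Sum>X\<in>tile p k a. f X) = (\<Sum>x\<in>tile p k 0. f (int p ^ k * a + x) :: real)"
  unfolding tile_shift[of p k a] by (rule sum.reindex_cong[where l = "\<lambda>x. int p ^ k * a + x"]) (auto simp: inj_on_def)

lemma card_tile: "odd p \<Longrightarrow> real (card (tile p k a)) = real p ^ k"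
proof -
  assume "odd p"
  then have "odd (int p ^ k)" by simp
  then obtain h where h: "int p ^ k = 2 * h + 1" by (rule oddE)
  have "int p ^ k \<ge> 0" by simp
  then have "int (card (tile p k a)) = int p ^ k" unfolding tile_eq[OF h] using h by simp
  then have "real_of_int (int (card (tile p k a))) = real_of_int (int p ^ k)" by (rule arg_cong)
  then show ?thesis by simp
qed

text \<open>Translation to the centre preserves parity because the centre is \<open>p^k\<close>
  times an index pair of even sum. The total error is \<open>C\<close> times the number
  \<open>p^(2k)\<close> of points.\<close>

lemma sum_even_tile:
  fixes F :: "int \<Rightarrow> int \<Rightarrow> real"
  assumes p: "odd p" and ab: "even (a + b)"
    and zero: "\<And>X Y. odd (X + Y) \<Longrightarrow> F X Y = 0"
    and approx: "\<And>X Y. X \<in> tile p k a \<Longrightarrow> Y \<in> tile p k b \<Longrightarrow> even (X + Y) \<Longrightarrow>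
      \<bar>F X Y - f (max \<bar>X - int p ^ k * a\<bar> \<bar>Y - int p ^ k * b\<bar>)\<bar> \<le> C"
    and C: "C \<ge> 0"
  shows "\<bar>(\<Sum>X\<in>tile p k a. \<Sum>Y\<in>tile p k b. F X Y) - diamond_sum p k f\<bar> \<le> C * (real p ^ 2) ^ k"
proof -
  let ?N = "int p ^ k" and ?T = "tile p k 0"
  have par: "even (?N * a + x + (?N * b + y)) \<longleftrightarrow> even (x + y)" for x y
  proof -
    have "?N * a + x + (?N * b + y) = ?N * (a + b) + (x + y)" by (simp add: algebra_simps)
    moreover have "even (?N * (a + b))" using ab by simp
    ultimately show ?thesis by (simp only: even_add simp_thms)
  qed
  have eq: "(\<Sum>X\<in>tile p k a. \<Sum>Y\<in>tile p k b. F X Y) - diamond_sum p k f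
    = (\<Sum>x\<in>?T. \<Sum>y\<in>?T. F (?N * a + x) (?N * b + y) - (if even (x + y) then f (max \<bar>x\<bar> \<bar>y\<bar>) else 0))"
    unfolding diamond_sum_def sum_subtractf sum_tile_shift[of _ p k a] sum_tile_shift[of _ p k b] ..
  have "\<bar>\<Sum>x\<in>?T. \<Sum>y\<in>?T. F (?N * a + x) (?N * b + y) - (if even (x + y) then f (max \<bar>x\<bar> \<bar>y\<bar>) else 0)\<bar>
    \<le> (\<Sum>x\<in>?T. \<Sum>y\<in>?T. \<bar>F (?N * a + x) (?N * b + y) - (if even (x + y) then f (max \<bar>x\<bar> \<bar>y\<bar>) else 0)\<bar>)"
    by (rule order_trans[OF sum_abs]) (rule sum_mono, rule sum_abs)
  also have "\<dots> \<le> (\<Sum>x\<in>?T. \<Sum>y\<in>?T. C)"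
  proof (intro sum_mono)
    fix x y assume xy: "x \<in> ?T" "y \<in> ?T"
    then have t: "?N * a + x \<in> tile p k a" "?N * b + y \<in> tile p k b" unfolding tile_def by simp_all
    show "\<bar>F (?N * a + x) (?N * b + y) - (if even (x + y) then f (max \<bar>x\<bar> \<bar>y\<bar>) else 0)\<bar> \<le> C"
    proof (cases "even (x + y)")
      case True
      then show ?thesis using approx[OF t] unfolding par by simp
    next
      case False
      then have "F (?N * a + x) (?N * b + y) = 0" by (intro zero) (simp only: par not_False_eq_True)
      then show ?thesis using False C by simp
    qed
  qed
  also have "\<dots> = C * (real p ^ 2) ^ k"
    using card_tile[OF p, of k 0] by (simp add: power2_eq_square power_mult_distrib)
  finally show ?thesis unfolding eq .
qed

text \<open>An odd tile of level r has (p^2 - 1)/2 even and (p^2 + 1)/2 odd children; iterating gives the weights below.\<close>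
lemma sum_odd_tile:
  fixes F :: "int \<Rightarrow> int \<Rightarrow> real" and f :: "nat \<Rightarrow> int \<Rightarrow> real"
  assumes p: "p = 2 * m + 1" and C: "C \<ge> 0"
    and zero: "\<And>X Y. odd (X + Y) \<Longrightarrow> F X Y = 0"
    and approx: "\<And>k a b X Y. k < s \<Longrightarrow> even (a + b) \<Longrightarrow> X \<in> tile p k a \<Longrightarrow> Y \<in> tile p k b \<Longrightarrow> even (X + Y) \<Longrightarrow>
      (\<And>k' a' b'. k < k' \<Longrightarrow> k' \<le> s \<Longrightarrow> X \<in> tile p k' a' \<Longrightarrow> Y \<in> tile p k' b' \<Longrightarrow> odd (a' + b')) \<Longrightarrow>
      Q X Y \<Longrightarrow> \<bar>F X Y - f k (max \<bar>X - int p ^ k * a\<bar> \<bar>Y - int p ^ k * b\<bar>)\<bar> \<le> C"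
    and "r \<le> s" "odd (a + b)"
    and "\<And>X Y. X \<in> tile p r a \<Longrightarrow> Y \<in> tile p r b \<Longrightarrow> Q X Y"
    and "\<And>X Y k' a' b'. X \<in> tile p r a \<Longrightarrow> Y \<in> tile p r b \<Longrightarrow> r < k' \<Longrightarrow> k' \<le> s \<Longrightarrow> X \<in> tile p k' a' \<Longrightarrow> Y \<in> tile p k' b' \<Longrightarrow> odd (a' + b')"
  shows "\<bar>(\<Sum>X\<in>tile p r a. \<Sum>Y\<in>tile p r b. F X Y)
     - (\<Sum>k<r. ((real p ^ 2 - 1) / 2) * ((real p ^ 2 + 1) / 2) ^ (r - 1 - k) * diamond_sum p k (f k))\<bar> \<le> C * (real p ^ 2) ^ r"
  using assms(5-)
proof (induction r arbitrary: a b)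
  case 0
  have "tile p 0 x = {x}" for x
  proof -
    have "X = x" if "2 * \<bar>X - x\<bar> < 1" for X using double_abs_less_one[OF that] by simp
    then show ?thesis unfolding tile_def by auto
  qed
  then show ?case using zero[OF 0(2)] C by simp
next
  case (Suc r)
  let ?I = "{- int m..int m}"
  define \<mu> \<nu> where "\<mu> = (real p ^ 2 - 1) / 2" and "\<nu> = (real p ^ 2 + 1) / 2"
  have \<mu>: "\<mu> = 2 * real m ^ 2 + 2 * real m" and \<nu>: "\<nu> = 2 * real m ^ 2 + 2 * real m + 1"
    unfolding \<mu>_def \<nu>_def p by (simp_all add: power2_eq_square field_simps)
  have po: "odd p" using p by simp
  define E where "E r = (\<Sum>k<r. \<mu> * \<nu> ^ (r - 1 - k) * diamond_sum p k (f k))" for r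
  define S where "S i j = (\<Sum>X\<in>tile p r (int p * a + i). \<Sum>Y\<in>tile p r (int p * b + j). F X Y)" for i j
  have sub: "X \<in> tile p (Suc r) c" if "X \<in> tile p r (int p * c + i)" "i \<in> ?I" for X c i
    unfolding tile_Suc[OF p] using that by blast
  have par: "even (int p * a + i + (int p * b + j)) \<longleftrightarrow> odd (i + j)" for i j
  proof -
    have "int p * a + i + (int p * b + j) = int p * (a + b) + (i + j)" by (simp add: algebra_simps)
    moreover have "odd (int p * (a + b))" using po Suc.prems(2) by simp
    ultimately show ?thesis by (simp only: even_add simp_thms)
  qed
  \<comment> \<open>The squares above a child are the parent and the squares above the parent, all
    of them odd. So the level of an even child is the largest level at which its points lie in an
    even square, which is what \<open>approx\<close> requires.\<close>
  have anc: "odd (a' + b')" if X: "X \<in> tile p r (int p * a + i)" "Y \<in> tile p r (int p * b + j)" "i \<in> ?I" "j \<in> ?I"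
     and k': "r < k'" "k' \<le> s" "X \<in> tile p k' a'" "Y \<in> tile p k' b'" for X Y i j k' a' b'
  proof (cases "k' = Suc r")
    case True
    have "a' = a" "b' = b" using tile_unique sub X k' unfolding True by blast+
    then show ?thesis using Suc.prems(2) by simp
  next
    case False
    then have "Suc r < k'" using k'(1) by simp
    then show ?thesis using Suc.prems(4)[OF sub[OF X(1,3)] sub[OF X(2,4)] _ k'(2-4)] by blast
  qed
  have child: "\<bar>S i j - (if odd (i + j) then diamond_sum p r (f r) else E r)\<bar> \<le> C * (real p ^ 2) ^ r"
    if ij: "i \<in> ?I" "j \<in> ?I" for i j
  proof (cases "odd (i + j)")
    case True
    have ev: "even (int p * a + i + (int p * b + j))" unfolding par by (rule True)
    have "\<bar>S i j - diamond_sum p r (f r)\<bar> \<le> C * (real p ^ 2) ^ r"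
      unfolding S_def
    proof (rule sum_even_tile[OF po ev zero _ C])
      fix X Y assume XY: "X \<in> tile p r (int p * a + i)" "Y \<in> tile p r (int p * b + j)" "even (X + Y)"
      have rs: "r < s" using Suc.prems(1) by simp
      show "\<bar>F X Y - f r (max \<bar>X - int p ^ r * (int p * a + i)\<bar> \<bar>Y - int p ^ r * (int p * b + j)\<bar>)\<bar> \<le> C"
        by (rule approx[OF rs ev XY]) (erule (3) anc[OF XY(1,2) ij], rule Suc.prems(3)[OF sub[OF XY(1) ij(1)] sub[OF XY(2) ij(2)]])
    qed
    then show ?thesis using True by simp
  next
    case False
    have od: "odd (int p * a + i + (int p * b + j))" unfolding par by (rule False)
    have "r \<le> s" using Suc.prems(1) by simp
    from Suc.IH[OF this od] have "\<bar>S i j - E r\<bar> \<le> C * (real p ^ 2) ^ r"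
      unfolding S_def E_def \<mu>_def \<nu>_def using anc[OF _ _ ij] Suc.prems(3)[OF sub[OF _ ij(1)] sub[OF _ ij(2)]] by blast
    then show ?thesis using False by simp
  qed
  have Esuc: "E (Suc r) = \<mu> * diamond_sum p r (f r) + \<nu> * E r"
  proof -
    have "\<mu> * \<nu> ^ (Suc r - 1 - k) * d = \<nu> * (\<mu> * \<nu> ^ (r - 1 - k) * d)" if "k < r" for k d
    proof -
      have "Suc r - 1 - k = Suc (r - 1 - k)" using that by simp
      then show ?thesis by (simp only: power_Suc) (simp only: ac_simps)
    qed
    then have "(\<Sum>k<r. \<mu> * \<nu> ^ (Suc r - 1 - k) * diamond_sum p k (f k)) = \<nu> * E r"
      unfolding E_def sum_distrib_left by (intro sum.cong refl) simp
    then show ?thesis unfolding E_def sum.lessThan_Suc by simp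
  qed
  have "(\<Sum>i\<in>?I. \<Sum>j\<in>?I. if odd (i + j) then diamond_sum p r (f r) else E r)
     = (\<Sum>i\<in>?I. \<Sum>j\<in>?I. (if odd (i + j) then 1 else 0) * diamond_sum p r (f r) + (if even (i + j) then 1 else 0) * E r)"
    by (intro sum.cong refl) auto
  also have "\<dots> = \<mu> * diamond_sum p r (f r) + \<nu> * E r"
    unfolding sum.distrib sum_distrib_right[symmetric] sum_odd_square sum_even_square \<mu> \<nu> ..
  finally have tot: "(\<Sum>i\<in>?I. \<Sum>j\<in>?I. if odd (i + j) then diamond_sum p r (f r) else E r) = E (Suc r)"
    unfolding Esuc .
  have "(\<Sum>X\<in>tile p (Suc r) a. \<Sum>Y\<in>tile p (Suc r) b. F X Y) - E (Suc r)
     = (\<Sum>i\<in>?I. \<Sum>j\<in>?I. S i j - (if odd (i + j) then diamond_sum p r (f r) else E r))"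
    unfolding sum_tile2_Suc[OF p] S_def[symmetric] tot[symmetric] sum_subtractf ..
  also have "\<bar>\<dots>\<bar> \<le> (\<Sum>i\<in>?I. \<Sum>j\<in>?I. \<bar>S i j - (if odd (i + j) then diamond_sum p r (f r) else E r)\<bar>)"
    by (rule order_trans[OF sum_abs]) (rule sum_mono, rule sum_abs)
  also have "\<dots> \<le> (\<Sum>i\<in>?I. \<Sum>j\<in>?I. C * (real p ^ 2) ^ r)"
    by (intro sum_mono child)
  also have "\<dots> = C * (real p ^ 2) ^ Suc r" 
    unfolding sum_constant card_int_interval p[symmetric] by (simp add: power2_eq_square)
  finally show ?case unfolding E_def \<mu>_def \<nu>_def .
qed

section \<open>The cubic main term of a diamond sum\<close>

text \<open>The comparison polynomial is the integral of \<open>4 t (L - t)\<close> from 0 to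
  \<open>D\<close>. Each summand differs from the increment of this polynomial by an amount of size
  at most \<open>2 L + 4/3\<close>.\<close>

lemma triangle_layer_sum:
  fixes L :: real
  assumes "real D \<le> L"
  shows "\<bar>(\<Sum>d=1..D. 4 * real d * (L - real d)) - (2 * L * real D ^ 2 - 4 / 3 * real D ^ 3)\<bar> \<le> real D * (2 * L + 4 / 3)"
  using assms
proof (induction D)
  case (Suc D)
  have e: "4 * real (Suc D) * (L - real (Suc D)) - ((2 * L * real (Suc D) ^ 2 - 4 / 3 * real (Suc D) ^ 3) - (2 * L * real D ^ 2 - 4 / 3 * real D ^ 3))
     = 2 * L - 4 * real (Suc D) + 4 / 3"
    by (simp add: power2_eq_square power3_eq_cube field_simps)
  have "\<bar>2 * L - 4 * real (Suc D) + 4 / 3\<bar> \<le> 2 * L + 4 / 3" using Suc.prems by (auto simp: abs_if)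
  moreover have "\<bar>(\<Sum>d=1..D. 4 * real d * (L - real d)) - (2 * L * real D ^ 2 - 4 / 3 * real D ^ 3)\<bar> \<le> real D * (2 * L + 4 / 3)"
    using Suc by simp
  moreover have "(\<Sum>d=1..Suc D. 4 * real d * (L - real d)) - (2 * L * real (Suc D) ^ 2 - 4 / 3 * real (Suc D) ^ 3)
     = ((\<Sum>d=1..D. 4 * real d * (L - real d)) - (2 * L * real D ^ 2 - 4 / 3 * real D ^ 3)) + (2 * L - 4 * real (Suc D) + 4 / 3)"
    unfolding e[symmetric] by simp
  ultimately have "\<bar>(\<Sum>d=1..Suc D. 4 * real d * (L - real d)) - (2 * L * real (Suc D) ^ 2 - 4 / 3 * real (Suc D) ^ 3)\<bar>
     \<le> real D * (2 * L + 4 / 3) + (2 * L + 4 / 3)"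
    by (simp only:)
  moreover have "real D * (2 * L + 4 / 3) + (2 * L + 4 / 3) = real (Suc D) * (2 * L + 4 / 3)"
    by (simp add: distrib_right)
  ultimately show ?case by (simp only:)
qed simp


text \<open>With \<open>L = p^k / 2 - G\<close> the summand at distance \<open>d\<close> is
  \<open>max 0 (L - d) / 2\<close> and the ring at distance \<open>d\<close> has \<open>4 d\<close>
  even points. The main term is therefore half of \<open>2 L^3 - 4/3 L^3\<close>.\<close>

lemma diamond_sum_estimate:
  fixes G :: real
  assumes p: "odd p" and G: "G \<ge> 0"
  shows "\<bar>diamond_sum p k (\<lambda>d. max 0 ((real p ^ k - 2 * real_of_int d - 2 * G) / 4))
     - 1 / 3 * max 0 (real p ^ k / 2 - G) ^ 3\<bar> \<le> 4 * (real p ^ 2) ^ k"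
proof -
  let ?f = "\<lambda>d :: int. max 0 ((real p ^ k - 2 * real_of_int d - 2 * G) / 4)"
  define N where "N = real p ^ k"
  define L where "L = N / 2 - G"
  have "odd (p ^ k)" using p by simp
  then obtain h where h: "p ^ k = 2 * h + 1" by (rule oddE)
  have ih: "int p ^ k = 2 * int h + 1" using arg_cong[OF h, of int] by simp
  have Nh: "N = 2 * real h + 1" unfolding N_def using arg_cong[OF h, of real] by simp
  have f: "?f d = max 0 (L - real_of_int d) / 2" for d
    unfolding L_def N_def by (auto simp: max_def field_simps)
  have N2: "(real p ^ 2) ^ k = N ^ 2" unfolding N_def by (simp add: power_mult[symmetric] mult.commute)
  have "diamond_sum p k ?f = ?f 0 + (\<Sum>d=1..h. 4 * real d * ?f (int d))"
    unfolding diamond_sum_def tile_eq[OF ih] using sum_even_square_max[where h = h and f = ?f] by simp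
  then have ds: "diamond_sum p k ?f = max 0 L / 2 + (\<Sum>d=1..h. 4 * real d * (max 0 (L - real d) / 2))"
    unfolding f by simp
  show ?thesis
  proof (cases "L \<le> 0")
    case True
    have z: "max 0 (L - real d) = 0" for d using True by simp
    have "diamond_sum p k ?f = 0" unfolding ds z using True by simp
    moreover have "max 0 (real p ^ k / 2 - G) = 0" using True unfolding L_def N_def by simp
    ultimately show ?thesis by simp
  next
    case False
    define D where "D = nat \<lfloor>L\<rfloor>"
    have D: "real D \<le> L" "L < real D + 1" unfolding D_def using False by linarith+
    have LN: "L \<le> N / 2" unfolding L_def using G by simp
    have Dh: "D \<le> h" using D(1) LN Nh by linarith
    have "(\<Sum>d=1..h. 4 * real d * (max 0 (L - real d) / 2)) = (\<Sum>d=1..D. 4 * real d * (max 0 (L - real d) / 2))"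
    proof (rule sum.mono_neutral_right)
      show "\<forall>d\<in>{1..h} - {1..D}. 4 * real d * (max 0 (L - real d) / 2) = 0"
      proof
        fix d assume "d \<in> {1..h} - {1..D}"
        then have "real D + 1 \<le> real d" by auto
        then have "max 0 (L - real d) = 0" using D(2) by simp
        then show "4 * real d * (max 0 (L - real d) / 2) = 0" by simp
      qed
    qed (use Dh in auto)
    also have "\<dots> = (\<Sum>d=1..D. 4 * real d * (L - real d)) / 2"
      unfolding sum_divide_distrib by (rule sum.cong[OF refl]) (use D(1) in auto)
    finally have dsL: "diamond_sum p k ?f = L / 2 + (\<Sum>d=1..D. 4 * real d * (L - real d)) / 2"
      unfolding ds using False by simp
    \<comment> \<open>The polynomial \<open>2 L t^2 - 4/3 t^3\<close> has derivative zero at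
      \<open>t = L\<close>, so replacing the integer part \<open>D\<close> by \<open>L\<close> costs
      only terms linear in \<open>L\<close>.\<close>
    define \<theta> where "\<theta> = L - real D"
    have th: "0 \<le> \<theta>" "\<theta> \<le> 1" unfolding \<theta>_def using D by simp_all
    have DL: "real D = L - \<theta>" unfolding \<theta>_def by simp
    have id: "2 * L * real D ^ 2 - 4 / 3 * real D ^ 3 - 2 / 3 * L ^ 3 = 4 / 3 * \<theta> ^ 3 - 2 * L * \<theta> ^ 2"
      unfolding DL by (simp add: power2_eq_square power3_eq_cube field_simps)
    have t3: "0 \<le> \<theta> ^ 3" "\<theta> ^ 3 \<le> 1" and t2: "0 \<le> \<theta> ^ 2" "\<theta> ^ 2 \<le> 1"
      using th by (simp_all add: power_le_one)
    have "L * \<theta> ^ 2 \<le> L * 1" using False t2 by (intro mult_left_mono) auto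
    then have y01: "L * \<theta> ^ 2 \<le> L" "0 \<le> L * \<theta> ^ 2" using False t2 by simp_all
    have e1: "\<bar>2 * L * real D ^ 2 - 4 / 3 * real D ^ 3 - 2 / 3 * L ^ 3\<bar> \<le> 2 * L + 4 / 3"
    proof -
      have "\<bar>4 / 3 * t - 2 * y\<bar> \<le> 2 * L + 4 / 3" if "0 \<le> t" "t \<le> 1" "y \<le> L" "0 \<le> y" for t y :: real
        using that False by (auto simp: abs_le_iff)
      from this[of "\<theta> ^ 3" "L * \<theta> ^ 2"] show ?thesis unfolding id using t3 y01 by (simp add: mult.assoc)
    qed
    have "real D * (2 * L + 4 / 3) \<le> L * (2 * L + 4 / 3)" using D False by (intro mult_right_mono) auto
    then have e2: "\<bar>(\<Sum>d=1..D. 4 * real d * (L - real d)) - (2 * L * real D ^ 2 - 4 / 3 * real D ^ 3)\<bar> \<le> L * (2 * L + 4 / 3)"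
      using triangle_layer_sum[OF D(1)] by linarith
    define S where "S = (\<Sum>d=1..D. 4 * real d * (L - real d))"
    have e3: "\<bar>S - 2 / 3 * L ^ 3\<bar> \<le> L * (2 * L + 4 / 3) + (2 * L + 4 / 3)"
      using e1 e2 unfolding S_def by linarith
    have e4: "\<bar>(L / 2 + S / 2) - 1 / 3 * L ^ 3\<bar> \<le> L / 2 + (L * (2 * L + 4 / 3) + (2 * L + 4 / 3)) / 2"
    proof -
      have "\<bar>(a / 2 + S' / 2) - 1 / 3 * t\<bar> \<le> a / 2 + R / 2" if "\<bar>S' - 2 / 3 * t\<bar> \<le> R" "0 < a" for a S' t R :: real
        using that by linarith
      from this[OF e3, of L] show ?thesis using False by simp
    qed
    have N1: "N \<ge> 1" using Nh by simp
    have LL: "L * L \<le> N / 2 * (N / 2)" using LN False by (intro mult_mono) auto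
    have NN: "N \<le> N * N" "1 \<le> N * N" using N1 mult_mono[of 1 N 1 N] mult_left_mono[of 1 N N] by simp_all
    have "L / 2 + (L * (2 * L + 4 / 3) + (2 * L + 4 / 3)) / 2 = L * L + 13 / 6 * L + 2 / 3" by (simp add: field_simps)
    also have "\<dots> \<le> N * N / 4 + 13 / 12 * N + 2 / 3" using LL LN by simp
    also have "\<dots> \<le> 4 * N ^ 2" using NN unfolding power2_eq_square by linarith
    finally have fin: "\<bar>(L / 2 + S / 2) - 1 / 3 * L ^ 3\<bar> \<le> 4 * N ^ 2" using e4 by linarith
    have "max 0 (real p ^ k / 2 - G) = L" using False unfolding L_def N_def by simp
    then show ?thesis using fin unfolding dsL N2 S_def by simp
  qed
qed

text \<open>A count with \<open>P = p^2\<close>: of the \<open>P^s\<close> points of an odd square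
  of level \<open>s\<close>, the summand for \<open>k\<close> counts those whose largest even square
  has level \<open>k\<close>. Exactly \<open>((P + 1) / 2)^s\<close> points are left, the odd ones
  at level 0.\<close>

lemma sum_weights_le:
  fixes P :: real
  assumes "P \<ge> 1"
  shows "(\<Sum>k<s. ((P - 1) / 2) * ((P + 1) / 2) ^ (s - 1 - k) * P ^ k) \<le> P ^ s"
proof -
  have "(\<Sum>k<s. ((P - 1) / 2) * ((P + 1) / 2) ^ (s - 1 - k) * P ^ k) = P ^ s - ((P + 1) / 2) ^ s"
  proof (induction s)
    case (Suc s)
    have "((P - 1) / 2) * ((P + 1) / 2) ^ (Suc s - 1 - k) * P ^ k = ((P + 1) / 2) * (((P - 1) / 2) * ((P + 1) / 2) ^ (s - 1 - k) * P ^ k)"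
      if "k < s" for k
    proof -
      have "Suc s - 1 - k = Suc (s - 1 - k)" using that by simp
      then show ?thesis by (simp only: power_Suc ac_simps)
    qed
    then have "(\<Sum>k<s. ((P - 1) / 2) * ((P + 1) / 2) ^ (Suc s - 1 - k) * P ^ k) = ((P + 1) / 2) * (P ^ s - ((P + 1) / 2) ^ s)"
      unfolding Suc[symmetric] sum_distrib_left by (intro sum.cong refl) simp
    then show ?case by (simp add: field_simps)
  qed simp
  moreover have "((P + 1) / 2) ^ s \<ge> 0" using assms by simp
  ultimately show ?thesis by simp
qed

section \<open>The Hilbert function of the truncated polynomial ring\<close>

definition box_exps :: "nat \<Rightarrow> nat \<Rightarrow> nat \<Rightarrow> (nat \<Rightarrow> nat) set" where
  "box_exps v q n = {e. (\<forall>i<v. e i < q) \<and> (\<forall>i\<ge>v. e i = 0) \<and> (\<Sum>i<v. e i) = n}"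

lemma box_expsI:
  "(\<And>i. i < v \<Longrightarrow> e i < q) \<Longrightarrow> (\<And>i. v \<le> i \<Longrightarrow> e i = 0) \<Longrightarrow> (\<Sum>i<v. e i) = n \<Longrightarrow> e \<in> box_exps v q n"
  unfolding box_exps_def by blast

lemma box_expsD:
  assumes "e \<in> box_exps v q n"
  shows "i < v \<Longrightarrow> e i < q" and "v \<le> i \<Longrightarrow> e i = 0" and "(\<Sum>i<v. e i) = n"
  using assms unfolding box_exps_def by blast+

lemma finite_box_exps: "finite (box_exps v q n)"
proof (rule finite_subset)
  show "box_exps v q n \<subseteq> {f. \<forall>i. (i \<in> {..<v} \<longrightarrow> f i \<in> {..<q}) \<and> (i \<notin> {..<v} \<longrightarrow> f i = 0)}"
    using box_expsD(1,2) by (intro subsetI CollectI allI conjI impI) (simp_all only: lessThan_iff not_less)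
  show "finite {f :: nat \<Rightarrow> nat. \<forall>i. (i \<in> {..<v} \<longrightarrow> f i \<in> {..<q}) \<and> (i \<notin> {..<v} \<longrightarrow> f i = 0)}"
    by (rule finite_set_of_finite_funs) (rule finite_lessThan)+
qed

lemma box_exps_Suc: "box_exps (Suc v) q n = (\<Union>i\<in>{i. i \<le> n \<and> i < q}. (\<lambda>e. e(v := i)) ` box_exps v q (n - i))"
proof
  show "box_exps (Suc v) q n \<subseteq> (\<Union>i\<in>{i. i \<le> n \<and> i < q}. (\<lambda>e. e(v := i)) ` box_exps v q (n - i))"
  proof
    fix e assume e: "e \<in> box_exps (Suc v) q n"
    have s: "(\<Sum>i<v. e i) + e v = n" using box_expsD(3)[OF e] by (simp only: sum.lessThan_Suc)
    have eq: "(\<Sum>i<v. (e(v := 0)) i) = (\<Sum>i<v. e i)" by (rule sum.cong) simp_all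
    have mem: "e(v := 0) \<in> box_exps v q (n - e v)"
    proof (rule box_expsI)
      fix i assume "i < v" then show "(e(v := 0)) i < q" using box_expsD(1)[OF e, of i] by simp
    next
      fix i assume "v \<le> i" then show "(e(v := 0)) i = 0" using box_expsD(2)[OF e, of i] by (cases "i = v") simp_all
    next
      show "(\<Sum>i<v. (e(v := 0)) i) = n - e v" unfolding eq using s by linarith
    qed
    have "e = (\<lambda>d. d(v := e v)) (e(v := 0))" by simp
    then have "e \<in> (\<lambda>d. d(v := e v)) ` box_exps v q (n - e v)" using mem by (rule image_eqI)
    moreover have "e v \<in> {i. i \<le> n \<and> i < q}" using s box_expsD(1)[OF e, of v] by simp
    ultimately show "e \<in> (\<Union>i\<in>{i. i \<le> n \<and> i < q}. (\<lambda>e. e(v := i)) ` box_exps v q (n - i))"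
      by (rule UN_I[rotated])
  qed
  show "(\<Union>i\<in>{i. i \<le> n \<and> i < q}. (\<lambda>e. e(v := i)) ` box_exps v q (n - i)) \<subseteq> box_exps (Suc v) q n"
  proof
    fix e assume "e \<in> (\<Union>i\<in>{i. i \<le> n \<and> i < q}. (\<lambda>e. e(v := i)) ` box_exps v q (n - i))"
    then obtain i d where i: "i \<le> n" "i < q" and d: "d \<in> box_exps v q (n - i)" and e: "e = d(v := i)" by blast
    have eq: "(\<Sum>j<v. (d(v := i)) j) = (\<Sum>j<v. d j)" by (rule sum.cong) simp_all
    show "e \<in> box_exps (Suc v) q n" unfolding e
    proof (rule box_expsI)
      fix j assume "j < Suc v" then show "(d(v := i)) j < q" using box_expsD(1)[OF d, of j] i(2) by (cases "j = v") simp_all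
    next
      fix j assume "Suc v \<le> j" then show "(d(v := i)) j = 0" using box_expsD(2)[OF d, of j] by simp
    next
      show "(\<Sum>j<Suc v. (d(v := i)) j) = n" unfolding sum.lessThan_Suc eq using box_expsD(3)[OF d] i(1) by simp
    qed
  qed
qed

lemma card_box_exps_Suc: "card (box_exps (Suc v) q n) = (\<Sum>i\<in>{i. i \<le> n \<and> i < q}. card (box_exps v q (n - i)))"
proof -
  have inj: "inj_on (\<lambda>e. e(v := i)) (box_exps v q m)" for i m
  proof (rule inj_onI)
    fix d e assume de: "d \<in> box_exps v q m" "e \<in> box_exps v q m" "d(v := i) = e(v := i)"
    show "d = e"
    proof
      fix j
      show "d j = e j"
      proof (cases "j = v")
        case True then show ?thesis using box_expsD(2)[OF de(1), of j] box_expsD(2)[OF de(2), of j] by simp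
      next
        case False then show ?thesis using fun_cong[OF de(3), of j] by simp
      qed
    qed
  qed
  have "card (box_exps (Suc v) q n) = (\<Sum>i\<in>{i. i \<le> n \<and> i < q}. card ((\<lambda>e. e(v := i)) ` box_exps v q (n - i)))"
    unfolding box_exps_Suc
  proof (rule card_UN_disjoint)
    show "\<forall>i\<in>{i. i \<le> n \<and> i < q}. \<forall>j\<in>{i. i \<le> n \<and> i < q}. i \<noteq> j \<longrightarrow>
      (\<lambda>e. e(v := i)) ` box_exps v q (n - i) \<inter> (\<lambda>e. e(v := j)) ` box_exps v q (n - j) = {}"
    proof (intro ballI impI)
      fix i j :: nat assume "i \<noteq> j"
      have "x v = i" if "x \<in> (\<lambda>e. e(v := i)) ` S" for x and i :: nat and S
        using that by (rule imageE) (simp only: fun_upd_same)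
      then show "(\<lambda>e. e(v := i)) ` box_exps v q (n - i) \<inter> (\<lambda>e. e(v := j)) ` box_exps v q (n - j) = {}"
        using \<open>i \<noteq> j\<close> by (intro equals0I) (metis IntD1 IntD2)
    qed
    show "finite {i. i \<le> n \<and> i < q}" by simp
    show "\<forall>i\<in>{i. i \<le> n \<and> i < q}. finite ((\<lambda>e. e(v := i)) ` box_exps v q (n - i))"
      by (intro ballI finite_imageI finite_box_exps)
  qed
  then show ?thesis unfolding card_image[OF inj] .
qed

text \<open>The polynomial \<open>1 + X + ... + X^(q-1)\<close>, which is the Hilbert series of
  \<open>k[x]/(x^q)\<close>.\<close>

definition geom_fps :: "nat \<Rightarrow> real fps" where
  "geom_fps q = Abs_fps (\<lambda>n. if n < q then 1 else 0)"

lemma geom_fps_nth: "fps_nth (geom_fps q) i = (if i < q then 1 else 0)"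
  unfolding geom_fps_def by (rule fps_nth_Abs_fps)

lemma one_minus_fps_X_mult_nth:
  fixes f :: "real fps"
  shows "fps_nth ((1 - fps_X) * f) n = fps_nth f n - (if n = 0 then 0 else fps_nth f (n - 1))"
  by (simp only: left_diff_distrib mult_1_left fps_sub_nth fps_X_mult_nth)

lemma card_box_exps_fps: "real (card (box_exps v q n)) = fps_nth (geom_fps q ^ v) n"
proof (induction v arbitrary: n)
  case 0
  have "card (box_exps 0 q n) = (if n = 0 then 1 else 0)"
  proof (cases "n = 0")
    case True
    have "box_exps 0 q n = {\<lambda>_. 0}"
    proof (intro set_eqI iffI)
      fix e assume e: "e \<in> box_exps 0 q n"
      have "e = (\<lambda>_. 0)"
      proof (rule ext)
        fix i show "e i = 0" by (rule box_expsD(2)[OF e le0])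
      qed
      then show "e \<in> {\<lambda>_. 0}" by (simp only: singleton_iff)
    next
      fix e :: "nat \<Rightarrow> nat" assume "e \<in> {\<lambda>_. 0}"
      then have "e = (\<lambda>_. 0)" by (rule singletonD)
      then show "e \<in> box_exps 0 q n" unfolding box_exps_def using True by simp
    qed
    then have "card (box_exps 0 q n) = card {\<lambda>_ :: nat. 0 :: nat}" by (rule arg_cong)
    also have "\<dots> = 1" by (rule is_singleton_altdef[THEN iffD1, OF is_singletonI])
    finally show ?thesis using True by simp
  next
    case False
    have "box_exps 0 q n = {}"
    proof (intro equals0I)
      fix e assume "e \<in> box_exps 0 q n"
      from box_expsD(3)[OF this] show False using False by (simp only: sum.empty lessThan_0)
    qed
    then show ?thesis using False by (simp only: card.empty if_False)
  qed
  then show ?case by simp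
next
  case (Suc v)
  have "fps_nth (geom_fps q ^ Suc v) n = (\<Sum>i=0..n. fps_nth (geom_fps q) i * fps_nth (geom_fps q ^ v) (n - i))"
    by (simp only: power_Suc fps_mult_nth)
  also have "\<dots> = (\<Sum>i=0..n. if i < q then real (card (box_exps v q (n - i))) else 0)"
    by (intro sum.cong refl) (simp only: geom_fps_nth Suc, simp)
  also have "\<dots> = (\<Sum>i\<in>{i. i \<le> n \<and> i < q}. real (card (box_exps v q (n - i))))"
    by (rule sum.mono_neutral_cong_right) auto
  finally show ?case unfolding card_box_exps_Suc by simp
qed

lemma geom_fps_mult: "(1 - fps_X) * geom_fps q = 1 - fps_X ^ q"
proof (rule fps_ext)
  fix n
  show "fps_nth ((1 - fps_X) * geom_fps q) n = fps_nth (1 - fps_X ^ q) n"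
    unfolding one_minus_fps_X_mult_nth geom_fps_nth fps_sub_nth fps_X_power_nth fps_one_nth
    by (cases n) auto
qed

text \<open>The series of \<open>1 / (1 - X)^(k+1)\<close>, given by its coefficients so that
  multiplication by \<open>1 - X\<close> is Pascal's rule.\<close>

definition binom_fps :: "nat \<Rightarrow> real fps" where
  "binom_fps k = Abs_fps (\<lambda>n. real ((n + k) choose k))"

lemma binom_fps_nth: "fps_nth (binom_fps k) n = real ((n + k) choose k)"
  unfolding binom_fps_def by (rule fps_nth_Abs_fps)

lemma binom_fps_Suc: "(1 - fps_X) * binom_fps (Suc k) = binom_fps k"
proof (rule fps_ext)
  fix n
  show "fps_nth ((1 - fps_X) * binom_fps (Suc k)) n = fps_nth (binom_fps k) n"
    unfolding one_minus_fps_X_mult_nth binom_fps_nth by (cases n) simp_all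
qed

lemma binom_fps_0: "(1 - fps_X) * binom_fps 0 = 1"
proof (rule fps_ext)
  fix n
  show "fps_nth ((1 - fps_X) * binom_fps 0) n = fps_nth 1 n"
    unfolding one_minus_fps_X_mult_nth binom_fps_nth fps_one_nth by (cases n) simp_all
qed

lemma binom_fps_3: "(1 - fps_X) ^ 4 * binom_fps 3 = 1"
proof -
  have "x ^ 4 * b = x * (x * (x * (x * b)))" for x b :: "real fps"
    by (simp only: power4_eq_xxxx mult.assoc)
  then show ?thesis unfolding numeral_3_eq_3 by (simp only: binom_fps_Suc binom_fps_0)
qed

text \<open>The spare factor \<open>1 - X\<close> turns coefficients into first differences of the
  Hilbert function, and then \<open>1 / (1 - X)^4\<close> suffices on the right. First differences
  have cubic size, which is the size that matters after division by \<open>q^3\<close>.\<close>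

lemma geom_fps_5: "(1 - fps_X) * geom_fps q ^ 5 = (1 - fps_X ^ q) ^ 5 * binom_fps 3"
proof -
  have sw: "(x ^ 4 * b) * (x * g ^ 5) = (x * g) ^ 5 * b" for x b g :: "real fps"
  proof -
    have "x ^ 5 = x ^ 4 * x" using power_Suc2[of x 4] by simp
    then show ?thesis by (simp only: power_mult_distrib ac_simps)
  qed
  have "(1 - fps_X) * geom_fps q ^ 5 = ((1 - fps_X) ^ 4 * binom_fps 3) * ((1 - fps_X) * geom_fps q ^ 5)"
    unfolding binom_fps_3 by simp
  also have "\<dots> = ((1 - fps_X) * geom_fps q) ^ 5 * binom_fps 3"
    by (rule sw)
  finally show ?thesis unfolding geom_fps_mult .
qed

definition shifted_binom :: "nat \<Rightarrow> nat \<Rightarrow> real" where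
  "shifted_binom m n = (if n < m then 0 else real ((n - m + 3) choose 3))"

lemma shifted_binom_fps: "fps_nth (fps_X ^ m * binom_fps 3) n = shifted_binom m n"
  by (simp add: fps_X_power_mult_nth shifted_binom_def binom_fps_nth)

text \<open>Below degree \<open>3 q\<close> only the first three terms of \<open>(1 - X^q)^5\<close>
  contribute. The application has degrees below \<open>5 q / 2\<close>.\<close>

lemma card_mon_deg_diff:
  assumes n: "Suc n < 3 * q"
  shows "real (card (mon_deg q (Suc n))) - real (card (mon_deg q n)) =
    shifted_binom 0 (Suc n) - 5 * shifted_binom q (Suc n) + 10 * shifted_binom (2 * q) (Suc n)"
proof -
  have md: "mon_deg q n = box_exps 5 q n" for n unfolding mon_deg_def box_exps_def ..
  have "real (card (mon_deg q (Suc n))) - real (card (mon_deg q n)) = fps_nth ((1 - fps_X) * geom_fps q ^ 5) (Suc n)"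
    unfolding md card_box_exps_fps one_minus_fps_X_mult_nth by simp
  also have "(1 - fps_X) * geom_fps q ^ 5 = fps_X ^ 0 * binom_fps 3 - 5 * (fps_X ^ q * binom_fps 3) + 10 * (fps_X ^ (2 * q) * binom_fps 3)
      - fps_X ^ (3 * q) * (10 * binom_fps 3 - 5 * (fps_X ^ q * binom_fps 3) + fps_X ^ (2 * q) * binom_fps 3)"
  proof -
    have ring: "(1 - Y) ^ 5 * B = B - 5 * (Y * B) + 10 * (Y ^ 2 * B) - Y ^ 3 * (10 * B - 5 * (Y * B) + Y ^ 2 * B)" for Y B :: "real fps"
      by algebra
    have pw: "(fps_X ^ q) ^ i = (fps_X ^ (i * q) :: real fps)" for i by (simp add: power_mult[symmetric] mult.commute)
    show ?thesis unfolding geom_fps_5 ring pw by simp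
  qed
  also have "fps_nth \<dots> (Suc n) = fps_nth (fps_X ^ 0 * binom_fps 3) (Suc n) - 5 * fps_nth (fps_X ^ q * binom_fps 3) (Suc n)
      + 10 * fps_nth (fps_X ^ (2 * q) * binom_fps 3) (Suc n)"
  proof -
    have "fps_nth (numeral k * F) j = numeral k * fps_nth F j" for k j and F :: "real fps"
      by (simp add: numeral_fps_const)
    then show ?thesis using n by (simp add: fps_X_power_mult_nth)
  qed
  finally show ?thesis unfolding shifted_binom_fps .
qed

text \<open>For \<open>n < m\<close> the factor \<open>n - m + 1\<close> is not positive, so
  truncating the factors at 0 covers both branches of the definition. In this form the limit needs
  no distinction of cases.\<close>

lemma shifted_binom_prod:
  "shifted_binom m n = max 0 (real n - real m + 1) * max 0 (real n - real m + 2) * max 0 (real n - real m + 3) / 6"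
proof (cases "n < m")
  case True
  then have "real n - real m + 1 \<le> 0" by simp
  then have "max 0 (real n - real m + 1) = 0" by simp
  then show ?thesis using True unfolding shifted_binom_def by simp
next
  case False
  define d where "d = n - m"
  then have d: "n = m + d" using False by simp
  have "6 * ((d + 3) choose 3) = (d + 3) * (d + 2) * (d + 1)"
  proof (induction d)
    case (Suc d)
    have "(Suc d + 3) choose 3 = ((d + 3) choose 3) + ((d + 3) choose 2)"
      using binomial_Suc_Suc[of "d + 3" 2] by simp
    moreover have "2 * ((d + 3) choose 2) = (d + 3) * (d + 2)"
      using choose_two[of "d + 3"] dvd_mult_div_cancel[of 2 "(d + 3) * (d + 2)"] by simp
    ultimately show ?case using Suc by (simp add: algebra_simps)
  qed simp
  then have "real (6 * ((d + 3) choose 3)) = real ((d + 3) * (d + 2) * (d + 1))" by (rule arg_cong)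
  then have "real ((d + 3) choose 3) = (real d + 1) * (real d + 2) * (real d + 3) / 6" by (simp add: algebra_simps)
  then show ?thesis unfolding shifted_binom_def d by simp
qed

lemma shifted_binom_tendsto:
  fixes n :: "nat \<Rightarrow> nat" and q :: "nat \<Rightarrow> nat"
  assumes nq: "(\<lambda>s. real (n s) / real (q s)) \<longlonglongrightarrow> x" and q: "filterlim q at_top sequentially"
  shows "(\<lambda>s. shifted_binom (c * q s) (n s) / real (q s) ^ 3) \<longlonglongrightarrow> max 0 (x - real c) ^ 3 / 6"
proof -
  have iq: "(\<lambda>s. i / real (q s)) \<longlonglongrightarrow> 0" for i :: real
    by (rule tendsto_divide_0[OF tendsto_const]) (rule filterlim_at_top_imp_at_infinity, rule filterlim_compose[OF filterlim_real_sequentially q])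
  have q0: "eventually (\<lambda>s. q s > 0) sequentially" using q[unfolded filterlim_at_top, rule_format, of 1] by (rule eventually_mono) simp
  have "(\<lambda>s. max 0 (real (n s) / real (q s) - real c + 1 / real (q s)) * max 0 (real (n s) / real (q s) - real c + 2 / real (q s))
     * max 0 (real (n s) / real (q s) - real c + 3 / real (q s)) / 6)
     \<longlonglongrightarrow> max 0 (x - real c + 0) * max 0 (x - real c + 0) * max 0 (x - real c + 0) / 6"
    by (intro tendsto_intros tendsto_max nq iq) simp_all
  then have "(\<lambda>s. max 0 (real (n s) / real (q s) - real c + 1 / real (q s)) * max 0 (real (n s) / real (q s) - real c + 2 / real (q s))
     * max 0 (real (n s) / real (q s) - real c + 3 / real (q s)) / 6) \<longlonglongrightarrow> max 0 (x - real c) ^ 3 / 6"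
    by (simp add: power3_eq_cube)
  then show ?thesis
  proof (rule Lim_transform_eventually)
    show "\<forall>\<^sub>F s in sequentially. max 0 (real (n s) / real (q s) - real c + 1 / real (q s)) * max 0 (real (n s) / real (q s) - real c + 2 / real (q s))
     * max 0 (real (n s) / real (q s) - real c + 3 / real (q s)) / 6 = shifted_binom (c * q s) (n s) / real (q s) ^ 3"
      using q0
    proof eventually_elim
      case (elim s)
      have m: "max 0 (real (n s) / real (q s) - real c + i / real (q s)) = max 0 (real (n s) - real (c * q s) + i) / real (q s)" for i
      proof -
        have "real (n s) / real (q s) - real c + i / real (q s) = (real (n s) - real (c * q s) + i) / real (q s)"
          using elim by (simp add: field_simps)
        then show ?thesis using elim by (simp add: max_def zero_le_divide_iff)
      qed
      show ?case unfolding m shifted_binom_prod by (simp add: power3_eq_cube)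
    qed
  qed
qed

section \<open>Limits and closed forms\<close>

lemma choose_three: "real ((n + 2) choose 3) = real n * (real n + 1) * (real n + 2) / 6"
proof (cases n)
  case (Suc k)
  have "real ((k + 3) choose 3) = (real k + 1) * (real k + 2) * (real k + 3) / 6"
    using shifted_binom_prod[of 0 k] unfolding shifted_binom_def by simp
  moreover have "n + 2 = k + 3" using Suc by simp
  ultimately have A: "real ((n + 2) choose 3) = (real k + 1) * (real k + 2) * (real k + 3) / 6" by (simp only:)
  have B: "real n = real k + 1" using Suc by simp
  show ?thesis unfolding A B by (simp add: algebra_simps)
qed simp

lemma Suc_choose_four: "Suc n choose 4 = (n choose 3) + (n choose 4)"
  using binomial_Suc_Suc[of n 3] by simp

lemma real_Ynum: "real (Ynum m) = (real m + 1) * (real m + 2) * (2 * real m + 3) / 6"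
proof -
  have e: "m + 4 = Suc (m + 3)" "m + 3 = Suc (m + 2)" "Suc m + 2 = m + 3" by simp_all
  have c1: "(m + 4) choose 4 = ((m + 3) choose 3) + ((m + 3) choose 4)"
    unfolding e(1) by (rule Suc_choose_four)
  have c2: "(m + 3) choose 4 = ((m + 2) choose 3) + ((m + 2) choose 4)"
    unfolding e(2) by (rule Suc_choose_four)
  have "Ynum m = ((Suc m + 2) choose 3) + ((m + 2) choose 3)"
    unfolding Ynum_def c1 c2 e(3) by simp
  then have "real (Ynum m) = real ((Suc m + 2) choose 3) + real ((m + 2) choose 3)" by (simp only: of_nat_add)
  then show ?thesis unfolding choose_three by (simp add: field_simps)
qed

lemma real_h0S: "real (h0S m) = 4 * (real m * (real m + 1) * (real m + 2) / 6)"
proof -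
  have e: "m + 3 = Suc (m + 2)" by simp
  have "(m + 3) choose 4 = ((m + 2) choose 3) + ((m + 2) choose 4)"
    unfolding e by (rule Suc_choose_four)
  then have "h0S m = 4 * ((m + 2) choose 3)" unfolding h0S_def by simp
  then have "real (h0S m) = 4 * real ((m + 2) choose 3)" by simp
  then show ?thesis unfolding choose_three .
qed

text \<open>Writing \<open>p = 2 h + 5\<close> makes all truncated subtractions exact:
  \<open>a = h\<close>, \<open>b = h + 1\<close>, and the last arguments are both
  \<open>h + 2\<close>. What remains is an identity of polynomials in \<open>h\<close>. The two
  multiplicities thus equal the numbers of even and of odd subsquares of an odd square.\<close>

lemma mu_m1_eq:
  assumes "odd p" "p \<ge> 5"
  shows "mu_m1 p = (real p ^ 2 - 1) / 2" and "mubar_m1 p = (real p ^ 2 + 1) / 2"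
proof -
  obtain t where "p = 2 * t + 1" using assms(1) by (rule oddE)
  then have "t \<ge> 2" using assms(2) by simp
  define h where "h = t - 2"
  have p: "p = 2 * h + 5" unfolding h_def using \<open>p = 2 * t + 1\<close> \<open>t \<ge> 2\<close> by simp
  have P0: "P0 p = h + 2" unfolding P0_def p by simp
  have a: "h + 2 * p = 5 * h + 10" "h + p = 3 * h + 5" "p - h - 3 = h + 2" unfolding p by simp_all
  have b: "h + 1 + 2 * p = 5 * h + 11" "h + 1 + p = 3 * h + 6" "p - (h + 1) - 2 = h + 2" unfolding p by simp_all
  have sub: "h + 2 - 2 = h" "h + 2 - 1 = h + 1" by simp_all
  show "mu_m1 p = (real p ^ 2 - 1) / 2"
    unfolding mu_m1_def Let_def P0 sub a real_Ynum unfolding p by (simp add: field_simps power2_eq_square)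
  show "mubar_m1 p = (real p ^ 2 + 1) / 2"
    unfolding mubar_m1_def Let_def P0 sub b real_h0S unfolding p by (simp add: field_simps power2_eq_square)
qed

text \<open>Consequently \<open>2 + P_j\<close> and \<open>2 + P_j + 1/p^j\<close> lie symmetrically
  about \<open>5/2\<close>, at distance \<open>1/(2 p^j)\<close>. All break points of the density
  are of this kind.\<close>

lemma Pj_eq:
  assumes "p > 0"
  shows "Pj p i = 1 / 2 - 1 / (2 * real p ^ i)"
proof (induction i)
  case (Suc i)
  have "Pj p (Suc i) = Pj p i + (real p - 1) / (2 * real p) * (1 / real p ^ i)"
    unfolding Pj_def by (simp add: ring_distribs)
  also have "\<dots> = 1 / 2 - 1 / (2 * real p ^ Suc i)" unfolding Suc using assms by (simp add: field_simps)
  finally show ?case .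
qed (simp add: Pj_def)

section \<open>Moments of the weights and the limit density of the kernel\<close>

lemma sum_weights:
  fixes u :: real
  shows "(\<Sum>i=1..j. u * (u + 1) ^ (i - 1)) = (u + 1) ^ j - 1"
  by (induction j) (simp_all add: algebra_simps)

text \<open>For \<open>P = p^2\<close> the factor \<open>1/(4 P^i)\<close> is the square of the
  distance \<open>1/(2 p^i)\<close>: this is the second moment of the break distances with respect
  to the weights.\<close>

lemma sum_weights_scaled:
  fixes u P :: real
  assumes "P = 2 * u + 1" "P > 0"
  shows "(\<Sum>i=1..j. u * (u + 1) ^ (i - 1) * (1 / (4 * P ^ i))) = (1 - (u + 1) ^ j / P ^ j) / 4"
proof (induction j)
  case (Suc j)
  have "(1 - (u + 1) ^ j / P ^ j) / 4 + u * (u + 1) ^ j * (1 / (4 * P ^ Suc j)) = (1 - ((u + 1) ^ j * (P - u)) / P ^ Suc j) / 4"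
    using assms(2) by (simp add: field_simps)
  moreover have "P - u = u + 1" using assms(1) by simp
  moreover have "(u + 1) ^ j * (u + 1) = (u + 1) ^ Suc j" by simp
  moreover have "(\<Sum>i=1..Suc j. u * (u + 1) ^ (i - 1) * (1 / (4 * P ^ i)))
    = (\<Sum>i=1..j. u * (u + 1) ^ (i - 1) * (1 / (4 * P ^ i))) + u * (u + 1) ^ j * (1 / (4 * P ^ Suc j))" by simp
  ultimately show ?case by (simp only: Suc)
qed simp

text \<open>Here \<open>z\<close> is the limit of the gap divided by \<open>p^s\<close>, the
  distance of the kernel degree from \<open>5/2\<close> in units of \<open>p^s\<close>. The first
  cube comes from the central even square, the factor 4 from the odd squares around it, and
  \<open>i = s - k\<close> is the depth of an even subsquare of level \<open>k\<close>. Summands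
  with \<open>1/(2 p^i) \<le> z\<close> are zero, so a cut-off \<open>J\<close> loses nothing once
  it is large enough.\<close>

definition kernel_density :: "nat \<Rightarrow> nat \<Rightarrow> real \<Rightarrow> real" where
  "kernel_density p J z = (max 0 (1 / 2 - z) ^ 3
     + 4 * (\<Sum>i=1..J. (real p ^ 2 - 1) / 2 * ((real p ^ 2 + 1) / 2) ^ (i - 1) * max 0 (1 / (2 * real p ^ i) - z) ^ 3)) / 3"

lemma inverse_power_mono:
  assumes "p > 1" "i \<le> j"
  shows "1 / (2 * real p ^ j) \<le> 1 / (2 * real p ^ i)"
proof -
  have "real p ^ i \<le> real p ^ j" using assms by (intro power_increasing) auto
  moreover have "real p ^ i > 0" using assms by simp
  moreover have "1 / (2 * b) \<le> 1 / (2 * a)" if "a \<le> b" "0 < a" for a b :: real using that by (simp add: frac_le)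
  ultimately show ?thesis by blast
qed

text \<open>The number of summands grows with \<open>s\<close>, but the strict inequality for
  \<open>z\<close> makes every summand beyond \<open>J\<close> vanish as soon as \<open>r s\<close>
  exceeds \<open>1/(2 p^(J+1))\<close>. What is left is the limit of a fixed finite sum.\<close>

lemma kernel_density_tendsto:
  assumes p: "p > 1" and z: "1 / (2 * real p ^ (J + 1)) < z" and r: "r \<longlonglongrightarrow> z"
  shows "(\<lambda>s. 1 / 3 * (max 0 (1 / 2 - r s) ^ 3
     + 4 * (\<Sum>k<s. (real p ^ 2 - 1) / 2 * ((real p ^ 2 + 1) / 2) ^ (s - 1 - k) * max 0 (real p ^ k / (2 * real p ^ s) - r s) ^ 3)))
     \<longlonglongrightarrow> kernel_density p J z"
proof (rule Lim_transform_eventually)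
  let ?g = "\<lambda>s. (max 0 (1 / 2 - r s) ^ 3
     + 4 * (\<Sum>i=1..J. (real p ^ 2 - 1) / 2 * ((real p ^ 2 + 1) / 2) ^ (i - 1) * max 0 (1 / (2 * real p ^ i) - r s) ^ 3)) / 3"
  show "?g \<longlonglongrightarrow> kernel_density p J z"
    unfolding kernel_density_def by (intro tendsto_divide tendsto_add tendsto_mult tendsto_power tendsto_sum tendsto_max tendsto_diff tendsto_const r) simp
  show "\<forall>\<^sub>F s in sequentially. ?g s = 1 / 3 * (max 0 (1 / 2 - r s) ^ 3
     + 4 * (\<Sum>k<s. (real p ^ 2 - 1) / 2 * ((real p ^ 2 + 1) / 2) ^ (s - 1 - k) * max 0 (real p ^ k / (2 * real p ^ s) - r s) ^ 3))"
    using order_tendstoD(1)[OF r z] eventually_ge_at_top[of J]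
  proof eventually_elim
    case (elim s)
    define h where "h t = (real p ^ 2 - 1) / 2 * ((real p ^ 2 + 1) / 2) ^ t * max 0 (1 / (2 * real p ^ Suc t) - r s) ^ 3" for t
    have "(\<Sum>k<s. (real p ^ 2 - 1) / 2 * ((real p ^ 2 + 1) / 2) ^ (s - 1 - k) * max 0 (real p ^ k / (2 * real p ^ s) - r s) ^ 3)
       = (\<Sum>k<s. h (s - Suc k))"
    proof (rule sum.cong[OF refl])
      fix k assume "k \<in> {..<s}"
      then have k: "s = k + Suc (s - Suc k)" by simp
      have "real p ^ s = real p ^ k * real p ^ Suc (s - Suc k)" by (subst k) (rule power_add)
      then have "real p ^ k / (2 * real p ^ s) = 1 / (2 * real p ^ Suc (s - Suc k))" using p by (simp only:) (simp add: field_simps)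
      moreover have "s - 1 - k = s - Suc k" by simp
      ultimately show "(real p ^ 2 - 1) / 2 * ((real p ^ 2 + 1) / 2) ^ (s - 1 - k) * max 0 (real p ^ k / (2 * real p ^ s) - r s) ^ 3 = h (s - Suc k)"
        unfolding h_def by (simp only:)
    qed
    also have "\<dots> = (\<Sum>t<s. h t)" by (rule sum.nat_diff_reindex)
    also have "\<dots> = (\<Sum>t<J. h t)"
    proof (rule sum.mono_neutral_right)
      show "\<forall>t\<in>{..<s} - {..<J}. h t = 0"
      proof
        fix t assume "t \<in> {..<s} - {..<J}"
        then have "1 / (2 * real p ^ Suc t) \<le> 1 / (2 * real p ^ (J + 1))" using p by (intro inverse_power_mono) auto
        then have "max 0 (1 / (2 * real p ^ Suc t) - r s) = 0" using elim(1) by (intro max_absorb1) linarith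
        then show "h t = 0" unfolding h_def by simp
      qed
    qed (use elim(2) in auto)
    also have "\<dots> = (\<Sum>i=1..J. (real p ^ 2 - 1) / 2 * ((real p ^ 2 + 1) / 2) ^ (i - 1) * max 0 (1 / (2 * real p ^ i) - r s) ^ 3)"
      unfolding One_nat_def sum.atLeast1_atMost_eq h_def by (rule sum.cong[OF refl]) simp
    finally show ?case by simp
  qed
qed

text \<open>The main term is homogeneous of degree three in the powers \<open>p^k\<close> and
  \<open>G\<close>, so division by \<open>p^(3s)\<close> leaves a function of
  \<open>G / p^s\<close>; the error becomes at most \<open>30 / p^s\<close>.\<close>

lemma kernel_limit:
  fixes d G :: "nat \<Rightarrow> real"
  assumes p: "p > 1" and z: "1 / (2 * real p ^ (J + 1)) < z" and r: "(\<lambda>s. G s / real p ^ s) \<longlonglongrightarrow> z"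
    and est: "\<forall>\<^sub>F s in sequentially. \<bar>d s - 1 / 3 * (max 0 (real p ^ s / 2 - G s) ^ 3
     + 4 * (\<Sum>k<s. (real p ^ 2 - 1) / 2 * ((real p ^ 2 + 1) / 2) ^ (s - 1 - k) * max 0 (real p ^ k / 2 - G s) ^ 3))\<bar> \<le> 30 * (real p ^ 2) ^ s"
  shows "(\<lambda>s. d s / (real p ^ s) ^ 3) \<longlonglongrightarrow> kernel_density p J z"
proof -
  define T where "T s = 1 / 3 * (max 0 (1 / 2 - G s / real p ^ s) ^ 3
     + 4 * (\<Sum>k<s. (real p ^ 2 - 1) / 2 * ((real p ^ 2 + 1) / 2) ^ (s - 1 - k) * max 0 (real p ^ k / (2 * real p ^ s) - G s / real p ^ s) ^ 3))" for s
  have T: "T \<longlonglongrightarrow> kernel_density p J z" unfolding T_def by (rule kernel_density_tendsto[OF p z r])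
  have "(\<lambda>s. d s / (real p ^ s) ^ 3 - T s) \<longlonglongrightarrow> 0"
  proof (rule tendsto_0_le)
    show "(\<lambda>s. 30 / real p ^ s) \<longlonglongrightarrow> 0" using p by (intro LIMSEQ_divide_realpow_zero) simp
    show "\<forall>\<^sub>F s in sequentially. norm (d s / (real p ^ s) ^ 3 - T s) \<le> norm (30 / real p ^ s) * 1"
      using est
    proof eventually_elim
      case (elim s)
      define q where "q = real p ^ s"
      have q: "q > 0" unfolding q_def using p by simp
      have scale: "1 / 3 * (A + 4 * (\<Sum>k<s. a k * b k)) / c = 1 / 3 * (A / c + 4 * (\<Sum>k<s. a k * (b k / c)))"
        if "c > 0" for A c :: real and a b :: "nat \<Rightarrow> real"
      proof -
        have "(\<Sum>k<s. a k * (b k / c)) = (\<Sum>k<s. a k * b k) / c" by (simp only: sum_divide_distrib times_divide_eq_right)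
        then show ?thesis using that by (simp only:) (simp add: field_simps)
      qed
      have q3: "q ^ 3 > 0" using q by simp
      have mx: "max 0 (y / 2 - G s) ^ 3 / q ^ 3 = max 0 (y / (2 * q) - G s / q) ^ 3" for y
      proof -
        have "max 0 (y / 2 - G s) / q = max (0 / q) ((y / 2 - G s) / q)" using q by (simp add: max_divide_distrib_right)
        also have "(y / 2 - G s) / q = y / (2 * q) - G s / q" by (simp add: diff_divide_distrib)
        finally show ?thesis unfolding power_divide[symmetric] by simp
      qed
      have half: "max 0 (q / 2 - G s) ^ 3 / q ^ 3 = max 0 (1 / 2 - G s / q) ^ 3" unfolding mx using q by simp
      have "1 / 3 * (max 0 (q / 2 - G s) ^ 3
          + 4 * (\<Sum>k<s. (real p ^ 2 - 1) / 2 * ((real p ^ 2 + 1) / 2) ^ (s - 1 - k) * max 0 (real p ^ k / 2 - G s) ^ 3)) / q ^ 3 = T s"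
        unfolding T_def q_def[symmetric] mx[symmetric] half[symmetric] by (rule scale[OF q3])
      then have "d s / q ^ 3 - T s = (d s - 1 / 3 * (max 0 (q / 2 - G s) ^ 3
          + 4 * (\<Sum>k<s. (real p ^ 2 - 1) / 2 * ((real p ^ 2 + 1) / 2) ^ (s - 1 - k) * max 0 (real p ^ k / 2 - G s) ^ 3))) / q ^ 3"
        by (simp only: diff_divide_distrib)
      then have "\<bar>d s / q ^ 3 - T s\<bar> \<le> 30 * (real p ^ 2) ^ s / q ^ 3"
        using elim q unfolding q_def[symmetric] by (simp only: abs_divide) (auto intro: divide_right_mono)
      also have "(real p ^ 2) ^ s = q ^ 2" unfolding q_def by (simp add: power_mult[symmetric] mult.commute)
      also have "30 * q ^ 2 / q ^ 3 = 30 / q" using q by (simp add: power2_eq_square power3_eq_cube)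
      finally show ?case unfolding q_def by simp
    qed
  qed
  from tendsto_add[OF this T] show ?thesis by simp
qed

lemma kernel_density_eq_0:
  assumes "1 / 2 \<le> z"
  shows "kernel_density p 0 z = 0"
  using assms unfolding kernel_density_def by simp

lemma kernel_density_0:
  assumes "z \<le> 1 / 2"
  shows "kernel_density p 0 z = (1 / 2 - z) ^ 3 / 3"
  using assms unfolding kernel_density_def by simp

lemma half_power_le: "p > 1 \<Longrightarrow> 1 / (2 * real p ^ j) \<le> 1 / 2"
  using inverse_power_mono[of p 0 j] by simp

lemma kernel_density_le:
  assumes p: "p > 1" and z: "z \<le> 1 / (2 * real p ^ j)"
  shows "kernel_density p j z = ((1 / 2 - z) ^ 3
     + 4 * (\<Sum>i=1..j. (real p ^ 2 - 1) / 2 * ((real p ^ 2 + 1) / 2) ^ (i - 1) * (1 / (2 * real p ^ i) - z) ^ 3)) / 3"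
proof -
  have "max 0 (1 / 2 - z) = 1 / 2 - z" using z half_power_le[OF p, of j] by simp
  moreover have "(\<Sum>i=1..j. (real p ^ 2 - 1) / 2 * ((real p ^ 2 + 1) / 2) ^ (i - 1) * max 0 (1 / (2 * real p ^ i) - z) ^ 3)
    = (\<Sum>i=1..j. (real p ^ 2 - 1) / 2 * ((real p ^ 2 + 1) / 2) ^ (i - 1) * (1 / (2 * real p ^ i) - z) ^ 3)"
  proof (rule sum.cong[OF refl])
    fix i assume "i \<in> {1..j}"
    then have "1 / (2 * real p ^ j) \<le> 1 / (2 * real p ^ i)" using p by (intro inverse_power_mono) auto
    then have "max 0 (1 / (2 * real p ^ i) - z) = 1 / (2 * real p ^ i) - z" using z by (intro max_absorb2) linarith
    then show "(real p ^ 2 - 1) / 2 * ((real p ^ 2 + 1) / 2) ^ (i - 1) * max 0 (1 / (2 * real p ^ i) - z) ^ 3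
      = (real p ^ 2 - 1) / 2 * ((real p ^ 2 + 1) / 2) ^ (i - 1) * (1 / (2 * real p ^ i) - z) ^ 3" by (simp only:)
  qed
  ultimately show ?thesis unfolding kernel_density_def by (simp only:)
qed

text \<open>Serves the closed ends of the intervals. There \<open>z\<close> may equal
  \<open>1/(2 p^(j+1))\<close>, and the strict inequality in the limit statement holds only with one
  summand more, which is zero.\<close>

lemma kernel_density_Suc:
  assumes p: "p > 1" and z: "1 / (2 * real p ^ (j + 1)) \<le> z"
  shows "kernel_density p (Suc j) z = kernel_density p j z"
proof -
  have "max 0 (1 / (2 * real p ^ Suc j) - z) = 0" using z by (intro max_absorb1) simp
  then show ?thesis unfolding kernel_density_def by (simp del: power_Suc)
qed

lemma density_above:
  assumes p: "p > 1" and z: "1 / (2 * real p ^ (j + 1)) \<le> x - 5 / 2" "x - 5 / 2 \<le> 1 / (2 * real p ^ j)"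
  shows "kernel_density p (Suc j) (x - 5 / 2) = (3 - x) ^ 3 / 3
     + 4 / 3 * (\<Sum>i=1..j. (1 / real p ^ i + Pj p i + 2 - x) ^ 3 * ((real p ^ 2 - 1) / 2) * ((real p ^ 2 + 1) / 2) ^ (i - 1))"
proof -
  have "1 / real p ^ i + Pj p i + 2 - x = 1 / (2 * real p ^ i) - (x - 5 / 2)" for i
    using p by (simp add: Pj_eq field_simps)
  then have "(\<Sum>i=1..j. (1 / real p ^ i + Pj p i + 2 - x) ^ 3 * ((real p ^ 2 - 1) / 2) * ((real p ^ 2 + 1) / 2) ^ (i - 1))
    = (\<Sum>i=1..j. (real p ^ 2 - 1) / 2 * ((real p ^ 2 + 1) / 2) ^ (i - 1) * (1 / (2 * real p ^ i) - (x - 5 / 2)) ^ 3)"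
    by (simp only: ac_simps)
  moreover have "1 / 2 - (x - 5 / 2) = 3 - x" by simp
  ultimately show ?thesis unfolding kernel_density_Suc[OF p z(1)] kernel_density_le[OF p z(2)] by simp
qed

text \<open>Explains the shape of the formula below \<open>5/2\<close>. The formula has cubes of
  \<open>w + z\<close> where the kernel has cubes of \<open>w - z\<close>; their difference
  \<open>6 z w^2 + 2 z^3\<close>, summed with the weights, yields the two corrections next to
  \<open>T\<close>. \<open>W\<close> stands for \<open>1/(2 p^j)\<close>, \<open>N\<close> for the
  \<open>j\<close>-th power of \<open>(p^2 + 1)/2\<close>, and the last bracket is the remainder,
  expressed through \<open>W - z\<close>.\<close>

lemma density_below_identity:
  fixes z W N T x :: real
  assumes "x = 5 / 2 - z"
  shows "x ^ 3 / 3 - 5 / 3 * (x - 1) ^ 3 + 10 / 3 * (x - 2) ^ 3 + ((1 / 2 - z) ^ 3 + 4 * T) / 3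
    = (3 - x) ^ 3 / 3 + 4 / 3 * (T + 6 * z * ((1 - 4 * W ^ 2 * N) / 4) + 2 * z ^ 3 * (N - 1))
     + (8 / 3 * (W - z) ^ 3 - 8 * W * (W - z) ^ 2 + 16 / 3 * W ^ 3) * N"
  unfolding assms by (simp add: power2_eq_square power3_eq_cube field_simps)

lemma density_below:
  assumes p: "p > 1" and z: "5 / 2 - x \<le> 1 / (2 * real p ^ j)"
  shows "x ^ 3 / 3 - 5 / 3 * (x - 1) ^ 3 + 10 / 3 * (x - 2) ^ 3 + kernel_density p j (5 / 2 - x) = (3 - x) ^ 3 / 3
     + 4 / 3 * (\<Sum>i=1..j. (1 / real p ^ i + Pj p i + 2 - x) ^ 3 * ((real p ^ 2 - 1) / 2) * ((real p ^ 2 + 1) / 2) ^ (i - 1))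
     + (8 / 3 * (x - 2 - Pj p j) ^ 3 - 4 / real p ^ j * (x - 2 - Pj p j) ^ 2 + 2 / (3 * real p ^ (3 * j))) * ((real p ^ 2 + 1) / 2) ^ j"
proof -
  define \<zeta> where "\<zeta> = 5 / 2 - x"
  define w where "w i = 1 / (2 * real p ^ i)" for i
  define u where "u = (real p ^ 2 - 1) / 2"
  define N where "N = (u + 1) ^ j"
  define T where "T = (\<Sum>i=1..j. u * (u + 1) ^ (i - 1) * (w i - \<zeta>) ^ 3)"
  have u1: "(real p ^ 2 + 1) / 2 = u + 1" unfolding u_def by (simp add: field_simps)
  have w2: "w i ^ 2 = 1 / (4 * (real p ^ 2) ^ i)" for i
    unfolding w_def by (simp add: power_divide power_mult_distrib power_mult[symmetric] mult.commute)
  have P: "real p ^ 2 = 2 * u + 1" "real p ^ 2 > 0" unfolding u_def using p by (simp_all add: field_simps)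
  have "(\<Sum>i=1..j. u * (u + 1) ^ (i - 1) * w i ^ 2) = (1 - N / (real p ^ 2) ^ j) / 4"
    unfolding w2 N_def by (rule sum_weights_scaled[OF P])
  also have "N / (real p ^ 2) ^ j = 4 * w j ^ 2 * N" unfolding w2 by simp
  finally have S2: "(\<Sum>i=1..j. u * (u + 1) ^ (i - 1) * w i ^ 2) = (1 - 4 * w j ^ 2 * N) / 4" .
  have "(1 / real p ^ i + Pj p i + 2 - x) ^ 3 * u * (u + 1) ^ (i - 1) = u * (u + 1) ^ (i - 1) * (w i - \<zeta>) ^ 3
     + 6 * \<zeta> * (u * (u + 1) ^ (i - 1) * w i ^ 2) + 2 * \<zeta> ^ 3 * (u * (u + 1) ^ (i - 1))" for i
  proof -
    have e: "1 / real p ^ i + Pj p i + 2 - x = w i + \<zeta>" unfolding w_def \<zeta>_def using p by (simp add: Pj_eq field_simps)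
    have "(a + b) ^ 3 * u * v = u * v * (a - b) ^ 3 + 6 * b * (u * v * a ^ 2) + 2 * b ^ 3 * (u * v)" for a b v :: real
      by (simp add: power2_eq_square power3_eq_cube algebra_simps)
    then show ?thesis unfolding e .
  qed
  then have "(\<Sum>i=1..j. (1 / real p ^ i + Pj p i + 2 - x) ^ 3 * u * (u + 1) ^ (i - 1))
    = T + 6 * \<zeta> * (\<Sum>i=1..j. u * (u + 1) ^ (i - 1) * w i ^ 2) + 2 * \<zeta> ^ 3 * (\<Sum>i=1..j. u * (u + 1) ^ (i - 1))"
    unfolding T_def by (simp only: sum.distrib sum_distrib_left)
  also have "\<dots> = T + 6 * \<zeta> * ((1 - 4 * w j ^ 2 * N) / 4) + 2 * \<zeta> ^ 3 * (N - 1)"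
    unfolding S2 sum_weights N_def ..
  finally have S: "(\<Sum>i=1..j. (1 / real p ^ i + Pj p i + 2 - x) ^ 3 * u * (u + 1) ^ (i - 1))
    = T + 6 * \<zeta> * ((1 - 4 * w j ^ 2 * N) / 4) + 2 * \<zeta> ^ 3 * (N - 1)" .
  have b1: "x - 2 - Pj p j = w j - \<zeta>" unfolding w_def \<zeta>_def using p by (simp add: Pj_eq)
  have b2: "4 / real p ^ j = 8 * w j" unfolding w_def by simp
  have b3: "2 / (3 * real p ^ (3 * j)) = 16 / 3 * w j ^ 3"
    unfolding w_def by (simp add: power_divide power_mult_distrib power_mult[symmetric] mult.commute)
  have kd: "kernel_density p j (5 / 2 - x) = ((1 / 2 - \<zeta>) ^ 3 + 4 * T) / 3"
    using kernel_density_le[OF p z] unfolding u1 u_def[symmetric] w_def[symmetric] \<zeta>_def[symmetric] T_def[symmetric] .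
  show ?thesis unfolding kd u1 u_def[symmetric] S b1 b2 b3 N_def[symmetric]
    by (rule density_below_identity) (simp add: \<zeta>_def)
qed

lemma power_inverse_tendsto_0:
  assumes "p > 1"
  shows "(\<lambda>s. c / real (p ^ s)) \<longlonglongrightarrow> 0"
  using LIMSEQ_divide_realpow_zero[of "real p" c] assms by simp

lemma floor_tendsto:
  assumes p: "p > 1" and x: "x \<ge> 0"
  shows "(\<lambda>s. real (nat \<lfloor>x * real (p ^ s)\<rfloor>) / real (p ^ s)) \<longlonglongrightarrow> x"
proof (rule tendsto_sandwich)
  have q: "real (p ^ s) > 0" for s using p by simp
  have n: "real (nat \<lfloor>x * real (p ^ s)\<rfloor>) \<le> x * real (p ^ s)" "x * real (p ^ s) - 1 \<le> real (nat \<lfloor>x * real (p ^ s)\<rfloor>)" for s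
  proof -
    have "real (nat \<lfloor>x * real (p ^ s)\<rfloor>) = real_of_int \<lfloor>x * real (p ^ s)\<rfloor>" using x by simp
    then show "real (nat \<lfloor>x * real (p ^ s)\<rfloor>) \<le> x * real (p ^ s)" "x * real (p ^ s) - 1 \<le> real (nat \<lfloor>x * real (p ^ s)\<rfloor>)"
      by linarith+
  qed
  have div: "N / Q \<le> x" if "N \<le> x * Q" "Q > 0" for N Q :: real using that by (simp add: pos_divide_le_eq)
  have div': "x - 1 / Q \<le> N / Q" if "x * Q - 1 \<le> N" "Q > 0" for N Q :: real
  proof -
    have "x - 1 / Q = (x * Q - 1) / Q" using that(2) by (simp add: diff_divide_distrib)
    also have "\<dots> \<le> N / Q" using that by (intro divide_right_mono) auto
    finally show ?thesis .
  qed
  have "x - 1 / real (p ^ s) \<le> real (nat \<lfloor>x * real (p ^ s)\<rfloor>) / real (p ^ s)" for s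
    by (rule div'[OF n(2) q])
  then show "\<forall>\<^sub>F s in sequentially. x - 1 / real (p ^ s) \<le> real (nat \<lfloor>x * real (p ^ s)\<rfloor>) / real (p ^ s)" by simp
  have "real (nat \<lfloor>x * real (p ^ s)\<rfloor>) / real (p ^ s) \<le> x" for s
    by (rule div[OF n(1) q])
  then show "\<forall>\<^sub>F s in sequentially. real (nat \<lfloor>x * real (p ^ s)\<rfloor>) / real (p ^ s) \<le> x" by simp
  show "(\<lambda>s. x - 1 / real (p ^ s)) \<longlonglongrightarrow> x" using tendsto_diff[OF tendsto_const power_inverse_tendsto_0[OF p, of 1], of x] by simp
qed simp

section \<open>Ranks and dimensions\<close>

context vector_space
begin

text \<open>The spaces of functions and of polynomials used below are in general
  infinite-dimensional, so finiteness enters through a finite set \<open>T\<close> whose span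
  contains the subspace at hand. The same device recurs in the next statements.\<close>

lemma independent_subset_card_le_dim:
  assumes "B \<subseteq> V" "independent B" "finite T" "V \<subseteq> span T"
  shows "finite B \<and> card B \<le> dim V"
proof -
  obtain B' where B': "B \<subseteq> B'" "B' \<subseteq> V" "independent B'" "V \<subseteq> span B'"
    using maximal_independent_subset_extend[OF assms(1,2)] .
  have f: "finite B'" using independent_span_bound[OF assms(3) B'(3)] B'(2) assms(4) by blast
  have "card B' = dim V" using basis_card_eq_dim B' by blast
  then show ?thesis using f B'(1) card_mono[OF f B'(1)] finite_subset by auto
qed

lemma dim_mono_finite:
  assumes "V \<subseteq> W" "finite T" "W \<subseteq> span T"
  shows "dim V \<le> dim W"
proof -
  obtain B where B: "B \<subseteq> V" "independent B" "V \<subseteq> span B" "card B = dim V"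
    using basis_exists[of V] by blast
  then show ?thesis using independent_subset_card_le_dim[of B W T] assms by fastforce
qed

end

context vector_space_pair
begin

lemma dim_image_plus_dim_kernel:
  assumes lf: "Vector_Spaces.linear s1 s2 f" and V: "vs1.subspace V" and T: "finite T" "V \<subseteq> vs1.span T"
  shows "vs1.dim V = vs2.dim (f ` V) + vs1.dim {x \<in> V. f x = 0}"
proof -
  let ?K = "{x \<in> V. f x = 0}"
  obtain B0 where B0: "B0 \<subseteq> ?K" "vs1.independent B0" "?K \<subseteq> vs1.span B0" "card B0 = vs1.dim ?K"
    using vs1.basis_exists[of ?K] by blast
  obtain B where B: "B0 \<subseteq> B" "B \<subseteq> V" "vs1.independent B" "V \<subseteq> vs1.span B"
    using vs1.maximal_independent_subset_extend[of B0 V] B0(1,2) by blast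
  have fB: "finite B" using vs1.independent_span_bound[OF T(1) B(3)] B(2) T(2) by blast
  let ?C = "B - B0"
  have fC: "finite ?C" and fB0: "finite B0" using fB B(1) finite_subset by auto
  have sC: "vs1.span ?C \<subseteq> V" using vs1.span_minimal[OF _ V] B(2) by blast
  have sB: "vs1.span B = V" using vs1.span_minimal[OF B(2) V] B(4) by blast
  \<comment> \<open>An element of the span of \<open>B - B0\<close> that \<open>f\<close> kills also
    lies in the span of \<open>B0\<close>. It thus has two expansions in the independent set
    \<open>B\<close> with disjoint supports, so it is zero.\<close>
  have inj: "inj_on f (vs1.span ?C)"
  proof (subst linear_inj_on_iff_eq_0[OF lf])
    show "vs1.subspace (vs1.span ?C)" by simp
    show "\<forall>x\<in>vs1.span ?C. f x = 0 \<longrightarrow> x = 0"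
    proof (intro ballI impI)
      fix x assume x: "x \<in> vs1.span ?C" "f x = 0"
      then have "x \<in> vs1.span B0" using sC B0(3) by blast
      then obtain u where u: "x = (\<Sum>v\<in>B0. s1 (u v) v)" unfolding vs1.span_finite[OF fB0] by blast
      obtain w where w: "x = (\<Sum>v\<in>?C. s1 (w v) v)" using x(1) unfolding vs1.span_finite[OF fC] by blast
      have "(\<Sum>v\<in>B. s1 (if v \<in> B0 then u v else - w v) v)
         = (\<Sum>v\<in>B0. s1 (if v \<in> B0 then u v else - w v) v) + (\<Sum>v\<in>?C. s1 (if v \<in> B0 then u v else - w v) v)"
        by (subst sum.subset_diff[OF B(1) fB]) (simp add: add.commute)
      also have "\<dots> = (\<Sum>v\<in>B0. s1 (u v) v) + (\<Sum>v\<in>?C. - s1 (w v) v)"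
        by (intro arg_cong2[of _ _ _ _ "(+)"] sum.cong refl) auto
      also have "\<dots> = 0" using u w by (simp add: sum_negf)
      finally have z: "(\<Sum>v\<in>B. s1 (if v \<in> B0 then u v else - w v) v) = 0" .
      have "u v = 0" if "v \<in> B0" for v
        using vs1.independentD[OF B(3) fB order_refl z, of v] that B(1) by auto
      then show "x = 0" using u by simp
    qed
  qed
  have iC: "vs1.independent ?C" using vs1.independent_mono[OF B(3)] by blast
  have i2: "vs2.independent (f ` ?C)" by (rule linear_independent_injective_image[OF lf iC inj])
  have injC: "inj_on f ?C" using inj vs1.span_superset inj_on_subset by blast
  have "f ` V = vs2.span (f ` B)" unfolding linear_span_image[OF lf] sB ..
  also have "\<dots> \<subseteq> vs2.span (insert 0 (f ` ?C))" using B0(1) by (intro vs2.span_mono) auto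
  finally have "f ` V \<subseteq> vs2.span (f ` ?C)" by (simp add: vs2.span_insert_0)
  moreover have "f ` ?C \<subseteq> f ` V" using B(2) by blast
  ultimately have "card (f ` ?C) = vs2.dim (f ` V)" using vs2.basis_card_eq_dim i2 by blast
  then have "vs2.dim (f ` V) = card B - card B0"
    using card_image[OF injC] card_Diff_subset[OF fB0 B(1)] by simp
  moreover have "card B = vs1.dim V" using vs1.basis_card_eq_dim[OF B(2,4,3)] .
  moreover have "card B0 \<le> card B" using card_mono[OF fB B(1)] .
  ultimately show ?thesis using B0(4) by simp
qed

lemma dim_image_inj_on:
  assumes lf: "Vector_Spaces.linear s1 s2 f" and V: "vs1.subspace V" and T: "finite T" "V \<subseteq> vs1.span T"
    and inj: "\<And>x. x \<in> V \<Longrightarrow> f x = 0 \<Longrightarrow> x = 0"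
  shows "vs2.dim (f ` V) = vs1.dim V"
proof -
  have "{x \<in> V. f x = 0} = {0}" using inj vs1.subspace_0[OF V] linear_0[OF lf] by auto
  moreover have "vs1.dim {0} = 0" using vs1.dim_le_card[of "{0}" "{}"] by simp
  ultimately show ?thesis using dim_image_plus_dim_kernel[OF lf V T] by simp
qed

lemma dim_le_of_inj_on:
  assumes lf: "Vector_Spaces.linear s1 s2 f" and V: "vs1.subspace V" and T: "finite T" "V \<subseteq> vs1.span T"
    and inj: "\<And>x. x \<in> V \<Longrightarrow> f x = 0 \<Longrightarrow> x = 0" and W: "f ` V \<subseteq> W" "finite T'" "W \<subseteq> vs2.span T'"
  shows "vs1.dim V \<le> vs2.dim W"
proof -
  have "vs2.dim (f ` V) = vs1.dim V" by (rule dim_image_inj_on[OF lf V T]) (rule inj)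
  then show ?thesis using vs2.dim_mono_finite[OF W] by (simp only:)
qed

end

section \<open>Rank, nullity and gradings for functions with finite support\<close>

abbreviation fun_scale :: "'k::field \<Rightarrow> ('a \<Rightarrow> 'k) \<Rightarrow> 'a \<Rightarrow> 'k" where
  "fun_scale \<equiv> (\<lambda>c f x. c * f x)"

global_interpretation fs: vector_space "fun_scale :: 'k::field \<Rightarrow> ('a \<Rightarrow> 'k) \<Rightarrow> 'a \<Rightarrow> 'k"
  by unfold_locales (auto simp: fun_eq_iff algebra_simps)

global_interpretation fsp: vector_space_pair "fun_scale :: 'k::field \<Rightarrow> ('a \<Rightarrow> 'k) \<Rightarrow> 'a \<Rightarrow> 'k"
    "fun_scale :: 'k::field \<Rightarrow> ('b \<Rightarrow> 'k) \<Rightarrow> 'b \<Rightarrow> 'k"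
  by unfold_locales

definition fun_on :: "'a set \<Rightarrow> ('a \<Rightarrow> 'k::field) set" where
  "fun_on X = {f. \<forall>x. x \<notin> X \<longrightarrow> f x = 0}"

definition delta :: "'a \<Rightarrow> 'a \<Rightarrow> 'k::field" where
  "delta x = (\<lambda>y. if y = x then 1 else 0)"

lemma sum_fun_apply: "(\<Sum>i\<in>I. f i) x = (\<Sum>i\<in>I. f i x :: 'k::field)"
  by (induction I rule: infinite_finite_induct) auto

lemma fun_linearI:
  assumes "\<And>f g. L (f + g) = L f + L g" "\<And>c f. L (\<lambda>x. c * f x) = (\<lambda>y. c * L f y)"
  shows "Vector_Spaces.linear (fun_scale :: 'k::field \<Rightarrow> ('a \<Rightarrow> 'k) \<Rightarrow> _) (fun_scale :: 'k \<Rightarrow> ('b \<Rightarrow> 'k) \<Rightarrow> _) L"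
  unfolding Vector_Spaces.linear_iff
  by (intro conjI allI fs.vector_space_axioms assms)

lemma subspace_fun_on: "fs.subspace (fun_on X)"
  unfolding fs.subspace_def fun_on_def by auto

lemma span_sum_scale:
  assumes "\<And>x. x \<in> X \<Longrightarrow> v x \<in> fs.span S"
  shows "(\<Sum>x\<in>X. (\<lambda>y. c x * v x y)) \<in> fs.span S"
proof (rule fs.span_sum)
  fix x assume "x \<in> X"
  then show "(\<lambda>y. c x * v x y) \<in> fs.span S" using fs.span_scale[OF assms[of x], of "c x"] by simp
qed

lemma fun_on_span: "finite X \<Longrightarrow> fun_on X \<subseteq> fs.span ((delta :: 'a \<Rightarrow> 'a \<Rightarrow> 'k::field) ` X)"
proof
  fix f :: "'a \<Rightarrow> 'k" assume X: "finite X" and f: "f \<in> fun_on X"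
  have "f = (\<Sum>x\<in>X. (\<lambda>y. f x * delta x y))"
  proof
    fix y
    have "(\<Sum>x\<in>X. (\<lambda>y. f x * delta x y)) y = (\<Sum>x\<in>X. if y = x then f x else 0)"
      by (simp add: sum_fun_apply delta_def if_distrib cong: if_cong)
    also have "\<dots> = f y" using X f by (simp add: fun_on_def)
    finally show "f y = (\<Sum>x\<in>X. (\<lambda>y. f x * delta x y)) y" by simp
  qed
  also have "\<dots> \<in> fs.span (delta ` X)"
    by (rule span_sum_scale) (rule fs.span_base, rule imageI)
  finally show "f \<in> fs.span (delta ` X)" .
qed

lemma dim_fun_on:
  assumes "finite X"
  shows "fs.dim (fun_on X :: ('a \<Rightarrow> 'k::field) set) = card X"
proof -
  let ?d = "delta :: 'a \<Rightarrow> 'a \<Rightarrow> 'k"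
  have inj: "inj_on ?d X"
    by (rule inj_onI) (metis delta_def zero_neq_one)
  have "fs.independent (?d ` X)"
  proof (rule fs.independent_if_scalars_zero)
    show "finite (?d ` X)" using assms by simp
    fix u :: "('a \<Rightarrow> 'k) \<Rightarrow> 'k" and v assume s: "(\<Sum>x\<in>?d ` X. (\<lambda>y. u x * x y)) = 0" and "v \<in> ?d ` X"
    then obtain y where y: "y \<in> X" "v = ?d y" by blast
    have "0 = (\<Sum>x\<in>?d ` X. (\<lambda>y. u x * x y)) y" using s by simp
    also have "\<dots> = (\<Sum>x\<in>X. u (?d x) * ?d x y)" by (simp add: sum_fun_apply sum.reindex[OF inj])
    also have "\<dots> = (\<Sum>x\<in>X. if x = y then u (?d x) else 0)" by (intro sum.cong) (auto simp: delta_def)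
    also have "\<dots> = u v" using y assms by simp
    finally show "u v = 0" by simp
  qed
  moreover have "?d ` X \<subseteq> fun_on X" by (auto simp: fun_on_def delta_def)
  ultimately have "card (?d ` X) = fs.dim (fun_on X :: ('a \<Rightarrow> 'k) set)"
    by (intro fs.basis_card_eq_dim fun_on_span assms)
  then show ?thesis using card_image[OF inj] by simp
qed

text \<open>Rank plus nullity for the matrix with rows \<open>v x\<close>. The rank is written as
  \<open>dim\<close> of the set of rows, not of its span, since this is the form in
  \<open>hk_piece_dim\<close>.\<close>

lemma card_eq_rank_plus_kernel:
  fixes v :: "'a \<Rightarrow> 'b \<Rightarrow> 'k::field"
  assumes X: "finite X"
  shows "card X = fs.dim (v ` X) + fs.dim {f \<in> fun_on X. \<forall>y. (\<Sum>x\<in>X. f x * v x y) = 0}"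
proof -
  define L where "L f = (\<lambda>y. \<Sum>x\<in>X. f x * v x y)" for f
  have L: "Vector_Spaces.linear fun_scale fun_scale L"
    by (rule fun_linearI) (auto simp: L_def fun_eq_iff distrib_right sum.distrib sum_distrib_left mult.assoc)
  have "L ` fun_on X \<subseteq> fs.span (v ` X)"
  proof (clarify)
    fix f :: "'a \<Rightarrow> 'k" assume "f \<in> fun_on X"
    have "L f = (\<Sum>x\<in>X. (\<lambda>y. f x * v x y))" by (simp add: fun_eq_iff L_def sum_fun_apply)
    also have "\<dots> \<in> fs.span (v ` X)" by (rule span_sum_scale) (rule fs.span_base, rule imageI)
    finally show "L f \<in> fs.span (v ` X)" .
  qed
  moreover have "v ` X \<subseteq> L ` fun_on X"
  proof (clarify)
    fix x assume x: "x \<in> X"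
    have "v x = L (delta x)"
    proof
      fix y
      have "L (delta x) y = (\<Sum>z\<in>X. if z = x then v z y else 0)"
        unfolding L_def delta_def by (rule sum.cong) auto
      then show "v x y = L (delta x) y" using X x by simp
    qed
    moreover have "delta x \<in> (fun_on X :: ('a \<Rightarrow> 'k) set)" using x by (auto simp: fun_on_def delta_def)
    ultimately show "v x \<in> L ` fun_on X" by blast
  qed
  ultimately have sp: "fs.span (L ` fun_on X) = fs.span (v ` X)"
    by (intro antisym fs.span_minimal fs.subspace_span) (use fs.span_superset[of "L ` fun_on X"] in blast)+
  have "fs.dim (L ` fun_on X) = fs.dim (v ` X)" using fs.span_eq_dim[OF sp] .
  moreover have "{f \<in> fun_on X. L f = 0} = {f \<in> fun_on X. \<forall>y. (\<Sum>x\<in>X. f x * v x y) = 0}"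
    by (auto simp: L_def fun_eq_iff)
  ultimately show ?thesis
    using fsp.dim_image_plus_dim_kernel[OF L subspace_fun_on _ fun_on_span[OF X]] X
    by (simp add: dim_fun_on)
qed

text \<open>If the columns are combinations of \<open>B\<close>, with coefficients
  \<open>u j b\<close>, then row \<open>i\<close> is the combination of the vectors
  \<open>u _ b\<close> with coefficients \<open>b i\<close>. So the rows lie in the span of at most
  \<open>card B\<close> vectors.\<close>

lemma dim_rows_le_dim_columns:
  fixes M :: "'a \<Rightarrow> 'b \<Rightarrow> 'k::field"
  assumes I: "finite I" and J: "finite J"
  shows "fs.dim ((\<lambda>i j. if j \<in> J then M i j else 0) ` I) \<le> fs.dim ((\<lambda>j i. if i \<in> I then M i j else 0) ` J)"
proof -
  let ?c = "(\<lambda>j i. if i \<in> I then M i j else 0)"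
  obtain B where B: "B \<subseteq> ?c ` J" "fs.independent B" "?c ` J \<subseteq> fs.span B" "card B = fs.dim (?c ` J)"
    using fs.basis_exists[of "?c ` J"] by blast
  have fB: "finite B" using B(1) J finite_subset by blast
  have "\<exists>u. ?c j = (\<Sum>b\<in>B. (\<lambda>i. u b * b i))" if "j \<in> J" for j
  proof -
    have "?c j \<in> fs.span B" using B(3) that by (rule subsetD[OF _ imageI])
    then show ?thesis unfolding fs.span_finite[OF fB] by (rule imageE) (rule exI)
  qed
  then have "\<forall>j\<in>J. \<exists>u. ?c j = (\<Sum>b\<in>B. (\<lambda>i. u b * b i))" by (intro ballI)
  from bchoice[OF this] obtain u where u0: "\<forall>j\<in>J. ?c j = (\<Sum>b\<in>B. (\<lambda>i. u j b * b i))" by (elim exE)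
  note u = bspec[OF u0]
  let ?l = "\<lambda>b j. if j \<in> J then u j b else 0"
  have "(\<lambda>i j. if j \<in> J then M i j else 0) ` I \<subseteq> fs.span (?l ` B)"
  proof clarify
    fix i assume i: "i \<in> I"
    have "(\<lambda>j. if j \<in> J then M i j else 0) = (\<Sum>b\<in>B. (\<lambda>j. b i * ?l b j))"
    proof
      fix j
      show "(if j \<in> J then M i j else 0) = (\<Sum>b\<in>B. (\<lambda>j. b i * ?l b j)) j"
      proof (cases "j \<in> J")
        case True
        have "M i j = ?c j i" using i by simp
        also have "\<dots> = (\<Sum>b\<in>B. (\<lambda>i. u j b * b i)) i" by (rule fun_cong[OF u[OF True]])
        also have "\<dots> = (\<Sum>b\<in>B. u j b * b i)" by (simp add: sum_fun_apply)
        finally show ?thesis using True by (simp add: sum_fun_apply mult.commute)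
      qed (simp add: sum_fun_apply)
    qed
    also have "\<dots> \<in> fs.span (?l ` B)" by (rule span_sum_scale) (rule fs.span_base, rule imageI)
    finally show "(\<lambda>j. if j \<in> J then M i j else 0) \<in> fs.span (?l ` B)" .
  qed
  then have "fs.dim ((\<lambda>i j. if j \<in> J then M i j else 0) ` I) \<le> card (?l ` B)"
    using fs.dim_le_card fB by blast
  also have "\<dots> \<le> card B" using card_image_le[OF fB] .
  finally show ?thesis unfolding B(4) .
qed

lemma dim_rows_eq_dim_columns:
  fixes M :: "'a \<Rightarrow> 'b \<Rightarrow> 'k::field"
  assumes "finite I" "finite J"
  shows "fs.dim ((\<lambda>i j. if j \<in> J then M i j else 0) ` I) = fs.dim ((\<lambda>j i. if i \<in> I then M i j else 0) ` J)"
  using dim_rows_le_dim_columns[of I J M] dim_rows_le_dim_columns[of J I "\<lambda>j i. M i j"] assms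
  by (intro antisym)

text \<open>One value of the grading is split off at a time: the projection to the part with
  \<open>\<pi> x = i\<close> has the block of \<open>i\<close> as image and the remaining blocks as
  kernel.\<close>

lemma dim_sum_blocks:
  fixes V :: "('a \<Rightarrow> 'k::field) set"
  assumes V: "fs.subspace V" "V \<subseteq> fun_on X" "finite X" and I: "finite I"
    and closed: "\<And>f i. f \<in> V \<Longrightarrow> i \<in> I \<Longrightarrow> (\<lambda>x. if \<pi> x = i then f x else 0) \<in> V"
  shows "fs.dim {f \<in> V. \<forall>x. f x \<noteq> 0 \<longrightarrow> \<pi> x \<in> I} = (\<Sum>i\<in>I. fs.dim {f \<in> V. \<forall>x. f x \<noteq> 0 \<longrightarrow> \<pi> x = i})"
  using I closed
proof (induction I rule: finite_induct)
  case empty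
  have "{f \<in> V. \<forall>x. f x \<noteq> 0 \<longrightarrow> \<pi> x \<in> {}} \<subseteq> {0}" by (auto simp: fun_eq_iff)
  then have "fs.dim {f \<in> V. \<forall>x. f x \<noteq> 0 \<longrightarrow> \<pi> x \<in> {}} \<le> card ({} :: ('a \<Rightarrow> 'k) set)"
    by (intro fs.dim_le_card) (simp_all only: fs.span_empty finite.emptyI)
  then show ?case by (simp only: card.empty le_zero_eq sum.empty)
next
  case (insert i J)
  define VJ where "VJ J = {f \<in> V. \<forall>x. f x \<noteq> 0 \<longrightarrow> \<pi> x \<in> J}" for J
  define L where "L f = (\<lambda>x. if \<pi> x = i then f x else 0)" for f :: "'a \<Rightarrow> 'k"
  have L: "Vector_Spaces.linear fun_scale fun_scale L"
    by (rule fun_linearI) (auto simp: L_def fun_eq_iff)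
  have s: "fs.subspace (VJ (insert i J))"
    using V(1) unfolding fs.subspace_def VJ_def
    by (auto, metis add_0) 
  have T: "VJ (insert i J) \<subseteq> fs.span (delta ` X)" using fun_on_span[OF V(3)] V(2) unfolding VJ_def by blast
  have "L ` VJ (insert i J) = {f \<in> V. \<forall>x. f x \<noteq> 0 \<longrightarrow> \<pi> x = i}" (is "_ = ?Vi")
  proof
    show "L ` VJ (insert i J) \<subseteq> ?Vi" using insert.prems(1) unfolding VJ_def L_def by (auto split: if_splits)
    show "?Vi \<subseteq> L ` VJ (insert i J)"
    proof
      fix f assume f: "f \<in> ?Vi"
      then have "f = L f" unfolding L_def by (auto simp: fun_eq_iff)
      moreover have "f \<in> VJ (insert i J)" using f unfolding VJ_def by auto
      ultimately show "f \<in> L ` VJ (insert i J)" by blast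
    qed
  qed
  moreover have "{f \<in> VJ (insert i J). L f = 0} = VJ J"
    using insert.hyps(2) unfolding VJ_def L_def by (auto simp: fun_eq_iff split: if_splits)
  ultimately have "fs.dim (VJ (insert i J)) = fs.dim ?Vi + fs.dim (VJ J)"
    using fsp.dim_image_plus_dim_kernel[OF L s _ T] V(3) by simp
  moreover have "fs.dim (VJ J) = (\<Sum>i\<in>J. fs.dim {f \<in> V. \<forall>x. f x \<noteq> 0 \<longrightarrow> \<pi> x = i})"
    unfolding VJ_def using insert.IH insert.prems by blast
  ultimately show ?case unfolding VJ_def using insert.hyps by simp
qed

section \<open>Syzygies of powers of three linear forms\<close>

text \<open>The homogeneous relation \<open>X^a A + Y^b B = (X+Y)^c C\<close> of degree
  \<open>e\<close>, dehomogenised at \<open>Y = 1\<close>. The factor \<open>Y^b\<close> becomes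
  invisible and survives only in the degree bound for \<open>B\<close>; in general divisibility by
  \<open>Y\<close> turns into a drop of degree.\<close>

definition syzygy :: "nat \<Rightarrow> nat \<Rightarrow> nat \<Rightarrow> nat \<Rightarrow> 'k::field poly \<Rightarrow> 'k poly \<Rightarrow> 'k poly \<Rightarrow> bool" where
  "syzygy a b c e A B C \<longleftrightarrow> [:0,1:] ^ a * A + B = [:1,1:] ^ c * C
     \<and> (A = 0 \<or> a + degree A \<le> e) \<and> (B = 0 \<or> b + degree B \<le> e) \<and> (C = 0 \<or> c + degree C \<le> e)"

text \<open>An element of least degree in the ideal generated by \<open>A\<close>, \<open>B\<close>,
  \<open>C\<close> divides every member of that ideal, by division with remainder.\<close>

lemma poly_bezout3:
  fixes A B C :: "'k::field poly"
  assumes "A \<noteq> 0"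
  shows "\<exists>D u v w. D = u * A + v * B + w * C \<and> D \<noteq> 0 \<and> D dvd A \<and> D dvd B \<and> D dvd C"
proof -
  define I where "I = {D. \<exists>u v w. D = u * A + v * B + w * C}"
  have IA: "A \<in> I" unfolding I_def
    by (intro CollectI exI[of _ 1] exI[of _ 0]) simp
  have IB: "B \<in> I" unfolding I_def
    by (rule CollectI, rule exI[of _ 0], rule exI[of _ 1], rule exI[of _ 0]) simp
  have IC: "C \<in> I" unfolding I_def
    by (rule CollectI, rule exI[of _ 0], rule exI[of _ 0], rule exI[of _ 1]) simp
  have ex: "\<exists>n D. D \<in> I \<and> D \<noteq> 0 \<and> degree D = n" using IA assms by blast
  define n where "n = (LEAST n. \<exists>D. D \<in> I \<and> D \<noteq> 0 \<and> degree D = n)"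
  obtain D where D: "D \<in> I" "D \<noteq> 0" "degree D = n"
    using LeastI_ex[OF ex] unfolding n_def by blast
  have min: "E = 0 \<or> n \<le> degree E" if "E \<in> I" for E
    using that unfolding n_def by (metis (mono_tags, lifting) Least_le)
  obtain u v w where uvw: "D = u * A + v * B + w * C" using D(1) unfolding I_def by blast
  have dv: "D dvd E" if EI: "E \<in> I" for E
  proof -
    obtain u' v' w' where E: "E = u' * A + v' * B + w' * C" using EI unfolding I_def by blast
    define Q where "Q = E div D"
    have "E mod D = E - Q * D" unfolding Q_def by (simp add: minus_div_mult_eq_mod)
    also have "\<dots> = (u' - Q * u) * A + (v' - Q * v) * B + (w' - Q * w) * C"
      unfolding E uvw by (simp add: algebra_simps)
    finally have "E mod D \<in> I" unfolding I_def by blast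
    then have "E mod D = 0" using min degree_mod_less[OF D(2), of E] D(3) by fastforce
    then show ?thesis by auto
  qed
  show ?thesis using uvw D(2) dv IA IB IC by blast
qed

lemma pcompose_monom_monom: "pcompose (monom (c::'k::field) i) (monom 1 p) = monom c (p * i)"
proof (induction i)
  case 0
  then show ?case by (simp add: monom_0)
next
  case (Suc i)
  then show ?case by (simp add: monom_Suc pcompose_pCons mult_monom)
qed

text \<open>Only the exponents are divided by \<open>p\<close>, the coefficients are kept. Hence the
  conclusion is a polynomial in \<open>X^p\<close> rather than a \<open>p\<close>-th power.\<close>

lemma pderiv_0_imp_pcompose:
  fixes A :: "'k::field poly"
  assumes "pderiv A = 0" "CHAR('k) = p" "p > 0"
  shows "\<exists>A'. A = pcompose A' (monom 1 p)"
proof -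
  have nz: "coeff A n = 0" if "\<not> p dvd n" for n
  proof (cases n)
    case (Suc k)
    have "of_nat (Suc k) * coeff A (Suc k) = (0::'k)" using assms(1) by (metis coeff_0 coeff_pderiv)
    moreover have "of_nat (Suc k) \<noteq> (0::'k)" using that Suc assms(2) by (metis of_nat_eq_0_iff_char_dvd)
    ultimately show ?thesis using Suc by simp
  qed (use that in simp)
  define A' where "A' = (\<Sum>i\<le>degree A. monom (coeff A (p * i)) i)"
  have "pcompose A' (monom 1 p) = (\<Sum>i\<le>degree A. monom (coeff A (p * i)) (p * i))"
    unfolding A'_def pcompose_sum
    by (intro sum.cong refl) (simp add: pcompose_monom_monom)
  also have "\<dots> = A"
  proof (rule poly_eqI)
    fix n
    have "coeff (\<Sum>i\<le>degree A. monom (coeff A (p * i)) (p * i)) n = (\<Sum>i\<le>degree A. if p * i = n then coeff A n else 0)"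
      by (simp add: coeff_sum) (intro sum.cong, auto)
    also have "\<dots> = coeff A n"
    proof (cases "p dvd n")
      case True
      then obtain k where k: "n = p * k" by blast
      have "(\<Sum>i\<le>degree A. if p * i = n then coeff A n else 0) = (\<Sum>i\<le>degree A. if i = k then coeff A n else 0)"
        using k assms(3) by (intro sum.cong) auto
      also have "\<dots> = (if k \<le> degree A then coeff A n else 0)" by simp
      also have "\<dots> = coeff A n"
      proof (cases "k \<le> degree A")
        case False
        then have "n > degree A" using k assms(3) by (metis less_le_trans mult.commute mult_le_mono2 nat_mult_1_right not_le Suc_leI One_nat_def)
        then show ?thesis by (simp add: coeff_eq_0)
      qed simp
      finally show ?thesis .
    next
      case False
      then have "(\<Sum>i\<le>degree A. if p * i = n then coeff A n else 0) = 0"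
        by (intro sum.neutral) auto
      then show ?thesis using nz[OF False] by simp
    qed
    finally show "coeff (\<Sum>i\<le>degree A. monom (coeff A (p * i)) (p * i)) n = coeff A n" .
  qed
  finally show ?thesis by metis
qed

lemma dvd_pderiv_imp_0:
  fixes A :: "'k::field poly"
  assumes "A dvd pderiv A"
  shows "pderiv A = 0"
proof (rule ccontr)
  assume n: "pderiv A \<noteq> 0"
  then have 1: "degree A \<le> degree (pderiv A)" using assms by (simp add: dvd_imp_degree_le)
  have 2: "degree (pderiv A) \<le> degree A - 1"
    by (rule degree_le) (auto simp: coeff_pderiv coeff_eq_0)
  have "degree A = 0" using 1 2 by simp
  then show False using n by (metis degree_eq_zeroE pderiv_pCons pderiv_0 pderiv_singleton)
qed

lemma dist_step:
  fixes a a' :: nat and v :: int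
  shows "\<bar>int a - v\<bar> \<le> \<bar>int a' - v\<bar> + \<bar>int a' - int a\<bar>" by linarith

lemma dvd_X_iff: "[:0,1:] dvd (A::'k::field poly) \<longleftrightarrow> poly A 0 = 0"
  using poly_eq_0_iff_dvd[of A 0] by simp

lemma dvd_X1_iff: "[:1,1:] dvd (A::'k::field poly) \<longleftrightarrow> poly A (-1) = 0"
  using poly_eq_0_iff_dvd[of A "-1"] by simp

lemma degree_linear_mult:
  assumes "A = [:v,1:] * A'" "A \<noteq> (0::'k::field poly)"
  shows "A' \<noteq> 0" "degree A = Suc (degree A')"
proof -
  show "A' \<noteq> 0" using assms by auto
  then show "degree A = Suc (degree A')" using assms degree_mult_eq[of "[:v,1:]" A'] by simp
qed

text \<open>Induction on \<open>2 e\<close> minus the gap \<open>a + b + c - 2 e\<close>. Whenever a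
  linear form divides a cofactor it should not divide, or a common factor can be cancelled, a nearby
  triple has a syzygy of larger gap, and the bound returns by the triangle inequality. If nothing of
  this kind is possible, either the gap is one, or vanishing Wronskians show that the relation is
  one in \<open>X^p\<close>, and all data can be divided by \<open>p\<close>.\<close>

theorem syzygy_gap_bound:
  fixes A B C :: "'k::field poly"
  assumes "CHAR('k) = p" "prime p"
    and "syzygy a b c e A B C" "A \<noteq> 0" "B \<noteq> 0" "C \<noteq> 0" "2 * e < a + b + c"
  shows "\<exists>r u1 u2 u3. u1 \<ge> 1 \<and> u2 \<ge> 1 \<and> u3 \<ge> 1 \<and>
     int (p ^ r) \<ge> int a + int b + int c - 2 * int e
       + \<bar>int a - int (p ^ r * u1)\<bar> + \<bar>int b - int (p ^ r * u2)\<bar> + \<bar>int c - int (p ^ r * u3)\<bar>"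
  using assms(3-)
proof (induction "4 * e - (a + b + c)" arbitrary: a b c e A B C rule: less_induct)
  case less
  define g where "g = int a + int b + int c - 2 * int e"
  let ?P = "\<lambda>a b c e. \<exists>r u1 u2 u3. u1 \<ge> 1 \<and> u2 \<ge> 1 \<and> u3 \<ge> 1 \<and>
     int (p ^ r) \<ge> int a + int b + int c - 2 * int e
       + \<bar>int a - int (p ^ r * u1)\<bar> + \<bar>int b - int (p ^ r * u2)\<bar> + \<bar>int c - int (p ^ r * u3)\<bar>"
  have nz: "A \<noteq> 0" "B \<noteq> 0" "C \<noteq> 0" using less.prems by auto
  have eq: "[:0,1:] ^ a * A + B = [:1,1:] ^ c * C" and
    dA: "a + degree A \<le> e" and dB: "b + degree B \<le> e" and dC: "c + degree C \<le> e"
    using less.prems unfolding syzygy_def by auto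
  have g1: "2 * e < a + b + c" using less.prems by simp
  have e0: "e \<ge> 1" using dA dB dC g1 by linarith
  \<comment> \<open>If the gap grows by at least the taxicab distance moved, the bound for the new
    triple implies that for the old one.\<close>
  have mstep: ?case if P: "?P a' b' c' e'" and
     "int a' + int b' + int c' - 2 * int e' \<ge> g + \<bar>int a' - int a\<bar> + \<bar>int b' - int b\<bar> + \<bar>int c' - int c\<bar>" for a' b' c' e'
  proof -
    obtain r u1 u2 u3 where u: "u1 \<ge> 1" "u2 \<ge> 1" "u3 \<ge> 1" and
     le: "int (p ^ r) \<ge> int a' + int b' + int c' - 2 * int e'
       + \<bar>int a' - int (p ^ r * u1)\<bar> + \<bar>int b' - int (p ^ r * u2)\<bar> + \<bar>int c' - int (p ^ r * u3)\<bar>"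
      using P by blast
    have "int (p ^ r) \<ge> g
       + \<bar>int a - int (p ^ r * u1)\<bar> + \<bar>int b - int (p ^ r * u2)\<bar> + \<bar>int c - int (p ^ r * u3)\<bar>"
      using le that(2) dist_step[of a "int (p ^ r * u1)" a'] dist_step[of b "int (p ^ r * u2)" b'] dist_step[of c "int (p ^ r * u3)" c']
      by linarith
    then show ?thesis using u unfolding g_def by blast
  qed
  have step: ?case if "syzygy a' b' c' e' A' B' C'" "A' \<noteq> 0" "B' \<noteq> 0" "C' \<noteq> 0" "e' \<le> e"
     "int a' + int b' + int c' - 2 * int e' \<ge> g + \<bar>int a' - int a\<bar> + \<bar>int b' - int b\<bar> + \<bar>int c' - int c\<bar>"
     "int a' + int b' + int c' - 2 * int e' \<ge> g + 1" for a' b' c' e' and A' B' C' :: "'k poly"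
  proof -
    have "a' \<le> e'" "b' \<le> e'" "c' \<le> e'" using that(1-4) unfolding syzygy_def by auto
    moreover have "a \<le> e" "b \<le> e" "c \<le> e" using dA dB dC by auto
    ultimately have "4 * e' - (a' + b' + c') < 4 * e - (a + b + c)" using that(5,7) g1 unfolding g_def by linarith
    moreover have "2 * e' < a' + b' + c'" using that(7) g1 unfolding g_def by linarith
    ultimately have "?P a' b' c' e'" using less.hyps that(1-4) by blast
    then show ?thesis using mstep that(6) by blast
  qed
  \<comment> \<open>Gap one is met with \<open>r = 0\<close> by the triple itself, at distance zero.
    The exponents are positive because each of them is at most \<open>e\<close>.\<close>
  have sg1: ?case if "g = 1"
  proof -
    have u: "a \<ge> 1" "b \<ge> 1" "c \<ge> 1" using that dA dB dC g_def by linarith+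
    show ?thesis
      apply (rule exI[of _ 0], rule exI[of _ a], rule exI[of _ b], rule exI[of _ c])
      using u that unfolding g_def by simp
  qed
  have sx: ?case if h: "[:0,1:] dvd A"
  proof -
    obtain A' where A': "A = [:0,1:] * A'" using h by blast
    note d = degree_linear_mult[OF A' nz(1)]
    have "[:0,1:] ^ a * A = [:0,1:] ^ Suc a * A'" unfolding A' by (simp only: power_Suc ac_simps)
    then have "syzygy (Suc a) b c e A' B C" unfolding syzygy_def
      using eq dA dB dC d by (simp del: power_Suc)
    then show ?thesis by (rule step) (use d nz g_def in auto)
  qed
  have sz: ?case if h: "[:1,1:] dvd C"
  proof -
    obtain C' where C': "C = [:1,1:] * C'" using h by blast
    note d = degree_linear_mult[OF C' nz(3)]
    have "[:1,1:] ^ c * C = [:1,1:] ^ Suc c * C'" unfolding C' by (simp only: power_Suc ac_simps)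
    then have "syzygy a b (Suc c) e A B C'" unfolding syzygy_def
      using eq dA dB dC d by (simp del: power_Suc)
    then show ?thesis by (rule step) (use d nz g_def in auto)
  qed
  \<comment> \<open>The case of a \<open>B\<close> divisible by \<open>Y\<close>, seen after
    dehomogenising as a degree that is not attained. With \<open>sx\<close> and \<open>sz\<close> it
    says that a cofactor may not contain its own linear form.\<close>
  have sy: ?case if h: "b + degree B < e"
  proof -
    have "syzygy a (Suc b) c e A B C" unfolding syzygy_def
      using eq dA dB dC h by simp
    then show ?thesis by (rule step) (use nz g_def in auto)
  qed
  have sD: ?case if h: "D dvd A" "D dvd B" "D dvd C" "degree D > 0" for D
  proof -
    obtain A' B' C' where ABC: "A = D * A'" "B = D * B'" "C = D * C'" using h unfolding dvd_def by metis
    have n: "D \<noteq> 0" "A' \<noteq> 0" "B' \<noteq> 0" "C' \<noteq> 0" using ABC nz by auto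
    have d: "degree A = degree D + degree A'" "degree B = degree D + degree B'" "degree C = degree D + degree C'"
      using ABC n by (auto simp: degree_mult_eq)
    have "D * ([:0,1:] ^ a * A' + B') = D * ([:1,1:] ^ c * C')"
      using eq unfolding ABC by (simp add: algebra_simps)
    then have "[:0,1:] ^ a * A' + B' = [:1,1:] ^ c * C'" using n(1) by simp
    then have "syzygy a b c (e - degree D) A' B' C'" unfolding syzygy_def
      using dA dB dC d by auto
    then show ?thesis by (rule step) (use n g_def h d dA in \<open>auto simp: of_nat_diff\<close>)
  qed
  \<comment> \<open>If \<open>X\<close> divides the other two cofactors, the relation can be divided
    by \<open>X\<close>: \<open>a\<close> and \<open>e\<close> both drop by one and the gap grows by
    one. If \<open>a = 0\<close>, then \<open>X\<close> divides \<open>A\<close> as well. The cases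
    \<open>szz\<close> and \<open>syy\<close> are the analogues for \<open>X + Y\<close> and
    \<open>Y\<close>.\<close>
  have sxx: ?case if h: "[:0,1:] dvd B" "[:0,1:] dvd C"
  proof (cases a)
    case 0
    have "A = [:1,1:] ^ c * C - B" using eq 0 by (simp add: algebra_simps)
    then have "[:0,1:] dvd A" using h by simp
    then show ?thesis by (rule sx)
  next
    case (Suc a')
    obtain B' C' where BC: "B = [:0,1:] * B'" "C = [:0,1:] * C'" using h unfolding dvd_def by metis
    note d = degree_linear_mult[OF BC(1) nz(2)] degree_linear_mult[OF BC(2) nz(3)]
    have "[:0,1:] * ([:0,1:] ^ a' * A + B') = [:0,1:] * ([:1,1:] ^ c * C')"
      using eq unfolding BC Suc by (simp only: power_Suc algebra_simps)
    then have "[:0,1:] ^ a' * A + B' = [:1,1:] ^ c * C'"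
      by (metis mult_cancel_left pCons_eq_0_iff zero_neq_one)
    then have "syzygy a' b c (e - 1) A B' C'" unfolding syzygy_def
      using dA dB dC d Suc by auto
    then show ?thesis by (rule step) (use nz d g_def e0 Suc in \<open>auto simp: of_nat_diff\<close>)
  qed
  have szz: ?case if h: "[:1,1:] dvd A" "[:1,1:] dvd B"
  proof (cases c)
    case 0
    have "C = [:0,1:] ^ a * A + B" using eq 0 by simp
    then have "[:1,1:] dvd C" using h by (metis dvd_add dvd_mult)
    then show ?thesis by (rule sz)
  next
    case (Suc c')
    obtain A' B' where AB: "A = [:1,1:] * A'" "B = [:1,1:] * B'" using h unfolding dvd_def by metis
    note d = degree_linear_mult[OF AB(1) nz(1)] degree_linear_mult[OF AB(2) nz(2)]
    have "[:1,1:] * ([:0,1:] ^ a * A' + B') = [:1,1:] * ([:1,1:] ^ c' * C)"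
      using eq unfolding AB Suc by (simp only: power_Suc algebra_simps)
    then have "[:0,1:] ^ a * A' + B' = [:1,1:] ^ c' * C"
      by (metis mult_cancel_left pCons_eq_0_iff zero_neq_one)
    then have "syzygy a b c' (e - 1) A' B' C" unfolding syzygy_def
      using dA dB dC d Suc by auto
    then show ?thesis by (rule step) (use nz d g_def e0 Suc in \<open>auto simp: of_nat_diff\<close>)
  qed
  have syy: ?case if h: "a + degree A < e" "c + degree C < e"
  proof (cases b)
    case 0
    show ?thesis
    proof (rule sy)
      have "B = [:1,1:] ^ c * C - [:0,1:] ^ a * A" using eq by (simp add: algebra_simps)
      moreover have "degree ([:1,1:] ^ c * C) < e" "degree ([:0,1:] ^ a * A) < e"
        using h nz by (simp_all add: degree_mult_eq degree_power_eq)
      ultimately show "b + degree B < e" using 0 degree_diff_less[of _ e] by simp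
    qed
  next
    case (Suc b')
    have "syzygy a b' c (e - 1) A B C" unfolding syzygy_def
      using eq dA dB dC h Suc by auto
    then show ?thesis by (rule step) (use nz g_def e0 Suc in \<open>auto simp: of_nat_diff\<close>)
  qed
  show ?case
  proof (rule ccontr)
    assume neg: "\<not> ?case"
    have g2: "2 * e + 2 \<le> a + b + c" 
    proof -
      have "g \<noteq> 1" using sg1 neg by blast
      then show ?thesis using g_def g1 by linarith
    qed
    have nx: "poly A 0 \<noteq> 0" using sx neg dvd_X_iff by blast
    have nz1: "poly C (-1) \<noteq> 0" using sz neg dvd_X1_iff by blast
    have "\<not> b + degree B < e" using sy neg by blast
    then have eB: "b + degree B = e" using dB by simp
    have nxx: "poly B 0 \<noteq> 0 \<or> poly C 0 \<noteq> 0" using sxx neg dvd_X_iff by blast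
    have nzz: "poly A (-1) \<noteq> 0 \<or> poly B (-1) \<noteq> 0" using szz neg dvd_X1_iff by blast
    have "\<not> (a + degree A < e \<and> c + degree C < e)" using syy neg by blast
    then have eAC: "a + degree A = e \<or> c + degree C = e" using dA dC by linarith
    let ?x = "[:0,1:] :: 'k poly" and ?z = "[:1,1:] :: 'k poly"
    \<comment> \<open>The derivative of the relation is multiplied by \<open>X (X + 1)\<close>, so
      that the exponents \<open>a\<close> and \<open>c\<close> reappear unchanged and no
      \<open>a - 1\<close> or \<open>c - 1\<close> occurs.\<close>
    define A1 where "A1 = of_nat a * A + ?x * pderiv A"
    define C1 where "C1 = of_nat c * C + ?z * pderiv C"
    have pp: "pderiv (v ^ n) * v = of_nat n * v ^ n * pderiv v" for v :: "'k poly" and n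
    proof (cases n)
      case (Suc k)
      have "pderiv (v ^ Suc k) * v = smult (of_nat (Suc k)) (v ^ k) * pderiv v * v"
        by (simp only: pderiv_power_Suc)
      also have "\<dots> = of_nat (Suc k) * v ^ Suc k * pderiv v"
        by (simp add: of_nat_poly ac_simps del: of_nat_Suc)
      finally show ?thesis unfolding Suc .
    qed simp
    have px: "pderiv (?x ^ a) * ?x = of_nat a * ?x ^ a" and pz: "pderiv (?z ^ c) * ?z = of_nat c * ?z ^ c"
      using pp[of ?x a] pp[of ?z c] by (simp_all add: pderiv_pCons)
    have "pderiv (?x ^ a * A + B) = pderiv (?z ^ c * C)" using eq by simp
    then have "?x ^ a * pderiv A + A * pderiv (?x ^ a) + pderiv B = ?z ^ c * pderiv C + C * pderiv (?z ^ c)"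
      by (simp add: pderiv_add pderiv_mult)
    then have "?x * ?z * (?x ^ a * pderiv A + A * pderiv (?x ^ a) + pderiv B) = ?x * ?z * (?z ^ c * pderiv C + C * pderiv (?z ^ c))"
      by simp
    then have "?z * ?x ^ a * (?x * pderiv A) + ?z * A * (pderiv (?x ^ a) * ?x) + ?x * ?z * pderiv B
       = ?x * ?z ^ c * (?z * pderiv C) + ?x * C * (pderiv (?z ^ c) * ?z)"
      by (simp only: algebra_simps)
    then have eq2: "?x ^ a * (?z * A1) + ?x * ?z * pderiv B = ?z ^ c * (?x * C1)"
      unfolding px pz A1_def C1_def by (simp only: algebra_simps)
    define M1 where "M1 = B * C1 - ?z * pderiv B * C"
    define M2 where "M2 = ?x * C1 * A - ?z * C * A1"
    define M3 where "M3 = B * A1 - ?x * pderiv B * A"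
    have m12: "?x ^ a * M2 = - (?x * M1)"
    proof -
      have "?x ^ a * M2 + ?x * M1 = (?x ^ a * A + B) * (?x * C1) - (?x ^ a * (?z * A1) + ?x * ?z * pderiv B) * C"
        unfolding M1_def M2_def by (simp only: algebra_simps)
      also have "\<dots> = 0" unfolding eq eq2 by (simp only: algebra_simps) simp
      finally show ?thesis by (simp only: eq_neg_iff_add_eq_0)
    qed
    have m32: "?z * M3 = - (?z ^ c * M2)"
    proof -
      have "?z * M3 = (?x ^ a * A + B) * (?z * A1) - (?x ^ a * (?z * A1) + ?x * ?z * pderiv B) * A"
        unfolding M3_def by (simp only: algebra_simps)
      also have "\<dots> = - (?z ^ c * M2)" unfolding eq eq2 M2_def by (simp only: algebra_simps) simp
      finally show ?thesis .
    qed
    have dpd: "degree (pderiv Y) \<le> degree Y - 1" for Y :: "'k poly"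
      by (rule degree_le) (auto simp: coeff_pderiv coeff_eq_0)
    have dzp: "degree ([:v,1:] * pderiv Y) \<le> degree Y" for Y :: "'k poly" and v
    proof (cases "degree Y = 0")
      case True
      then have "pderiv Y = 0" by (metis degree_eq_zeroE pderiv_pCons pderiv_0 pderiv_singleton)
      then show ?thesis by simp
    next
      case False
      have "degree ([:v,1:] * pderiv Y) \<le> 1 + degree (pderiv Y)"
        using degree_mult_le[of "[:v,1:]" "pderiv Y"] by simp
      then show ?thesis using False dpd[of Y] by simp
    qed
    have dC1: "degree C1 \<le> degree C" unfolding C1_def of_nat_poly
      by (rule degree_add_le[OF _ dzp]) (simp add: degree_smult_le)
    have dM1: "degree M1 \<le> degree B + degree C"
    proof -
      have "degree (B * C1) \<le> degree B + degree C" using degree_mult_le[of B C1] dC1 by simp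
      moreover have "degree (?z * pderiv B * C) \<le> degree B + degree C"
        using degree_mult_le[of "?z * pderiv B" C] dzp[of 1 B] by simp
      ultimately show ?thesis unfolding M1_def by (rule degree_diff_le)
    qed
    \<comment> \<open>A nonzero \<open>M2\<close> would give
      \<open>a \<le> 1 + deg B + deg C \<le> 1 + 2 e - b - c\<close>, that is a gap of at most one.
      This is why gap one was treated separately.\<close>
    have M2: "M2 = 0"
    proof (rule ccontr)
      assume n2: "M2 \<noteq> 0"
      then have n1: "M1 \<noteq> 0" using m12 by auto
      have "degree (?x ^ a * M2) = a + degree M2" using n2 by (simp add: degree_mult_eq degree_power_eq)
      moreover have "degree (- (?x * M1)) = 1 + degree M1" using n1 by (simp add: degree_mult_eq)
      ultimately have "a + degree M2 = 1 + degree M1" using m12 by simp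
      then show False using dM1 dB dC g2 by linarith
    qed
    have canc: "v \<noteq> 0 \<Longrightarrow> v * Y = 0 \<Longrightarrow> Y = 0" for v Y :: "'k poly" by (metis mult_eq_0_iff)
    have x0: "?x \<noteq> 0" and z0: "?z \<noteq> 0" by simp_all
    have "- (?x * M1) = 0" unfolding m12[symmetric] M2 by simp
    then have "?x * M1 = 0" by (simp only: neg_equal_0_iff_equal)
    then have M1: "M1 = 0" by (rule canc[OF x0])
    have "?z * M3 = 0" unfolding m32 M2 by simp
    then have M3: "M3 = 0" by (rule canc[OF z0])
    have ev: "poly M1 v = 0" "poly M2 v = 0" "poly M3 v = 0" for v using M1 M2 M3 by auto
    \<comment> \<open>At 0 the terms with derivatives drop out of \<open>M2\<close> and
      \<open>M3\<close>, leaving \<open>a\<close> times nonzero values, since \<open>X\<close>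
      divides neither \<open>A\<close> nor both of \<open>B\<close> and \<open>C\<close>. The same
      at -1 gives the statement for \<open>c\<close>.\<close>
    have pa: "of_nat a = (0::'k)"
      using ev(2,3)[of 0] nx nxx unfolding M2_def M3_def A1_def by auto
    have pc: "of_nat c = (0::'k)"
      using ev(1,2)[of "-1"] nz1 nzz unfolding M1_def M2_def C1_def by auto
    have A1: "A1 = ?x * pderiv A" and C1: "C1 = ?z * pderiv C"
      unfolding A1_def C1_def using pa pc by (simp_all add: of_nat_poly)
    have "?x * (B * pderiv A - pderiv B * A) = M3" unfolding M3_def A1 by (simp only: algebra_simps)
    then have "B * pderiv A - pderiv B * A = 0" using M3 by - (rule canc[OF x0], simp only:)
    then have AB: "B * pderiv A = pderiv B * A" by (simp only: right_minus_eq)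
    have "?z * (B * pderiv C - pderiv B * C) = M1" unfolding M1_def C1 by (simp only: algebra_simps)
    then have "B * pderiv C - pderiv B * C = 0" using M1 by - (rule canc[OF z0], simp only:)
    then have BC: "B * pderiv C = pderiv B * C" by (simp only: right_minus_eq)
    have "?x * (?z * (A * pderiv C - pderiv A * C)) = M2" unfolding M2_def A1 C1 by (simp only: algebra_simps)
    then have "A * pderiv C - pderiv A * C = 0" using M2 by - (rule canc[OF z0], rule canc[OF x0], simp only:)
    then have AC: "A * pderiv C = pderiv A * C" by (simp only: right_minus_eq)
    \<comment> \<open>Now all three Wronskians of \<open>A\<close>, \<open>B\<close>,
      \<open>C\<close> vanish. With a combination of them equal to a unit, each polynomial divides
      its own derivative, which must then be zero.\<close>
    obtain D u v w where D: "D = u * A + v * B + w * C" "D \<noteq> 0" "D dvd A" "D dvd B" "D dvd C"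
      using poly_bezout3[OF nz(1)] by blast
    have "degree D = 0" using sD[of D] D neg by blast
    then have uD: "D dvd 1" using D(2) by (simp add: is_unit_iff_degree)
    have dvdD: "Y dvd pderiv Y" if "Y dvd D * pderiv Y" for Y
      using that uD by (metis dvd_mult_unit_iff' )
    have "D * pderiv A = u * (A * pderiv A) + v * (B * pderiv A) + w * (pderiv A * C)"
      unfolding D(1) by (simp only: algebra_simps)
    also have "\<dots> = A * (u * pderiv A + v * pderiv B + w * pderiv C)"
      unfolding AB AC[symmetric] by (simp only: algebra_simps)
    finally have "D * pderiv A = A * (u * pderiv A + v * pderiv B + w * pderiv C)" .
    then have "A dvd D * pderiv A" by simp
    then have A0: "pderiv A = 0" by (rule dvd_pderiv_imp_0[OF dvdD])
    have "D * pderiv B = u * (pderiv B * A) + v * (B * pderiv B) + w * (pderiv B * C)"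
      unfolding D(1) by (simp only: algebra_simps)
    also have "\<dots> = B * (u * pderiv A + v * pderiv B + w * pderiv C)"
      unfolding AB[symmetric] BC[symmetric] by (simp only: algebra_simps)
    finally have "D * pderiv B = B * (u * pderiv A + v * pderiv B + w * pderiv C)" .
    then have "B dvd D * pderiv B" by simp
    then have B0: "pderiv B = 0" by (rule dvd_pderiv_imp_0[OF dvdD])
    have "D * pderiv C = u * (A * pderiv C) + v * (B * pderiv C) + w * (C * pderiv C)"
      unfolding D(1) by (simp only: algebra_simps)
    also have "\<dots> = C * (u * pderiv A + v * pderiv B + w * pderiv C)"
      unfolding AC BC by (simp only: algebra_simps)
    finally have "D * pderiv C = C * (u * pderiv A + v * pderiv B + w * pderiv C)" .
    then have "C dvd D * pderiv C" by simp
    then have C0: "pderiv C = 0" by (rule dvd_pderiv_imp_0[OF dvdD])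
    have p0: "p > 0" using \<open>prime p\<close> by (simp add: prime_gt_0_nat)
    have p1: "p > 1" using prime_gt_1_nat[OF \<open>prime p\<close>] .
    obtain A' B' C' where ABC': "A = pcompose A' (monom 1 p)" "B = pcompose B' (monom 1 p)" "C = pcompose C' (monom 1 p)"
      using pderiv_0_imp_pcompose[OF _ assms(1) p0] A0 B0 C0 by meson
    have deg: "degree A = p * degree A'" "degree B = p * degree B'" "degree C = p * degree C'"
      unfolding ABC' by (simp_all add: degree_pcompose degree_monom_eq mult.commute)
    have "p dvd a" "p dvd c" using pa pc assms(1) by (simp_all add: of_nat_eq_0_iff_char_dvd)
    then obtain a' c' where ac: "a = p * a'" "c = p * c'" unfolding dvd_def by blast
    \<comment> \<open>Since \<open>Y\<close> divides neither \<open>B\<close> nor both of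
      \<open>A\<close> and \<open>C\<close>, the degree \<open>e\<close> is attained. As the degrees
      of \<open>A\<close>, \<open>B\<close>, \<open>C\<close> are multiples of \<open>p\<close>, so
      is \<open>e\<close>, and then \<open>b\<close>.\<close>
    have "p dvd e"
    proof (cases "a + degree A = e")
      case True
      then show ?thesis unfolding ac deg True[symmetric] by simp
    next
      case False
      then have "c + degree C = e" using eAC by simp
      then show ?thesis unfolding ac deg by (metis dvd_add dvd_triv_left)
    qed
    then obtain e' where e: "e = p * e'" by blast
    have "p dvd b" using eB e deg by (metis dvd_add_left_iff dvd_triv_left)
    then obtain b' where b: "b = p * b'" by blast
    have ch: "CHAR('k poly) = p" using assms(1) by simp
    have fr: "?z ^ p = pcompose ?z (monom 1 p)"
    proof -
      have "(monom 1 1 + 1 :: 'k poly) ^ CHAR('k poly) = monom 1 1 ^ CHAR('k poly) + 1 ^ CHAR('k poly)"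
        by (rule freshmans_dream) (use ch \<open>prime p\<close> in \<open>simp_all only:\<close>)
      then have "(monom 1 1 + 1 :: 'k poly) ^ p = monom 1 1 ^ p + 1 ^ p" unfolding ch .
      then have "(monom 1 1 + 1 :: 'k poly) ^ p = monom 1 p + 1" by (simp add: monom_power)
      moreover have "monom 1 1 + 1 = ?z" by (simp add: monom_Suc monom_0 one_pCons)
      ultimately show ?thesis by (simp add: pcompose_pCons one_pCons)
    qed
    have frx: "?x ^ p = pcompose ?x (monom 1 p)"
    proof -
      have "?x = monom 1 1" by (simp add: monom_Suc monom_0)
      then have "?x ^ p = monom 1 p" by (simp add: monom_power)
      moreover have "pcompose ?x (monom 1 p) = monom 1 p" by (simp add: pcompose_pCons)
      ultimately show ?thesis by (simp only:)
    qed
    have pw: "pcompose (v ^ n) m = pcompose v m ^ n" for v m :: "'k poly" and n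
    proof (induction n)
      case 0
      show ?case unfolding power_0 one_pCons by (rule pcompose_const)
    qed (simp add: pcompose_mult)
    have "pcompose (?x ^ a' * A' + B' - ?z ^ c' * C') (monom 1 p) = 0"
      using eq unfolding ac ABC' power_mult fr frx by (simp add: pcompose_diff pcompose_add pcompose_mult pw)
    moreover have "degree (monom (1::'k) p) > 0" using p0 by (simp add: degree_monom_eq)
    ultimately have "?x ^ a' * A' + B' - ?z ^ c' * C' = 0" using pcompose_eq_0 by blast
    then have eq': "?x ^ a' * A' + B' = ?z ^ c' * C'" by simp
    have le: "a' + degree A' \<le> e'" "b' + degree B' \<le> e'" "c' + degree C' \<le> e'"
      using dA dB dC unfolding deg ac b e by (metis add_mult_distrib2 mult_le_cancel1 p0)+
    have syz': "syzygy a' b' c' e' A' B' C'" unfolding syzygy_def using eq' le by simp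
    have nz': "A' \<noteq> 0" "B' \<noteq> 0" "C' \<noteq> 0" using nz unfolding ABC' by auto
    have g': "2 * e' < a' + b' + c'"
    proof -
      have "p * (2 * e') < p * (a' + b' + c')" using g1 unfolding ac b e by (simp add: algebra_simps)
      then show ?thesis using p0 by simp
    qed
    have "4 * e' - (a' + b' + c') < 4 * e - (a + b + c)"
    proof -
      have "4 * e - (a + b + c) = p * (4 * e' - (a' + b' + c'))"
        unfolding ac b e by (simp add: algebra_simps diff_mult_distrib2)
      moreover have "4 * e' - (a' + b' + c') > 0" using le g' by linarith
      ultimately show ?thesis using p1 by simp
    qed
    then obtain r u1 u2 u3 where u: "u1 \<ge> 1" "u2 \<ge> 1" "u3 \<ge> 1" and
     l: "int (p ^ r) \<ge> int a' + int b' + int c' - 2 * int e'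
       + \<bar>int a' - int (p ^ r * u1)\<bar> + \<bar>int b' - int (p ^ r * u2)\<bar> + \<bar>int c' - int (p ^ r * u3)\<bar>"
      using less.hyps[OF _ syz' nz' g'] by blast
    have ab: "\<bar>int (p * v) - int (p ^ Suc r * w)\<bar> = int p * \<bar>int v - int (p ^ r * w)\<bar>" for v w
      using abs_mult[of "int p" "int v - int (p ^ r * w)"] by (simp add: algebra_simps)
    have "int p * int (p ^ r) \<ge> int p * (int a' + int b' + int c' - 2 * int e'
       + \<bar>int a' - int (p ^ r * u1)\<bar> + \<bar>int b' - int (p ^ r * u2)\<bar> + \<bar>int c' - int (p ^ r * u3)\<bar>)"
      by (rule mult_left_mono[OF l]) simp
    then have "int (p ^ Suc r) \<ge> int a + int b + int c - 2 * int e
       + \<bar>int a - int (p ^ Suc r * u1)\<bar> + \<bar>int b - int (p ^ Suc r * u2)\<bar> + \<bar>int c - int (p ^ Suc r * u3)\<bar>"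
      unfolding ac b e ab by (simp add: algebra_simps)
    then show False using neg u by blast
  qed
qed

section \<open>Spaces of syzygies in a fixed degree\<close>

global_interpretation ps: vector_space "smult :: 'k::field \<Rightarrow> 'k poly \<Rightarrow> 'k poly"
  by unfold_locales (auto simp: smult_add_left smult_add_right)

global_interpretation fpp: vector_space_pair "fun_scale :: 'k::field \<Rightarrow> ('a \<Rightarrow> 'k) \<Rightarrow> 'a \<Rightarrow> 'k" "smult :: 'k \<Rightarrow> 'k poly \<Rightarrow> 'k poly"
  by unfold_locales

text \<open>The last components of syzygies: \<open>(X+Y)^c C\<close> must lie in the ideal
  generated by \<open>X^a\<close> and \<open>Y^b\<close>, that is, all its coefficients at monomials
  outside this ideal vanish.\<close>

definition syz_space :: "nat \<Rightarrow> nat \<Rightarrow> nat \<Rightarrow> nat \<Rightarrow> 'k::field poly set" where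
  "syz_space a b c e = {C. (C = 0 \<or> c + degree C \<le> e) \<and>
     (\<forall>i<a. i \<le> e \<longrightarrow> e - i < b \<longrightarrow> coeff ([:1,1:] ^ c * C) i = 0)}"

lemma syz_space_iff: "C \<in> syz_space a b c e \<longleftrightarrow> (\<exists>A B. syzygy a b c e A B C)"
proof
  assume C: "C \<in> syz_space a b c e"
  define G where "G = [:1,1:] ^ c * C"
  have dG: "G = 0 \<or> degree G \<le> e"
    using C degree_mult_le[of "[:1,1:] ^ c" C] unfolding G_def syz_space_def
    by (cases "C = 0") (auto simp: degree_linear_power)
  \<comment> \<open>All coefficients from index \<open>a\<close> on go into \<open>A\<close>, also
    those divisible by \<open>Y^b\<close>; the vanishing conditions put the others into
    \<open>B\<close>.\<close>
  have "[:0,1:] ^ a * poly_shift a G + poly_cutoff a G = G"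
  proof (rule poly_eqI)
    fix n
    have m: "[:0,1:] ^ a = (monom 1 a :: 'a poly)" by (simp add: monom_altdef)
    show "coeff ([:0,1:] ^ a * poly_shift a G + poly_cutoff a G) n = coeff G n"
      unfolding m by (auto simp: coeff_monom_mult coeff_poly_shift coeff_poly_cutoff)
  qed
  moreover have "poly_shift a G = 0 \<or> a + degree (poly_shift a G) \<le> e"
  proof (rule disjCI)
    assume n: "\<not> a + degree (poly_shift a G) \<le> e"
    have "coeff (poly_shift a G) (degree (poly_shift a G)) = 0"
      using n dG by (auto simp: coeff_poly_shift coeff_eq_0)
    then show "poly_shift a G = 0" by simp
  qed
  moreover have "poly_cutoff a G = 0 \<or> b + degree (poly_cutoff a G) \<le> e"
  proof (rule disjCI)
    let ?d = "degree (poly_cutoff a G)"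
    assume n: "\<not> b + ?d \<le> e"
    have "coeff (poly_cutoff a G) ?d = 0"
    proof (cases "?d < a \<and> ?d \<le> e")
      case True
      then show ?thesis using n C unfolding coeff_poly_cutoff G_def syz_space_def by auto
    next
      case False
      then show ?thesis using dG by (auto simp: coeff_poly_cutoff coeff_eq_0)
    qed
    then show "poly_cutoff a G = 0" by simp
  qed
  ultimately have "syzygy a b c e (poly_shift a G) (poly_cutoff a G) C"
    using C unfolding syzygy_def G_def syz_space_def by simp
  then show "\<exists>A B. syzygy a b c e A B C" by blast
next
  assume "\<exists>A B. syzygy a b c e A B C"
  then obtain A B where s: "syzygy a b c e A B C" by blast
  have "coeff ([:1,1:] ^ c * C) i = 0" if i: "i < a" "i \<le> e" "e - i < b" for i
  proof -
    have m: "[:0,1:] ^ a = (monom 1 a :: 'a poly)" by (simp add: monom_altdef)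
    have "coeff ([:1,1:] ^ c * C) i = coeff B i"
    proof -
      have "[:1,1:] ^ c * C = monom 1 a * A + B" using s unfolding syzygy_def m by simp
      then show ?thesis using i(1) by (simp add: coeff_monom_mult)
    qed
    also have "\<dots> = 0"
    proof (cases "B = 0")
      case False
      then have "b + degree B \<le> e" using s unfolding syzygy_def by blast
      then show ?thesis using i by (intro coeff_eq_0) linarith
    qed simp
    finally show ?thesis .
  qed
  then show "C \<in> syz_space a b c e" using s unfolding syz_space_def syzygy_def by simp
qed

lemma syz_space_finite_span: "syz_space a b c e \<subseteq> ps.span (monom 1 ` {..e})"
proof
  fix C :: "'a poly" assume C: "C \<in> syz_space a b c e"
  then have "degree C \<le> e" unfolding syz_space_def by auto
  then have "C = (\<Sum>i\<le>e. monom (coeff C i) i)" by (rule poly_as_sum_of_monoms'[symmetric])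
  also have "\<dots> = (\<Sum>i\<le>e. smult (coeff C i) (monom 1 i))" by (simp add: smult_monom)
  also have "\<dots> \<in> ps.span (monom 1 ` {..e})"
    by (rule ps.span_sum, rule ps.span_scale, rule ps.span_base, rule imageI)
  finally show "C \<in> ps.span (monom 1 ` {..e})" .
qed

text \<open>\<open>X^a\<close> divides \<open>B1 C2 - B2 C1\<close>, but this difference has degree
  at most \<open>2 e - b - c\<close>, which is less than \<open>a\<close> when the gap is
  positive.\<close>

lemma syzygy_proportional:
  fixes A1 B1 C1 :: "'k::field poly"
  assumes "2 * e < a + b + c" "syzygy a b c e A1 B1 C1" "syzygy a b c e A2 B2 C2"
  shows "B1 * C2 = B2 * C1"
proof -
  define M where "M = A2 * C1 - A1 * C2"
  let ?x = "[:0,1:] :: 'k poly" and ?z = "[:1,1:] :: 'k poly"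
  have e1: "?x ^ a * A1 + B1 = ?z ^ c * C1" and e2: "?x ^ a * A2 + B2 = ?z ^ c * C2"
    using assms unfolding syzygy_def by blast+
  have "(?x ^ a * A1 + B1) * C2 - (?x ^ a * A2 + B2) * C1 = 0"
    unfolding e1 e2 by (simp only: algebra_simps) simp
  moreover have "(?x ^ a * A1 + B1) * C2 - (?x ^ a * A2 + B2) * C1 = (B1 * C2 - B2 * C1) - ?x ^ a * M"
    unfolding M_def by (simp only: algebra_simps)
  ultimately have h: "B1 * C2 - B2 * C1 = ?x ^ a * M" by simp
  have dp: "degree (B * C) \<le> 2 * e - b - c"
    if "B = 0 \<or> b + degree B \<le> e" "C = 0 \<or> c + degree C \<le> e" for B C :: "'k poly"
    using that degree_mult_le[of B C] by (cases "B = 0 \<or> C = 0") auto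
  have "degree (B1 * C2 - B2 * C1) \<le> 2 * e - b - c"
    using assms unfolding syzygy_def by (intro degree_diff_le dp) auto
  have "M = 0"
  proof (rule ccontr)
    assume n: "M \<noteq> 0"
    have nz: "B1 * C2 - B2 * C1 \<noteq> 0" unfolding h using n by simp
    then have bc: "b + c \<le> 2 * e"
      using assms unfolding syzygy_def by (cases "B1 * C2 = 0") auto
    have "degree (?x ^ a * M) = a + degree M" using n by (simp add: degree_mult_eq degree_power_eq)
    then have "a \<le> 2 * e - b - c" using \<open>degree (B1 * C2 - B2 * C1) \<le> 2 * e - b - c\<close> unfolding h by simp
    then show False using assms(1) bc by linarith
  qed
  then show ?thesis using h by simp
qed

text \<open>A syzygy of degree \<open>e + 1\<close> whose \<open>B\<close> and \<open>C\<close> both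
  miss their top coefficient is one of degree \<open>e\<close>. By proportionality the pairs of top
  coefficients of all syzygies lie on one line, so a single additional vector suffices.\<close>

lemma dim_syz_space_Suc:
  assumes "2 * Suc e < a + b + c"
  shows "ps.dim (syz_space a b c (Suc e) :: 'k::field poly set) \<le> Suc (ps.dim (syz_space a b c e :: 'k poly set))"
proof -
  let ?S = "syz_space a b c :: nat \<Rightarrow> 'k poly set"
  obtain B where B: "B \<subseteq> ?S e" "ps.independent B" "?S e \<subseteq> ps.span B" "card B = ps.dim (?S e)"
    using ps.basis_exists by blast
  have fB: "finite B"
    using ps.independent_span_bound[OF _ B(2), of "monom 1 ` {..e}"] B(1) syz_space_finite_span[of a b c e] by auto
  show ?thesis
  proof (cases "?S (Suc e) \<subseteq> ?S e")
    case True
    then have "ps.dim (?S (Suc e)) \<le> card B" using B(3) by (intro ps.dim_le_card fB) auto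
    then show ?thesis using B(4) by simp
  next
    case False
    then obtain C1 where C1: "C1 \<in> ?S (Suc e)" "C1 \<notin> ?S e" by blast
    obtain A1 B1 where s1: "syzygy a b c (Suc e) A1 B1 C1" using C1(1) unfolding syz_space_iff by blast
    have key: "\<exists>k. C2 - smult k C1 \<in> ?S e" if C2: "C2 \<in> ?S (Suc e)" for C2
    proof -
      obtain A2 B2 where s2: "syzygy a b c (Suc e) A2 B2 C2" using C2 unfolding syz_space_iff by blast
      \<comment> \<open>The value at \<open>Y = 0\<close> of the homogeneous cofactor; 0 if the
        degree is too small for a nonzero cofactor.\<close>
      define tc where "tc C = (if c \<le> Suc e then coeff C (Suc e - c) else 0)" for C :: "'k poly"
      define tb where "tb B = (if b \<le> Suc e then coeff B (Suc e - b) else 0)" for B :: "'k poly"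
      have lower: "C \<in> ?S e" if s: "syzygy a b c (Suc e) A B C" and t: "tc C = 0" "tb B = 0" for A B C
      proof -
        have low: "Y = 0 \<or> v + degree Y \<le> e"
          if Y: "Y = 0 \<or> v + degree Y \<le> Suc e" and t: "(if v \<le> Suc e then coeff Y (Suc e - v) else 0) = 0" for Y :: "'k poly" and v
        proof (rule ccontr)
          assume n: "\<not> ?thesis"
          then have v: "v + degree Y = Suc e" using Y by auto
          then have "Suc e - v = degree Y" "v \<le> Suc e" by auto
          then have "lead_coeff Y = 0" using t by simp
          then show False using n by simp
        qed
        have lC: "C = 0 \<or> c + degree C \<le> e" using low[of C c] s t unfolding tc_def syzygy_def by blast
        have lB: "B = 0 \<or> b + degree B \<le> e" using low[of B b] s t unfolding tb_def syzygy_def by blast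
        have "coeff ([:1,1:] ^ c * C) i = 0" if i: "i < a" "i \<le> e" "e - i < b" for i
        proof -
          have m: "[:0,1:] ^ a = (monom 1 a :: 'k poly)" by (simp add: monom_altdef)
          have "coeff ([:1,1:] ^ c * C) i = coeff ([:0,1:] ^ a * A + B) i" using s unfolding syzygy_def by simp
          also have "\<dots> = coeff B i" using i(1) unfolding m by (simp add: coeff_monom_mult)
          also have "\<dots> = 0"
          proof (cases "B = 0")
            case False
            then show ?thesis using lB i by (intro coeff_eq_0) linarith
          qed simp
          finally show ?thesis .
        qed
        then show ?thesis using lC unfolding syz_space_def by blast
      qed
      have pr: "tb B1 * tc C2 = tb B2 * tc C1"
      proof (cases "b \<le> Suc e \<and> c \<le> Suc e")
        case True
        have cm: "coeff (B * C) ((Suc e - b) + (Suc e - c)) = coeff B (Suc e - b) * coeff C (Suc e - c)"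
          if "B = 0 \<or> b + degree B \<le> Suc e" "C = 0 \<or> c + degree C \<le> Suc e" for B C :: "'k poly"
        proof (cases "B = 0 \<or> C = 0")
          case True then show ?thesis by auto
        next
          case False
          then have d: "degree B \<le> Suc e - b" "degree C \<le> Suc e - c" using that by auto
          have "coeff (B * C) ((Suc e - b) + (Suc e - c))
              = (\<Sum>i\<le>(Suc e - b) + (Suc e - c). coeff B i * coeff C ((Suc e - b) + (Suc e - c) - i))"
            by (rule coeff_mult)
          also have "\<dots> = (\<Sum>i\<in>{Suc e - b}. coeff B i * coeff C ((Suc e - b) + (Suc e - c) - i))"
          proof (rule sum.mono_neutral_right)
            show "\<forall>i\<in>{..Suc e - b + (Suc e - c)} - {Suc e - b}. coeff B i * coeff C (Suc e - b + (Suc e - c) - i) = 0"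
            proof
              fix i assume i: "i \<in> {..Suc e - b + (Suc e - c)} - {Suc e - b}"
              then consider "i > Suc e - b" | "i < Suc e - b" by force
              then show "coeff B i * coeff C (Suc e - b + (Suc e - c) - i) = 0"
              proof cases
                case 1 then show ?thesis using d by (simp add: coeff_eq_0)
              next
                case 2
                then have "coeff C (Suc e - b + (Suc e - c) - i) = 0" using d by (intro coeff_eq_0) linarith
                then show ?thesis by simp
              qed
            qed
          qed auto
          also have "\<dots> = coeff B (Suc e - b) * coeff C (Suc e - c)" by simp
          finally show ?thesis .
        qed
        have "B1 * C2 = B2 * C1" by (rule syzygy_proportional[OF assms s1 s2])
        then have "coeff (B1 * C2) ((Suc e - b) + (Suc e - c)) = coeff (B2 * C1) ((Suc e - b) + (Suc e - c))" by simp
        then show ?thesis using cm s1 s2 True unfolding tb_def tc_def syzygy_def by simp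
      next
        case False
        then show ?thesis unfolding tb_def tc_def by auto
      qed
      have t1: "tc C1 \<noteq> 0 \<or> tb B1 \<noteq> 0" using lower[OF s1] C1(2) by blast
      \<comment> \<open>At least one of the two top coefficients of the chosen syzygy is nonzero; by
        \<open>pr\<close> the quotient taken there removes the other one too.\<close>
      define k where "k = (if tc C1 \<noteq> 0 then tc C2 / tc C1 else tb B2 / tb B1)"
      have z: "tc C2 - k * tc C1 = 0" "tb B2 - k * tb B1 = 0"
        using t1 pr unfolding k_def by (auto simp: field_simps)
      have sub: "Y2 - smult k Y1 = 0 \<or> v + degree (Y2 - smult k Y1) \<le> Suc e"
        if "Y1 = 0 \<or> v + degree Y1 \<le> Suc e" "Y2 = 0 \<or> v + degree Y2 \<le> Suc e" for Y1 Y2 :: "'k poly" and v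
      proof -
        have "degree (Y2 - smult k Y1) \<le> max (degree Y2) (degree Y1)"
          by (intro degree_diff_le) (auto simp: degree_smult_le le_max_iff_disj)
        then show ?thesis using that by auto
      qed
      have "syzygy a b c (Suc e) (A2 - smult k A1) (B2 - smult k B1) (C2 - smult k C1)"
      proof -
        have "[:0,1:] ^ a * (A2 - smult k A1) + (B2 - smult k B1)
          = ([:0,1:] ^ a * A2 + B2) - smult k ([:0,1:] ^ a * A1 + B1)"
          by (simp add: right_diff_distrib smult_add_right)
        also have "\<dots> = [:1,1:] ^ c * (C2 - smult k C1)"
          using s1 s2 unfolding syzygy_def by (simp add: right_diff_distrib)
        finally show ?thesis using sub s1 s2 unfolding syzygy_def by blast
      qed
      then have "C2 - smult k C1 \<in> ?S e"
        using lower z unfolding tc_def tb_def by (simp split: if_splits)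
      then show ?thesis by blast
    qed
    have "?S (Suc e) \<subseteq> ps.span (insert C1 B)"
    proof
      fix C2 assume "C2 \<in> ?S (Suc e)"
      then obtain k where "C2 - smult k C1 \<in> ?S e" using key by blast
      then have "C2 - smult k C1 \<in> ps.span B" using B(3) by blast
      then show "C2 \<in> ps.span (insert C1 B)" unfolding ps.span_insert by blast
    qed
    then have "ps.dim (?S (Suc e)) \<le> card (insert C1 B)" by (intro ps.dim_le_card) (auto simp: fB)
    also have "\<dots> \<le> Suc (card B)" by (simp add: card_insert_le_m1 fB card_insert_if)
    finally show ?thesis using B(4) by simp
  qed
qed

lemma dim_syz_space_trivial:
  assumes "syz_space a b c e \<subseteq> {0 :: 'k::field poly}"
  shows "ps.dim (syz_space a b c e :: 'k poly set) = 0"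
proof -
  have "ps.dim (syz_space a b c e :: 'k poly set) \<le> card ({} :: 'k poly set)"
    by (rule ps.dim_le_card) (use assms in simp_all)
  then show ?thesis by simp
qed

text \<open>The dimension is zero below the first degree with a nonzero syzygy, and from there on it
  grows by at most one per degree.\<close>

lemma dim_syz_space_le:
  assumes "2 * e < a + b + c"
    and "\<And>e'. e' \<le> e \<Longrightarrow> \<not> (syz_space a b c e' \<subseteq> {0 :: 'k::field poly}) \<Longrightarrow> v \<le> e'"
  shows "ps.dim (syz_space a b c e :: 'k poly set) \<le> Suc e - v"
  using assms
proof (induction e)
  case 0
  show ?case
  proof (cases "syz_space a b c 0 \<subseteq> {0 :: 'k poly}")
    case True then show ?thesis by (simp add: dim_syz_space_trivial)
  next
    case False
    then have "v = 0" using 0 by auto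
    moreover have "ps.dim (syz_space a b c 0 :: 'k poly set) \<le> card (monom (1::'k) ` {..0::nat})"
      by (rule ps.dim_le_card[OF syz_space_finite_span]) simp
    ultimately show ?thesis by simp
  qed
next
  case (Suc e)
  have IH: "ps.dim (syz_space a b c e :: 'k poly set) \<le> Suc e - v" using Suc by simp
  show ?case
  proof (cases "syz_space a b c (Suc e) \<subseteq> {0 :: 'k poly}")
    case True then show ?thesis by (simp add: dim_syz_space_trivial)
  next
    case False
    then have "v \<le> Suc e" using Suc.prems by blast
    then show ?thesis using dim_syz_space_Suc[OF Suc.prems(1), where 'k = 'k] IH by linarith
  qed
qed

text \<open>The multiples of one nonzero syzygy by all forms of degree \<open>e - e0\<close>,
  dehomogenised.\<close>

lemma dim_syz_space_ge:
  fixes A B C :: "'k::field poly"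
  assumes "syzygy a b c e0 A B C" "C \<noteq> 0" "e0 \<le> e"
  shows "Suc e - e0 \<le> ps.dim (syz_space a b c e :: 'k poly set)"
proof -
  define N where "N = e - e0"
  define L where "L F = (\<Sum>i\<le>N. monom (F i) i) * C" for F :: "nat \<Rightarrow> 'k"
  have L: "Vector_Spaces.linear fun_scale smult L"
    unfolding Vector_Spaces.linear_iff
  proof (intro conjI allI)
    show "vector_space (fun_scale :: 'k \<Rightarrow> (nat \<Rightarrow> 'k) \<Rightarrow> _)" by (rule fs.vector_space_axioms)
    show "vector_space (smult :: 'k \<Rightarrow> _)" by (rule ps.vector_space_axioms)
    show "L (x + y) = L x + L y" for x y
      unfolding L_def plus_fun_apply add_monom[symmetric] sum.distrib distrib_right ..
    show "L (fun_scale k x) = smult k (L x)" for k x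
      unfolding L_def smult_monom[symmetric] by (simp only: ps.scale_sum_right[symmetric] mult_smult_left)
  qed
  have inj: "F = 0" if "F \<in> fun_on {..N}" "L F = 0" for F
  proof
    fix i
    have "(\<Sum>i\<le>N. monom (F i) i) = 0" using that(2) assms(2) unfolding L_def by simp
    then have "coeff (\<Sum>i\<le>N. monom (F i) i) i = 0" by simp
    moreover have "coeff (\<Sum>i\<le>N. monom (F i) i) i = (if i \<le> N then F i else 0)"
      by (simp add: coeff_sum)
    ultimately show "F i = 0 i" using that(1) unfolding fun_on_def by (cases "i \<le> N") auto
  qed
  have im: "L ` fun_on {..N} \<subseteq> syz_space a b c e"
  proof clarify
    fix F :: "nat \<Rightarrow> 'k"
    let ?h = "\<Sum>i\<le>N. monom (F i) i"
    have dh: "degree ?h \<le> N" by (rule degree_sum_le) (auto intro: order_trans[OF degree_monom_le])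
    have "Y * ?h = 0 \<or> v + degree (Y * ?h) \<le> e" if "Y = 0 \<or> v + degree Y \<le> e0" for Y v
      using that degree_mult_le[of Y ?h] dh assms(3) unfolding N_def by auto
    moreover have "[:0,1:] ^ a * (A * ?h) + B * ?h = [:1,1:] ^ c * (C * ?h)"
    proof -
      have "[:0,1:] ^ a * (A * ?h) + B * ?h = ([:0,1:] ^ a * A + B) * ?h"
        by (simp only: distrib_right mult.assoc)
      also have "[:0,1:] ^ a * A + B = [:1,1:] ^ c * C" using assms(1) unfolding syzygy_def by blast
      finally show ?thesis by (simp only: mult.assoc)
    qed
    ultimately have "syzygy a b c e (A * ?h) (B * ?h) (C * ?h)"
      using assms(1) unfolding syzygy_def by blast
    then show "L F \<in> syz_space a b c e" unfolding L_def syz_space_iff mult.commute[of _ C] by blast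
  qed
  have "fs.dim (fun_on {..N} :: (nat \<Rightarrow> 'k) set) \<le> ps.dim (syz_space a b c e :: 'k poly set)"
    by (rule fpp.dim_le_of_inj_on[OF L subspace_fun_on _ fun_on_span _ im _ syz_space_finite_span])
       (simp_all add: inj)
  then show ?thesis using assms(3) by (simp add: dim_fun_on N_def)
qed

section \<open>Dimensions of string spaces\<close>

text \<open>The kernel of \<open>(X+Y)^c\<close> on \<open>k[X,Y]/(X^a, Y^b)\<close> from degree
  \<open>e - c\<close> to degree \<open>e\<close>. In contrast to \<open>syz_space\<close>, the
  argument itself is reduced modulo \<open>X^a\<close> and \<open>Y^b\<close>.\<close>

definition string_space :: "nat \<Rightarrow> nat \<Rightarrow> nat \<Rightarrow> nat \<Rightarrow> 'k::field poly set" where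
  "string_space a b c e = {F. (\<forall>i. coeff F i \<noteq> 0 \<longrightarrow> c \<le> e \<and> i \<le> e - c \<and> i < a \<and> e - c - i < b) \<and>
     (\<forall>i<a. i \<le> e \<longrightarrow> e - i < b \<longrightarrow> coeff ([:1,1:] ^ c * F) i = 0)}"

lemma string_space_subset: "string_space a b c e \<subseteq> (syz_space a b c e :: 'k::field poly set)"
proof
  fix F :: "'k poly" assume F: "F \<in> string_space a b c e"
  have "F = 0 \<or> c + degree F \<le> e"
  proof (rule disjCI)
    assume n: "\<not> c + degree F \<le> e"
    have "c \<le> e \<and> degree F \<le> e - c" if "coeff F (degree F) \<noteq> 0"
      using F that unfolding string_space_def by blast
    then have "coeff F (degree F) = 0" using n by linarith
    then show "F = 0" by simp
  qed
  then show "F \<in> syz_space a b c e" using F unfolding string_space_def syz_space_def by blast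
qed

lemma coeff_X1_power_0: "coeff ([:1,1:] ^ c :: 'k::field poly) 0 = 1"
proof -
  have "poly ([:1,1:] ^ c :: 'k poly) 0 = 1" by (simp add: poly_power)
  then show ?thesis by (simp add: poly_0_coeff_0)
qed

text \<open>The constant term of \<open>(1+X)^c\<close> is 1, so multiplication leaves the lowest
  coefficient unchanged. This detects that a product is nonzero modulo powers of \<open>X\<close>
  and \<open>Y\<close>.\<close>

lemma exists_common_lowest_coeff:
  assumes "F \<noteq> (0 :: 'k::field poly)"
  shows "\<exists>i. coeff F i \<noteq> 0 \<and> coeff ([:1,1:] ^ c * F) i \<noteq> 0"
proof -
  have lc: "coeff F (degree F) \<noteq> 0" using assms by simp
  define i where "i = (LEAST i. coeff F i \<noteq> 0)"
  have i: "coeff F i \<noteq> 0" unfolding i_def by (rule LeastI[of _ "degree F"]) (rule lc)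
  have less: "coeff F j = 0" if "j < i" for j using not_less_Least[of j "\<lambda>i. coeff F i \<noteq> 0"] that unfolding i_def by blast
  have "coeff ([:1,1:] ^ c * F) i = (\<Sum>j\<le>i. coeff ([:1,1:] ^ c) j * coeff F (i - j))" by (rule coeff_mult)
  also have "\<dots> = (\<Sum>j\<in>{0}. coeff ([:1,1:] ^ c) j * coeff F (i - j))"
    by (rule sum.mono_neutral_right) (use less in auto)
  also have "\<dots> = coeff F i" by (simp add: coeff_X1_power_0)
  finally show ?thesis using i by auto
qed

lemma string_space_eq:
  assumes "c \<le> e" "e < a + c" "e < b + c"
  shows "string_space a b c e = (syz_space a b c e :: 'k::field poly set)"
proof
  show "syz_space a b c e \<subseteq> (string_space a b c e :: 'k poly set)"
  proof
    fix F :: "'k poly" assume F: "F \<in> syz_space a b c e"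
    have "c \<le> e \<and> i \<le> e - c \<and> i < a \<and> e - c - i < b" if "coeff F i \<noteq> 0" for i
    proof -
      have "F \<noteq> 0" using that by auto
      then have "c + degree F \<le> e" using F unfolding syz_space_def by blast
      moreover have "i \<le> degree F" using that by (rule le_degree)
      ultimately show ?thesis using assms by linarith
    qed
    then show "F \<in> string_space a b c e" using F unfolding syz_space_def string_space_def by blast
  qed
qed (rule string_space_subset)

text \<open>If \<open>a + c \<le> e\<close>, then \<open>e < b\<close>, so nothing is lost modulo
  \<open>Y^b\<close> and the lowest coefficient survives. The case \<open>b + c \<le> e\<close> is
  symmetric, with the leading coefficient.\<close>

lemma string_space_trivial:
  assumes e: "2 * e < a + b + c" and "e < c \<or> a + c \<le> e \<or> b + c \<le> e"
  shows "string_space a b c e \<subseteq> {0 :: 'k::field poly}"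
proof
  fix F :: "'k poly" assume F: "F \<in> string_space a b c e"
  have supp: "c \<le> e \<and> i \<le> e - c \<and> i < a \<and> e - c - i < b" if "coeff F i \<noteq> 0" for i
    using F that unfolding string_space_def by blast
  have van: "coeff ([:1,1:] ^ c * F) i = 0" if "i < a" "i \<le> e" "e - i < b" for i
    using F that unfolding string_space_def by blast
  show "F \<in> {0}"
  proof (rule ccontr)
    assume "F \<notin> {0}"
    then have F0: "F \<noteq> 0" by simp
    then have lc: "coeff F (degree F) \<noteq> 0" by simp
    have ce: "c \<le> e" using supp[OF lc] by simp
    consider "a + c \<le> e" | "b + c \<le> e" using assms(2) ce by linarith
    then show False
    proof cases
      case 1
      obtain i where i: "coeff F i \<noteq> 0" "coeff ([:1,1:] ^ c * F) i \<noteq> 0"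
        using exists_common_lowest_coeff[OF F0] by blast
      have "i < a" "i \<le> e" "e - i < b" using supp[OF i(1)] 1 e by linarith+
      then show False using van i(2) by blast
    next
      case 2
      have "degree ([:1,1:] ^ c * F) = c + degree F" using F0 by (simp add: degree_mult_eq degree_linear_power)
      moreover have "[:1,1:] ^ c * F \<noteq> 0" using F0 by simp
      ultimately have "coeff ([:1,1:] ^ c * F) (c + degree F) \<noteq> 0" by (metis leading_coeff_0_iff)
      moreover have "c + degree F < a" "c + degree F \<le> e" "e - (c + degree F) < b"
        using supp[OF lc] 2 e ce by linarith+
      ultimately show False using van by blast
    qed
  qed
qed

section \<open>The dimension of a string space and the nearest centre\<close>

lemma gap_arith_upper:
  fixes g x y N Q m c :: int
  assumes "N \<le> \<bar>Q - 2 * m\<bar>" "2 * c + 1 = Q \<or> 2 * c = Q + 1" "g + x + y + \<bar>c - m\<bar> \<le> N"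
  shows "2 * g + 2 * x + 2 * y \<le> N + 1"
  using assms by (auto simp: abs_if split: if_splits)

lemma gap_arith_center:
  fixes a b c e N Q m1 m2 D :: int
  assumes "2 * \<bar>m1 - m2\<bar> \<le> Q - N" "2 * D \<le> N - 1" "2 * e < a + b + c" "2 * c + 1 = Q \<or> 2 * c = Q + 1"
    "D = \<bar>a - m1\<bar> + \<bar>b - m2\<bar>"
  shows "e < a + c" "e < b + c"
  using assms by (auto simp: abs_if split: if_splits)

lemma gap_arith_degree:
  fixes a b c e N Q m1 m2 D :: int
  assumes "Q + N \<le> 2 * m1 + 2 * m2" "2 * (a + b + c - 2 * e) \<le> N - 2 * D - 1" "2 * c + 1 = Q \<or> 2 * c = Q + 1"
    "D = \<bar>a - m1\<bar> + \<bar>b - m2\<bar>"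
  shows "c \<le> e"
  using assms by (auto simp: abs_if split: if_splits)

lemma gap_arith_third:
  fixes c m N Q :: nat
  assumes "2 * m + N = Q \<or> 2 * m = Q + N" "2 * c + 1 = Q \<or> 2 * c = Q + 1" "1 \<le> N"
  shows "2 * \<bar>int c - int m\<bar> \<le> int N + 1"
  using assms by (auto simp: abs_if)

lemma gap_arith_lower:
  fixes a b c N m1 m2 m3 m0 D :: nat
  assumes "m1 + m2 + m3 = 2 * m0 + N" "2 * \<bar>int c - int m3\<bar> \<le> int N + 1"
    "\<alpha> = m0 + (a - m1) + (b - m2) + (c - m3)"
  shows "4 * int \<alpha> \<le> 2 * (int a + int b + int c) - int N + 2 * (\<bar>int a - int m1\<bar> + \<bar>int b - int m2\<bar>) + 1"
proof -
  have t: "2 * int (x - y) = int x - int y + \<bar>int x - int y\<bar>" for x y :: nat by (cases "x \<le> y") auto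
  have "4 * int \<alpha> = 2 * (2 * int m0) + 2 * (2 * int (a - m1)) + 2 * (2 * int (b - m2)) + 2 * (2 * int (c - m3))"
    unfolding assms(3) by simp
  also have "\<dots> = 2 * (2 * int m0) + 2 * (int a - int m1 + \<bar>int a - int m1\<bar>) + 2 * (int b - int m2 + \<bar>int b - int m2\<bar>) + 2 * (int c - int m3 + \<bar>int c - int m3\<bar>)"
    unfolding t ..
  also have "2 * int m0 = int m1 + int m2 + int m3 - int N" using assms(1) by linarith
  finally show ?thesis using assms(2) by (simp add: algebra_simps)
qed

text \<open>In the given range a nonzero \<open>C\<close> forces nonzero \<open>A\<close> and
  \<open>B\<close>, so the gap bound applies with some \<open>r\<close>. The third exponent already
  uses up about half of \<open>p^r\<close> there, which leaves half for the gap and the other two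
  distances.\<close>

lemma syz_space_gap:
  assumes ch: "CHAR('k::field) = p" "prime p" "p \<ge> 3"
    and c: "2 * c + 1 = p ^ s \<or> 2 * c = p ^ s + 1" and ab: "a \<le> p ^ s" "b \<le> p ^ s"
    and e: "2 * e < a + b + c" "e < a + c" "e < b + c"
    and nt: "\<not> syz_space a b c e \<subseteq> {0 :: 'k poly}"
  shows "\<exists>r\<le>s. \<exists>u1\<ge>1. \<exists>u2\<ge>1. 2 * (int a + int b + int c - 2 * int e)
     + 2 * \<bar>int a - int (p ^ r * u1)\<bar> + 2 * \<bar>int b - int (p ^ r * u2)\<bar> \<le> int (p ^ r) + 1"
proof -
  obtain C :: "'k poly" where C: "C \<in> syz_space a b c e" "C \<noteq> 0" using nt by blast
  obtain A B where s: "syzygy a b c e A B C" using C(1) unfolding syz_space_iff by blast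
  have cC: "c + degree C \<le> e" using s C(2) unfolding syzygy_def by blast
  have eq: "[:0,1:] ^ a * A + B = [:1,1:] ^ c * C" using s unfolding syzygy_def by blast
  have dzC: "degree ([:1,1:] ^ c * C) = c + degree C" using C(2) by (simp add: degree_mult_eq degree_linear_power)
  have A0: "A \<noteq> 0"
  proof
    assume A: "A = 0"
    then have B: "B = [:1,1:] ^ c * C" using eq by simp
    then have "B \<noteq> 0" using C(2) by simp
    then have "b + degree B \<le> e" using s unfolding syzygy_def by blast
    then show False using dzC B e by simp
  qed
  have B0: "B \<noteq> 0"
  proof
    assume B: "B = 0"
    obtain i where i: "coeff C i \<noteq> 0" "coeff ([:1,1:] ^ c * C) i \<noteq> 0"
      using exists_common_lowest_coeff[OF C(2)] by blast
    have "[:0,1:] ^ a = (monom 1 a :: 'k poly)" by (simp add: monom_altdef)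
    then have "[:1,1:] ^ c * C = monom 1 a * A" using eq B by simp
    then have "a \<le> i" using i(2) by (auto simp: coeff_monom_mult split: if_splits)
    then have "a \<le> degree C" using le_degree[OF i(1)] by simp
    then show False using cC e by simp
  qed
  obtain r u1 u2 u3 where u: "u1 \<ge> 1" "u2 \<ge> 1" "u3 \<ge> 1" and
    le: "int (p ^ r) \<ge> int a + int b + int c - 2 * int e
       + \<bar>int a - int (p ^ r * u1)\<bar> + \<bar>int b - int (p ^ r * u2)\<bar> + \<bar>int c - int (p ^ r * u3)\<bar>"
    using syzygy_gap_bound[OF ch(1,2) s A0 B0 C(2) e(1)] by blast
  have ge: "p ^ r \<le> p ^ r * u1" "p ^ r \<le> p ^ r * u2" "p ^ r \<le> p ^ r * u3" using u by auto
  have rs: "r \<le> s"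
  proof (rule ccontr)
    assume "\<not> r \<le> s"
    then have "p ^ Suc s \<le> p ^ r" using ch(3) by (intro power_increasing) auto
    then have "p * p ^ s \<le> p ^ r" by simp
    then have 1: "3 * p ^ s \<le> p ^ r" by (rule order_trans[OF mult_le_mono1[OF ch(3)]])
    define N Q m1 m2 m3 where "N = p ^ r" and "Q = p ^ s" and "m1 = p ^ r * u1" and "m2 = p ^ r * u2" and "m3 = p ^ r * u3"
    note defs = this
    have "Q \<ge> 1" unfolding defs using ch(3) by simp
    then show False using 1[folded defs] le[folded defs] ge[folded defs] c[folded defs] ab[folded defs] e(1) by linarith
  qed
  \<comment> \<open>As \<open>P\<close> is odd, \<open>P - 2 u3\<close> is not zero; so
    \<open>q\<close> differs from \<open>2 p^r u3\<close> by at least \<open>p^r\<close>, and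
    \<open>c\<close> from \<open>p^r u3\<close> by at least \<open>(p^r - 1) / 2\<close>.\<close>
  define P where "P = p ^ (s - r)"
  have q: "p ^ s = p ^ r * P" using rs by (simp add: P_def flip: power_add)
  have "odd p" using prime_odd_nat[OF ch(2)] ch(3) by simp
  then have "odd P" unfolding P_def by simp
  then have "int P - 2 * int u3 \<noteq> 0" by presburger
  then have "1 \<le> \<bar>int P - 2 * int u3\<bar>" by linarith
  then have "int (p ^ r) * 1 \<le> int (p ^ r) * \<bar>int P - 2 * int u3\<bar>" by (intro mult_left_mono) auto
  also have "\<dots> = \<bar>int (p ^ s) - 2 * int (p ^ r * u3)\<bar>"
    unfolding q using abs_mult[of "int (p ^ r)" "int P - 2 * int u3"] by (simp add: algebra_simps)
  finally have 3: "int (p ^ r) * 1 \<le> \<bar>int (p ^ s) - 2 * int (p ^ r * u3)\<bar>" .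
  define N Q m1 m2 m3 where "N = p ^ r" and "Q = p ^ s" and "m1 = p ^ r * u1" and "m2 = p ^ r * u2" and "m3 = p ^ r * u3"
  note defs = this
  have "2 * (int a + int b + int c - 2 * int e) + 2 * \<bar>int a - int m1\<bar> + 2 * \<bar>int b - int m2\<bar> \<le> int N + 1"
  proof -
    have "2 * int c + 1 = int Q \<or> 2 * int c = int Q + 1" using c[folded defs] by linarith
    from gap_arith_upper[OF 3[folded defs, unfolded mult_1_right] this le[folded defs]] show ?thesis .
  qed
  then show ?thesis using rs u unfolding defs by blast
qed

text \<open>\<open>W\<close> bounds twice the gap of any nonzero syzygy, hence from below the degree
  in which syzygies begin. Counting degrees from there gives four times the dimension up to the
  rounding term 4.\<close>

lemma dim_string_space_le:
  assumes ch: "CHAR('k::field) = p" "prime p" "p \<ge> 3"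
    and c: "2 * c + 1 = p ^ s \<or> 2 * c = p ^ s + 1" and ab: "a \<le> p ^ s" "b \<le> p ^ s"
    and e: "2 * e < a + b + c"
    and W: "\<And>r u1 u2. r \<le> s \<Longrightarrow> u1 \<ge> 1 \<Longrightarrow> u2 \<ge> 1 \<Longrightarrow> \<bar>int a - int (p ^ r * u1)\<bar> + \<bar>int b - int (p ^ r * u2)\<bar> \<le> int (p ^ r) \<Longrightarrow>
       int (p ^ r) + 1 - 2 * \<bar>int a - int (p ^ r * u1)\<bar> - 2 * \<bar>int b - int (p ^ r * u2)\<bar> \<le> W"
  shows "4 * int (ps.dim (string_space a b c e :: 'k poly set)) \<le> max 0 (W - 2 * (int a + int b + int c - 2 * int e) + 4)"
proof (cases "e < c \<or> a + c \<le> e \<or> b + c \<le> e")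
  case True
  have "ps.dim (string_space a b c e :: 'k poly set) \<le> card ({} :: 'k poly set)"
    by (rule ps.dim_le_card) (use string_space_trivial[OF e True] in simp_all)
  then show ?thesis by simp
next
  case False
  then have eq: "string_space a b c e = (syz_space a b c e :: 'k poly set)" by (intro string_space_eq) auto
  define v where "v = nat \<lceil>(2 * real_of_int (int a + int b + int c) - real_of_int W) / 4\<rceil>"
  have "v \<le> e'" if e': "e' \<le> e" "\<not> syz_space a b c e' \<subseteq> {0 :: 'k poly}" for e'
  proof -
    obtain r u1 u2 where r: "r \<le> s" "u1 \<ge> 1" "u2 \<ge> 1" and
      le: "2 * (int a + int b + int c - 2 * int e')
     + 2 * \<bar>int a - int (p ^ r * u1)\<bar> + 2 * \<bar>int b - int (p ^ r * u2)\<bar> \<le> int (p ^ r) + 1"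
      using syz_space_gap[OF ch c ab _ _ _ e'(2)] e' e False by fastforce
    have "\<bar>int a - int (p ^ r * u1)\<bar> + \<bar>int b - int (p ^ r * u2)\<bar> \<le> int (p ^ r)"
    proof -
      have "int a + int b + int c - 2 * int e' \<ge> 1" using e e'(1) by linarith
      moreover have "2 * g + 2 * x + 2 * y \<le> N + 1 \<Longrightarrow> g \<ge> 1 \<Longrightarrow> x \<ge> 0 \<Longrightarrow> y \<ge> 0 \<Longrightarrow> x + y \<le> N" for g x y N :: int
        by linarith
      ultimately show ?thesis using le abs_ge_zero by blast
    qed
    from W[OF r this] le have "2 * (int a + int b + int c - 2 * int e') \<le> W" unfolding ring_distribs by linarith
    then have "2 * (int a + int b + int c) - W \<le> 4 * int e'" unfolding ring_distribs by linarith
    then have "real_of_int (2 * (int a + int b + int c) - W) \<le> real_of_int (4 * int e')" by (simp only: of_int_le_iff)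
    then have "(2 * real_of_int (int a + int b + int c) - real_of_int W) / 4 \<le> real_of_int (int e')" by simp
    then have "\<lceil>(2 * real_of_int (int a + int b + int c) - real_of_int W) / 4\<rceil> \<le> int e'" by (simp only: ceiling_le_iff)
    then show ?thesis unfolding v_def by linarith
  qed
  then have d: "ps.dim (syz_space a b c e :: 'k poly set) \<le> Suc e - v" by (rule dim_syz_space_le[OF e])
  have "(2 * real_of_int (int a + int b + int c) - real_of_int W) / 4 \<le> real_of_int (int v)"
    unfolding v_def by linarith
  then have "real_of_int (2 * (int a + int b + int c) - W) \<le> real_of_int (4 * int v)" by simp
  then have "2 * (int a + int b + int c) - W \<le> 4 * int v" by (simp only: of_int_le_iff)
  then show ?thesis using d unfolding eq ring_distribs by linarith
qed

text \<open>\<open>C\<close> has \<open>e - u3 + 1\<close> unknown coefficients, and at most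
  \<open>u1 + u2 - e - 1 = e - u3\<close> coefficients have to vanish: one unknown more than
  conditions.\<close>

lemma syz_space_exists:
  assumes odd: "u1 + u2 + u3 = 2 * e + 1" and "u3 \<le> e"
  shows "\<exists>C :: 'k::field poly. C \<in> syz_space u1 u2 u3 e \<and> C \<noteq> 0"
proof -
  define E where "E = {i. i < u1 \<and> i \<le> e \<and> e - i < u2}"
  define X where "X = {..e - u3}"
  define v where "v j = (\<lambda>i. if i \<in> E then coeff ([:1,1:] ^ u3 * monom (1::'k) j) i else 0)" for j
  have fE: "finite E" unfolding E_def by simp
  have "E \<subseteq> {Suc e - u2..<u1}" unfolding E_def by auto
  then have "card E \<le> card {Suc e - u2..<u1}" by (intro card_mono) auto
  then have cE: "card E < card X" unfolding X_def using assms by simp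
  have "v ` X \<subseteq> fs.span (delta ` E)" using fun_on_span[OF fE] by (auto simp: v_def fun_on_def)
  then have "fs.dim (v ` X) \<le> card (delta ` E :: (nat \<Rightarrow> 'k) set)" by (rule fs.dim_le_card) (simp add: fE)
  also have "\<dots> \<le> card E" by (rule card_image_le[OF fE])
  finally have dv: "fs.dim (v ` X) \<le> card E" .
  define K where "K = {f \<in> fun_on X. \<forall>y. (\<Sum>x\<in>X. f x * v x y) = 0}"
  have "card X = fs.dim (v ` X) + fs.dim K"
    unfolding K_def by (rule card_eq_rank_plus_kernel) (simp add: X_def)
  then have "fs.dim K \<noteq> 0" using dv cE by linarith
  have "\<not> K \<subseteq> {0}"
  proof
    assume "K \<subseteq> {0}"
    then have "fs.dim K \<le> card ({} :: (nat \<Rightarrow> 'k) set)" by (intro fs.dim_le_card) (simp_all only: fs.span_empty finite.emptyI)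
    then show False using \<open>fs.dim K \<noteq> 0\<close> by simp
  qed
  then obtain f where fK: "f \<in> K" "f \<noteq> 0" by blast
  have f: "f \<in> fun_on X" "\<And>y. (\<Sum>x\<in>X. f x * v x y) = 0" using fK(1) unfolding K_def by simp_all
  define C where "C = (\<Sum>j\<in>X. monom (f j) j)"
  have cf: "coeff C j = f j" for j
  proof -
    have "coeff C j = (if j \<in> X then f j else 0)" unfolding C_def X_def by (simp add: coeff_sum)
    then show ?thesis using f(1) unfolding fun_on_def by auto
  qed
  have C0: "C \<noteq> 0"
  proof
    assume "C = 0"
    then have "f j = 0" for j using cf[of j] by simp
    then have "f = 0" by (simp add: fun_eq_iff)
    then show False using fK(2) by simp
  qed
  have "coeff ([:1,1:] ^ u3 * C) i = 0" if i: "i \<in> E" for i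
  proof -
    have "monom (f j) j = smult (f j) (monom 1 j)" for j by (simp add: smult_monom)
    then have "[:1,1:] ^ u3 * C = (\<Sum>j\<in>X. smult (f j) ([:1,1:] ^ u3 * monom 1 j))"
      unfolding C_def by (simp add: sum_distrib_left)
    then have "coeff ([:1,1:] ^ u3 * C) i = (\<Sum>j\<in>X. f j * v j i)"
      unfolding v_def using i by (simp add: coeff_sum)
    then show ?thesis using f(2) by simp
  qed
  moreover have "degree C \<le> e - u3" unfolding C_def X_def
    by (rule degree_sum_le) (auto intro: order_trans[OF degree_monom_le])
  ultimately have "C \<in> syz_space u1 u2 u3 e" using assms(2) unfolding syz_space_def E_def by auto
  then show ?thesis using C0 by blast
qed

lemma syzygy_frobenius:
  fixes A B C :: "'k::field poly"
  assumes ch: "CHAR('k) = p" "prime p" and s: "syzygy a b c e A B C"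
  shows "syzygy (p ^ r * a) (p ^ r * b) (p ^ r * c) (p ^ r * e) (A ^ p ^ r) (B ^ p ^ r) (C ^ p ^ r)"
proof -
  let ?x = "[:0,1:] :: 'k poly" and ?z = "[:1,1:] :: 'k poly"
  have p0: "p ^ r > 0" using prime_gt_0_nat[OF ch(2)] by simp
  have "(?x ^ a * A + B) ^ p ^ r = (?x ^ a * A) ^ p ^ r + B ^ p ^ r"
    by (rule freshmans_dream'[of _ r]) (use ch in simp_all)
  moreover have "(?x ^ a * A + B) ^ p ^ r = (?z ^ c * C) ^ p ^ r" using s unfolding syzygy_def by simp
  ultimately have "?x ^ (p ^ r * a) * A ^ p ^ r + B ^ p ^ r = ?z ^ (p ^ r * c) * C ^ p ^ r"
    by (simp only: power_mult_distrib power_mult[symmetric] mult.commute[of "p ^ r"])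
  moreover have "Y ^ p ^ r = 0 \<or> p ^ r * v + degree (Y ^ p ^ r) \<le> p ^ r * e"
    if "Y = 0 \<or> v + degree Y \<le> e" for Y :: "'k poly" and v
  proof (cases "Y = 0")
    case True then show ?thesis using p0 by (simp add: power_0_left)
  next
    case False
    then have "p ^ r * (v + degree Y) \<le> p ^ r * e" using that by simp
    moreover have "degree (Y ^ p ^ r) = p ^ r * degree Y" using False by (simp add: degree_power_eq)
    ultimately show ?thesis by (simp add: add_mult_distrib2)
  qed
  ultimately show ?thesis using s unfolding syzygy_def by blast
qed

text \<open>Raising an exponent costs one degree, since the relation is multiplied by that linear
  form; lowering it is free, since the form is absorbed by the cofactor. The truncated differences
  are exactly these costs. Powers of \<open>Y\<close> show only in the degree.\<close>

lemma syzygy_shift: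
  fixes A B C :: "'k::field poly"
  assumes s: "syzygy a b c e A B C" and C: "C \<noteq> 0"
  shows "\<exists>A' B' (C' :: 'k poly). syzygy a' b' c' (e + (a' - a) + (b' - b) + (c' - c)) A' B' C' \<and> C' \<noteq> 0"
proof -
  let ?x = "[:0,1:] :: 'k poly" and ?z = "[:1,1:] :: 'k poly"
  define E where "E = e + (a' - a) + (b' - b) + (c' - c)"
  have eq: "?x ^ a * A + B = ?z ^ c * C" using s unfolding syzygy_def by blast
  have xa: "?x ^ a' * ?x ^ (a - a') = ?x ^ a * ?x ^ (a' - a)"
    unfolding power_add[symmetric] by (rule arg_cong[of _ _ "\<lambda>n. ?x ^ n"]) simp
  have zc: "?z ^ c' * ?z ^ (c - c') = ?z ^ c * ?z ^ (c' - c)"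
    unfolding power_add[symmetric] by (rule arg_cong[of _ _ "\<lambda>n. ?z ^ n"]) simp
  have dx: "degree (?x ^ n) = n" and dz: "degree (?z ^ n) = n" for n by (simp_all add: degree_linear_power)
  have dxz: "degree (?x ^ m * ?z ^ n * Y) = m + n + degree Y" if "Y \<noteq> 0" for m n and Y :: "'k poly"
    using that by (simp add: degree_mult_eq dx dz)
  have "?x ^ a' * (?x ^ (a - a') * ?z ^ (c' - c) * A) + ?x ^ (a' - a) * ?z ^ (c' - c) * B
      = (?x ^ a' * ?x ^ (a - a')) * ?z ^ (c' - c) * A + ?x ^ (a' - a) * ?z ^ (c' - c) * B"
    by (simp only: mult.assoc)
  also have "\<dots> = ?x ^ (a' - a) * ?z ^ (c' - c) * (?x ^ a * A + B)"
    unfolding xa by (simp only: algebra_simps)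
  also have "\<dots> = ?x ^ (a' - a) * (?z ^ c * ?z ^ (c' - c)) * C"
    unfolding eq by (simp only: ac_simps)
  also have "\<dots> = ?z ^ c' * (?x ^ (a' - a) * ?z ^ (c - c') * C)"
    unfolding zc[symmetric] by (simp only: ac_simps)
  finally have 1: "?x ^ a' * (?x ^ (a - a') * ?z ^ (c' - c) * A) + ?x ^ (a' - a) * ?z ^ (c' - c) * B
      = ?z ^ c' * (?x ^ (a' - a) * ?z ^ (c - c') * C)" .
  have 2: "?x ^ (a - a') * ?z ^ (c' - c) * A = 0 \<or> a' + degree (?x ^ (a - a') * ?z ^ (c' - c) * A) \<le> E"
  proof (cases "A = 0")
    case False
    then have "a + degree A \<le> e" using s unfolding syzygy_def by blast
    then have "a' + ((a - a') + (c' - c) + degree A) \<le> E" unfolding E_def by linarith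
    then show ?thesis using dxz[OF False] by simp
  qed simp
  have 3: "?x ^ (a' - a) * ?z ^ (c' - c) * B = 0 \<or> b' + degree (?x ^ (a' - a) * ?z ^ (c' - c) * B) \<le> E"
  proof (cases "B = 0")
    case False
    then have "b + degree B \<le> e" using s unfolding syzygy_def by blast
    then have "b' + ((a' - a) + (c' - c) + degree B) \<le> E" unfolding E_def by linarith
    then show ?thesis using dxz[OF False] by simp
  qed simp
  have 4: "?x ^ (a' - a) * ?z ^ (c - c') * C = 0 \<or> c' + degree (?x ^ (a' - a) * ?z ^ (c - c') * C) \<le> E"
  proof -
    have "c + degree C \<le> e" using s C unfolding syzygy_def by blast
    then have "c' + ((a' - a) + (c - c') + degree C) \<le> E" unfolding E_def by linarith
    then show ?thesis using dxz[OF C] by simp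
  qed
  have 5: "?x ^ (a' - a) * ?z ^ (c - c') * C \<noteq> 0" using C by simp
  have "syzygy a' b' c' E (?x ^ (a - a') * ?z ^ (c' - c) * A) (?x ^ (a' - a) * ?z ^ (c' - c) * B) (?x ^ (a' - a) * ?z ^ (c - c') * C)"
    unfolding syzygy_def by (intro conjI 1 2 3 4)
  with 5 have "\<exists>A' B' (C' :: 'k poly). syzygy a' b' c' E A' B' C' \<and> C' \<noteq> 0" by blast
  then show ?thesis unfolding E_def .
qed

text \<open>A syzygy of gap one at \<open>(u1, u2, u3)\<close> becomes, after raising to the power
  \<open>p^k\<close>, one of gap \<open>p^k\<close> at the centre. Shifting it to
  \<open>(a, b, c)\<close> gives a syzygy of a degree controlled by the distance, and its multiples
  fill the required dimension. The inequalities for \<open>u1\<close>, \<open>u2\<close> are the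
  triangle inequalities with third side \<open>P / 2\<close>.\<close>

lemma dim_string_space_ge:
  assumes ch: "CHAR('k::field) = p" "prime p" "p \<ge> 3"
    and c: "2 * c + 1 = p ^ s \<or> 2 * c = p ^ s + 1"
    and e: "2 * e < a + b + c"
    and k: "k \<le> s" and P: "P = p ^ (s - k)"
    and u: "2 * \<bar>int u1 - int u2\<bar> < int P" "P < 2 * (u1 + u2)"
    and d: "2 * (\<bar>int a - int (p ^ k * u1)\<bar> + \<bar>int b - int (p ^ k * u2)\<bar>) < int (p ^ k)"
  shows "int (p ^ k) - 2 * (\<bar>int a - int (p ^ k * u1)\<bar> + \<bar>int b - int (p ^ k * u2)\<bar>)
     - 2 * (int a + int b + int c - 2 * int e) \<le> 4 * int (ps.dim (string_space a b c e :: 'k poly set))"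
proof (cases "2 * (int a + int b + int c - 2 * int e) < int (p ^ k) - 2 * (\<bar>int a - int (p ^ k * u1)\<bar> + \<bar>int b - int (p ^ k * u2)\<bar>)")
  case False
  then show ?thesis by linarith
next
  case True
  define N Q m1 m2 where "N = p ^ k" and "Q = p ^ s" and "m1 = p ^ k * u1" and "m2 = p ^ k * u2"
  note defs = this
  define D where "D = \<bar>int a - int (p ^ k * u1)\<bar> + \<bar>int b - int (p ^ k * u2)\<bar>"
  have q: "p ^ s = p ^ k * P" unfolding P using k by (simp flip: power_add)
  have qi: "int (p ^ s) = int (p ^ k) * int P" unfolding q by simp
  have "odd p" using prime_odd_nat[OF ch(2)] ch(3) by simp
  then have oP: "odd P" and ok: "odd (p ^ k)" unfolding P by simp_all
  have "2 * \<bar>int u1 - int u2\<bar> \<le> int P - 1" using u(1) by linarith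
  then have "int (p ^ k) * (2 * \<bar>int u1 - int u2\<bar>) \<le> int (p ^ k) * (int P - 1)" by (intro mult_left_mono) auto
  moreover have "int (p ^ k) * \<bar>int u1 - int u2\<bar> = \<bar>int (p ^ k * u1) - int (p ^ k * u2)\<bar>"
    using abs_mult[of "int (p ^ k)" "int u1 - int u2"] by (simp add: algebra_simps)
  ultimately have tri: "2 * \<bar>int (p ^ k * u1) - int (p ^ k * u2)\<bar> \<le> int (p ^ s) - int (p ^ k)"
    unfolding qi by (simp add: algebra_simps)
  have "P + 1 \<le> 2 * (u1 + u2)" using u(2) by linarith
  then have "p ^ k * (P + 1) \<le> p ^ k * (2 * (u1 + u2))" by (rule mult_le_mono2)
  then have sm: "p ^ s + p ^ k \<le> 2 * (p ^ k * u1) + 2 * (p ^ k * u2)" unfolding q by (simp add: algebra_simps)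
  have D: "D = \<bar>int a - int m1\<bar> + \<bar>int b - int m2\<bar>" unfolding D_def defs ..
  have "2 * D < int N" using d unfolding D_def defs .
  then have d': "2 * D \<le> int N - 1" by simp
  have "2 * (int a + int b + int c - 2 * int e) < int N - 2 * D" using True unfolding D_def defs .
  then have T: "2 * (int a + int b + int c - 2 * int e) \<le> int N - 2 * D - 1" by simp
  have ci: "2 * int c + 1 = int Q \<or> 2 * int c = int Q + 1" using c[folded defs] by linarith
  have ei: "2 * int e < int a + int b + int c" using e by linarith
  have "e < a + c" "e < b + c" using gap_arith_center[OF tri[folded defs] d' ei ci D] by linarith+
  moreover have "c \<le> e"
  proof -
    have "int Q + int N \<le> 2 * int m1 + 2 * int m2" using sm[folded defs] by linarith
    from gap_arith_degree[OF this T ci D] show ?thesis by simp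
  qed
  ultimately have eq: "string_space a b c e = (syz_space a b c e :: 'k poly set)" by (intro string_space_eq)
  obtain t where t: "P = 2 * t + 1" using oP by (rule oddE)
  \<comment> \<open>\<open>t\<close> and \<open>t + 1\<close> are the integers next to
    \<open>P / 2\<close> and serve \<open>c\<close> equally well, so the choice can be made by
    parity to obtain an odd sum.\<close>
  define u3 where "u3 = (if odd (u1 + u2 + t) then t else t + 1)"
  have o3: "odd (u1 + u2 + u3)" unfolding u3_def by simp
  have u3: "2 * u3 + 1 = P \<or> 2 * u3 = P + 1" unfolding u3_def t by simp
  define e0 where "e0 = (u1 + u2 + u3) div 2"
  have e0: "u1 + u2 + u3 = 2 * e0 + 1" unfolding e0_def using o3 by simp
  have "u3 \<le> e0" using e0 u3 u(2)[unfolded distrib_left] t by (elim disjE) linarith+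
  then obtain C :: "'k poly" where C: "C \<in> syz_space u1 u2 u3 e0" "C \<noteq> 0" using syz_space_exists[OF e0] by blast
  then obtain A B where "syzygy u1 u2 u3 e0 A B C" unfolding syz_space_iff by blast
  from syzygy_frobenius[OF ch(1,2) this, of k]
  have "syzygy (p ^ k * u1) (p ^ k * u2) (p ^ k * u3) (p ^ k * e0) (A ^ p ^ k) (B ^ p ^ k) (C ^ p ^ k)" .
  moreover have "C ^ p ^ k \<noteq> 0" using C(2) by simp
  ultimately obtain A' B' C' :: "'k poly" where
    s: "syzygy a b c (p ^ k * e0 + (a - p ^ k * u1) + (b - p ^ k * u2) + (c - p ^ k * u3)) A' B' C'" "C' \<noteq> 0"
    using syzygy_shift[of "p ^ k * u1" "p ^ k * u2" "p ^ k * u3" "p ^ k * e0" "A ^ p ^ k" "B ^ p ^ k" "C ^ p ^ k" a b c] by blast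
  define \<alpha> where "\<alpha> = p ^ k * e0 + (a - p ^ k * u1) + (b - p ^ k * u2) + (c - p ^ k * u3)"
  have c3: "2 * \<bar>int c - int (p ^ k * u3)\<bar> \<le> int (p ^ k) + 1"
  proof -
    have pk: "p ^ k \<ge> 1" using ch(3) by simp
    have "p ^ k * (2 * u3 + 1) = p ^ s \<or> p ^ k * (2 * u3) = p ^ k * (P + 1)" using u3 unfolding q by auto
    then have "2 * (p ^ k * u3) + p ^ k = p ^ s \<or> 2 * (p ^ k * u3) = p ^ s + p ^ k"
      unfolding q by (simp add: algebra_simps)
    from gap_arith_third[OF this c pk] show ?thesis .
  qed
  have "p ^ k * (u1 + u2 + u3) = p ^ k * (2 * e0 + 1)" unfolding e0 ..
  then have pe: "p ^ k * u1 + p ^ k * u2 + p ^ k * u3 = 2 * (p ^ k * e0) + p ^ k" by (simp add: algebra_simps)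
  define m3 m0 where "m3 = p ^ k * u3" and "m0 = p ^ k * e0"
  note defs' = defs this
  have "4 * int \<alpha> \<le> 2 * (int a + int b + int c) - int N + 2 * D + 1"
    unfolding D by (rule gap_arith_lower[OF pe[folded defs'] c3[folded defs'] \<alpha>_def[folded defs']])
  note al = this
  show ?thesis
  proof (cases "\<alpha> \<le> e")
    case True
    have "Suc e - \<alpha> \<le> ps.dim (syz_space a b c e :: 'k poly set)"
      using dim_syz_space_ge[OF s[folded \<alpha>_def] True] .
    then show ?thesis using al True unfolding eq D_def[symmetric] unfolding defs(1)[symmetric] ring_distribs by linarith
  next
    case False
    then show ?thesis using al T D unfolding ring_distribs by linarith
  qed
qed

section \<open>Linear substitutions in truncated polynomials\<close>

type_synonym 'k mpoly5 = "(nat \<Rightarrow> nat) \<Rightarrow>\<^sub>0 'k"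

abbreviation lookup where "lookup \<equiv> Poly_Mapping.lookup"
abbreviation keys where "keys \<equiv> Poly_Mapping.keys"
abbreviation single where "single \<equiv> Poly_Mapping.single"

definition unit_exp :: "nat \<Rightarrow> nat \<Rightarrow> nat" where
  "unit_exp i = (\<lambda>j. if j = i then 1 else 0)"

definition var :: "nat \<Rightarrow> 'k::field mpoly5" where
  "var i = single (unit_exp i) 1"

definition homog :: "nat \<Rightarrow> 'k::field mpoly5 set" where
  "homog n = {f. \<forall>e \<in> keys f. (\<forall>i\<ge>5. e i = 0) \<and> (\<Sum>i<5. e i) = n}"

definition pow_ideal :: "nat \<Rightarrow> 'k::field mpoly5 set" where
  "pow_ideal q = {f. \<forall>e \<in> keys f. \<exists>i<5. q \<le> e i}"

definition exp_prod :: "(nat \<Rightarrow> 'k::field mpoly5) \<Rightarrow> (nat \<Rightarrow> nat) \<Rightarrow> 'k mpoly5" where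
  "exp_prod l e = (\<Prod>i<5. l i ^ e i)"

definition subst :: "(nat \<Rightarrow> 'k::field mpoly5) \<Rightarrow> 'k mpoly5 \<Rightarrow> 'k mpoly5" where
  "subst l f = (\<Sum>e\<in>keys f. single 0 (lookup f e) * exp_prod l e)"

lemma poly_mapping_sum_single: "f = (\<Sum>e\<in>keys f. single e (lookup f e))"
proof (rule poly_mapping_eqI)
  fix k
  have "lookup (\<Sum>e\<in>keys f. single e (lookup f e)) k = (\<Sum>e\<in>keys f. if e = k then lookup f k else 0)"
    unfolding lookup_sum by (intro sum.cong refl) (auto simp: lookup_single when_def)
  also have "\<dots> = lookup f k" by (simp add: in_keys_iff)
  finally show "lookup f k = lookup (\<Sum>e\<in>keys f. single e (lookup f e)) k" by simp
qed

lemma poly_mapping_single_induct [case_names zero single add]: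
  fixes f :: "'k::field mpoly5"
  assumes "P 0" "\<And>e c. P (single e c)" "\<And>f g. P f \<Longrightarrow> P g \<Longrightarrow> P (f + g)"
  shows "P f"
proof -
  have "P (\<Sum>e\<in>E. single e (lookup f e))" if "finite E" for E
    using that
  proof (induction E rule: finite_induct)
    case (insert e E)
    show ?case unfolding sum.insert[OF insert.hyps] by (rule assms(3)[OF assms(2) insert.IH])
  qed (simp add: assms(1))
  from this[OF finite_keys[of f]] show ?thesis by (simp only: poly_mapping_sum_single[symmetric])
qed

lemma subst_superset:
  assumes "keys f \<subseteq> E" "finite E"
  shows "subst l f = (\<Sum>e\<in>E. single 0 (lookup f e) * exp_prod l e)"
  unfolding subst_def by (rule sum.mono_neutral_left) (use assms in \<open>auto simp: in_keys_iff\<close>)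

lemma subst_zero: "subst l 0 = 0" by (simp add: subst_def)

lemma subst_add: "subst l (f + g) = subst l f + subst l g"
proof -
  let ?E = "keys f \<union> keys g"
  have k: "keys (f + g) \<subseteq> ?E" by (rule Poly_Mapping.keys_add)
  have "subst l (f + g) = (\<Sum>e\<in>?E. single 0 (lookup (f + g) e) * exp_prod l e)"
    by (rule subst_superset[OF k]) simp
  also have "\<dots> = (\<Sum>e\<in>?E. single 0 (lookup f e) * exp_prod l e) + (\<Sum>e\<in>?E. single 0 (lookup g e) * exp_prod l e)"
    by (simp add: lookup_add single_add distrib_right sum.distrib)
  also have "\<dots> = subst l f + subst l g"
    by (intro arg_cong2[of _ _ _ _ "(+)"] subst_superset[symmetric]) auto
  finally show ?thesis .
qed

lemma subst_single: "subst l (single e c) = single 0 c * exp_prod l e"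
  using subst_superset[of "single e c" "{e}" l] by simp

lemma exp_prod_add: "exp_prod l (e + d) = exp_prod l e * exp_prod l d"
  by (simp add: exp_prod_def power_add prod.distrib)

lemma subst_mult: "subst l (f * g) = subst l f * subst l g"
proof (induction f rule: poly_mapping_single_induct)
  case (single e c)
  show ?case
  proof (induction g rule: poly_mapping_single_induct)
    case (single d b)
    have c: "single 0 (c * b) = single 0 c * (single 0 b :: 'a mpoly5)" by (simp add: mult_single)
    have sw: "(x * y) * (u * v) = (x * u) * (y * v)" for x y u v :: "'a mpoly5" by (simp only: ac_simps)
    have "subst l (single e c * single d b) = single 0 (c * b) * (exp_prod l e * exp_prod l d)"
      by (simp only: mult_single subst_single exp_prod_add)
    also have "\<dots> = (single 0 c * exp_prod l e) * (single 0 b * exp_prod l d)" unfolding c by (rule sw)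
    also have "\<dots> = subst l (single e c) * subst l (single d b)" by (simp only: subst_single)
    finally show ?case .
  qed (simp_all add: subst_zero subst_add distrib_left)
qed (simp_all add: subst_zero subst_add distrib_right)

lemma subst_one: "subst l 1 = 1"
  using subst_single[of l 0 1] by (simp add: exp_prod_def)

lemma subst_power: "subst l (f ^ n) = subst l f ^ n"
  by (induction n) (simp_all add: subst_one subst_mult)

lemma subst_prod: "subst l (prod f I) = (\<Prod>i\<in>I. subst l (f i))"
  by (induction I rule: infinite_finite_induct) (simp_all add: subst_one subst_mult)

lemma subst_sum: "subst l (sum f I) = (\<Sum>i\<in>I. subst l (f i))"
  by (induction I rule: infinite_finite_induct) (simp_all add: subst_zero subst_add)

lemma subst_const: "subst l (single 0 c) = single 0 c"
  by (simp add: subst_single exp_prod_def)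

lemma exp_prod_unit: "i < 5 \<Longrightarrow> exp_prod l (unit_exp i) = l i"
proof -
  assume i: "i < 5"
  have "exp_prod l (unit_exp i) = (\<Prod>j<5. if j = i then l i else 1)"
    unfolding exp_prod_def unit_exp_def by (intro prod.cong) auto
  then show ?thesis using i by simp
qed

lemma subst_var: "i < 5 \<Longrightarrow> subst l (var i) = l i"
  by (simp add: var_def subst_single exp_prod_unit)

lemma exp_prod_var:
  assumes "\<forall>i\<ge>5. e i = 0"
  shows "exp_prod var e = single e (1::'k::field)"
proof -
  have pw: "var i ^ n = (single (\<lambda>j. if j = i then n else 0) 1 :: 'k mpoly5)" for i n
  proof (induction n)
    case 0
    have "(\<lambda>j. if j = i then 0 else 0) = (0 :: nat \<Rightarrow> nat)" by (simp add: fun_eq_iff)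
    then show ?case by simp
  next
    case (Suc n)
    have "unit_exp i + (\<lambda>j. if j = i then n else 0) = (\<lambda>j. if j = i then Suc n else 0)"
      by (auto simp: unit_exp_def fun_eq_iff)
    then show ?case unfolding power_Suc Suc.IH by (simp add: var_def mult_single)
  qed
  have "(\<Prod>i<m. var i ^ e i) = (single (\<lambda>j. if j < m then e j else 0) 1 :: 'k mpoly5)" for m
  proof (induction m)
    case 0
    have "(\<lambda>j. if j < 0 then e j else 0) = (0 :: nat \<Rightarrow> nat)" by (simp add: fun_eq_iff)
    then show ?case by simp
  next
    case (Suc m)
    have "(\<lambda>j. if j < m then e j else 0) + (\<lambda>j. if j = m then e m else 0) = (\<lambda>j. if j < Suc m then e j else 0)"
      by (auto simp: fun_eq_iff)
    then show ?case unfolding prod.lessThan_Suc Suc.IH unfolding pw mult_single by simp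
  qed
  moreover have "(\<lambda>j. if j < 5 then e j else 0) = e" using assms by (auto simp: fun_eq_iff)
  ultimately show ?thesis unfolding exp_prod_def by metis
qed

section \<open>Homogeneous polynomials and the Frobenius power of the maximal ideal\<close>

lemma homog_zero: "0 \<in> homog n" by (simp add: homog_def)

lemma homog_add: "f \<in> homog n \<Longrightarrow> g \<in> homog n \<Longrightarrow> f + g \<in> homog n"
  unfolding homog_def using Poly_Mapping.keys_add[of f g] by blast

lemma homog_sum: "(\<And>i. i \<in> I \<Longrightarrow> f i \<in> homog n) \<Longrightarrow> sum f I \<in> homog n"
  by (induction I rule: infinite_finite_induct) (simp_all add: homog_zero homog_add)

lemma homog_mult:
  assumes "f \<in> homog m" "g \<in> homog n"
  shows "f * g \<in> homog (m + n)"
  unfolding homog_def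
proof (intro CollectI ballI)
  fix e assume "e \<in> keys (f * g)"
  then obtain a b where "e = a + b" "a \<in> keys f" "b \<in> keys g"
    using keys_mult[of f g] by blast
  then show "(\<forall>i\<ge>5. e i = 0) \<and> (\<Sum>i<5. e i) = m + n"
    using assms unfolding homog_def by (auto simp: sum.distrib)
qed

lemma homog_one: "1 \<in> homog 0"
  by (auto simp: homog_def split: if_splits)

lemma homog_power: "f \<in> homog m \<Longrightarrow> f ^ k \<in> homog (k * m)"
  by (induction k) (auto simp: homog_one homog_mult)

lemma homog_const: "single 0 c \<in> homog 0"
  by (auto simp: homog_def split: if_splits)

lemma homog_exp_prod:
  assumes "\<And>i. i < 5 \<Longrightarrow> l i \<in> homog 1"
  shows "exp_prod l e \<in> homog (\<Sum>i<5. e i)"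
proof -
  have "(\<Prod>i<m. l i ^ e i) \<in> homog (\<Sum>i<m. e i)" if "m \<le> 5" for m
    using that
  proof (induction m)
    case (Suc m)
    then have "l m ^ e m \<in> homog (e m * 1)" by (intro homog_power assms) simp
    then show ?case using Suc homog_mult[of "\<Prod>i<m. l i ^ e i"] by simp
  qed (simp add: homog_one)
  then show ?thesis unfolding exp_prod_def by simp
qed

lemma homog_subst:
  assumes "\<And>i. i < 5 \<Longrightarrow> l i \<in> homog 1" "f \<in> homog n"
  shows "subst l f \<in> homog n"
  unfolding subst_def
proof (rule homog_sum)
  fix e assume "e \<in> keys f"
  then have "(\<Sum>i<5. e i) = n" using assms(2) by (auto simp: homog_def)
  moreover have "exp_prod l e \<in> homog (\<Sum>i<5. e i)" by (rule homog_exp_prod) (rule assms(1))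
  ultimately show "single 0 (lookup f e) * exp_prod l e \<in> homog n"
    using homog_mult[OF homog_const, of "exp_prod l e" n] by simp
qed

lemma pow_ideal_zero: "0 \<in> pow_ideal q" by (simp add: pow_ideal_def)

lemma pow_ideal_add: "f \<in> pow_ideal q \<Longrightarrow> g \<in> pow_ideal q \<Longrightarrow> f + g \<in> pow_ideal q"
  unfolding pow_ideal_def using Poly_Mapping.keys_add[of f g] by blast

lemma pow_ideal_uminus: "f \<in> pow_ideal q \<Longrightarrow> - f \<in> pow_ideal q"
  unfolding pow_ideal_def by (auto simp: in_keys_iff)

lemma pow_ideal_sum: "(\<And>i. i \<in> I \<Longrightarrow> f i \<in> pow_ideal q) \<Longrightarrow> sum f I \<in> pow_ideal q"
  by (induction I rule: infinite_finite_induct) (simp_all add: pow_ideal_zero pow_ideal_add)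

lemma pow_ideal_mult: "f \<in> pow_ideal q \<Longrightarrow> f * g \<in> pow_ideal q"
  unfolding pow_ideal_def
proof (intro CollectI ballI)
  fix e assume f: "f \<in> {f. \<forall>e\<in>keys f. \<exists>i<5. q \<le> e i}" and "e \<in> keys (f * g)"
  then obtain a b where ab: "e = a + b" "a \<in> keys f" "b \<in> keys g"
    using keys_mult[of f g] by blast
  then obtain i where "i < 5" "q \<le> a i" using f by blast
  then show "\<exists>i<5. q \<le> e i" unfolding ab(1) by (intro exI[of _ i]) auto
qed

definition linear_form :: "(nat \<Rightarrow> nat \<Rightarrow> 'k) \<Rightarrow> nat \<Rightarrow> 'k::field mpoly5" where
  "linear_form M i = (\<Sum>j<5. single 0 (M i j) * var j)"

lemma homog_linear_form: "linear_form M i \<in> homog 1"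
  unfolding linear_form_def
proof (rule homog_sum)
  fix j :: nat assume "j \<in> {..<5}"
  then have "var j \<in> homog 1" by (auto simp: homog_def var_def unit_exp_def)
  then show "single 0 (M i j) * var j \<in> homog 1" using homog_mult[OF homog_const] by fastforce
qed

lemma CHAR_mpoly5: "CHAR('k::field mpoly5) = CHAR('k)"
proof (rule CHAR_eqI)
  show "of_nat CHAR('k) = (0 :: 'k mpoly5)" by (simp flip: single_of_nat)
next
  fix n assume "of_nat n = (0 :: 'k mpoly5)"
  then have "lookup (of_nat n :: 'k mpoly5) 0 = 0" by simp
  then have "of_nat n = (0::'k)" by (simp add: lookup_of_nat)
  then show "CHAR('k) dvd n" by (simp add: of_nat_eq_0_iff_char_dvd)
qed

text \<open>Taking \<open>q\<close>-th powers is additive, so the power of the linear form is a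
  combination of the \<open>x_j^q\<close>. This is why every linear substitution respects the
  ideal.\<close>

lemma linear_form_power_in_pow_ideal:
  fixes M :: "nat \<Rightarrow> nat \<Rightarrow> 'k::field"
  assumes "prime CHAR('k)" "q = CHAR('k) ^ s"
  shows "linear_form M i ^ q \<in> pow_ideal q"
proof -
  have "linear_form M i ^ q = (\<Sum>j<5. (single 0 (M i j) * var j :: 'k mpoly5) ^ q)"
    unfolding linear_form_def
    by (rule freshmans_dream_sum'[where n = s]) (use assms CHAR_mpoly5[where 'k = 'k] in auto)
  also have "\<dots> \<in> pow_ideal q"
  proof (rule pow_ideal_sum)
    fix j :: nat assume j: "j \<in> {..<5}"
    have "\<exists>i<5. q \<le> (if i = j then q else 0)" using j by (intro exI[of _ j]) auto
    moreover have "var j ^ n = (single (\<lambda>i. if i = j then n else 0) 1 :: 'k mpoly5)" for n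
    proof (induction n)
      case 0
      have "(\<lambda>i. if i = j then 0 else 0) = (0 :: nat \<Rightarrow> nat)" by (simp add: fun_eq_iff)
      then show ?case by simp
    next
      case (Suc n)
      have "unit_exp j + (\<lambda>i. if i = j then n else 0) = (\<lambda>i. if i = j then Suc n else 0)"
        by (auto simp: unit_exp_def fun_eq_iff)
      then show ?case unfolding power_Suc Suc.IH by (simp add: var_def mult_single)
    qed
    ultimately have "var j ^ q \<in> (pow_ideal q :: 'k mpoly5 set)" by (simp add: pow_ideal_def)
    then show "(single 0 (M i j) * var j) ^ q \<in> pow_ideal q"
      by (simp add: power_mult_distrib mult.commute pow_ideal_mult)
  qed
  finally show ?thesis .
qed

lemma subst_pow_ideal:
  fixes M :: "nat \<Rightarrow> nat \<Rightarrow> 'k::field"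
  assumes "prime CHAR('k)" "q = CHAR('k) ^ s" "f \<in> pow_ideal q"
  shows "subst (linear_form M) f \<in> pow_ideal q"
  unfolding subst_def
proof (rule pow_ideal_sum)
  fix e assume "e \<in> keys f"
  then obtain i where i: "i < 5" "q \<le> e i" using assms(3) by (auto simp: pow_ideal_def)
  have "exp_prod (linear_form M) e = linear_form M i ^ e i * (\<Prod>i\<in>{..<5}-{i}. linear_form M i ^ e i)"
    unfolding exp_prod_def using i by (subst prod.remove[of _ i]) auto
  also have "\<dots> = linear_form M i ^ q * (linear_form M i ^ (e i - q) * (\<Prod>i\<in>{..<5}-{i}. linear_form M i ^ e i))"
    using i(2) by (simp flip: power_add mult.assoc)
  also have "\<dots> \<in> pow_ideal q"
    by (rule pow_ideal_mult[OF linear_form_power_in_pow_ideal[where s = s, OF assms(1,2)]])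
  finally show "single 0 (lookup f e) * exp_prod (linear_form M) e \<in> pow_ideal q"
    by (simp add: mult.commute pow_ideal_mult)
qed

lemma subst_subst_inverse:
  assumes lf: "\<And>i. i < 5 \<Longrightarrow> subst (linear_form N) (linear_form M i) = (var i :: 'k::field mpoly5)"
    and f: "f \<in> homog n"
  shows "subst (linear_form N) (subst (linear_form M) f) = f"
proof -
  have "subst (linear_form N) (subst (linear_form M) f)
     = (\<Sum>e\<in>keys f. single 0 (lookup f e) * (\<Prod>i<5. subst (linear_form N) (linear_form M i) ^ e i))"
    unfolding subst_def[of "linear_form M"] exp_prod_def
    by (simp add: subst_sum subst_mult subst_const subst_prod subst_power)
  also have "\<dots> = (\<Sum>e\<in>keys f. single 0 (lookup f e) * exp_prod var e)"
    unfolding exp_prod_def by (intro sum.cong refl arg_cong2[of _ _ _ _ "(*)"] prod.cong) (auto simp: lf)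
  also have "\<dots> = (\<Sum>e\<in>keys f. single e (lookup f e))"
    using f by (intro sum.cong refl) (auto simp: exp_prod_var homog_def mult_single)
  also have "\<dots> = f" by (rule poly_mapping_sum_single[symmetric])
  finally show ?thesis .
qed

section \<open>Kernels of quadrics under a linear change of variables\<close>

definition to_mpoly :: "(nat \<Rightarrow> nat) set \<Rightarrow> ((nat \<Rightarrow> nat) \<Rightarrow> 'k::field) \<Rightarrow> 'k mpoly5" where
  "to_mpoly X F = (\<Sum>e\<in>X. single e (F e))"

text \<open>The kernel of the quadratic form \<open>Q\<close> on the degree-\<open>n\<close> part of
  \<open>A\<close>, in the monomial basis. A monomial of degree \<open>n + 2\<close> that is not in
  \<open>mon_deg\<close> lies in the ideal, so only the coefficients on
  \<open>mon_deg q (n + 2)\<close> have to vanish.\<close>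

definition mult_kernel :: "nat \<Rightarrow> nat \<Rightarrow> 'k::field mpoly5 \<Rightarrow> ((nat \<Rightarrow> nat) \<Rightarrow> 'k) set" where
  "mult_kernel q n Q = {F \<in> fun_on (mon_deg q n). \<forall>d \<in> mon_deg q (n + 2). lookup (Q * to_mpoly (mon_deg q n) F) d = 0}"

lemma finite_mon_deg: "finite (mon_deg q n)"
proof (rule finite_subset)
  show "mon_deg q n \<subseteq> {f. \<forall>i. (i \<in> {..<5} \<longrightarrow> f i \<in> {..<q}) \<and> (i \<notin> {..<5} \<longrightarrow> f i = 0)}"
    by (auto simp: mon_deg_def)
  show "finite {f :: nat \<Rightarrow> nat. \<forall>i. (i \<in> {..<5} \<longrightarrow> f i \<in> {..<q}) \<and> (i \<notin> {..<5} \<longrightarrow> f i = 0)}"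
    by (rule finite_set_of_finite_funs) auto
qed

lemma lookup_to_mpoly: "finite X \<Longrightarrow> lookup (to_mpoly X F) e = (if e \<in> X then F e else 0)"
proof -
  assume X: "finite X"
  have "lookup (to_mpoly X F) e = (\<Sum>d\<in>X. if d = e then F e else 0)"
    unfolding to_mpoly_def lookup_sum by (intro sum.cong refl) (auto simp: lookup_single when_def)
  then show ?thesis using X by simp
qed

lemma to_mpoly_add: "to_mpoly X (F + G) = to_mpoly X F + to_mpoly X G"
  by (simp add: to_mpoly_def single_add sum.distrib)

lemma to_mpoly_scale: "to_mpoly X (\<lambda>e. c * F e) = single 0 c * to_mpoly X F"
  by (simp add: to_mpoly_def sum_distrib_left mult_single)

lemma lookup_const_mult: "lookup (single 0 c * f) e = c * lookup f e"
  by (simp flip: mult_map_scale_conv_mult add: map.rep_eq when_def)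

lemma homog_to_mpoly: "to_mpoly (mon_deg q n) F \<in> homog n"
proof -
  have "e \<in> mon_deg q n" if "e \<in> keys (to_mpoly (mon_deg q n) F)" for e
    using that by (simp add: in_keys_iff lookup_to_mpoly[OF finite_mon_deg] split: if_splits)
  then show ?thesis unfolding homog_def mon_deg_def by blast
qed

lemma subspace_mult_kernel: "fs.subspace (mult_kernel q n Q)"
proof -
  have "to_mpoly X 0 = (0 :: 'a mpoly5)" for X by (simp add: to_mpoly_def)
  moreover have "lookup (Q * (single 0 c * f)) e = c * lookup (Q * f) e" for c f e
    by (simp add: mult.left_commute[of Q] lookup_const_mult)
  ultimately show ?thesis
  using subspace_fun_on[of "mon_deg q n"] unfolding fs.subspace_def mult_kernel_def
  by (auto simp: to_mpoly_add to_mpoly_scale lookup_add distrib_left)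
qed

lemma homog_in_pow_idealI:
  assumes "f \<in> homog n" "\<And>e. e \<in> mon_deg q n \<Longrightarrow> lookup f e = 0"
  shows "f \<in> pow_ideal q"
  unfolding pow_ideal_def
proof (intro CollectI ballI)
  fix e assume e: "e \<in> keys f"
  have 1: "(\<forall>i\<ge>5. e i = 0) \<and> (\<Sum>i<5. e i) = n" using assms(1) e unfolding homog_def by blast
  have "e \<notin> mon_deg q n" using e assms(2)[of e] by (auto simp: in_keys_iff)
  then have "\<not> (\<forall>i<5. e i < q)" using 1 unfolding mon_deg_def by blast
  then show "\<exists>i<5. q \<le> e i" by (meson not_less)
qed

lemma pow_ideal_lookup_mon_deg:
  assumes "f \<in> pow_ideal q" "e \<in> mon_deg q n"
  shows "lookup f e = 0"
proof (rule ccontr)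
  assume "lookup f e \<noteq> 0"
  then have "e \<in> keys f" by (simp add: in_keys_iff)
  then obtain i where "i < 5" "q \<le> e i" using assms(1) unfolding pow_ideal_def by blast
  moreover have "\<forall>i<5. e i < q" using assms(2) unfolding mon_deg_def by blast
  ultimately show False by (meson not_less)
qed

lemma homog_uminus: "f \<in> homog n \<Longrightarrow> - f \<in> homog n"
  by (simp add: homog_def in_keys_iff)

lemma dim_mult_kernel_le:
  fixes M N :: "nat \<Rightarrow> nat \<Rightarrow> 'k::field"
  assumes ch: "prime CHAR('k)" "q = CHAR('k) ^ s"
    and MN: "\<And>i. i < 5 \<Longrightarrow> subst (linear_form N) (linear_form M i) = (var i :: 'k mpoly5)"
    and Q: "Q \<in> homog 2" "subst (linear_form M) Q = Q'"
  shows "fs.dim (mult_kernel q n Q) \<le> fs.dim (mult_kernel q n Q')"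
proof -
  let ?X = "mon_deg q n"
  let ?S = "subst (linear_form M)"
  \<comment> \<open>The substitution followed by dropping all monomials with an exponent of
    \<open>q\<close> or more; by \<open>diff\<close> the dropped part lies in the ideal.\<close>
  define L where "L F = (\<lambda>d. if d \<in> ?X then lookup (?S (to_mpoly ?X F)) d else 0)" for F :: "(nat \<Rightarrow> nat) \<Rightarrow> 'k"
  have L: "Vector_Spaces.linear fun_scale fun_scale L"
    by (rule fun_linearI)
       (auto simp: L_def fun_eq_iff to_mpoly_add to_mpoly_scale subst_add subst_mult subst_const lookup_add lookup_const_mult)
  have diff: "?S (to_mpoly ?X F) - to_mpoly ?X (L F) \<in> pow_ideal q" for F
  proof (rule homog_in_pow_idealI)
    have "?S (to_mpoly ?X F) + - to_mpoly ?X (L F) \<in> homog n"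
      by (intro homog_add homog_uminus homog_to_mpoly homog_subst homog_linear_form)
    then show "?S (to_mpoly ?X F) - to_mpoly ?X (L F) \<in> homog n" by simp
    show "lookup (?S (to_mpoly ?X F) - to_mpoly ?X (L F)) e = 0" if "e \<in> ?X" for e
      using that by (simp add: lookup_minus lookup_to_mpoly[OF finite_mon_deg] L_def)
  qed
  have im: "L ` mult_kernel q n Q \<subseteq> mult_kernel q n Q'"
  proof clarify
    fix F assume F: "F \<in> mult_kernel q n Q"
    let ?f = "to_mpoly ?X F"
    have "Q * ?f \<in> pow_ideal q"
    proof (rule homog_in_pow_idealI)
      show "Q * ?f \<in> homog (n + 2)" using homog_mult[OF Q(1) homog_to_mpoly] by (simp only: add.commute)
      show "lookup (Q * ?f) e = 0" if "e \<in> mon_deg q (n + 2)" for e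
        using that F unfolding mult_kernel_def by blast
    qed
    then have "?S (Q * ?f) \<in> pow_ideal q" by (rule subst_pow_ideal[OF ch])
    then have 1: "Q' * ?S ?f \<in> pow_ideal q" by (simp add: subst_mult Q(2))
    have "Q' * to_mpoly ?X (L F) = Q' * ?S ?f + - ((?S ?f - to_mpoly ?X (L F)) * Q')"
      by (simp add: algebra_simps)
    then have "Q' * to_mpoly ?X (L F) \<in> pow_ideal q"
      using pow_ideal_add[OF 1 pow_ideal_uminus[OF pow_ideal_mult[OF diff]]] by (simp only:)
    then have "\<forall>d\<in>mon_deg q (n + 2). lookup (Q' * to_mpoly ?X (L F)) d = 0"
      using pow_ideal_lookup_mon_deg by blast
    moreover have "L F \<in> fun_on ?X" by (auto simp: L_def fun_on_def)
    ultimately show "L F \<in> mult_kernel q n Q'" by (simp add: mult_kernel_def)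
  qed
  have inj: "F = 0" if F: "F \<in> mult_kernel q n Q" "L F = 0" for F
  proof
    fix e
    let ?f = "to_mpoly ?X F"
    have z: "to_mpoly ?X (L F) = 0" unfolding F(2) by (simp add: to_mpoly_def)
    have "?S ?f \<in> pow_ideal q" using diff[of F] z by simp
    then have "subst (linear_form N) (?S ?f) \<in> pow_ideal q" by (rule subst_pow_ideal[OF ch])
    moreover have "subst (linear_form N) (?S ?f) = ?f"
      by (rule subst_subst_inverse[OF _ homog_to_mpoly]) (rule MN)
    ultimately have I: "?f \<in> pow_ideal q" by simp
    show "F e = 0 e"
    proof (cases "e \<in> ?X")
      case True
      have "lookup ?f e = 0" by (rule pow_ideal_lookup_mon_deg[OF I True])
      then show ?thesis using True by (simp add: lookup_to_mpoly[OF finite_mon_deg])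
    next
      case False
      then show ?thesis using F(1) by (simp add: mult_kernel_def fun_on_def)
    qed
  qed
  have sp: "mult_kernel q n Q'' \<subseteq> fs.span (delta ` ?X)" for Q'' :: "'k mpoly5"
    using fun_on_span[OF finite_mon_deg] by (auto simp: mult_kernel_def)
  show ?thesis
    by (rule fsp.dim_le_of_inj_on[OF L subspace_mult_kernel _ sp _ im _ sp])
       (auto simp: finite_mon_deg intro: inj)
qed

section \<open>The quadric\<close>

definition sum_squares :: "'k::field mpoly5" where
  "sum_squares = (\<Sum>i<5. var i * var i)"

definition split_quadric :: "'k::field mpoly5" where
  "split_quadric = var 0 * var 1 + var 2 * var 3 + var 4 * var 4"

text \<open>Pigeonhole in the prime field: the \<open>(p + 1) / 2\<close> squares and the
  \<open>(p + 1) / 2\<close> values \<open>-1 - i^2\<close> cannot be disjoint among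
  \<open>p\<close> elements.\<close>

lemma sum_of_two_squares_eq_minus_one:
  assumes "CHAR('k::field) = p" "prime p" "odd p"
  shows "\<exists>A B :: 'k. A * A + B * B = - 1"
proof -
  obtain m where m: "p = 2 * m + 1" using assms(3) by (rule oddE)
  define S where "S = (\<lambda>i. of_nat i * of_nat i :: 'k) ` {..m}"
  define F where "F = (of_nat :: nat \<Rightarrow> 'k) ` {..<p}"
  have p0: "p > 0" using m by simp
  have modF: "of_nat n \<in> F" for n
  proof -
    have "of_nat n = (of_nat (p * (n div p) + n mod p) :: 'k)" by (simp only: mult_div_mod_eq)
    also have "\<dots> = of_nat (n mod p)" unfolding of_nat_add of_nat_mult
      using assms(1) of_nat_CHAR[where 'a = 'k] by simp
    finally show ?thesis unfolding F_def using p0 by auto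
  qed
  have inj: "inj_on (\<lambda>i. of_nat i * of_nat i :: 'k) {..m}"
  proof (rule inj_onI)
    fix i j assume ij: "i \<in> {..m}" "j \<in> {..m}" "of_nat i * of_nat i = (of_nat j * of_nat j :: 'k)"
    have main: "i = j" if "i \<le> j" "j \<le> m" "of_nat i * of_nat i = (of_nat j * of_nat j :: 'k)" for i j
    proof -
      have "of_nat (j - i) * of_nat (j + i) = (of_nat j * of_nat j - of_nat i * of_nat i :: 'k)"
        using that(1) by (simp add: of_nat_diff algebra_simps)
      then have "of_nat ((j - i) * (j + i)) = (0 :: 'k)" using that(3) by (simp only: of_nat_mult) simp
      then have "p dvd (j - i) * (j + i)" unfolding of_nat_eq_0_iff_char_dvd assms(1) .
      then have "p dvd j - i \<or> p dvd j + i" using assms(2) by (simp add: prime_dvd_mult_iff)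
      then have "j - i = 0 \<or> j + i = 0" using that(1,2) m by (auto dest!: dvd_imp_le)
      then show ?thesis using that(1) by auto
    qed
    have le: "i \<le> m" "j \<le> m" using ij by simp_all
    show "i = j"
    proof (cases "i \<le> j")
      case True
      then show ?thesis by (rule main[OF _ le(2) ij(3)])
    next
      case False
      then have "j \<le> i" by simp
      then show ?thesis by (rule main[OF _ le(1) ij(3)[symmetric], symmetric])
    qed
  qed
  have cS: "card S = m + 1" unfolding S_def using card_image[OF inj] by simp
  define S' where "S' = (\<lambda>s. - 1 - s) ` S"
  have "inj_on (\<lambda>s. - 1 - s) S" by (rule inj_onI) simp
  then have cS': "card S' = m + 1" unfolding S'_def using cS by (simp add: card_image)
  have S1: "S \<subseteq> F"
  proof
    fix x assume "x \<in> S"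
    then obtain i where "x = of_nat i * of_nat i" unfolding S_def by blast
    then have "x = of_nat (i * i)" by simp
    then show "x \<in> F" using modF[of "i * i"] by (simp only:)
  qed
  have "S' \<subseteq> F"
  proof
    fix x assume "x \<in> S'"
    then obtain i where x: "x = - 1 - of_nat i * of_nat i" unfolding S'_def S_def by blast
    have "of_nat (2 * m + 1) = (0 :: 'k)" using assms(1) m of_nat_CHAR[where 'a = 'k] by simp
    then have "of_nat (2 * m) = (- 1 :: 'k)" by (simp add: eq_neg_iff_add_eq_0 add.commute)
    then have "x = of_nat (2 * m * (1 + i * i))" unfolding x by (simp only: of_nat_mult of_nat_add) (simp add: algebra_simps)
    then show "x \<in> F" using modF[of "2 * m * (1 + i * i)"] by (simp only:)
  qed
  then have "card (S \<union> S') \<le> card F" using S1 by (intro card_mono) (auto simp: F_def)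
  also have "\<dots> \<le> p" unfolding F_def using card_image_le[of "{..<p}" "of_nat :: nat \<Rightarrow> 'k"] by simp
  finally have le: "card (S \<union> S') \<le> p" .
  have "finite S" "finite S'" unfolding S'_def S_def by simp_all
  then have "S \<inter> S' = {} \<Longrightarrow> card (S \<union> S') = card S + card S'" by (rule card_Un_disjoint)
  then have "S \<inter> S' \<noteq> {}" using le cS cS' m by linarith
  then obtain x where "x \<in> S" "x \<in> S'" by blast
  then obtain i j where "x = of_nat i * of_nat i" "x = - 1 - of_nat j * (of_nat j :: 'k)" unfolding S'_def S_def by blast
  then have "of_nat i * of_nat i + of_nat j * of_nat j = (- 1 :: 'k)" by (simp add: algebra_simps)
  then show ?thesis by blast
qed

lemma less_5_cases: "(i::nat) < 5 \<Longrightarrow> i = 0 \<or> i = 1 \<or> i = 2 \<or> i = 3 \<or> i = 4"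
  by linarith

lemma sum_5: "(\<Sum>j<5. f j) = f 0 + f 1 + f 2 + f 3 + f (4::nat)"
  by (simp add: eval_nat_numeral ac_simps)

lemma homog_var: "i < 5 \<Longrightarrow> var i \<in> homog 1"
  by (auto simp: homog_def var_def unit_exp_def)

lemma homog_var_mult: "i < 5 \<Longrightarrow> j < 5 \<Longrightarrow> var i * var j \<in> homog 2"
  using homog_mult[OF homog_var homog_var, of i j] by (simp add: numeral_2_eq_2)

text \<open>\<open>A^2 + B^2 = -1\<close> takes the place of a square root of -1, which
  \<open>k\<close> may lack: it turns two of the squares into \<open>- u^2 - v^2\<close>, and the
  differences of squares that arise factor into \<open>x_0 x_1\<close> and \<open>x_2 x_3\<close>.
  The dimensions agree because the substitution works in both directions.\<close>

lemma dim_mult_kernel_sum_squares: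
  assumes "CHAR('k::field) = p" "prime p" "odd p" "q = p ^ s"
  shows "fs.dim (mult_kernel q n (sum_squares :: 'k mpoly5)) = fs.dim (mult_kernel q n (split_quadric :: 'k mpoly5))"
proof -
  obtain A B :: 'k where AB: "A * A + B * B = - 1" using sum_of_two_squares_eq_minus_one[OF assms(1-3)] by blast
  define h :: 'k where "h = 1 / 4"
  have "(of_nat 2 :: 'k) \<noteq> 0"
    unfolding of_nat_eq_0_iff_char_dvd assms(1) using assms(2,3) by (metis primes_dvd_imp_eq two_is_prime_nat even_numeral)
  then have "(2 :: 'k) \<noteq> 0" by simp
  then have "(2 * 2 :: 'k) \<noteq> 0" by (simp only: mult_eq_0_iff) simp
  then have h4: "4 * h = 1" unfolding h_def by simp
  \<comment> \<open>With \<open>u = x_0 - h x_1\<close> and \<open>v = x_2 - h x_3\<close> the rows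
    are \<open>x_0 + h x_1\<close>, \<open>x_2 + h x_3\<close>, \<open>A u + B v\<close>,
    \<open>B u - A v\<close>, \<open>x_4\<close>. The value \<open>h = 1/4\<close> makes
    \<open>(x_0 + h x_1)^2 - u^2\<close> equal to \<open>x_0 x_1\<close>.\<close>
  define M :: "nat \<Rightarrow> nat \<Rightarrow> 'k" where
    "M = (\<lambda>i j. [[1, h, 0, 0, 0], [0, 0, 1, h, 0], [A, - (A * h), B, - (B * h), 0],
            [B, - (B * h), - A, A * h, 0], [0, 0, 0, 0, 1]] ! i ! j)"
  define N :: "nat \<Rightarrow> nat \<Rightarrow> 'k" where
    "N = (\<lambda>i j. [[2 * h, 0, - (2 * h * A), - (2 * h * B), 0], [2, 0, 2 * A, 2 * B, 0],
            [0, 2 * h, - (2 * h * B), 2 * h * A, 0], [0, 2, 2 * B, - (2 * A), 0], [0, 0, 0, 0, 1]] ! i ! j)"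
  let ?c = "single 0 :: 'k \<Rightarrow> 'k mpoly5"
  have c: "?c (x * y) = ?c x * ?c y" "?c (x + y) = ?c x + ?c y" "?c (- x) = - ?c x" "?c 1 = 1" "?c 0 = 0" for x y
    by (simp_all add: mult_single single_add single_uminus)
  define a b h' where "a = ?c A" and "b = ?c B" and "h' = ?c h"
  have ab: "a * a + b * b = - 1" unfolding a_def b_def c[symmetric] AB ..
  have "h' + h' + h' + h' = ?c (4 * h)" unfolding h'_def by (simp flip: c(2))
  then have hh: "h' + h' + h' + h' = 1" unfolding h4 c .
  define u v where "u = var 0 - h' * var 1" and "v = var 2 - h' * var 3"
  define w z where "w = a * var 2 + b * var 3" and "z = b * var 2 - a * var 3"
  have l: "linear_form M 0 = var 0 + h' * var 1" "linear_form M 1 = var 2 + h' * var 3"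
    "linear_form M 2 = a * u + b * v" "linear_form M 3 = b * u - a * v" "linear_form M 4 = var 4"
    unfolding linear_form_def sum_5 M_def u_def v_def a_def b_def h'_def by (simp_all add: c algebra_simps)
  have l': "linear_form N 0 = (h' + h') * (var 0 - w)" "linear_form N 1 = 2 * (var 0 + w)"
    "linear_form N 2 = (h' + h') * (var 1 - z)" "linear_form N 3 = 2 * (var 1 + z)" "linear_form N 4 = var 4"
    unfolding linear_form_def sum_5 N_def w_def z_def a_def b_def h'_def by (simp_all add: c algebra_simps)
  have sc: "subst l a = a" "subst l b = b" "subst l h' = h'" "subst l 2 = 2" for l
    using subst_const[of l A] subst_const[of l B] subst_const[of l h] subst_const[of l 2]
    unfolding a_def b_def h'_def by simp_all
  have sm: "subst l (f - g) = subst l f - subst l g" for l and f g :: "'k mpoly5"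
  proof -
    have "subst l (f - g) + subst l g = subst l f" by (simp flip: subst_add)
    then show ?thesis by (simp add: eq_diff_eq)
  qed
  have sv: "subst l (var 0) = l 0" "subst l (var 1) = l 1" "subst l (var 2) = l 2" "subst l (var 3) = l 3" "subst l (var 4) = l 4"
    for l :: "nat \<Rightarrow> 'k mpoly5"
    by (simp_all add: subst_var)
  note sv2 = sv sv[unfolded One_nat_def] and l2 = l l[unfolded One_nat_def] and l2' = l' l'[unfolded One_nat_def]
  have MN: "subst (linear_form N) (linear_form M i) = var i" if "i < 5" for i
  proof -
    have u: "subst (linear_form N) u = - w"
    proof -
      have "subst (linear_form N) u = - ((h' + h' + h' + h') * w)"
        unfolding u_def by (simp add: sm subst_mult sc sv2 l2' algebra_simps)
      then show ?thesis unfolding hh by simp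
    qed
    have v: "subst (linear_form N) v = - z"
    proof -
      have "subst (linear_form N) v = - ((h' + h' + h' + h') * z)"
        unfolding v_def by (simp add: sm subst_mult sc sv2 l2' algebra_simps)
      then show ?thesis unfolding hh by simp
    qed
    have 0: "subst (linear_form N) (linear_form M 0) = var 0"
    proof -
      have "subst (linear_form N) (linear_form M 0) = (h' + h' + h' + h') * var 0"
        unfolding l by (simp add: subst_add subst_mult sc sv2 l2' algebra_simps)
      then show ?thesis unfolding hh by simp
    qed
    have 1: "subst (linear_form N) (linear_form M 1) = var 1"
    proof -
      have "subst (linear_form N) (linear_form M 1) = (h' + h' + h' + h') * var 1"
        unfolding l by (simp add: subst_add subst_mult sc sv2 l2' algebra_simps)
      then show ?thesis unfolding hh by simp
    qed
    have 2: "subst (linear_form N) (linear_form M 2) = var 2"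
    proof -
      have "subst (linear_form N) (linear_form M 2) = - ((a * a + b * b) * var 2)"
        unfolding l w_def z_def by (simp add: subst_add subst_mult sc u v w_def z_def algebra_simps)
      then show ?thesis unfolding ab by simp
    qed
    have 3: "subst (linear_form N) (linear_form M 3) = var 3"
    proof -
      have "subst (linear_form N) (linear_form M 3) = - ((a * a + b * b) * var 3)"
        unfolding l by (simp add: sm subst_mult sc u v w_def z_def algebra_simps)
      then show ?thesis unfolding ab by simp
    qed
    have 4: "subst (linear_form N) (linear_form M 4) = var 4" unfolding l sv l' ..
    show ?thesis using less_5_cases[OF that] 0 1 2 3 4 by (elim disjE) (simp_all only:)
  qed
  have NM: "subst (linear_form M) (linear_form N i) = var i" if "i < 5" for i
  proof -
    have w: "subst (linear_form M) w = - u"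
    proof -
      have "subst (linear_form M) w = (a * a + b * b) * u"
        unfolding w_def by (simp add: subst_add subst_mult sc sv2 l2 algebra_simps)
      then show ?thesis unfolding ab by simp
    qed
    have z: "subst (linear_form M) z = - v"
    proof -
      have "subst (linear_form M) z = (a * a + b * b) * v"
        unfolding z_def by (simp add: sm subst_mult sc sv2 l2 algebra_simps)
      then show ?thesis unfolding ab by simp
    qed
    have 0: "subst (linear_form M) (linear_form N 0) = var 0"
    proof -
      have "subst (linear_form M) (linear_form N 0) = (h' + h' + h' + h') * var 0"
        unfolding l' by (simp add: sm subst_add subst_mult sc sv2 l2 w u_def algebra_simps)
      then show ?thesis unfolding hh by simp
    qed
    have 1: "subst (linear_form M) (linear_form N 1) = var 1"
    proof -
      have "subst (linear_form M) (linear_form N 1) = (h' + h' + h' + h') * var 1"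
        unfolding l' by (simp add: sm subst_add subst_mult sc sv2 l2 w u_def algebra_simps)
      then show ?thesis unfolding hh by simp
    qed
    have 2: "subst (linear_form M) (linear_form N 2) = var 2"
    proof -
      have "subst (linear_form M) (linear_form N 2) = (h' + h' + h' + h') * var 2"
        unfolding l' by (simp add: sm subst_add subst_mult sc sv2 l2 z v_def algebra_simps)
      then show ?thesis unfolding hh by simp
    qed
    have 3: "subst (linear_form M) (linear_form N 3) = var 3"
    proof -
      have "subst (linear_form M) (linear_form N 3) = (h' + h' + h' + h') * var 3"
        unfolding l' by (simp add: sm subst_add subst_mult sc sv2 l2 z v_def algebra_simps)
      then show ?thesis unfolding hh by simp
    qed
    have 4: "subst (linear_form M) (linear_form N 4) = var 4" unfolding l' sv l ..
    show ?thesis using less_5_cases[OF that] 0 1 2 3 4 by (elim disjE) (simp_all only:)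
  qed
  have homQ: "sum_squares \<in> (homog 2 :: 'k mpoly5 set)" "split_quadric \<in> (homog 2 :: 'k mpoly5 set)"
    unfolding sum_squares_def split_quadric_def by (intro homog_sum homog_add homog_var_mult; simp)+
  have QM: "subst (linear_form M) sum_squares = (split_quadric :: 'k mpoly5)"
  proof -
    have "subst (linear_form M) sum_squares = linear_form M 0 * linear_form M 0 + linear_form M 1 * linear_form M 1
       + linear_form M 2 * linear_form M 2 + linear_form M 3 * linear_form M 3 + linear_form M 4 * linear_form M 4"
      unfolding sum_squares_def sum_5 by (simp only: subst_add subst_mult sv)
    also have "\<dots> = (var 0 + h' * var 1) * (var 0 + h' * var 1) + (var 2 + h' * var 3) * (var 2 + h' * var 3)
        + (a * a + b * b) * (u * u + v * v) + var 4 * var 4"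
      unfolding l by (simp add: algebra_simps)
    also have "\<dots> = (h' + h' + h' + h') * (var 0 * var 1 + var 2 * var 3) + var 4 * var 4"
      unfolding ab u_def v_def by (simp add: algebra_simps)
    also have "\<dots> = split_quadric" unfolding hh split_quadric_def by simp
    finally show ?thesis .
  qed
  have QN: "subst (linear_form N) split_quadric = (sum_squares :: 'k mpoly5)"
    unfolding QM[symmetric] by (rule subst_subst_inverse[OF _ homQ(1)]) (rule MN)
  have ch: "prime CHAR('k)" "q = CHAR('k) ^ s" using assms by simp_all
  have "fs.dim (mult_kernel q n (sum_squares :: 'k mpoly5)) \<le> fs.dim (mult_kernel q n (split_quadric :: 'k mpoly5))"
  proof (rule dim_mult_kernel_le[where M = M and N = N and s = s])
    show "prime CHAR('k)" "q = CHAR('k) ^ s" by (rule ch)+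
    show "subst (linear_form N) (linear_form M i) = var i" if "i < 5" for i by (rule MN[OF that])
    show "sum_squares \<in> (homog 2 :: 'k mpoly5 set)" by (rule homQ)
    show "subst (linear_form M) sum_squares = split_quadric" by (rule QM)
  qed
  moreover have "fs.dim (mult_kernel q n (split_quadric :: 'k mpoly5)) \<le> fs.dim (mult_kernel q n (sum_squares :: 'k mpoly5))"
  proof (rule dim_mult_kernel_le[where M = N and N = M and s = s])
    show "prime CHAR('k)" "q = CHAR('k) ^ s" by (rule ch)+
    show "subst (linear_form M) (linear_form N i) = var i" if "i < 5" for i by (rule NM[OF that])
    show "split_quadric \<in> (homog 2 :: 'k mpoly5 set)" by (rule homQ)
    show "subst (linear_form N) split_quadric = sum_squares" by (rule QN)
  qed
  ultimately show ?thesis by (rule antisym)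
qed

section \<open>From the rank of the quadric to its kernel\<close>

lemma lookup_mult_to_mpoly:
  "lookup (Q * to_mpoly X F) d = (\<Sum>e\<in>X. F e * lookup (Q * single e 1) d)"
proof -
  have "Q * to_mpoly X F = (\<Sum>e\<in>X. single 0 (F e) * (Q * single e 1))"
    unfolding to_mpoly_def sum_distrib_left
    by (intro sum.cong refl) (simp add: mult.left_commute[of "single 0 _"] mult_single)
  then show ?thesis by (simp add: lookup_sum lookup_const_mult)
qed

lemma unit_exp_add2: "unit_exp i + unit_exp i + e = e(i := e i + 2)"
  by (auto simp: unit_exp_def fun_eq_iff)

text \<open>The exponent vectors obtained by adding 2 in different places are distinct, so the sum
  of five indicators is the single indicator of \<open>quad_image\<close>.\<close>

lemma lookup_sum_squares_single:
  "lookup (sum_squares * single e 1) d = (if \<exists>i<5. d = e(i := e i + 2) then 1 else (0::'k::field))"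
proof -
  have "sum_squares * single e 1 = (\<Sum>i<5. single (e(i := e i + 2)) (1::'k))"
    unfolding sum_squares_def sum_distrib_right var_def mult_single unit_exp_add2 by simp
  then have l: "lookup (sum_squares * single e 1) d = (\<Sum>i<5. if e(i := e i + 2) = d then 1 else (0::'k))"
    by (simp add: lookup_sum lookup_single when_def)
  show ?thesis
  proof (cases "\<exists>i<5. d = e(i := e i + 2)")
    case True
    then obtain i where i: "i < 5" "d = e(i := e i + 2)" by blast
    have "e(j := e j + 2) = d \<longleftrightarrow> j = i" for j
    proof
      assume "e(j := e j + 2) = d"
      then have "(e(j := e j + 2)) i = (e(i := e i + 2)) i" unfolding i(2) by simp
      then show "j = i" by (auto split: if_splits simp: fun_upd_def)
    qed (simp add: i(2))
    then have "lookup (sum_squares * single e 1) d = (\<Sum>j<5. if j = i then 1 else (0::'k))" unfolding l by simp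
    then show ?thesis using i True by simp
  next
    case False
    then have "\<forall>i<5. e(i := e i + 2) \<noteq> d" by blast
    then show ?thesis using False unfolding l by simp
  qed
qed

lemma mult_kernel_quad_image:
  "mult_kernel q n sum_squares =
    {f \<in> fun_on (mon_deg q n). \<forall>y. (\<Sum>x\<in>mon_deg q n. f x * (quad_image q (n + 2) x y :: 'k::field)) = 0}"
proof -
  have "(\<Sum>x\<in>mon_deg q n. f x * (quad_image q (n + 2) x y :: 'k)) =
     (if y \<in> mon_deg q (n + 2) then lookup (sum_squares * to_mpoly (mon_deg q n) f) y else 0)" for f y
    unfolding lookup_mult_to_mpoly lookup_sum_squares_single quad_image_def by simp
  then show ?thesis unfolding mult_kernel_def by auto
qed

text \<open>Written additively because \<open>hk_piece_dim\<close> is a truncated difference; it is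
  exact since the rank is at most the dimension of the target.\<close>

lemma hk_piece_dim_kernel:
  fixes K :: "'k::field itself"
  shows "hk_piece_dim K q (n + 2) + card (mon_deg q n) = card (mon_deg q (n + 2)) + fs.dim (mult_kernel q n (sum_squares :: 'k mpoly5))"
proof -
  let ?v = "quad_image q (n + 2) :: (nat \<Rightarrow> nat) \<Rightarrow> (nat \<Rightarrow> nat) \<Rightarrow> 'k"
  have "card (mon_deg q n) = fs.dim (?v ` mon_deg q n) + fs.dim (mult_kernel q n (sum_squares :: 'k mpoly5))"
    unfolding mult_kernel_quad_image by (rule card_eq_rank_plus_kernel[OF finite_mon_deg])
  moreover have "?v ` mon_deg q n \<subseteq> fun_on (mon_deg q (n + 2))"
    by (rule image_subsetI) (simp add: fun_on_def quad_image_def)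
  then have "?v ` mon_deg q n \<subseteq> fs.span (delta ` mon_deg q (n + 2))"
    by (rule order_trans[OF _ fun_on_span[OF finite_mon_deg]])
  then have "fs.dim (?v ` mon_deg q n) \<le> card (delta ` mon_deg q (n + 2) :: ((nat \<Rightarrow> nat) \<Rightarrow> 'k) set)"
    by (rule fs.dim_le_card) (simp add: finite_mon_deg)
  then have "fs.dim (?v ` mon_deg q n) \<le> card (mon_deg q (n + 2))"
    by (rule order_trans[OF _ card_image_le[OF finite_mon_deg]])
  moreover have "hk_piece_dim K q (n + 2) = card (mon_deg q (n + 2)) - fs.dim (?v ` mon_deg q n)"
    unfolding hk_piece_dim_def by simp
  ultimately show ?thesis by linarith
qed

text \<open>The complement in the socle monomial \<open>(x_0 ... x_4)^(q-1)\<close> of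
  \<open>A\<close>, so monomials of degree \<open>n\<close> and \<open>5 (q - 1) - n\<close> are
  paired.\<close>

definition reflect :: "nat \<Rightarrow> (nat \<Rightarrow> nat) \<Rightarrow> nat \<Rightarrow> nat" where
  "reflect q e = (\<lambda>i. if i < 5 then q - 1 - e i else 0)"

lemma reflect_mon_deg:
  assumes "e \<in> mon_deg q n" "n + n' = 5 * (q - 1)"
  shows "reflect q e \<in> mon_deg q n'" "reflect q (reflect q e) = e"
proof -
  have lt: "e i < q" if "i < 5" for i using assms(1) that unfolding mon_deg_def by blast
  have "(\<Sum>i<5. e i) + (\<Sum>i<5. q - 1 - e i) = (\<Sum>i<5::nat. q - 1)"
    unfolding sum.distrib[symmetric] by (intro sum.cong refl) (use lt in fastforce)
  moreover have "(\<Sum>i<5. e i) = n" using assms(1) unfolding mon_deg_def by blast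
  ultimately have "(\<Sum>i<5. q - 1 - e i) = n'" using assms(2) by simp
  moreover have "(\<Sum>i<5. reflect q e i) = (\<Sum>i<5. q - 1 - e i)" by (simp add: reflect_def)
  moreover have "reflect q e i < q" if "i < 5" for i using lt[OF that] that by (simp add: reflect_def)
  ultimately show "reflect q e \<in> mon_deg q n'" unfolding mon_deg_def by (simp add: reflect_def)
  show "reflect q (reflect q e) = e"
  proof
    fix i
    show "reflect q (reflect q e) i = e i"
      using lt[of i] assms(1) unfolding reflect_def mon_deg_def by (cases "i < 5") auto
  qed
qed

lemma bij_reflect:
  assumes "n + n' = 5 * (q - 1)"
  shows "bij_betw (reflect q) (mon_deg q n) (mon_deg q n')"
proof (rule bij_betw_byWitness[where f' = "reflect q"])
  have "n' + n = 5 * (q - 1)" using assms by simp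
  note r = reflect_mon_deg[OF _ assms] reflect_mon_deg[OF _ this]
  show "\<forall>e\<in>mon_deg q n. reflect q (reflect q e) = e" "\<forall>e\<in>mon_deg q n'. reflect q (reflect q e) = e"
    using r by blast+
  show "reflect q ` mon_deg q n \<subseteq> mon_deg q n'" "reflect q ` mon_deg q n' \<subseteq> mon_deg q n"
    using r by blast+
qed

lemma reflect_step:
  assumes "d \<in> mon_deg q n" "e \<in> mon_deg q m"
  shows "(\<exists>i<5. d = e(i := e i + 2)) \<longleftrightarrow> (\<exists>i<5. reflect q e = (reflect q d)(i := reflect q d i + 2))"
proof -
  have dl: "d i < q" if "i < 5" for i using assms(1) that unfolding mon_deg_def by blast
  have el: "e i < q" if "i < 5" for i using assms(2) that unfolding mon_deg_def by blast
  have d0: "d i = 0" "e i = 0" if "\<not> i < 5" for i using assms that unfolding mon_deg_def by auto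
  have "d = e(i := e i + 2) \<longleftrightarrow> reflect q e = (reflect q d)(i := reflect q d i + 2)" if i: "i < 5" for i
  proof -
    have "d j = (e(i := e i + 2)) j \<longleftrightarrow> reflect q e j = ((reflect q d)(i := reflect q d i + 2)) j" for j
    proof (cases "j < 5")
      case True
      then show ?thesis using dl[OF True] el[OF True] dl[OF i] el[OF i] i unfolding reflect_def by (cases "j = i") auto
    next
      case False
      then show ?thesis using d0 i unfolding reflect_def by auto
    qed
    then show ?thesis unfolding fun_eq_iff by blast
  qed
  then show ?thesis by blast
qed

text \<open>The cokernel of the quadric in degree \<open>n + 2\<close> is dual to the space of
  functionals that vanish on the image. Under the reflection of monomials these functionals become
  the kernel in the complementary degree, since the matrix of the quadric becomes its
  transpose.\<close>

lemma hk_piece_dim_dual: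
  fixes K :: "'k::field itself"
  assumes n: "n + 2 + n' = 5 * (q - 1)"
  shows "hk_piece_dim K q (n + 2) = fs.dim (mult_kernel q n' (sum_squares :: 'k mpoly5))"
proof -
  let ?J = "mon_deg q (n + 2)" and ?I = "mon_deg q n"
  define M where "M e d = (if \<exists>i<5. d = e(i := e i + 2) then 1 else 0 :: 'k)" for e d :: "nat \<Rightarrow> nat"
  have rows: "quad_image q (n + 2) = (\<lambda>e d. if d \<in> ?J then M e d else 0)"
    unfolding quad_image_def M_def by (auto simp: fun_eq_iff)
  let ?c = "\<lambda>d e. if e \<in> ?I then M e d else 0"
  have 1: "fs.dim ((quad_image q (n + 2) :: _ \<Rightarrow> _ \<Rightarrow> 'k) ` ?I) = fs.dim (?c ` ?J)"
    unfolding rows by (rule dim_rows_eq_dim_columns[OF finite_mon_deg finite_mon_deg])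
  define G where "G = {g \<in> fun_on ?J. \<forall>e. (\<Sum>d\<in>?J. g d * ?c d e) = 0}"
  have 2: "card ?J = fs.dim (?c ` ?J) + fs.dim G"
    unfolding G_def by (rule card_eq_rank_plus_kernel[OF finite_mon_deg])
  have hk: "hk_piece_dim K q (n + 2) = fs.dim G"
    unfolding hk_piece_dim_def using 1 2 by simp
  define L where "L g = (\<lambda>x. if x \<in> mon_deg q n' then g (reflect q x) else 0)" for g :: "(nat \<Rightarrow> nat) \<Rightarrow> 'k"
  have L: "Vector_Spaces.linear fun_scale fun_scale L"
    by (rule fun_linearI) (auto simp: L_def fun_eq_iff)
  have sG: "fs.subspace G"
    using subspace_fun_on[of ?J] unfolding G_def fs.subspace_def
    by (auto simp: distrib_right sum.distrib mult.assoc simp flip: sum_distrib_left)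
  have GT: "G \<subseteq> fs.span (delta ` ?J)" using fun_on_span[OF finite_mon_deg] unfolding G_def by blast
  have n1: "n' + (n + 2) = 5 * (q - 1)" and n2: "(n' + 2) + n = 5 * (q - 1)" using n by simp_all
  have key: "(\<Sum>x\<in>mon_deg q n'. g (reflect q x) * quad_image q (n' + 2) x (reflect q e)) = (\<Sum>d\<in>?J. g d * ?c d e)"
    if e: "e \<in> ?I" for g :: "(nat \<Rightarrow> nat) \<Rightarrow> 'k" and e
  proof -
    have re: "reflect q e \<in> mon_deg q (n' + 2)" by (rule reflect_mon_deg(1)[OF e]) (use n in simp)
    have "(\<Sum>x\<in>mon_deg q n'. g (reflect q x) * quad_image q (n' + 2) x (reflect q e))
       = (\<Sum>x\<in>mon_deg q n'. g (reflect q x) * ?c (reflect q x) e)"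
    proof (intro sum.cong refl arg_cong2[of _ _ _ _ "(*)"])
      fix x assume x: "x \<in> mon_deg q n'"
      have rx: "reflect q x \<in> ?J" "reflect q (reflect q x) = x" by (rule reflect_mon_deg[OF x n1])+
      show "quad_image q (n' + 2) x (reflect q e) = ?c (reflect q x) e"
        using reflect_step[OF rx(1) e] e re rx(2) unfolding quad_image_def M_def by simp
    qed
    also have "\<dots> = (\<Sum>d\<in>?J. g d * ?c d e)"
      by (rule sum.reindex_bij_betw[OF bij_reflect[OF n1]])
    finally show ?thesis .
  qed
  have im: "L ` G = mult_kernel q n' sum_squares"
  proof
    show "L ` G \<subseteq> mult_kernel q n' sum_squares"
      unfolding mult_kernel_quad_image
    proof (rule image_subsetI, rule CollectI)
      fix g assume g: "g \<in> G"
      have g0: "(\<Sum>d\<in>?J. g d * ?c d e) = 0" for e using g unfolding G_def by simp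
      have "(\<Sum>x\<in>mon_deg q n'. L g x * quad_image q (n' + 2) x y) = 0" for y
      proof (cases "y \<in> mon_deg q (n' + 2)")
        case True
        have e: "reflect q y \<in> ?I" "reflect q (reflect q y) = y" by (rule reflect_mon_deg[OF True n2])+
        have "(\<Sum>x\<in>mon_deg q n'. L g x * quad_image q (n' + 2) x y)
           = (\<Sum>x\<in>mon_deg q n'. g (reflect q x) * quad_image q (n' + 2) x (reflect q (reflect q y)))"
          unfolding L_def e(2) by (rule sum.cong) simp_all
        also have "\<dots> = (\<Sum>d\<in>?J. g d * ?c d (reflect q y))" by (rule key[OF e(1)])
        also have "\<dots> = 0" by (rule g0)
        finally show ?thesis .
      next
        case False
        then show ?thesis unfolding quad_image_def by simp
      qed
      moreover have "L g \<in> fun_on (mon_deg q n')" unfolding L_def fun_on_def by simp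
      ultimately show "L g \<in> fun_on (mon_deg q n') \<and> (\<forall>y. (\<Sum>x\<in>mon_deg q n'. L g x * quad_image q (n' + 2) x y) = 0)"
        by blast
    qed
    show "mult_kernel q n' sum_squares \<subseteq> L ` G"
      unfolding mult_kernel_quad_image
    proof
      fix f assume "f \<in> {f \<in> fun_on (mon_deg q n'). \<forall>y. (\<Sum>x\<in>mon_deg q n'. f x * (quad_image q (n' + 2) x y :: 'k)) = 0}"
      then have f: "f \<in> fun_on (mon_deg q n')" "\<And>y. (\<Sum>x\<in>mon_deg q n'. f x * (quad_image q (n' + 2) x y :: 'k)) = 0"
        by simp_all
      define g where "g = (\<lambda>d. if d \<in> ?J then f (reflect q d) else 0)"
      have gr: "g (reflect q x) = f x" if "x \<in> mon_deg q n'" for x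
        using reflect_mon_deg[OF that n1] unfolding g_def by simp
      have "(\<Sum>d\<in>?J. g d * ?c d e) = 0" for e
      proof (cases "e \<in> ?I")
        case True
        have "(\<Sum>x\<in>mon_deg q n'. g (reflect q x) * quad_image q (n' + 2) x (reflect q e)) = 0"
          using f(2)[of "reflect q e"] by (simp add: gr)
        then show ?thesis unfolding key[OF True] .
      qed simp
      moreover have "g \<in> fun_on ?J" unfolding g_def fun_on_def by simp
      ultimately have "g \<in> G" unfolding G_def by blast
      moreover have "L g = f"
      proof
        fix x show "L g x = f x" using f(1) gr[of x] unfolding L_def fun_on_def by auto
      qed
      ultimately show "f \<in> L ` G" by blast
    qed
  qed
  have "fs.dim (L ` G) = fs.dim G"
  proof (rule fsp.dim_image_inj_on[OF L sG _ GT])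
    show "finite (delta ` ?J :: ((nat \<Rightarrow> nat) \<Rightarrow> 'k) set)" by (simp add: finite_mon_deg)
    fix g assume g: "g \<in> G" "L g = 0"
    show "g = 0"
    proof
      fix d
      show "g d = 0 d"
      proof (cases "d \<in> ?J")
        case True
        have r: "reflect q d \<in> mon_deg q n'" "reflect q (reflect q d) = d" by (rule reflect_mon_deg[OF True n])+
        have "L g (reflect q d) = 0" using g(2) by simp
        then show ?thesis using r unfolding L_def by simp
      next
        case False
        then show ?thesis using g(1) unfolding G_def fun_on_def by auto
      qed
    qed
  qed
  then show ?thesis unfolding hk im by simp
qed

section \<open>Splitting the kernel into strings\<close>

global_interpretation pfp: vector_space_pair "smult :: 'k::field \<Rightarrow> 'k poly \<Rightarrow> 'k poly" "fun_scale :: 'k \<Rightarrow> ('a \<Rightarrow> 'k) \<Rightarrow> 'a \<Rightarrow> 'k"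
  by unfold_locales

definition box_points :: "nat \<Rightarrow> nat \<Rightarrow> nat \<Rightarrow> nat \<Rightarrow> (nat \<times> nat \<times> nat) set" where
  "box_points a b c t = {(x, y, z). x < a \<and> y < b \<and> z < c \<and> x + y + z = t}"

text \<open>The degree-t part of the kernel of X + Y + Z on k[X,Y,Z]/(X^a, Y^b, Z^c).\<close>
definition box_kernel :: "nat \<Rightarrow> nat \<Rightarrow> nat \<Rightarrow> nat \<Rightarrow> (nat \<times> nat \<times> nat \<Rightarrow> 'k::field) set" where
  "box_kernel a b c t = {G \<in> fun_on (box_points a b c t). \<forall>x y z. (x, y, z) \<in> box_points a b c (Suc t) \<longrightarrow>
     (if 0 < x then G (x - 1, y, z) else 0) + (if 0 < y then G (x, y - 1, z) else 0)
       + (if 0 < z then G (x, y, z - 1) else 0) = 0}"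

lemma coeff_X1_power_Suc:
  "coeff ([:1,1:] ^ Suc k * f) x = coeff ([:1,1:] ^ k * f) x + (if 0 < x then coeff ([:1,1:] ^ k * f) (x - 1) else (0 :: 'k::field))"
proof -
  have X1: "[:1,1:] * g = g + pCons 0 g" for g :: "'k poly" by simp
  have "[:1,1:] ^ Suc k * f = [:1,1:] ^ k * f + pCons 0 ([:1,1:] ^ k * f)"
    unfolding power_Suc unfolding mult.assoc unfolding X1 ..
  then show ?thesis by (cases x) (simp_all only: coeff_add coeff_pCons_0 coeff_pCons_Suc, simp_all)
qed

lemma coeff_X1_power_beyond:
  assumes "\<And>i. coeff f i \<noteq> 0 \<Longrightarrow> i \<le> d" "x > k + d"
  shows "coeff ([:1,1:] ^ k * f :: 'k::field poly) x = 0"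
proof (rule coeff_eq_0)
  have "degree f \<le> d" by (rule degree_le) (use assms(1) in force)
  then have "k + degree f < x" using assms(2) by simp
  moreover have "degree ([:1,1:] ^ k * f) \<le> k + degree f"
    using degree_mult_le[of "[:1,1:] ^ k" f] by (simp only: degree_linear_power)
  ultimately show "degree ([:1,1:] ^ k * f) < x" by simp
qed

text \<open>If \<open>G_z\<close> is the coefficient of \<open>Z^z\<close> in an element killed by
  \<open>X + Y + Z\<close>, then \<open>G_(z-1) = - (X+Y) G_z\<close>. So everything is determined
  by the top coefficient \<open>G_(c-1)\<close>, which is \<open>f\<close> up to the sign
  \<open>(-1)^(c-1)\<close>, and the remaining condition at \<open>z = 0\<close> is
  \<open>(X+Y)^c f = 0\<close>.\<close>

definition box_of_string :: "nat \<Rightarrow> nat \<Rightarrow> nat \<Rightarrow> nat \<Rightarrow> 'k::field poly \<Rightarrow> nat \<times> nat \<times> nat \<Rightarrow> 'k" where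
  "box_of_string a b c t f = (\<lambda>(x, y, z). if (x, y, z) \<in> box_points a b c t
     then (- 1) ^ z * coeff ([:1,1:] ^ (c - 1 - z) * f) x else 0)"

lemma box_of_string_in_kernel:
  assumes f: "f \<in> string_space a b c (Suc t)" and c: "c \<ge> 1"
  shows "box_of_string a b c t f \<in> box_kernel a b c t"
proof -
  have supp: "c \<le> Suc t \<and> i \<le> Suc t - c" if "coeff f i \<noteq> 0" for i
    using f that unfolding string_space_def by blast
  have "(if 0 < x then box_of_string a b c t f (x - 1, y, z) else 0) + (if 0 < y then box_of_string a b c t f (x, y - 1, z) else 0)
       + (if 0 < z then box_of_string a b c t f (x, y, z - 1) else 0) = 0"
    if xyz: "(x, y, z) \<in> box_points a b c (Suc t)" for x y z
  proof -
    have b: "x < a" "y < b" "z < c" "x + y + z = Suc t" using xyz unfolding box_points_def by auto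
    define k where "k = c - 1 - z"
    define R where "R k = [:1,1:] ^ k * f" for k
    have 1: "(if 0 < x then box_of_string a b c t f (x - 1, y, z) else 0) = (- 1) ^ z * (if 0 < x then coeff (R k) (x - 1) else 0)"
      using b unfolding box_of_string_def box_points_def k_def R_def by auto
    \<comment> \<open>On the face \<open>y = 0\<close> the term with \<open>y - 1\<close> is absent;
      correspondingly the coefficient would belong to a negative power of \<open>Y\<close> and is
      zero by degree.\<close>
    have beyond: "coeff (R k) x = 0" if "y = 0"
      unfolding R_def
    proof (cases "f = 0")
      case False
      then have "coeff f (degree f) \<noteq> 0" by simp
      then have ct: "c \<le> Suc t" using supp by blast
      show "coeff ([:1,1:] ^ k * f) x = 0"
        by (rule coeff_X1_power_beyond[where d = "Suc t - c"]) (use supp ct b that in \<open>auto simp: k_def\<close>)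
    qed simp
    have 2: "(if 0 < y then box_of_string a b c t f (x, y - 1, z) else 0) = (- 1) ^ z * coeff (R k) x"
    proof (cases "0 < y")
      case True
      then show ?thesis using b unfolding box_of_string_def box_points_def k_def R_def by auto
    next
      case False
      then show ?thesis using beyond by simp
    qed
    have S: "coeff (R (Suc k)) x = coeff (R k) x + (if 0 < x then coeff (R k) (x - 1) else 0)"
      unfolding R_def by (rule coeff_X1_power_Suc)
    have 3: "(if 0 < z then box_of_string a b c t f (x, y, z - 1) else 0) = - ((- 1) ^ z * coeff (R (Suc k)) x)"
    proof (cases z)
      case 0
      have "coeff ([:1,1:] ^ c * f) x = 0"
        using f b 0 unfolding string_space_def by auto
      moreover have "Suc k = c" using 0 c unfolding k_def by simp
      ultimately show ?thesis using 0 unfolding R_def by simp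
    next
      case (Suc z')
      have "c - 1 - z' = Suc k" using b(3) Suc unfolding k_def by simp
      then show ?thesis using b Suc unfolding box_of_string_def box_points_def R_def by simp
    qed
    show ?thesis unfolding 1 2 3 S by (simp add: algebra_simps)
  qed
  moreover have "box_of_string a b c t f \<in> fun_on (box_points a b c t)"
    unfolding fun_on_def box_of_string_def by auto
  ultimately show ?thesis unfolding box_kernel_def by blast
qed

lemma box_kernel_from_string:
  assumes G: "G \<in> box_kernel a b c t" and c: "c \<ge> 1"
  shows "\<exists>f \<in> string_space a b c (Suc t). box_of_string a b c t f = (G :: nat \<times> nat \<times> nat \<Rightarrow> 'k::field)"
proof -
  define d where "d = Suc t - c"
  define s :: 'k where "s = (- 1) ^ (c - 1)"
  have ss: "s * s = 1" unfolding s_def by (simp flip: power_mult_distrib)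
  define f where "f = (\<Sum>i\<le>t. monom (if c \<le> Suc t \<and> i \<le> d then s * G (i, d - i, c - 1) else 0) i)"
  have cf: "coeff f i = (if c \<le> Suc t \<and> i \<le> d then s * G (i, d - i, c - 1) else 0)" for i
  proof -
    have "coeff f i = (if i \<le> t then (if c \<le> Suc t \<and> i \<le> d then s * G (i, d - i, c - 1) else 0) else 0)"
      unfolding f_def by (simp add: coeff_sum)
    then show ?thesis using c unfolding d_def by auto
  qed
  have G0: "G (x, y, z) = 0" if "(x, y, z) \<notin> box_points a b c t" for x y z
    using G that unfolding box_kernel_def fun_on_def by blast
  have Gk: "(if 0 < x then G (x - 1, y, z) else 0) + (if 0 < y then G (x, y - 1, z) else 0)
       + (if 0 < z then G (x, y, z - 1) else 0) = 0" if "(x, y, z) \<in> box_points a b c (Suc t)" for x y z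
    using G that unfolding box_kernel_def by blast
  define R where "R k = [:1,1:] ^ k * f" for k
  have S: "coeff (R (Suc k)) x = coeff (R k) x + (if 0 < x then coeff (R k) (x - 1) else 0)" for k x
    unfolding R_def by (rule coeff_X1_power_Suc)
  have beyond: "coeff (R k) x = 0" if "x + c > k + Suc t" for k x
  proof (cases "c \<le> Suc t")
    case True
    show ?thesis unfolding R_def
      by (rule coeff_X1_power_beyond[where d = d]) (use True that cf in \<open>auto simp: d_def split: if_splits\<close>)
  next
    case False
    then have "f = 0" by (intro poly_eqI) (simp add: cf)
    then show ?thesis unfolding R_def by simp
  qed
  \<comment> \<open>Descent from the top power of \<open>Z\<close>: \<open>k = c - 1 - z\<close>
    counts the applications of \<open>X + Y\<close>.\<close>
  have claim: "G (x, y, z) = (- 1) ^ z * coeff (R k) x"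
    if "z + k + 1 = c" "x < a" "y < b" "x + y + z = t" for x y z k
    using that
  proof (induction k arbitrary: x y z)
    case 0
    have h: "c \<le> Suc t" "x \<le> d" "d - x = y" "c - 1 = z" using 0 unfolding d_def by auto
    have "coeff (R 0) x = s * G (x, y, z)" using h cf[of x] unfolding R_def by simp
    moreover have "(- 1) ^ z = s" unfolding s_def h(4) ..
    ultimately show ?case using ss by (simp add: mult.assoc[symmetric])
  next
    case (Suc k)
    have "(x, y, Suc z) \<in> box_points a b c (Suc t)" using Suc.prems unfolding box_points_def by simp
    from Gk[OF this] have g: "(if 0 < x then G (x - 1, y, Suc z) else 0) + (if 0 < y then G (x, y - 1, Suc z) else 0) + G (x, y, z) = 0"
      by simp
    have 1: "(if 0 < x then G (x - 1, y, Suc z) else 0) = - ((- 1) ^ z * (if 0 < x then coeff (R k) (x - 1) else 0))"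
      using Suc.IH[of "Suc z" "x - 1" y] Suc.prems by auto
    have 2: "(if 0 < y then G (x, y - 1, Suc z) else 0) = - ((- 1) ^ z * coeff (R k) x)"
    proof (cases "0 < y")
      case True
      then show ?thesis using Suc.IH[of "Suc z" x "y - 1"] Suc.prems by auto
    next
      case False
      then have "coeff (R k) x = 0" using Suc.prems by (intro beyond) auto
      then show ?thesis using False by simp
    qed
    have "G (x, y, z) = (- 1) ^ z * (if 0 < x then coeff (R k) (x - 1) else 0) + (- 1) ^ z * coeff (R k) x"
    proof -
      have "Z = X + Y" if "- X + - Y + Z = 0" for X Y Z :: 'k
      proof -
        have "Z = (X + Y) + (- X + - Y + Z)" by (simp add: algebra_simps)
        then show ?thesis unfolding that by simp
      qed
      from this[OF g[unfolded 1 2]] show ?thesis .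
    qed
    then show ?case unfolding S by (simp only: distrib_left add.commute)
  qed
  have "f \<in> string_space a b c (Suc t)"
  proof -
    have "c \<le> Suc t \<and> i \<le> Suc t - c \<and> i < a \<and> Suc t - c - i < b" if n: "coeff f i \<noteq> 0" for i
    proof -
      have h: "c \<le> Suc t" "i \<le> d" "G (i, d - i, c - 1) \<noteq> 0" using n cf[of i] by (auto split: if_splits)
      then have "(i, d - i, c - 1) \<in> box_points a b c t" using G0 by blast
      then show ?thesis using h unfolding box_points_def d_def by auto
    qed
    moreover have "coeff ([:1,1:] ^ c * f) x = 0" if x: "x < a" "x \<le> Suc t" "Suc t - x < b" for x
    proof -
      define y where "y = Suc t - x"
      have y: "y < b" "x + y = Suc t" using x unfolding y_def by auto
      have "(x, y, 0) \<in> box_points a b c (Suc t)" using x y c unfolding box_points_def by simp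
      from Gk[OF this] have g: "(if 0 < x then G (x - 1, y, 0) else 0) + (if 0 < y then G (x, y - 1, 0) else 0) = 0" by simp
      have 1: "(if 0 < x then G (x - 1, y, 0) else 0) = (if 0 < x then coeff (R (c - 1)) (x - 1) else 0)"
        using claim[of 0 "c - 1" "x - 1" y] x y c by auto
      have 2: "(if 0 < y then G (x, y - 1, 0) else 0) = coeff (R (c - 1)) x"
      proof (cases "0 < y")
        case True
        then show ?thesis using claim[of 0 "c - 1" x "y - 1"] x y c by auto
      next
        case False
        then have "coeff (R (c - 1)) x = 0" using y c by (intro beyond) auto
        then show ?thesis using False by simp
      qed
      have "coeff (R (Suc (c - 1))) x = 0" unfolding S using g unfolding 1 2 by (simp only: add.commute)
      then show ?thesis using c unfolding R_def by simp
    qed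
    ultimately show ?thesis unfolding string_space_def by blast
  qed
  moreover have "box_of_string a b c t f = G"
  proof (rule ext)
    fix v :: "nat \<times> nat \<times> nat"
    obtain x y z where v: "v = (x, y, z)" by (cases v) auto
    show "box_of_string a b c t f v = G v"
    proof (cases "(x, y, z) \<in> box_points a b c t")
      case True
      then have b: "x < a" "y < b" "z < c" "x + y + z = t" unfolding box_points_def by auto
      have "G (x, y, z) = (- 1) ^ z * coeff (R (c - 1 - z)) x" by (rule claim) (use b in auto)
      then show ?thesis using True unfolding v box_of_string_def R_def by simp
    next
      case False
      then show ?thesis using G0 unfolding v box_of_string_def by simp
    qed
  qed
  ultimately show ?thesis by blast
qed

lemma subspace_string_space: "ps.subspace (string_space a b c e :: 'k::field poly set)"
proof (rule ps.subspaceI)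
  define P where "P i \<longleftrightarrow> c \<le> e \<and> i \<le> e - c \<and> i < a \<and> e - c - i < b" for i
  define W where "W i \<longleftrightarrow> i < a \<and> i \<le> e \<and> e - i < b" for i
  have S: "x \<in> string_space a b c e \<longleftrightarrow> (\<forall>i. \<not> P i \<longrightarrow> coeff x i = 0) \<and> (\<forall>i. W i \<longrightarrow> coeff ([:1,1:] ^ c * x) i = 0)"
    for x :: "'k poly" unfolding string_space_def P_def W_def by blast
  show "(0 :: 'k poly) \<in> string_space a b c e" unfolding S by simp
  show "x + y \<in> string_space a b c e" if "x \<in> string_space a b c e" "y \<in> string_space a b c e" for x y :: "'k poly"
    using that unfolding S distrib_left coeff_add by simp
  show "smult k x \<in> string_space a b c e" if "x \<in> string_space a b c e" for k and x :: "'k poly"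
    using that unfolding S mult_smult_right coeff_smult by simp
qed

lemma dim_box_kernel:
  assumes c: "c \<ge> 1"
  shows "fs.dim (box_kernel a b c t :: (nat \<times> nat \<times> nat \<Rightarrow> 'k::field) set) = ps.dim (string_space a b c (Suc t) :: 'k poly set)"
proof -
  let ?L = "box_of_string a b c t :: 'k poly \<Rightarrow> _"
  have L: "Vector_Spaces.linear smult fun_scale ?L"
    unfolding Vector_Spaces.linear_iff
  proof (intro conjI allI)
    show "vector_space (fun_scale :: 'k \<Rightarrow> (nat \<times> nat \<times> nat \<Rightarrow> 'k) \<Rightarrow> _)" by (rule fs.vector_space_axioms)
    show "vector_space (smult :: 'k \<Rightarrow> _)" by (rule ps.vector_space_axioms)
    show "?L (x + y) = ?L x + ?L y" for x y
      unfolding box_of_string_def by (auto simp: fun_eq_iff distrib_left)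
    show "?L (smult k x) = fun_scale k (?L x)" for k x
      unfolding box_of_string_def by (auto simp: fun_eq_iff)
  qed
  have im: "?L ` string_space a b c (Suc t) = box_kernel a b c t"
  proof
    show "?L ` string_space a b c (Suc t) \<subseteq> box_kernel a b c t"
      by (rule image_subsetI) (rule box_of_string_in_kernel[OF _ c])
    show "box_kernel a b c t \<subseteq> ?L ` string_space a b c (Suc t)"
    proof
      fix G :: "nat \<times> nat \<times> nat \<Rightarrow> 'k" assume "G \<in> box_kernel a b c t"
      from box_kernel_from_string[OF this c] obtain f where f: "f \<in> string_space a b c (Suc t)" "?L f = G"
        by (elim bexE)
      show "G \<in> ?L ` string_space a b c (Suc t)" unfolding f(2)[symmetric] by (rule imageI[OF f(1)])
    qed
  qed
  have "fs.dim (?L ` string_space a b c (Suc t)) = ps.dim (string_space a b c (Suc t) :: 'k poly set)"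
  proof (rule pfp.dim_image_inj_on[OF L subspace_string_space])
    show "finite (monom (1::'k) ` {..Suc t})" by simp
    show "string_space a b c (Suc t) \<subseteq> ps.span (monom (1::'k) ` {..Suc t})"
      by (rule order_trans[OF string_space_subset syz_space_finite_span])
    fix f :: "'k poly" assume f: "f \<in> string_space a b c (Suc t)" "?L f = 0"
    show "f = 0"
    proof (rule poly_eqI, rule ccontr)
      fix i assume "coeff f i \<noteq> coeff 0 i"
      then have n: "coeff f i \<noteq> 0" by simp
      have h: "c \<le> Suc t \<and> i \<le> Suc t - c \<and> i < a \<and> Suc t - c - i < b"
        using f(1) n unfolding string_space_def by blast
      then have "(i, Suc t - c - i, c - 1) \<in> box_points a b c t" using c unfolding box_points_def by auto
      then have "?L f (i, Suc t - c - i, c - 1) = (- 1) ^ (c - 1) * coeff f i"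
        unfolding box_of_string_def by simp
      then show False using f(2) n by simp
    qed
  qed
  then show ?thesis unfolding im .
qed

section \<open>The bigrading by differences of exponents\<close>

definition weight :: "(nat \<Rightarrow> nat) \<Rightarrow> int \<times> int" where
  "weight e = (int (e 0) - int (e 1), int (e 2) - int (e 3))"

text \<open>The elements of weight \<open>(j, l)\<close> and parity \<open>\<epsilon>\<close> are
  multiples of one monomial by products of powers of \<open>X = x_0 x_1\<close>,
  \<open>Y = x_2 x_3\<close> and \<open>Z = x_4^2\<close>; the positive and negative parts of
  \<open>j\<close>, \<open>l\<close> give that monomial.\<close>

definition string_exp :: "int \<Rightarrow> int \<Rightarrow> nat \<Rightarrow> nat \<times> nat \<times> nat \<Rightarrow> nat \<Rightarrow> nat" where
  "string_exp j l \<epsilon> = (\<lambda>(x, y, z) i. if i = 0 then x + nat j else if i = 1 then x + nat (- j)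
     else if i = 2 then y + nat l else if i = 3 then y + nat (- l) else if i = 4 then 2 * z + \<epsilon> else 0)"

lemma unit_exp_add_eq_iff:
  assumes "i \<noteq> k"
  shows "unit_exp i + unit_exp k + e = d \<longleftrightarrow> (0 < d i \<and> 0 < d k) \<and> e = d(i := d i - 1, k := d k - 1)"
proof
  assume d: "unit_exp i + unit_exp k + e = d"
  have dx: "d x = (if x = i then 1 else 0) + (if x = k then 1 else 0) + e x" for x
    unfolding d[symmetric] plus_fun_apply unit_exp_def ..
  have "e x = (d(i := d i - 1, k := d k - 1)) x" for x
    using dx[of x] dx[of i] dx[of k] assms by (cases "x = i"; cases "x = k") simp_all
  then have "e = d(i := d i - 1, k := d k - 1)" by (rule ext)
  then show "(0 < d i \<and> 0 < d k) \<and> e = d(i := d i - 1, k := d k - 1)"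
    using dx[of i] dx[of k] by simp
next
  assume h: "(0 < d i \<and> 0 < d k) \<and> e = d(i := d i - 1, k := d k - 1)"
  show "unit_exp i + unit_exp k + e = d"
  proof (rule ext)
    fix x
    have "e x = (d(i := d i - 1, k := d k - 1)) x" using h by simp
    then show "(unit_exp i + unit_exp k + e) x = d x"
      using h assms by (cases "x = i"; cases "x = k") (simp_all add: unit_exp_def)
  qed
qed

lemma double_unit_exp_add_eq_iff:
  "unit_exp i + unit_exp i + e = d \<longleftrightarrow> 2 \<le> d i \<and> e = d(i := d i - 2)"
proof
  assume "unit_exp i + unit_exp i + e = d"
  then have "d = e(i := e i + 2)" unfolding unit_exp_add2 by simp
  then show "2 \<le> d i \<and> e = d(i := d i - 2)" by simp
next
  assume h: "2 \<le> d i \<and> e = d(i := d i - 2)"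
  then have "e i = d i - 2" by simp
  then have ei: "e i + 2 = d i" using h by linarith
  have "e(i := d i) = d" using h by simp
  then have "e(i := e i + 2) = d" unfolding ei .
  then show "unit_exp i + unit_exp i + e = d" unfolding unit_exp_add2 .
qed

lemma lookup_split_quadric:
  assumes F: "F \<in> fun_on (mon_deg q n)"
  shows "lookup (split_quadric * to_mpoly (mon_deg q n) F) d =
    (if 0 < d 0 \<and> 0 < d 1 then F (d(0 := d 0 - 1, 1 := d 1 - 1)) else 0)
    + (if 0 < d 2 \<and> 0 < d 3 then F (d(2 := d 2 - 1, 3 := d 3 - 1)) else 0)
    + (if 2 \<le> d 4 then F (d(4 := d 4 - 2)) else (0::'k::field))"
proof -
  let ?X = "mon_deg q n"
  have one: "(\<Sum>e\<in>?X. F e * (if u + e = d then 1 else 0)) = (if P then F e0 else 0)"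
    if u: "\<And>e. u + e = d \<longleftrightarrow> P \<and> e = e0" for u e0 and P
  proof -
    have "(\<Sum>e\<in>?X. F e * (if u + e = d then 1 else 0)) = (\<Sum>e\<in>?X. if e = e0 then (if P then F e0 else 0) else 0)"
      unfolding u by (rule sum.cong) auto
    also have "\<dots> = (if e0 \<in> ?X then (if P then F e0 else 0) else 0)" by (simp only: sum.delta[OF finite_mon_deg])
    also have "\<dots> = (if P then F e0 else 0)" using F unfolding fun_on_def by simp
    finally show ?thesis .
  qed
  note u1 = unit_exp_add_eq_iff[of 0 1 _ d, OF zero_neq_one]
  have "(2::nat) \<noteq> 3" by simp
  note u2 = unit_exp_add_eq_iff[OF this, of _ d]
  note u3 = double_unit_exp_add_eq_iff[of 4 _ d]
  have "lookup (split_quadric * single e 1) d =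
      (if unit_exp 0 + unit_exp 1 + e = d then 1 else 0) + (if unit_exp 2 + unit_exp 3 + e = d then 1 else 0)
      + (if unit_exp 4 + unit_exp 4 + e = d then 1 else (0::'k))" for e
    unfolding split_quadric_def var_def distrib_right mult_single lookup_add lookup_single when_def by simp
  then have "lookup (split_quadric * to_mpoly ?X F) d =
     (\<Sum>e\<in>?X. F e * (if unit_exp 0 + unit_exp 1 + e = d then 1 else 0))
     + (\<Sum>e\<in>?X. F e * (if unit_exp 2 + unit_exp 3 + e = d then 1 else 0))
     + (\<Sum>e\<in>?X. F e * (if unit_exp 4 + unit_exp 4 + e = d then 1 else 0))"
    unfolding lookup_mult_to_mpoly by (simp only: distrib_left sum.distrib)
  also have "\<dots> = (if 0 < d 0 \<and> 0 < d 1 then F (d(0 := d 0 - 1, 1 := d 1 - 1)) else 0)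
    + (if 0 < d 2 \<and> 0 < d 3 then F (d(2 := d 2 - 1, 3 := d 3 - 1)) else 0)
    + (if 2 \<le> d 4 then F (d(4 := d 4 - 2)) else 0)"
    by (rule arg_cong2[of _ _ _ _ "(+)", OF arg_cong2[of _ _ _ _ "(+)", OF one[OF u1] one[OF u2]] one[OF u3]])
  finally show ?thesis .
qed

lemma weight_string_exp: "weight (string_exp j l \<epsilon> v) = (j, l)"
  by (cases v) (simp add: weight_def string_exp_def)

lemma nat_abs_less_iff: "x + nat j < q \<and> x + nat (- j) < q \<longleftrightarrow> x < q - nat \<bar>j\<bar>"
proof (cases "0 \<le> j")
  case True
  then have "nat (- j) = 0" "nat \<bar>j\<bar> = nat j" by simp_all
  then show ?thesis unfolding less_diff_conv by auto
next
  case False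
  then have "nat j = 0" "nat \<bar>j\<bar> = nat (- j)" by simp_all
  then show ?thesis unfolding less_diff_conv by auto
qed

lemma nat_add_nat_uminus: "nat j + nat (- j) = nat \<bar>j\<bar>"
  by linarith

lemma string_exp_mem:
  assumes q: "q = 2 * m + 1" and \<epsilon>: "\<epsilon> \<le> 1" and n: "n = nat \<bar>j\<bar> + nat \<bar>l\<bar> + \<epsilon> + 2 * t"
  shows "string_exp j l \<epsilon> v \<in> mon_deg q n \<longleftrightarrow> v \<in> box_points (q - nat \<bar>j\<bar>) (q - nat \<bar>l\<bar>) (m + 1 - \<epsilon>) t"
proof -
  obtain x y z where v: "v = (x, y, z)" by (cases v) auto
  let ?e = "string_exp j l \<epsilon> v"
  have e: "?e 0 = x + nat j" "?e 1 = x + nat (- j)" "?e 2 = y + nat l" "?e 3 = y + nat (- l)" "?e 4 = 2 * z + \<epsilon>"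
    unfolding v string_exp_def by simp_all
  have e5: "\<forall>i\<ge>5. ?e i = 0" unfolding v string_exp_def by simp
  have al: "(\<forall>i<5. ?e i < q) \<longleftrightarrow> ?e 0 < q \<and> ?e 1 < q \<and> ?e 2 < q \<and> ?e 3 < q \<and> ?e 4 < q"
  proof
    assume h: "?e 0 < q \<and> ?e 1 < q \<and> ?e 2 < q \<and> ?e 3 < q \<and> ?e 4 < q"
    show "\<forall>i<5. ?e i < q"
    proof (intro allI impI)
      fix i :: nat assume "i < 5"
      from less_5_cases[OF this] show "?e i < q" using h by (elim disjE) simp_all
    qed
  qed simp
  have sm: "(\<Sum>i<5. ?e i) = 2 * x + nat \<bar>j\<bar> + 2 * y + nat \<bar>l\<bar> + (2 * z + \<epsilon>)"
    unfolding sum_5 e nat_add_nat_uminus[symmetric] by simp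
  note xj = nat_abs_less_iff[of x j q] and yl = nat_abs_less_iff[of y l q]
  \<comment> \<open>The exponent of \<open>x_4\<close> is at most \<open>2 m\<close>, so
    \<open>z\<close> takes \<open>m + 1\<close> values for even and \<open>m\<close> values for odd
    exponents. This is where \<open>c\<close> becomes \<open>(q + 1)/2\<close> or
    \<open>(q - 1)/2\<close>.\<close>
  have zc: "2 * z + \<epsilon> < q \<longleftrightarrow> z < m + 1 - \<epsilon>" using q \<epsilon> by auto
  have "?e \<in> mon_deg q n \<longleftrightarrow> (x + nat j < q \<and> x + nat (- j) < q) \<and> (y + nat l < q \<and> y + nat (- l) < q) \<and> 2 * z + \<epsilon> < q
      \<and> 2 * x + nat \<bar>j\<bar> + 2 * y + nat \<bar>l\<bar> + (2 * z + \<epsilon>) = n"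
    unfolding mon_deg_def mem_Collect_eq al sm e using e5 by blast
  also have "\<dots> \<longleftrightarrow> v \<in> box_points (q - nat \<bar>j\<bar>) (q - nat \<bar>l\<bar>) (m + 1 - \<epsilon>) t"
    unfolding xj yl zc box_points_def v n by auto
  finally show ?thesis .
qed

definition exp_point :: "(nat \<Rightarrow> nat) \<Rightarrow> nat \<times> nat \<times> nat" where
  "exp_point e = (min (e 0) (e 1), min (e 2) (e 3), e 4 div 2)"

lemma exp_point_string_exp: "\<epsilon> \<le> 1 \<Longrightarrow> exp_point (string_exp j l \<epsilon> v) = v"
  by (cases v; cases "j \<ge> 0"; cases "l \<ge> 0") (auto simp: exp_point_def string_exp_def)

lemma string_exp_exp_point:
  assumes \<epsilon>: "\<epsilon> \<le> 1" and n: "n = nat \<bar>j\<bar> + nat \<bar>l\<bar> + \<epsilon> + 2 * t"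
    and e: "e \<in> mon_deg q n" "weight e = (j, l)"
  shows "string_exp j l \<epsilon> (exp_point e) = e"
proof -
  have w: "j = int (e 0) - int (e 1)" "l = int (e 2) - int (e 3)" using e(2) by (simp_all add: weight_def)
  have m2: "x + y = 2 * min x y + nat \<bar>int x - int y\<bar>" for x y :: nat by (cases "x \<le> y") auto
  have "e 0 + e 1 + e 2 + e 3 + e 4 = n" using e(1) unfolding mon_deg_def sum_5 by simp
  then have "2 * min (e 0) (e 1) + 2 * min (e 2) (e 3) + e 4 = \<epsilon> + 2 * t"
    using m2[of "e 0" "e 1"] m2[of "e 2" "e 3"] n unfolding w by linarith
  then have ee: "2 * (min (e 0) (e 1) + min (e 2) (e 3)) + e 4 = \<epsilon> + 2 * t" by (simp only: distrib_left)
  \<comment> \<open>The degree and the weight fix the parity of the exponent of \<open>x_4\<close>,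
    so it has the prescribed remainder \<open>\<epsilon>\<close>.\<close>
  have e4: "2 * (e 4 div 2) + \<epsilon> = e 4"
  proof -
    have ar: "2 * (u div 2) + \<epsilon> = u" if "2 * M + u = \<epsilon> + 2 * t" for M u :: nat
    proof -
      have u: "u = \<epsilon> + (t - M) * 2" using that \<epsilon> by linarith
      have "u div 2 = t - M" unfolding u using \<epsilon> by (subst div_mult_self1) simp_all
      then show ?thesis unfolding u by simp
    qed
    show ?thesis by (rule ar[OF ee])
  qed
  have e5: "e i = 0" if "i \<ge> 5" for i using e(1) that unfolding mon_deg_def by simp
  have mj: "min x y + nat (int x - int y) = x" "min x y + nat (- (int x - int y)) = y" for x y :: nat by auto
  show ?thesis
  proof
    fix i :: nat
    consider "i = 0" | "i = 1" | "i = 2" | "i = 3" | "i = 4" | "i \<ge> 5" by linarith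
    then show "string_exp j l \<epsilon> (exp_point e) i = e i"
      by cases (simp_all add: string_exp_def exp_point_def w mj e4 e5 del: minus_diff_eq)
  qed
qed

text \<open>Within one weight the exponents of \<open>X\<close>, \<open>Y\<close>, \<open>Z\<close>
  are coordinates, and the quadric acts as \<open>X + Y + Z\<close>, because each of its three terms
  preserves the weight and raises one coordinate by one.\<close>

lemma dim_weight_block:
  assumes q: "q = 2 * m + 1" and \<epsilon>: "\<epsilon> \<le> 1" and n: "n = nat \<bar>j\<bar> + nat \<bar>l\<bar> + \<epsilon> + 2 * t"
  shows "fs.dim {F \<in> mult_kernel q n (split_quadric :: 'k::field mpoly5). \<forall>e. F e \<noteq> 0 \<longrightarrow> weight e = (j, l)}
    = fs.dim (box_kernel (q - nat \<bar>j\<bar>) (q - nat \<bar>l\<bar>) (m + 1 - \<epsilon>) t :: (nat \<times> nat \<times> nat \<Rightarrow> 'k) set)"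
proof -
  let ?a = "q - nat \<bar>j\<bar>" and ?b = "q - nat \<bar>l\<bar>" and ?c = "m + 1 - \<epsilon>" and ?E = "string_exp j l \<epsilon>"
  define V where "V = {F \<in> mult_kernel q n (split_quadric :: 'k mpoly5). \<forall>e. F e \<noteq> 0 \<longrightarrow> weight e = (j, l)}"
  define L where "L F = (\<lambda>v. F (?E v))" for F :: "(nat \<Rightarrow> nat) \<Rightarrow> 'k"
  have L: "Vector_Spaces.linear fun_scale fun_scale L"
    by (rule fun_linearI) (auto simp: L_def fun_eq_iff)
  have n2: "n + 2 = nat \<bar>j\<bar> + nat \<bar>l\<bar> + \<epsilon> + 2 * Suc t" using n by simp
  have Vsub: "V \<subseteq> fun_on (mon_deg q n)" unfolding V_def mult_kernel_def by blast
  have sV: "fs.subspace V"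
  proof (rule fs.subspaceI)
    note s = subspace_mult_kernel[of q n "split_quadric :: 'k mpoly5"]
    show "0 \<in> V" unfolding V_def using fs.subspace_0[OF s] by simp
    show "x + y \<in> V" if "x \<in> V" "y \<in> V" for x y
    proof -
      have "x e \<noteq> 0 \<or> y e \<noteq> 0" if "(x + y) e \<noteq> 0" for e using that by auto
      then show ?thesis using fs.subspace_add[OF s] that unfolding V_def by blast
    qed
    show "fun_scale k x \<in> V" if "x \<in> V" for k x
      using fs.subspace_scale[OF s, of x k] that unfolding V_def by simp
  qed
  have cond: "lookup (split_quadric * to_mpoly (mon_deg q n) F) (?E (x, y, z)) =
     (if 0 < x then F (?E (x - 1, y, z)) else 0) + (if 0 < y then F (?E (x, y - 1, z)) else 0)
       + (if 0 < z then F (?E (x, y, z - 1)) else 0)" if F: "F \<in> fun_on (mon_deg q n)" for F x y z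
  proof -
    let ?d = "?E (x, y, z)"
    have d: "?d 0 = x + nat j" "?d 1 = x + nat (- j)" "?d 2 = y + nat l" "?d 3 = y + nat (- l)" "?d 4 = 2 * z + \<epsilon>"
      unfolding string_exp_def by simp_all
    have p: "0 < ?d 0 \<and> 0 < ?d 1 \<longleftrightarrow> 0 < x" "0 < ?d 2 \<and> 0 < ?d 3 \<longleftrightarrow> 0 < y" "2 \<le> ?d 4 \<longleftrightarrow> 0 < z"
      unfolding d using \<epsilon> by auto
    have u: "0 < x \<longrightarrow> ?d(0 := ?d 0 - 1, 1 := ?d 1 - 1) = ?E (x - 1, y, z)"
      "0 < y \<longrightarrow> ?d(2 := ?d 2 - 1, 3 := ?d 3 - 1) = ?E (x, y - 1, z)"
      "0 < z \<longrightarrow> ?d(4 := ?d 4 - 2) = ?E (x, y, z - 1)"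
      unfolding d by (auto simp: string_exp_def fun_eq_iff)
    have i: "(if P then F v else 0) = (if P then F v' else 0)" if "P \<longrightarrow> v = v'" for P v v'
      using that by simp
    show ?thesis unfolding lookup_split_quadric[OF F] p
      by (rule arg_cong2[of _ _ _ _ "(+)", OF arg_cong2[of _ _ _ _ "(+)", OF i[OF u(1)] i[OF u(2)]] i[OF u(3)]])
  qed
  have im: "L ` V = box_kernel ?a ?b ?c t"
  proof
    show "L ` V \<subseteq> box_kernel ?a ?b ?c t"
    proof (rule image_subsetI)
      fix F assume F: "F \<in> V"
      have Ff: "F \<in> fun_on (mon_deg q n)" using F Vsub by blast
      have "L F \<in> fun_on (box_points ?a ?b ?c t)"
        unfolding fun_on_def L_def using Ff string_exp_mem[OF q \<epsilon> n] unfolding fun_on_def by simp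
      moreover have "(if 0 < x then L F (x - 1, y, z) else 0) + (if 0 < y then L F (x, y - 1, z) else 0)
         + (if 0 < z then L F (x, y, z - 1) else 0) = 0" if "(x, y, z) \<in> box_points ?a ?b ?c (Suc t)" for x y z
      proof -
        have "?E (x, y, z) \<in> mon_deg q (n + 2)" using that string_exp_mem[OF q \<epsilon> n2] by simp
        then have "lookup (split_quadric * to_mpoly (mon_deg q n) F) (?E (x, y, z)) = 0"
          using F unfolding V_def mult_kernel_def by blast
        then show ?thesis unfolding cond[OF Ff] L_def .
      qed
      ultimately show "L F \<in> box_kernel ?a ?b ?c t" unfolding box_kernel_def by blast
    qed
    show "box_kernel ?a ?b ?c t \<subseteq> L ` V"
    proof
      fix G :: "nat \<times> nat \<times> nat \<Rightarrow> 'k" assume G: "G \<in> box_kernel ?a ?b ?c t"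
      have G0: "G v = 0" if "v \<notin> box_points ?a ?b ?c t" for v
        using G that unfolding box_kernel_def fun_on_def by blast
      define F where "F e = (if e \<in> mon_deg q n \<and> weight e = (j, l) then G (exp_point e) else 0)" for e
      have FE: "F (?E v) = G v" for v
        using G0[of v] string_exp_mem[OF q \<epsilon> n, of v] unfolding F_def
        by (simp add: weight_string_exp exp_point_string_exp[OF \<epsilon>])
      have Ff: "F \<in> fun_on (mon_deg q n)" unfolding F_def fun_on_def by simp
      have "lookup (split_quadric * to_mpoly (mon_deg q n) F) d = 0" if d: "d \<in> mon_deg q (n + 2)" for d
      proof (cases "weight d = (j, l)")
        case True
        obtain x y z where v: "exp_point d = (x, y, z)" by (cases "exp_point d") auto
        have dE: "?E (x, y, z) = d" using string_exp_exp_point[OF \<epsilon> n2 d True] unfolding v .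
        then have "(x, y, z) \<in> box_points ?a ?b ?c (Suc t)" using d string_exp_mem[OF q \<epsilon> n2, of "(x, y, z)"] by simp
        then have "(if 0 < x then G (x - 1, y, z) else 0) + (if 0 < y then G (x, y - 1, z) else 0)
         + (if 0 < z then G (x, y, z - 1) else 0) = 0" using G unfolding box_kernel_def by blast
        then show ?thesis unfolding dE[symmetric] cond[OF Ff] FE .
      next
        case False
        have z: "F e = 0" if "weight e \<noteq> (j, l)" for e using that unfolding F_def by simp
        have w: "0 < d 0 \<and> 0 < d 1 \<Longrightarrow> weight (d(0 := d 0 - 1, 1 := d 1 - 1)) = weight d"
          "0 < d 2 \<and> 0 < d 3 \<Longrightarrow> weight (d(2 := d 2 - 1, 3 := d 3 - 1)) = weight d"
          "weight (d(4 := d 4 - 2)) = weight d"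
          unfolding weight_def by (auto simp: of_nat_diff)
        show ?thesis unfolding lookup_split_quadric[OF Ff] using w z False by simp
      qed
      then have "F \<in> mult_kernel q n split_quadric" unfolding mult_kernel_def using Ff by blast
      moreover have "\<forall>e. F e \<noteq> 0 \<longrightarrow> weight e = (j, l)" unfolding F_def by simp
      ultimately have FV: "F \<in> V" unfolding V_def by blast
      have GL: "L F = G" unfolding L_def FE ..
      show "G \<in> L ` V" unfolding GL[symmetric] by (rule imageI[OF FV])
    qed
  qed
  have "fs.dim (L ` V) = fs.dim V"
  proof (rule fsp.dim_image_inj_on[OF L sV])
    show "finite (delta ` mon_deg q n :: ((nat \<Rightarrow> nat) \<Rightarrow> 'k) set)" by (simp add: finite_mon_deg)
    show "V \<subseteq> fs.span (delta ` mon_deg q n)" by (rule order_trans[OF Vsub fun_on_span[OF finite_mon_deg]])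
    fix F assume F: "F \<in> V" "L F = 0"
    show "F = 0"
    proof (rule ext, rule ccontr)
      fix e assume ne: "F e \<noteq> 0 e"
      then have "F e \<noteq> 0" by simp
      then have e: "e \<in> mon_deg q n" "weight e = (j, l)"
        using F(1) Vsub unfolding fun_on_def V_def by blast+
      have "F (?E (exp_point e)) = 0" using fun_cong[OF F(2), of "exp_point e"] unfolding L_def by simp
      then show False using string_exp_exp_point[OF \<epsilon> n e] \<open>F e \<noteq> 0\<close> by simp
    qed
  qed
  then have "fs.dim V = fs.dim (box_kernel ?a ?b ?c t :: (nat \<times> nat \<times> nat \<Rightarrow> 'k) set)" unfolding im by (rule sym)
  then show ?thesis unfolding V_def .
qed

theorem dim_mult_kernel_split_quadric:
  assumes q: "q = 2 * m + 1" and m: "m \<ge> 1"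
  shows "fs.dim (mult_kernel q n (split_quadric :: 'k::field mpoly5)) =
    (\<Sum>(j, l)\<in>{- int q<..<int q} \<times> {- int q<..<int q}. if nat \<bar>j\<bar> + nat \<bar>l\<bar> \<le> n
      then ps.dim (string_space (q - nat \<bar>j\<bar>) (q - nat \<bar>l\<bar>) (m + 1 - (n - nat \<bar>j\<bar> - nat \<bar>l\<bar>) mod 2)
         (Suc ((n - nat \<bar>j\<bar> - nat \<bar>l\<bar>) div 2)) :: 'k poly set) else 0)"
proof -
  let ?V = "mult_kernel q n (split_quadric :: 'k mpoly5)"
  let ?I = "{- int q<..<int q} \<times> {- int q<..<int q}"
  have Vsub: "?V \<subseteq> fun_on (mon_deg q n)" unfolding mult_kernel_def by blast
  have wI: "weight e \<in> ?I" if "e \<in> mon_deg q n" for e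
  proof -
    have "e i < q" if "i < 5" for i using \<open>e \<in> mon_deg q n\<close> that unfolding mon_deg_def by blast
    from this[of 0] this[of 1] this[of 2] this[of 3] show ?thesis unfolding weight_def by simp
  qed
  have closed: "(\<lambda>x. if weight x = i then F x else 0) \<in> ?V" if F: "F \<in> ?V" for F i
  proof -
    let ?F = "\<lambda>x. if weight x = i then F x else 0"
    have Ff: "F \<in> fun_on (mon_deg q n)" using F Vsub by blast
    then have Ff': "?F \<in> fun_on (mon_deg q n)" unfolding fun_on_def by simp
    have "lookup (split_quadric * to_mpoly (mon_deg q n) ?F) d = 0" if d: "d \<in> mon_deg q (n + 2)" for d
    proof -
      have w: "0 < d 0 \<and> 0 < d 1 \<Longrightarrow> weight (d(0 := d 0 - 1, 1 := d 1 - 1)) = weight d"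
          "0 < d 2 \<and> 0 < d 3 \<Longrightarrow> weight (d(2 := d 2 - 1, 3 := d 3 - 1)) = weight d"
          "weight (d(4 := d 4 - 2)) = weight d"
          unfolding weight_def by (auto simp: of_nat_diff)
      have "lookup (split_quadric * to_mpoly (mon_deg q n) F) d = 0" using F d unfolding mult_kernel_def by blast
      then have z: "(if 0 < d 0 \<and> 0 < d 1 then F (d(0 := d 0 - 1, 1 := d 1 - 1)) else 0)
         + (if 0 < d 2 \<and> 0 < d 3 then F (d(2 := d 2 - 1, 3 := d 3 - 1)) else 0)
         + (if 2 \<le> d 4 then F (d(4 := d 4 - 2)) else 0) = 0" unfolding lookup_split_quadric[OF Ff] .
      show ?thesis
      proof (cases "weight d = i")
        case True
        have "lookup (split_quadric * to_mpoly (mon_deg q n) ?F) d =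
            (if 0 < d 0 \<and> 0 < d 1 then F (d(0 := d 0 - 1, 1 := d 1 - 1)) else 0)
         + (if 0 < d 2 \<and> 0 < d 3 then F (d(2 := d 2 - 1, 3 := d 3 - 1)) else 0)
         + (if 2 \<le> d 4 then F (d(4 := d 4 - 2)) else 0)"
          unfolding lookup_split_quadric[OF Ff'] using w True by simp
        then show ?thesis unfolding z .
      next
        case False
        then show ?thesis unfolding lookup_split_quadric[OF Ff'] using w by simp
      qed
    qed
    then show ?thesis unfolding mult_kernel_def using Ff' by blast
  qed
  have all: "{F \<in> ?V. \<forall>e. F e \<noteq> 0 \<longrightarrow> weight e \<in> ?I} = ?V"
    using Vsub wI unfolding fun_on_def by blast
  have "fs.dim {F \<in> ?V. \<forall>e. F e \<noteq> 0 \<longrightarrow> weight e \<in> ?I} = (\<Sum>i\<in>?I. fs.dim {F \<in> ?V. \<forall>e. F e \<noteq> 0 \<longrightarrow> weight e = i})"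
  proof (rule dim_sum_blocks[OF subspace_mult_kernel Vsub finite_mon_deg])
    show "finite ?I" by simp
    show "(\<lambda>x. if weight x = i then F x else 0) \<in> ?V" if "F \<in> ?V" for F i by (rule closed[OF that])
  qed
  then have "fs.dim ?V = (\<Sum>i\<in>?I. fs.dim {F \<in> ?V. \<forall>e. F e \<noteq> 0 \<longrightarrow> weight e = i})"
    unfolding all .
  also have "\<dots> = (\<Sum>(j, l)\<in>?I. if nat \<bar>j\<bar> + nat \<bar>l\<bar> \<le> n
      then ps.dim (string_space (q - nat \<bar>j\<bar>) (q - nat \<bar>l\<bar>) (m + 1 - (n - nat \<bar>j\<bar> - nat \<bar>l\<bar>) mod 2)
         (Suc ((n - nat \<bar>j\<bar> - nat \<bar>l\<bar>) div 2)) :: 'k poly set) else 0)"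
  proof (rule sum.cong[OF refl])
    fix i assume "i \<in> ?I"
    obtain j l where i: "i = (j, l)" by (cases i) (rule that)
    let ?B = "{F \<in> ?V. \<forall>e. F e \<noteq> 0 \<longrightarrow> weight e = (j, l)}"
    define \<epsilon> t where "\<epsilon> = (n - nat \<bar>j\<bar> - nat \<bar>l\<bar>) mod 2" and "t = (n - nat \<bar>j\<bar> - nat \<bar>l\<bar>) div 2"
    have "fs.dim ?B = (if nat \<bar>j\<bar> + nat \<bar>l\<bar> \<le> n
      then ps.dim (string_space (q - nat \<bar>j\<bar>) (q - nat \<bar>l\<bar>) (m + 1 - \<epsilon>) (Suc t) :: 'k poly set) else 0)"
    proof (cases "nat \<bar>j\<bar> + nat \<bar>l\<bar> \<le> n")
      case True
      have "\<epsilon> < 2" unfolding \<epsilon>_def by (rule mod_less_divisor) simp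
      then have e: "\<epsilon> \<le> 1" by simp
      have "\<epsilon> + 2 * t = n - nat \<bar>j\<bar> - nat \<bar>l\<bar>" unfolding \<epsilon>_def t_def by (rule mod_mult_div_eq)
      then have "n = nat \<bar>j\<bar> + nat \<bar>l\<bar> + \<epsilon> + 2 * t" using True by linarith
      then have "fs.dim ?B = fs.dim (box_kernel (q - nat \<bar>j\<bar>) (q - nat \<bar>l\<bar>) (m + 1 - \<epsilon>) t :: (nat \<times> nat \<times> nat \<Rightarrow> 'k) set)"
        by (rule dim_weight_block[OF q e])
      also have "\<dots> = ps.dim (string_space (q - nat \<bar>j\<bar>) (q - nat \<bar>l\<bar>) (m + 1 - \<epsilon>) (Suc t) :: 'k poly set)"
        by (rule dim_box_kernel) (use e m in linarith)
      finally show ?thesis unfolding if_P[OF True] .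
    next
      case False
      have "?B \<subseteq> {0}"
      proof
        fix F assume F: "F \<in> ?B"
        have "F e = 0" for e
        proof (rule ccontr)
          assume "F e \<noteq> 0"
          then have e: "e \<in> mon_deg q n" "weight e = (j, l)" using F Vsub unfolding fun_on_def by blast+
          have "e 0 + e 1 + e 2 + e 3 + e 4 = n" using e(1) unfolding mon_deg_def sum_5 by simp
          moreover have "j = int (e 0) - int (e 1)" "l = int (e 2) - int (e 3)" using e(2) by (simp_all add: weight_def)
          ultimately show False using False by linarith
        qed
        then show "F \<in> {0}" by (simp add: fun_eq_iff)
      qed
      then have "fs.dim ?B \<le> card ({} :: ((nat \<Rightarrow> nat) \<Rightarrow> 'k) set)"
        by (intro fs.dim_le_card) (simp_all only: fs.span_empty finite.emptyI)
      then show ?thesis unfolding if_not_P[OF False] by simp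
    qed
    then show "fs.dim {F \<in> ?V. \<forall>e. F e \<noteq> 0 \<longrightarrow> weight e = i} = (case i of (j, l) \<Rightarrow> if nat \<bar>j\<bar> + nat \<bar>l\<bar> \<le> n
      then ps.dim (string_space (q - nat \<bar>j\<bar>) (q - nat \<bar>l\<bar>) (m + 1 - (n - nat \<bar>j\<bar> - nat \<bar>l\<bar>) mod 2)
         (Suc ((n - nat \<bar>j\<bar> - nat \<bar>l\<bar>) div 2)) :: 'k poly set) else 0)"
      unfolding i \<epsilon>_def t_def prod.case .
  qed
  finally show ?thesis .
qed

section \<open>Summation over the strings\<close>

text \<open>When one of \<open>a\<close>, \<open>b\<close> is at least the other plus
  \<open>c\<close>, the positive gap leaves enough room for the lowest or the leading coefficient to
  survive multiplication. This is a failed triangle inequality.\<close>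

lemma string_space_trivial_large:
  assumes e: "2 * e < a + b + c" and ab: "a + c \<le> b \<or> b + c \<le> a"
  shows "string_space a b c e \<subseteq> {0 :: 'k::field poly}"
proof
  fix F :: "'k poly" assume F: "F \<in> string_space a b c e"
  have supp: "c \<le> e \<and> i \<le> e - c \<and> i < a \<and> e - c - i < b" if "coeff F i \<noteq> 0" for i
    using F that unfolding string_space_def by blast
  have van: "coeff ([:1,1:] ^ c * F) i = 0" if "i < a" "i \<le> e" "e - i < b" for i
    using F that unfolding string_space_def by blast
  have "F = 0"
  proof (rule ccontr)
    assume F0: "F \<noteq> 0"
    from ab show False
    proof
      assume ba: "a + c \<le> b"
      obtain i where i: "coeff F i \<noteq> 0" "coeff ([:1,1:] ^ c * F) i \<noteq> 0" using exists_common_lowest_coeff[OF F0] by blast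
      have "i < a" "i \<le> e" "e - i < b" using supp[OF i(1)] e ba by linarith+
      from van[OF this] i(2) show False by contradiction
    next
      assume ba: "b + c \<le> a"
      define i where "i = degree F + c"
      have lead: "coeff F (degree F) \<noteq> 0" using F0 by simp
      have "degree ([:1,1:] ^ c * F) = i"
        using F0 by (simp add: degree_mult_eq degree_power_eq i_def)
      moreover have "[:1,1:] ^ c * F \<noteq> 0" using F0 by simp
      ultimately have "coeff ([:1,1:] ^ c * F) i \<noteq> 0" using leading_coeff_neq_0 by metis
      moreover have "i < a" "i \<le> e" "e - i < b" using supp[OF lead] e ba unfolding i_def by linarith+
      ultimately show False using van by blast
    qed
  qed
  then show "F \<in> {0}" by simp
qed

definition string_dim :: "'k::field itself \<Rightarrow> nat \<Rightarrow> nat \<Rightarrow> nat \<Rightarrow> int \<Rightarrow> int \<Rightarrow> nat" where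
  "string_dim K q m n j l = (if nat \<bar>j\<bar> + nat \<bar>l\<bar> \<le> n
     then ps.dim (string_space (q - nat \<bar>j\<bar>) (q - nat \<bar>l\<bar>) (m + 1 - (n - nat \<bar>j\<bar> - nat \<bar>l\<bar>) mod 2)
       (Suc ((n - nat \<bar>j\<bar> - nat \<bar>l\<bar>) div 2)) :: 'k poly set) else 0)"

text \<open>The gap does not depend on \<open>x\<close> and \<open>y\<close>: what
  \<open>a + b\<close> loses is made up by the smaller \<open>e\<close>, and the parity bit in
  \<open>c\<close> corrects the rounding in \<open>div 2\<close>.\<close>

lemma string_params:
  assumes "x < q" "y < q" "x + y \<le> n"
  shows "int (q - x) + int (q - y) + int (m + 1 - (n - x - y) mod 2) - 2 * int (Suc ((n - x - y) div 2)) = 2 * int q + int m - 1 - int n"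
proof -
  define N where "N = n - x - y"
  have "int n = int x + int y + int N" unfolding N_def using assms by simp
  moreover have "int N = 2 * int (N div 2) + int (N mod 2)" using mult_div_mod_eq[of 2 N] by linarith
  moreover have "int (m + 1 - N mod 2) = int m + 1 - int (N mod 2)" by (subst of_nat_diff) auto
  ultimately show ?thesis unfolding N_def[symmetric] using assms by simp
qed

section \<open>Choosing the nearest centre\<close>

text \<open>Levels above \<open>k\<close> contribute nothing positive by \<open>far\<close>. For
  \<open>r \<le> k\<close> two balls that share a point have centres at distance
  \<open>p^r M\<close> with \<open>2 M < P + 1\<close>; as \<open>P\<close> is odd,
  \<open>2 M \<le> P - 1\<close>, and the triangle inequality finishes.\<close>

lemma near_center_dominates:
  fixes j l u v u' v' :: int
  assumes p: "odd p" and near: "2 * (\<bar>j - int p ^ k * u\<bar> + \<bar>l - int p ^ k * v\<bar>) < int p ^ k"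
    and far: "\<And>k' u' v'. k < k' \<Longrightarrow> k' \<le> s \<Longrightarrow> int p ^ k' \<le> 2 * (\<bar>j - int p ^ k' * u'\<bar> + \<bar>l - int p ^ k' * v'\<bar>)"
    and r: "r \<le> s"
  shows "int p ^ r - 2 * (\<bar>j - int p ^ r * u'\<bar> + \<bar>l - int p ^ r * v'\<bar>) \<le> int p ^ k - 2 * (\<bar>j - int p ^ k * u\<bar> + \<bar>l - int p ^ k * v\<bar>)"
proof (cases "int p ^ r \<le> 2 * (\<bar>j - int p ^ r * u'\<bar> + \<bar>l - int p ^ r * v'\<bar>)")
  case True
  then show ?thesis using near by linarith
next
  case False
  have rk: "r \<le> k"
  proof (rule ccontr)
    assume "\<not> r \<le> k"
    then have "k < r" by simp
    from far[OF this r, of u' v'] False show False by contradiction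
  qed
  define P where "P = int p ^ (k - r)"
  define R where "R = int p ^ r"
  have kP: "int p ^ k = R * P" unfolding P_def R_def power_add[symmetric] using rk by simp
  have Podd: "odd P" unfolding P_def using p by simp
  have Rpos: "R > 0" unfolding R_def using odd_pos[OF p] by simp
  define M where "M = \<bar>P * u - u'\<bar> + \<bar>P * v - v'\<bar>"
  define D where "D = \<bar>j - R * P * u\<bar> + \<bar>l - R * P * v\<bar>"
  define d where "d = \<bar>j - R * u'\<bar> + \<bar>l - R * v'\<bar>"
  have h: "R * \<bar>P * w - w'\<bar> = \<bar>R * P * w - R * w'\<bar>" for w w'
  proof -
    have "R * P * w - R * w' = R * (P * w - w')" by (simp add: algebra_simps)
    then show ?thesis using Rpos by (simp add: abs_mult)
  qed
  have RM: "R * M = \<bar>R * P * u - R * u'\<bar> + \<bar>R * P * v - R * v'\<bar>"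
    unfolding M_def distrib_left h ..
  have tri: "\<bar>x - y\<bar> \<le> \<bar>t - x\<bar> + \<bar>t - y\<bar>" "\<bar>t - x\<bar> \<le> \<bar>t - y\<bar> + \<bar>x - y\<bar>" for x y t :: int by linarith+
  have up: "R * M \<le> D + d"
    unfolding RM D_def d_def using tri(1)[of "R * P * u" "R * u'" j] tri(1)[of "R * P * v" "R * v'" l] by linarith
  have low: "D \<le> d + R * M"
    unfolding RM D_def d_def using tri(2)[of j "R * P * u" "R * u'"] tri(2)[of l "R * P * v" "R * v'"] by linarith
  have D: "2 * D < R * P" using near unfolding kP D_def by simp
  have d: "2 * d < R" using False unfolding R_def[symmetric] d_def by simp
  have "2 * (R * M) < R * P + R" using up D d by linarith
  then have "R * (2 * M) < R * (P + 1)" by (simp add: algebra_simps)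
  then have "2 * M < P + 1" using Rpos by simp
  then have "2 * M \<le> P - 1" using Podd by presburger
  then have "R * (2 * M) \<le> R * (P - 1)" using Rpos by (intro mult_left_mono) auto
  then have "2 * (R * M) \<le> R * P - R" by (simp add: algebra_simps)
  then have "R - 2 * d \<le> R * P - 2 * D" using low by linarith
  then show ?thesis unfolding kP R_def[symmetric] D_def d_def .
qed

text \<open>Translates between distances of \<open>q - |j|\<close> and of \<open>j\<close> from
  multiples of \<open>p^r\<close>; both reflections preserve these multiples since
  \<open>p^r\<close> divides \<open>q\<close>.\<close>

lemma reflect_center:
  fixes j R T :: int
  assumes "Q = R * T"
  shows "\<exists>u'. \<bar>j - R * u'\<bar> = \<bar>(Q - \<bar>j\<bar>) - R * w\<bar>"
proof (cases "0 \<le> j")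
  case True
  have "(Q - j) - R * w = - (j - R * (T - w))" unfolding assms by (simp add: algebra_simps)
  then have "\<bar>j - R * (T - w)\<bar> = \<bar>(Q - j) - R * w\<bar>" by (simp only: abs_minus_cancel)
  then show ?thesis using True by auto
next
  case False
  have "(Q + j) - R * w = j - R * (w - T)" unfolding assms by (simp add: algebra_simps)
  then have "\<bar>j - R * (w - T)\<bar> = \<bar>(Q + j) - R * w\<bar>" by (simp only:)
  moreover have "Q - \<bar>j\<bar> = Q + j" using False by simp
  ultimately show ?thesis by auto
qed

lemma quarter_approx:
  fixes S T :: int
  assumes "0 \<le> S" "4 * S \<le> max 0 (T + 5)" "T \<le> 4 * S"
  shows "\<bar>real_of_int S - max 0 (real_of_int T / 4)\<bar> \<le> 2"
proof (cases "0 \<le> T")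
  case True
  then have "4 * S \<le> T + 5" using assms(2) by simp
  then have "real_of_int (4 * S) \<le> real_of_int (T + 5)" by (simp only: of_int_le_iff)
  moreover have "real_of_int T \<le> real_of_int (4 * S)" using assms(3) by (simp only: of_int_le_iff)
  moreover have "max 0 (real_of_int T / 4) = real_of_int T / 4" using True by simp
  ultimately show ?thesis by (simp add: abs_le_iff)
next
  case False
  then have "S \<le> 1" using assms(2) by simp
  moreover have "max 0 (real_of_int T / 4) = 0" using False by simp
  ultimately show ?thesis using assms(1) by simp
qed

text \<open>The hypothesis is tested at the nonzero points with coordinates 0, 1, -1 in the quadrant
  of \<open>(j, l)\<close>. For \<open>a = Q - |j|\<close>, \<open>b = Q - |l|\<close> the result
  says that \<open>a\<close>, \<open>b\<close>, \<open>Q/2\<close> satisfy the triangle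
  inequalities.\<close>

lemma top_level_bounds:
  fixes j l Q :: int
  assumes far: "\<And>u v. Q \<le> 2 * (\<bar>j - Q * u\<bar> + \<bar>l - Q * v\<bar>)" and jl: "\<bar>j\<bar> < Q" "\<bar>l\<bar> < Q"
  shows "2 * \<bar>j\<bar> - 2 * \<bar>l\<bar> \<le> Q" "2 * \<bar>l\<bar> - 2 * \<bar>j\<bar> \<le> Q" "2 * \<bar>j\<bar> + 2 * \<bar>l\<bar> \<le> 3 * Q"
proof -
  have s: "\<bar>x - Q * (if 0 \<le> x then 1 else - 1)\<bar> = Q - \<bar>x\<bar>" if "\<bar>x\<bar> < Q" for x
    using that by (auto simp: abs_if split: if_splits)
  show "2 * \<bar>j\<bar> - 2 * \<bar>l\<bar> \<le> Q" using far[of "if 0 \<le> j then 1 else - 1" 0] unfolding s[OF jl(1)] by simp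
  show "2 * \<bar>l\<bar> - 2 * \<bar>j\<bar> \<le> Q" using far[of 0 "if 0 \<le> l then 1 else - 1"] unfolding s[OF jl(2)] by simp
  show "2 * \<bar>j\<bar> + 2 * \<bar>l\<bar> \<le> 3 * Q"
    using far[of "if 0 \<le> j then 1 else - 1" "if 0 \<le> l then 1 else - 1"] unfolding s[OF jl(1)] s[OF jl(2)] by simp
qed

text \<open>The inequalities for \<open>(j, l)\<close> pass to its centre up to a slack of less than
  one, which the oddness of \<open>P\<close> removes. For \<open>P - |u|\<close> and
  \<open>P - |v|\<close> they are the hypotheses of \<open>dim_string_space_ge\<close>.\<close>

lemma center_bounds:
  fixes j l B P u v :: int
  assumes Q: "Q = B * P" and B: "B > 0" and P: "odd P"
    and far: "\<And>u v. Q \<le> 2 * (\<bar>j - Q * u\<bar> + \<bar>l - Q * v\<bar>)" and jl: "\<bar>j\<bar> < Q" "\<bar>l\<bar> < Q"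
    and near: "2 * (\<bar>j - B * u\<bar> + \<bar>l - B * v\<bar>) < B"
  shows "2 * \<bar>\<bar>u\<bar> - \<bar>v\<bar>\<bar> < P" "2 * (\<bar>u\<bar> + \<bar>v\<bar>) < 3 * P" "\<bar>u\<bar> \<le> P" "\<bar>v\<bar> \<le> P"
proof -
  define U where "U = \<bar>u\<bar>"
  define V where "V = \<bar>v\<bar>"
  have rt: "\<bar>\<bar>x\<bar> - B * \<bar>w\<bar>\<bar> \<le> \<bar>x - B * w\<bar>" for x w
  proof -
    have "B * \<bar>w\<bar> = \<bar>B * w\<bar>" using B by (simp add: abs_mult)
    then show ?thesis using abs_triangle_ineq3[of x "B * w"] by (simp only:)
  qed
  have dbl: "2 * x' + 2 * y' < B" if "x' \<le> x" "y' \<le> y" "2 * (x + y) < B" for x x' y y' :: int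
    using that by simp
  have n: "2 * \<bar>\<bar>j\<bar> - B * U\<bar> + 2 * \<bar>\<bar>l\<bar> - B * V\<bar> < B"
    unfolding U_def V_def by (rule dbl[OF rt[of j u] rt[of l v] near])
  have ab: "2 * b - 2 * d < 2 * a - 2 * c + B" "2 * d - 2 * b < 2 * c - 2 * a + B" "2 * b + 2 * d < 2 * a + 2 * c + B"
    "b < a + B" "d < c + B" if "2 * \<bar>a - b\<bar> + 2 * \<bar>c - d\<bar> < B" for a b c d :: int
    using that by (auto simp: abs_if split: if_splits)
  note n' = ab[OF n]
  note tb = top_level_bounds[OF far jl]
  have c: "x < y" if "B * x < B * y" for x y using that B by simp
  have "2 * (B * U) - 2 * (B * V) < B * P + B" using n'(1) tb(1) unfolding Q by linarith
  then have "B * (2 * (U - V)) < B * (P + 1)" by (simp add: algebra_simps)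
  then have 1: "2 * (U - V) < P + 1" by (rule c)
  have "2 * (B * V) - 2 * (B * U) < B * P + B" using n'(2) tb(2) unfolding Q by linarith
  then have "B * (2 * (V - U)) < B * (P + 1)" by (simp add: algebra_simps)
  then have 2: "2 * (V - U) < P + 1" by (rule c)
  have "2 * (B * U) + 2 * (B * V) < 3 * (B * P) + B" using n'(3) tb(3) unfolding Q by linarith
  then have "B * (2 * (U + V)) < B * (3 * P + 1)" by (simp add: algebra_simps)
  then have 3: "2 * (U + V) < 3 * P + 1" by (rule c)
  have "B * U < B * P + B" using n'(4) jl unfolding Q by linarith
  then have "B * U < B * (P + 1)" by (simp add: algebra_simps)
  then have 4: "U < P + 1" by (rule c)
  have "B * V < B * P + B" using n'(5) jl unfolding Q by linarith
  then have "B * V < B * (P + 1)" by (simp add: algebra_simps)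
  then have 5: "V < P + 1" by (rule c)
  have "2 * (U - V) < P" "2 * (V - U) < P" "2 * (U + V) < 3 * P" using 1 2 3 P by presburger+
  then show "2 * \<bar>\<bar>u\<bar> - \<bar>v\<bar>\<bar> < P" "2 * (\<bar>u\<bar> + \<bar>v\<bar>) < 3 * P" "\<bar>u\<bar> \<le> P" "\<bar>v\<bar> \<le> P"
    unfolding U_def[symmetric] V_def[symmetric] using 4 5 by (simp_all add: abs_if)
qed

text \<open>Above, the chosen centre dominates all others, so \<open>W = p^k + 1 - 2 D\<close> is
  admissible; below, the syzygy at the centre itself is used. If the degree is too small for the
  string to occur, \<open>2 G\<close> exceeds \<open>p^k - 2 D\<close> and both quantities are
  zero.\<close>

lemma string_dim_near:
  fixes K :: "'k::field itself" and j l u v G :: int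
  assumes ch: "CHAR('k) = p" "prime p" "p \<ge> 3" and q: "p ^ s = 2 * m + 1"
    and jl: "\<bar>j\<bar> < int p ^ s" "\<bar>l\<bar> < int p ^ s" and k: "k \<le> s"
    and near: "2 * (\<bar>j - int p ^ k * u\<bar> + \<bar>l - int p ^ k * v\<bar>) < int p ^ k"
    and far: "\<And>k' u' v'. k < k' \<Longrightarrow> k' \<le> s \<Longrightarrow> int p ^ k' \<le> 2 * (\<bar>j - int p ^ k' * u'\<bar> + \<bar>l - int p ^ k' * v'\<bar>)"
    and top: "k = s \<Longrightarrow> u = 0 \<and> v = 0"
    and G: "G = 2 * int p ^ s + int m - 1 - int n" "G \<ge> 1"
  shows "\<bar>real (string_dim K (p ^ s) m n j l)
    - max 0 ((real p ^ k - 2 * real_of_int (\<bar>j - int p ^ k * u\<bar> + \<bar>l - int p ^ k * v\<bar>) - 2 * real_of_int G) / 4)\<bar> \<le> 2"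
proof -
  define D where "D = \<bar>j - int p ^ k * u\<bar> + \<bar>l - int p ^ k * v\<bar>"
  define B where "B = int p ^ k"
  define P where "P = int p ^ (s - k)"
  define Q where "Q = int p ^ s"
  have odd: "odd p" using ch(2,3) primes_dvd_imp_eq[OF two_is_prime_nat ch(2)] by auto
  have Q: "Q = B * P" unfolding Q_def B_def P_def power_add[symmetric] using k by simp
  have nearD: "2 * D < B" unfolding D_def B_def by (rule near)
  have Bpos: "B > 0" unfolding B_def using ch(3) by simp
  have Podd: "odd P" unfolding P_def using odd by simp
  have Ppos: "P > 0" unfolding P_def using ch(3) by simp
  have BQ: "B \<le> Q" unfolding Q using Bpos Ppos by simp
  have Qm: "Q = 2 * int m + 1" unfolding Q_def using arg_cong[OF q, of int] by simp
  have ub: "2 * \<bar>\<bar>u\<bar> - \<bar>v\<bar>\<bar> < P" "2 * (\<bar>u\<bar> + \<bar>v\<bar>) < 3 * P" "\<bar>u\<bar> \<le> P" "\<bar>v\<bar> \<le> P"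
    and sum3: "2 * \<bar>j\<bar> + 2 * \<bar>l\<bar> \<le> 3 * Q"
  proof -
    have "(2 * \<bar>\<bar>u\<bar> - \<bar>v\<bar>\<bar> < P \<and> 2 * (\<bar>u\<bar> + \<bar>v\<bar>) < 3 * P \<and> \<bar>u\<bar> \<le> P \<and> \<bar>v\<bar> \<le> P) \<and> 2 * \<bar>j\<bar> + 2 * \<bar>l\<bar> \<le> 3 * Q"
    proof (cases "k = s")
      case True
      have "2 * (\<bar>j\<bar> + \<bar>l\<bar>) < Q" using near top[OF True] unfolding True Q_def by simp
      then show ?thesis using top[OF True] Ppos Bpos BQ by simp
    next
      case False
      have far': "Q \<le> 2 * (\<bar>j - Q * u\<bar> + \<bar>l - Q * v\<bar>)" for u v
        unfolding Q_def using far[of s u v] False k by simp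
      show ?thesis
        using center_bounds[OF Q Bpos Podd far' jl[folded Q_def] near[folded B_def]] top_level_bounds(3)[OF far' jl[folded Q_def]] by blast
    qed
    then show "2 * \<bar>\<bar>u\<bar> - \<bar>v\<bar>\<bar> < P" "2 * (\<bar>u\<bar> + \<bar>v\<bar>) < 3 * P" "\<bar>u\<bar> \<le> P" "\<bar>v\<bar> \<le> P" "2 * \<bar>j\<bar> + 2 * \<bar>l\<bar> \<le> 3 * Q"
      by blast+
  qed
  define S where "S = int (string_dim K (p ^ s) m n j l)"
  have "4 * S \<le> max 0 ((B - 2 * D - 2 * G) + 5) \<and> B - 2 * D - 2 * G \<le> 4 * S"
  proof (cases "nat \<bar>j\<bar> + nat \<bar>l\<bar> \<le> n")
    case False
    then have S0: "S = 0" unfolding S_def string_dim_def by simp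
    have "int n + 1 \<le> \<bar>j\<bar> + \<bar>l\<bar>" using False by linarith
    moreover have "0 \<le> D" unfolding D_def by simp
    ultimately have "B - 2 * D - 2 * G \<le> 0"
      using sum3 G(1) Qm BQ unfolding Q_def[symmetric] by linarith
    then show ?thesis unfolding S0 by simp
  next
    case True
    define a where "a = p ^ s - nat \<bar>j\<bar>"
    define b where "b = p ^ s - nat \<bar>l\<bar>"
    define c where "c = m + 1 - (n - nat \<bar>j\<bar> - nat \<bar>l\<bar>) mod 2"
    define e where "e = Suc ((n - nat \<bar>j\<bar> - nat \<bar>l\<bar>) div 2)"
    have S: "S = int (ps.dim (string_space a b c e :: 'k poly set))"
      unfolding S_def string_dim_def a_def b_def c_def e_def using True by simp
    have Qi: "int (p ^ s) = Q" unfolding Q_def by simp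
    have lt: "nat \<bar>x\<bar> < p ^ s \<longleftrightarrow> \<bar>x\<bar> < int p ^ s" for x :: int
      using nat_less_iff[of "\<bar>x\<bar>" "p ^ s"] by (simp only: abs_ge_zero of_nat_power simp_thms)
    have xy: "nat \<bar>j\<bar> < p ^ s" "nat \<bar>l\<bar> < p ^ s"
      using jl by (simp_all only: lt)
    have par: "int a + int b + int c - 2 * int e = G"
      using string_params[OF xy True, of m] unfolding a_def b_def c_def e_def G(1) Qi Q_def[symmetric] .
    have ia: "int a = Q - \<bar>j\<bar>" "int b = Q - \<bar>l\<bar>" unfolding a_def b_def using xy Qi by simp_all
    have c: "2 * c + 1 = p ^ s \<or> 2 * c = p ^ s + 1"
    proof -
      have "(n - nat \<bar>j\<bar> - nat \<bar>l\<bar>) mod 2 = 0 \<or> (n - nat \<bar>j\<bar> - nat \<bar>l\<bar>) mod 2 = 1" by presburger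
      then show ?thesis unfolding c_def q by auto
    qed
    have e: "2 * e < a + b + c" using par G(2) by linarith
    have "4 * S \<le> max 0 ((B + 1 - 2 * D) - 2 * (int a + int b + int c - 2 * int e) + 4)"
      unfolding S
    proof (rule dim_string_space_le[OF ch c _ _ e])
      show "a \<le> p ^ s" "b \<le> p ^ s" unfolding a_def b_def by simp_all
      fix r u1 u2 :: nat assume r: "r \<le> s"
      have ir: "int (p ^ r * w) = int p ^ r * int w" for w by simp
      have QT: "Q = int p ^ r * int p ^ (s - r)" unfolding Q_def power_add[symmetric] using r by simp
      obtain u' where u': "\<bar>j - int p ^ r * u'\<bar> = \<bar>(Q - \<bar>j\<bar>) - int p ^ r * int u1\<bar>" using reflect_center[OF QT] by blast
      obtain v' where v': "\<bar>l - int p ^ r * v'\<bar> = \<bar>(Q - \<bar>l\<bar>) - int p ^ r * int u2\<bar>" using reflect_center[OF QT] by blast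
      have "int p ^ r - 2 * (\<bar>j - int p ^ r * u'\<bar> + \<bar>l - int p ^ r * v'\<bar>) \<le> B - 2 * D"
        unfolding B_def D_def by (rule near_center_dominates[OF odd near far r])
      then show "int (p ^ r) + 1 - 2 * \<bar>int a - int (p ^ r * u1)\<bar> - 2 * \<bar>int b - int (p ^ r * u2)\<bar> \<le> B + 1 - 2 * D"
        unfolding u' v' ia ir by simp
    qed
    then have up: "4 * S \<le> max 0 ((B - 2 * D - 2 * G) + 5)" unfolding par by (simp add: algebra_simps)
    define u1 where "u1 = nat (P - \<bar>u\<bar>)"
    define u2 where "u2 = nat (P - \<bar>v\<bar>)"
    have iu: "int u1 = P - \<bar>u\<bar>" "int u2 = P - \<bar>v\<bar>" unfolding u1_def u2_def using ub(3,4) by simp_all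
    have iP: "int (p ^ (s - k)) = P" unfolding P_def by simp
    have ik: "int (p ^ k * w) = B * int w" "int (p ^ k) = B" for w unfolding B_def by simp_all
    have rt: "\<bar>(Q - \<bar>x\<bar>) - B * (P - \<bar>w\<bar>)\<bar> \<le> \<bar>x - B * w\<bar>" for x w
    proof -
      have "(Q - \<bar>x\<bar>) - B * (P - \<bar>w\<bar>) = - (\<bar>x\<bar> - B * \<bar>w\<bar>)" unfolding Q by (simp add: algebra_simps)
      moreover have "B * \<bar>w\<bar> = \<bar>B * w\<bar>" using Bpos by (simp add: abs_mult)
      ultimately show ?thesis using abs_triangle_ineq3[of x "B * w"] by (simp only: abs_minus_cancel)
    qed
    define d where "d = \<bar>int a - int (p ^ k * u1)\<bar> + \<bar>int b - int (p ^ k * u2)\<bar>"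
    have dD: "d \<le> D" unfolding d_def ik ia iu D_def B_def[symmetric] using rt[of j u] rt[of l v] by linarith
    have "int (p ^ k) - 2 * d - 2 * (int a + int b + int c - 2 * int e) \<le> 4 * int (ps.dim (string_space a b c e :: 'k poly set))"
      unfolding d_def
    proof (rule dim_string_space_ge[OF ch c e k refl])
      show "2 * \<bar>int u1 - int u2\<bar> < int (p ^ (s - k))" unfolding iP iu using ub(1) by (simp add: abs_minus_commute)
      have "P < 2 * (int u1 + int u2)" unfolding iu using ub(2) by simp
      then have "int (p ^ (s - k)) < int (2 * (u1 + u2))" unfolding iP by simp
      then show "p ^ (s - k) < 2 * (u1 + u2)" by (simp only: of_nat_less_iff)
      show "2 * (\<bar>int a - int (p ^ k * u1)\<bar> + \<bar>int b - int (p ^ k * u2)\<bar>) < int (p ^ k)"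
        using dD nearD unfolding d_def[symmetric] ik(2) by linarith
    qed
    then have "B - 2 * D - 2 * G \<le> 4 * S" unfolding par ik(2) S using dD by linarith
    with up show ?thesis by blast
  qed
  then have "\<bar>real_of_int S - max 0 (real_of_int (B - 2 * D - 2 * G) / 4)\<bar> \<le> 2"
    by (intro quarter_approx) (simp_all add: S_def)
  then show ?thesis unfolding S_def D_def[symmetric] B_def by simp
qed

text \<open>Near a corner of the square \<open>a + b \<le> c\<close> and thus \<open>e < c\<close>;
  near the middle of a side one of \<open>a\<close>, \<open>b\<close> is at least the other plus
  \<open>c\<close>. Both make the kernel zero.\<close>

lemma string_dim_far:
  fixes K :: "'k::field itself" and j l u v G :: int
  assumes q: "p ^ s = 2 * m + 1" and jl: "\<bar>j\<bar> < int p ^ s" "\<bar>l\<bar> < int p ^ s"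
    and near: "2 * (\<bar>j - int p ^ s * u\<bar> + \<bar>l - int p ^ s * v\<bar>) < int p ^ s" and uv: "u \<noteq> 0 \<or> v \<noteq> 0"
    and G: "2 * int p ^ s + int m - 1 - int n \<ge> 1"
  shows "string_dim K (p ^ s) m n j l = 0"
proof (cases "nat \<bar>j\<bar> + nat \<bar>l\<bar> \<le> n")
  case True
  define Q where "Q = int p ^ s"
  define a where "a = p ^ s - nat \<bar>j\<bar>"
  define b where "b = p ^ s - nat \<bar>l\<bar>"
  define c where "c = m + 1 - (n - nat \<bar>j\<bar> - nat \<bar>l\<bar>) mod 2"
  define e where "e = Suc ((n - nat \<bar>j\<bar> - nat \<bar>l\<bar>) div 2)"
  have Qi: "int (p ^ s) = Q" unfolding Q_def by simp
  have Qm: "Q = 2 * int m + 1" unfolding Qi[symmetric] q by simp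
  have lt: "nat \<bar>x\<bar> < p ^ s \<longleftrightarrow> \<bar>x\<bar> < int p ^ s" for x :: int
      using nat_less_iff[of "\<bar>x\<bar>" "p ^ s"] by (simp only: abs_ge_zero of_nat_power simp_thms)
    have xy: "nat \<bar>j\<bar> < p ^ s" "nat \<bar>l\<bar> < p ^ s"
    using jl by (simp_all only: lt)
  have "int a + int b + int c - 2 * int e = 2 * Q + int m - 1 - int n"
    using string_params[OF xy True, of m] unfolding a_def b_def c_def e_def Qi .
  then have "int a + int b + int c - 2 * int e \<ge> 1" using G unfolding Q_def by (simp only:)
  then have e: "2 * e < a + b + c" by linarith
  have ia: "int a = Q - \<bar>j\<bar>" "int b = Q - \<bar>l\<bar>" unfolding a_def b_def using xy Qi by simp_all
  have cm: "m \<le> c" "c \<le> m + 1"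
  proof -
    have "r mod 2 \<le> 1" for r :: nat by presburger
    then have "m \<le> m + 1 - r mod 2 \<and> m + 1 - r mod 2 \<le> m + 1" for r
      using diff_le_mono2[of "r mod 2" 1 "m + 1"] by simp
    then show "m \<le> c" "c \<le> m + 1" unfolding c_def by blast+
  qed
  have Qpos: "Q > 0" unfolding Qm by simp
  have rt: "\<bar>\<bar>x\<bar> - Q * \<bar>w\<bar>\<bar> \<le> \<bar>x - Q * w\<bar>" for x w
  proof -
    have "Q * \<bar>w\<bar> = \<bar>Q * w\<bar>" using Qpos by (simp add: abs_mult)
    then show ?thesis using abs_triangle_ineq3[of x "Q * w"] by (simp only:)
  qed
  have dbl: "2 * x' + 2 * y' < Q" if "x' \<le> x" "y' \<le> y" "2 * (x + y) < Q" for x x' y y' :: int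
    using that by simp
  have n: "2 * \<bar>\<bar>j\<bar> - Q * \<bar>u\<bar>\<bar> + 2 * \<bar>\<bar>l\<bar> - Q * \<bar>v\<bar>\<bar> < Q"
    by (rule dbl[OF rt[of j u] rt[of l v] near[folded Q_def]])
  define x where "x = \<bar>j\<bar>"
  define y where "y = \<bar>l\<bar>"
  define w where "w = \<bar>u\<bar>"
  define z where "z = \<bar>v\<bar>"
  have wz: "0 \<le> w" "0 \<le> z" "w \<noteq> 0 \<or> z \<noteq> 0" unfolding w_def z_def using uv by simp_all
  have xQ: "x < Q" "y < Q" unfolding x_def y_def Q_def by (rule jl)+
  have ia': "int a = Q - x" "int b = Q - y" unfolding ia x_def y_def by simp_all
  have ab: "2 * b - 2 * a + 2 * d - 2 * c < Q" "2 * b - 2 * a + 2 * c - 2 * d < Q" "2 * a - 2 * b + 2 * d - 2 * c < Q"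
    "2 * b < 2 * a + Q" "2 * d < 2 * c + Q" if "2 * \<bar>a - b\<bar> + 2 * \<bar>c - d\<bar> < Q" for a b c d :: int
    using that by (auto simp: abs_if split: if_splits)
  note n' = ab[OF n[folded x_def y_def w_def z_def]]
  have lt2: "t \<le> 1" if "Q * t < Q * 2" for t
    using that Qpos by simp
  have "w \<le> 1" by (rule lt2) (use n'(4) xQ Qpos in linarith)
  moreover have "z \<le> 1" by (rule lt2) (use n'(5) xQ Qpos in linarith)
  ultimately consider "w = 1" "z = 1" | "w = 1" "z = 0" | "w = 0" "z = 1" using wz by linarith
  then have "e < c \<or> a + c \<le> b \<or> b + c \<le> a"
  proof cases
    case 1
    have "2 * int a + 2 * int b < Q" using n'(1) unfolding 1 ia' mult_1_right right_diff_distrib by linarith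
    then have "a + b \<le> c" using cm Qm by linarith
    then show ?thesis using e by linarith
  next
    case 2
    have "2 * int a + 2 * y < Q" using n'(2) unfolding 2 ia' mult_1_right mult_zero_right right_diff_distrib by linarith
    then have "a + c \<le> b" using cm Qm ia' by linarith
    then show ?thesis by simp
  next
    case 3
    have "2 * int b + 2 * x < Q" using n'(3) unfolding 3 ia' mult_1_right mult_zero_right right_diff_distrib by linarith
    then have "b + c \<le> a" using cm Qm ia' by linarith
    then show ?thesis by simp
  qed
  then have "string_space a b c e \<subseteq> {0 :: 'k poly}"
  proof
    assume "e < c" then show ?thesis by (intro string_space_trivial[OF e] disjI1)
  next
    assume "a + c \<le> b \<or> b + c \<le> a" then show ?thesis by (rule string_space_trivial_large[OF e])
  qed
  then have "ps.dim (string_space a b c e :: 'k poly set) = 0"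
    using ps.dim_le_card[of "string_space a b c e :: 'k poly set" "{}"] by simp
  then show ?thesis unfolding string_dim_def a_def b_def c_def e_def by simp
qed (simp add: string_dim_def)


section \<open>Diagonal coordinates and the sum over all strings\<close>

lemma abs_add_eq_max: "\<bar>x\<bar> + \<bar>y\<bar> = max \<bar>x + y\<bar> \<bar>x - y\<bar>" for x y :: int
  by (auto simp: max_def abs_if split: if_splits)

lemma max_diagonal:
  fixes j l u v R :: int
  shows "max \<bar>(j + l) - R * (u + v)\<bar> \<bar>(j - l) - R * (u - v)\<bar> = \<bar>j - R * u\<bar> + \<bar>l - R * v\<bar>"
proof -
  have "(j + l) - R * (u + v) = (j - R * u) + (l - R * v)" "(j - l) - R * (u - v) = (j - R * u) - (l - R * v)"
    by (simp_all add: algebra_simps)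
  then show ?thesis unfolding abs_add_eq_max by (simp only:)
qed

text \<open>In diagonal coordinates the taxicab norm is the maximum norm, so the ball of radius
  \<open>p^k / 2\<close> around a point of \<open>p^k Z^2\<close> is the square whose indices
  \<open>u + v\<close>, \<open>u - v\<close> have even sum.\<close>

lemma tile_diagonal:
  "j + l \<in> tile p k (u + v) \<and> j - l \<in> tile p k (u - v) \<longleftrightarrow> 2 * (\<bar>j - int p ^ k * u\<bar> + \<bar>l - int p ^ k * v\<bar>) < int p ^ k"
proof -
  have "2 * x < B \<and> 2 * y < B \<longleftrightarrow> 2 * max x y < B" for x y B :: int by (auto simp: max_def)
  then show ?thesis unfolding tile_def mem_Collect_eq max_diagonal[symmetric] .
qed

lemma diagonal_coords:
  fixes X Y :: int
  assumes "even (X + Y)"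
  obtains j l where "X = j + l" "Y = j - l"
proof -
  from assms obtain j where "X + Y = 2 * j" by (rule evenE)
  then show thesis using that[of j "X - j"] by simp
qed

definition diagonal_dim :: "'k::field itself \<Rightarrow> nat \<Rightarrow> nat \<Rightarrow> nat \<Rightarrow> int \<Rightarrow> int \<Rightarrow> real" where
  "diagonal_dim K q m n X Y = (if even (X + Y) then real (string_dim K q m n ((X + Y) div 2) ((X - Y) div 2)) else 0)"

lemma diagonal_dim_eq: "diagonal_dim K q m n (j + l) (j - l) = real (string_dim K q m n j l)"
proof -
  have "even ((j + l) + (j - l))" "((j + l) + (j - l)) div 2 = j" "((j + l) - (j - l)) div 2 = l" by simp_all
  then show ?thesis unfolding diagonal_dim_def by (simp only: if_True)
qed

abbreviation central_tiles :: "(int \<times> int) set" where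
  "central_tiles \<equiv> {(0, 0), (1, 0), (-1, 0), (0, 1), (0, -1)}"

lemma central_tiles_iff: "(a, b) \<in> central_tiles \<longleftrightarrow> \<bar>a\<bar> + \<bar>b\<bar> \<le> 1"
proof -
  have "\<bar>a\<bar> + \<bar>b\<bar> \<le> 1 \<longleftrightarrow> a = 0 \<and> b = 0 \<or> a = 1 \<and> b = 0 \<or> a = - 1 \<and> b = 0 \<or> a = 0 \<and> b = 1 \<or> a = 0 \<and> b = - 1"
    by linarith
  then show ?thesis by simp
qed

lemma sum_abs_tile_less:
  assumes "X \<in> tile p s a" "Y \<in> tile p s b" "\<bar>a\<bar> + \<bar>b\<bar> \<le> 1"
  shows "\<bar>X\<bar> + \<bar>Y\<bar> < 2 * int p ^ s"
proof -
  define Q where "Q = int p ^ s"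
  have Q: "Q \<ge> 0" unfolding Q_def by simp
  have t: "2 * \<bar>x\<bar> < Q + 2 * (Q * \<bar>c\<bar>)" if "2 * \<bar>x - Q * c\<bar> < Q" for x c
  proof -
    have g: "2 * t' < Q + 2 * y" if "t' \<le> z + y" "2 * z < Q" for t' y z :: int using that by linarith
    have "Q * \<bar>c\<bar> = \<bar>Q * c\<bar>" using Q by (simp add: abs_mult)
    moreover have "\<bar>x\<bar> \<le> \<bar>x - Q * c\<bar> + \<bar>Q * c\<bar>" by linarith
    ultimately have "\<bar>x\<bar> \<le> \<bar>x - Q * c\<bar> + Q * \<bar>c\<bar>" by (simp only:)
    then show ?thesis by (rule g[OF _ that])
  qed
  have "2 * \<bar>X\<bar> < Q + 2 * (Q * \<bar>a\<bar>)" "2 * \<bar>Y\<bar> < Q + 2 * (Q * \<bar>b\<bar>)"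
    using t assms(1,2) unfolding tile_def Q_def[symmetric] by blast+
  moreover have "Q * (\<bar>a\<bar> + \<bar>b\<bar>) \<le> Q * 1" using Q assms(3) by (intro mult_left_mono)
  then have "Q * \<bar>a\<bar> + Q * \<bar>b\<bar> \<le> Q" by (simp add: algebra_simps)
  ultimately show ?thesis unfolding Q_def[symmetric] by linarith
qed

lemma tile_index_le:
  assumes "odd p" "X \<in> tile p s a" "Y \<in> tile p s b" "\<bar>X\<bar> + \<bar>Y\<bar> < 2 * int p ^ s" "even (X + Y)"
  shows "\<bar>a\<bar> + \<bar>b\<bar> \<le> 2"
proof -
  define Q where "Q = int p ^ s"
  have Q: "Q > 0" unfolding Q_def using odd_pos[OF assms(1)] by simp
  have t: "2 * (Q * \<bar>c\<bar>) < Q + 2 * \<bar>x\<bar>" if "2 * \<bar>x - Q * c\<bar> < Q" for x c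
  proof -
    have g: "2 * t' < Q + 2 * y" if "t' \<le> z + y" "2 * z < Q" for t' y z :: int using that by linarith
    have "Q * \<bar>c\<bar> = \<bar>Q * c\<bar>" using Q by (simp add: abs_mult)
    also have "\<dots> \<le> \<bar>x - Q * c\<bar> + \<bar>x\<bar>" by linarith
    finally show ?thesis by (rule g[OF _ that])
  qed
  have "2 * (Q * \<bar>a\<bar>) < Q + 2 * \<bar>X\<bar>" "2 * (Q * \<bar>b\<bar>) < Q + 2 * \<bar>Y\<bar>"
    using t assms(2,3) unfolding tile_def Q_def[symmetric] by blast+
  then have "Q * \<bar>a\<bar> + Q * \<bar>b\<bar> < 3 * Q" using assms(4) unfolding Q_def[symmetric] by linarith
  then have "Q * (\<bar>a\<bar> + \<bar>b\<bar>) < Q * 3" by (simp add: algebra_simps)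
  then show ?thesis using Q by simp
qed

text \<open>The strings are the even points with \<open>|X| + |Y| < 2 q\<close>, and this region
  contains the five central squares. What it contains outside of them lies in squares with
  \<open>|a| + |b| = 2\<close>, which are even with a nonzero centre and contribute nothing.\<close>

lemma sum_string_dim_eq:
  fixes K :: "'k::field itself"
  assumes p: "odd p" and q: "p ^ s = 2 * m + 1" and G: "2 * int p ^ s + int m - 1 - int n \<ge> 1"
  shows "(\<Sum>(j, l)\<in>{- (int p ^ s)<..<int p ^ s} \<times> {- (int p ^ s)<..<int p ^ s}. real (string_dim K (p ^ s) m n j l))
    = (\<Sum>(a, b)\<in>central_tiles. \<Sum>X\<in>tile p s a. \<Sum>Y\<in>tile p s b. diagonal_dim K (p ^ s) m n X Y)"
proof -
  define Q where "Q = int p ^ s"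
  define F where "F = (\<lambda>(X, Y). diagonal_dim K (p ^ s) m n X Y)"
  define S where "S = {(X, Y). even (X + Y) \<and> \<bar>X\<bar> + \<bar>Y\<bar> < 2 * Q}"
  define U where "U = (\<Union>(a, b)\<in>central_tiles. tile p s a \<times> tile p s b)"
  have box: "\<bar>j + l\<bar> + \<bar>j - l\<bar> < 2 * Q \<longleftrightarrow> \<bar>j\<bar> < Q \<and> \<bar>l\<bar> < Q" for j l
    by (auto simp: abs_if split: if_splits)
  have "(\<Sum>(j, l)\<in>{- Q<..<Q} \<times> {- Q<..<Q}. real (string_dim K (p ^ s) m n j l)) = (\<Sum>z\<in>S. F z)"
  proof (rule sum.reindex_bij_witness[where i = "\<lambda>(X, Y). ((X + Y) div 2, (X - Y) div 2)" and j = "\<lambda>(j, l). (j + l, j - l)"])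
    fix z assume z: "z \<in> S"
    obtain X Y where XY: "z = (X, Y)" by (cases z)
    have e: "even (X + Y)" "\<bar>X\<bar> + \<bar>Y\<bar> < 2 * Q" using z unfolding S_def XY by simp_all
    obtain j l where jl: "X = j + l" "Y = j - l" using diagonal_coords[OF e(1)] .
    have h: "(X + Y) div 2 = j" "(X - Y) div 2 = l" unfolding jl by simp_all
    show "(case case z of (X, Y) \<Rightarrow> ((X + Y) div 2, (X - Y) div 2) of (j, l) \<Rightarrow> (j + l, j - l)) = z"
      unfolding XY prod.case h by (simp add: jl)
    have "\<bar>j\<bar> < Q" "\<bar>l\<bar> < Q" using e(2) box unfolding jl by simp_all
    then show "(case z of (X, Y) \<Rightarrow> ((X + Y) div 2, (X - Y) div 2)) \<in> {- Q<..<Q} \<times> {- Q<..<Q}"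
      unfolding XY prod.case h by (auto simp: abs_less_iff)
  next
    fix z assume z: "z \<in> {- Q<..<Q} \<times> {- Q<..<Q}"
    obtain j l where jl: "z = (j, l)" by (cases z)
    have "\<bar>j\<bar> < Q \<and> \<bar>l\<bar> < Q" using z unfolding jl by auto
    then have "\<bar>j + l\<bar> + \<bar>j - l\<bar> < 2 * Q" unfolding box .
    then show "(case z of (j, l) \<Rightarrow> (j + l, j - l)) \<in> S" unfolding jl S_def by simp
    have "((j + l) + (j - l)) div 2 = j" "((j + l) - (j - l)) div 2 = l" by simp_all
    then show "(case case z of (j, l) \<Rightarrow> (j + l, j - l) of (X, Y) \<Rightarrow> ((X + Y) div 2, (X - Y) div 2)) = z"
      unfolding jl prod.case by (simp only:)
    show "F (case z of (j, l) \<Rightarrow> (j + l, j - l)) = (case z of (j, l) \<Rightarrow> real (string_dim K (p ^ s) m n j l))"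
      unfolding jl prod.case F_def by (rule diagonal_dim_eq)
  qed
  also have "\<dots> = (\<Sum>z\<in>U. F z)"
  proof (rule sum.mono_neutral_cong)
    show "finite S"
    proof (rule finite_subset)
      show "S \<subseteq> {- (2 * Q)..2 * Q} \<times> {- (2 * Q)..2 * Q}" unfolding S_def by auto
    qed simp
    show "finite U" unfolding U_def by (auto intro!: finite_tile)
    show "F z = 0" if "z \<in> U - S" for z
    proof -
      from that obtain X Y a b where z: "z = (X, Y)" "(a, b) \<in> central_tiles" "X \<in> tile p s a" "Y \<in> tile p s b"
        unfolding U_def by blast
      have "\<bar>X\<bar> + \<bar>Y\<bar> < 2 * Q"
        unfolding Q_def by (rule sum_abs_tile_less[OF z(3,4)]) (use z(2) central_tiles_iff in blast)
      then have "odd (X + Y)" using that unfolding z(1) S_def by blast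
      then show ?thesis unfolding F_def z(1) diagonal_dim_def by simp
    qed
    show "F z = 0" if z: "z \<in> S - U" for z
    proof -
      obtain X Y where XY: "z = (X, Y)" by (cases z)
      have e: "even (X + Y)" "\<bar>X\<bar> + \<bar>Y\<bar> < 2 * Q" using z unfolding S_def XY by simp_all
      obtain a where a: "X \<in> tile p s a" using tile_exists[OF p] by blast
      obtain b where b: "Y \<in> tile p s b" using tile_exists[OF p] by blast
      have "(a, b) \<notin> central_tiles" using z a b unfolding U_def XY by blast
      then have ab1: "\<not> \<bar>a\<bar> + \<bar>b\<bar> \<le> 1" unfolding central_tiles_iff .
      have ab2: "\<bar>a\<bar> + \<bar>b\<bar> \<le> 2" by (rule tile_index_le[OF p a b e(2)[unfolded Q_def] e(1)])
      have "\<bar>a\<bar> + \<bar>b\<bar> = 2" using ab1 ab2 by linarith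
      then have "even (a + b)" by presburger
      then obtain u v where uv: "a = u + v" "b = u - v" using diagonal_coords by blast
      obtain j l where jl: "X = j + l" "Y = j - l" using diagonal_coords[OF e(1)] .
      have near: "2 * (\<bar>j - int p ^ s * u\<bar> + \<bar>l - int p ^ s * v\<bar>) < int p ^ s"
        using a b tile_diagonal unfolding uv jl by blast
      have jlQ: "\<bar>j\<bar> < int p ^ s" "\<bar>l\<bar> < int p ^ s" using e(2) box unfolding jl Q_def by simp_all
      have "u \<noteq> 0 \<or> v \<noteq> 0" using ab1 unfolding uv by auto
      from string_dim_far[OF q jlQ near this G] show ?thesis
        unfolding F_def XY jl prod.case diagonal_dim_eq by simp
    qed
  qed simp
  also have "\<dots> = (\<Sum>z\<in>central_tiles. sum F (case z of (a, b) \<Rightarrow> tile p s a \<times> tile p s b))"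
    unfolding U_def
  proof (rule sum.UNION_disjoint)
    show "\<forall>z\<in>central_tiles. finite (case z of (a, b) \<Rightarrow> tile p s a \<times> tile p s b)"
      by (auto intro!: finite_tile)
    show "\<forall>z\<in>central_tiles. \<forall>w\<in>central_tiles. z \<noteq> w \<longrightarrow>
       (case z of (a, b) \<Rightarrow> tile p s a \<times> tile p s b) \<inter> (case w of (a, b) \<Rightarrow> tile p s a \<times> tile p s b) = {}"
    proof (intro ballI impI equals0I)
      fix z w x assume "z \<noteq> w" and
        x: "x \<in> (case z of (a, b) \<Rightarrow> tile p s a \<times> tile p s b) \<inter> (case w of (a, b) \<Rightarrow> tile p s a \<times> tile p s b)"
      obtain a b a' b' where zw: "z = (a, b)" "w = (a', b')" by (cases z, cases w)
      have "fst x \<in> tile p s a" "fst x \<in> tile p s a'" "snd x \<in> tile p s b" "snd x \<in> tile p s b'"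
        using x unfolding zw by auto
      then have "a = a'" "b = b'" using tile_unique by blast+
      then show False using \<open>z \<noteq> w\<close> unfolding zw by simp
    qed
  qed simp
  also have "\<dots> = (\<Sum>(a, b)\<in>central_tiles. \<Sum>X\<in>tile p s a. \<Sum>Y\<in>tile p s b. diagonal_dim K (p ^ s) m n X Y)"
  proof (rule sum.cong[OF refl])
    fix z :: "int \<times> int"
    obtain a b where z: "z = (a, b)" by (cases z)
    show "sum F (case z of (a, b) \<Rightarrow> tile p s a \<times> tile p s b)
      = (case z of (a, b) \<Rightarrow> \<Sum>X\<in>tile p s a. \<Sum>Y\<in>tile p s b. diagonal_dim K (p ^ s) m n X Y)"
      unfolding z prod.case F_def by (simp only: sum.cartesian_product)
  qed
  finally show ?thesis unfolding Q_def .
qed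

text \<open>The central square is even of level \<open>s\<close>; each of its four neighbours is odd
  and is resolved by the recursion. The constant 30 is five squares times 2 + 4: 2 per point for the
  dimension of a string and 4 for replacing diamond sums by cubes.\<close>

lemma sum_string_dim_estimate:
  fixes K :: "'k::field itself" and G :: int
  assumes ch: "CHAR('k) = p" "prime p" "p \<ge> 3" and q: "p ^ s = 2 * m + 1"
    and G: "G = 2 * int p ^ s + int m - 1 - int n" "G \<ge> 1"
  shows "\<bar>(\<Sum>(j, l)\<in>{- (int p ^ s)<..<int p ^ s} \<times> {- (int p ^ s)<..<int p ^ s}. real (string_dim K (p ^ s) m n j l))
    - 1 / 3 * (max 0 (real p ^ s / 2 - real_of_int G) ^ 3
     + 4 * (\<Sum>k<s. (real p ^ 2 - 1) / 2 * ((real p ^ 2 + 1) / 2) ^ (s - 1 - k) * max 0 (real p ^ k / 2 - real_of_int G) ^ 3))\<bar>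
    \<le> 30 * (real p ^ 2) ^ s"
proof -
  have odd: "odd p" using ch(2,3) primes_dvd_imp_eq[OF two_is_prime_nat ch(2)] by auto
  obtain h where h: "p = 2 * h + 1" using odd by (rule oddE)
  define F where "F = diagonal_dim K (p ^ s) m n"
  define f where "f = (\<lambda>k d. max 0 ((real p ^ k - 2 * real_of_int d - 2 * real_of_int G) / 4))"
  define M where "M k = max 0 (real p ^ k / 2 - real_of_int G) ^ 3" for k
  define w where "w k = (real p ^ 2 - 1) / 2 * ((real p ^ 2 + 1) / 2) ^ (s - 1 - k)" for k
  have zero: "F X Y = 0" if "odd (X + Y)" for X Y using that unfolding F_def diagonal_dim_def by simp
  have box: "\<bar>j\<bar> < int p ^ s" "\<bar>l\<bar> < int p ^ s" if "\<bar>j + l\<bar> + \<bar>j - l\<bar> < 2 * int p ^ s" for j l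
    using that by (auto simp: abs_if split: if_splits)
  have pt: "\<bar>F X Y - f k (max \<bar>X - int p ^ k * a\<bar> \<bar>Y - int p ^ k * b\<bar>)\<bar> \<le> 2"
    if k: "k \<le> s" "k = s \<Longrightarrow> a = 0 \<and> b = 0" and ab: "even (a + b)" and t: "X \<in> tile p k a" "Y \<in> tile p k b" and e: "even (X + Y)"
      and anc: "\<And>k' a' b'. k < k' \<Longrightarrow> k' \<le> s \<Longrightarrow> X \<in> tile p k' a' \<Longrightarrow> Y \<in> tile p k' b' \<Longrightarrow> odd (a' + b')"
      and small: "\<bar>X\<bar> + \<bar>Y\<bar> < 2 * int p ^ s" for X Y a b k
  proof -
    obtain j l where jl: "X = j + l" "Y = j - l" using diagonal_coords[OF e] .
    obtain u v where uv: "a = u + v" "b = u - v" using diagonal_coords[OF ab] .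
    have near: "2 * (\<bar>j - int p ^ k * u\<bar> + \<bar>l - int p ^ k * v\<bar>) < int p ^ k"
      using t tile_diagonal unfolding uv jl by blast
    have far: "int p ^ k' \<le> 2 * (\<bar>j - int p ^ k' * u'\<bar> + \<bar>l - int p ^ k' * v'\<bar>)" if "k < k'" "k' \<le> s" for k' u' v'
    proof (rule ccontr)
      assume "\<not> ?thesis"
      then have "j + l \<in> tile p k' (u' + v')" "j - l \<in> tile p k' (u' - v')" using tile_diagonal[of j l p k' u' v'] by simp_all
      then have "odd ((u' + v') + (u' - v'))" using anc[OF that] unfolding jl by blast
      then show False by simp
    qed
    have top: "u = 0 \<and> v = 0" if "k = s" using k(2)[OF that] unfolding uv by simp
    show ?thesis unfolding f_def F_def jl uv diagonal_dim_eq max_diagonal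
      by (rule string_dim_near[OF ch q box(1)[OF small[unfolded jl]] box(2)[OF small[unfolded jl]] k(1) near far top G])
  qed
  have small: "\<bar>X\<bar> + \<bar>Y\<bar> < 2 * int p ^ s" if "X \<in> tile p s a" "Y \<in> tile p s b" "\<bar>a\<bar> + \<bar>b\<bar> \<le> 1" for X Y a b
    using sum_abs_tile_less[OF that] .
  have ds: "\<bar>diamond_sum p k (f k) - 1 / 3 * M k\<bar> \<le> 4 * (real p ^ 2) ^ k" for k
    unfolding f_def M_def by (rule diamond_sum_estimate[OF odd]) (use G(2) in simp)
  have even: "\<bar>(\<Sum>X\<in>tile p s 0. \<Sum>Y\<in>tile p s 0. F X Y) - diamond_sum p s (f s)\<bar> \<le> 2 * (real p ^ 2) ^ s"
  proof (rule sum_even_tile[OF odd _ zero])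
    fix X Y assume XY: "X \<in> tile p s 0" "Y \<in> tile p s 0" "even (X + Y)"
    show "\<bar>F X Y - f s (max \<bar>X - int p ^ s * 0\<bar> \<bar>Y - int p ^ s * 0\<bar>)\<bar> \<le> 2"
      by (rule pt) (use XY small[OF XY(1,2)] in simp_all)
  qed simp_all
  define W where "W = (\<Sum>k<s. w k * diamond_sum p k (f k))"
  have oddt: "\<bar>(\<Sum>X\<in>tile p s a. \<Sum>Y\<in>tile p s b. F X Y) - W\<bar> \<le> 2 * (real p ^ 2) ^ s"
    if ab: "odd (a + b)" "\<bar>a\<bar> + \<bar>b\<bar> \<le> 1" for a b
    unfolding W_def w_def
  proof (rule sum_odd_tile[where Q = "\<lambda>X Y. \<bar>X\<bar> + \<bar>Y\<bar> < 2 * int p ^ s" and s = s, OF h _ zero _ le_refl ab(1)])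
    fix k a b X Y
    assume *: "k < s" "even (a + b)" "X \<in> tile p k a" "Y \<in> tile p k b" "even (X + Y)"
      "\<And>k' a' b'. k < k' \<Longrightarrow> k' \<le> s \<Longrightarrow> X \<in> tile p k' a' \<Longrightarrow> Y \<in> tile p k' b' \<Longrightarrow> odd (a' + b')"
      "\<bar>X\<bar> + \<bar>Y\<bar> < 2 * int p ^ s"
    show "\<bar>F X Y - f k (max \<bar>X - int p ^ k * a\<bar> \<bar>Y - int p ^ k * b\<bar>)\<bar> \<le> 2"
      by (rule pt[OF _ _ *(2-7)]) (use *(1) in simp_all)
  next
    fix X Y assume "X \<in> tile p s a" "Y \<in> tile p s b"
    then show "\<bar>X\<bar> + \<bar>Y\<bar> < 2 * int p ^ s" using small ab(2) by blast
  qed simp_all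
  have W: "\<bar>W - 1 / 3 * (\<Sum>k<s. w k * M k)\<bar> \<le> 4 * (real p ^ 2) ^ s"
  proof -
    have P1: "real p ^ 2 \<ge> 1" using ch(3) by (intro one_le_power) simp
    have w0: "w k \<ge> 0" for k unfolding w_def using P1 by simp
    have "W - 1 / 3 * (\<Sum>k<s. w k * M k) = (\<Sum>k<s. w k * (diamond_sum p k (f k) - 1 / 3 * M k))"
      unfolding W_def by (simp add: sum_distrib_left sum_subtractf right_diff_distrib mult.left_commute)
    also have "\<bar>\<dots>\<bar> \<le> (\<Sum>k<s. \<bar>w k * (diamond_sum p k (f k) - 1 / 3 * M k)\<bar>)" by (rule sum_abs)
    also have "\<dots> \<le> (\<Sum>k<s. 4 * (w k * (real p ^ 2) ^ k))"
    proof (rule sum_mono)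
      fix k
      have "\<bar>w k * (diamond_sum p k (f k) - 1 / 3 * M k)\<bar> = w k * \<bar>diamond_sum p k (f k) - 1 / 3 * M k\<bar>"
        using w0[of k] by (simp add: abs_mult)
      also have "\<dots> \<le> w k * (4 * (real p ^ 2) ^ k)" by (rule mult_left_mono[OF ds w0])
      finally show "\<bar>w k * (diamond_sum p k (f k) - 1 / 3 * M k)\<bar> \<le> 4 * (w k * (real p ^ 2) ^ k)" by (simp only: mult.left_commute)
    qed
    also have "\<dots> \<le> 4 * (real p ^ 2) ^ s"
      unfolding sum_distrib_left[symmetric] w_def using sum_weights_le[OF P1, of s] by simp
    finally show ?thesis .
  qed
  have "(\<Sum>(j, l)\<in>{- (int p ^ s)<..<int p ^ s} \<times> {- (int p ^ s)<..<int p ^ s}. real (string_dim K (p ^ s) m n j l))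
    = (\<Sum>(a, b)\<in>central_tiles. \<Sum>X\<in>tile p s a. \<Sum>Y\<in>tile p s b. F X Y)"
    unfolding F_def using sum_string_dim_eq[OF odd q] G by simp
  also have "\<dots> = (\<Sum>X\<in>tile p s 0. \<Sum>Y\<in>tile p s 0. F X Y) + ((\<Sum>X\<in>tile p s 1. \<Sum>Y\<in>tile p s 0. F X Y)
     + ((\<Sum>X\<in>tile p s (-1). \<Sum>Y\<in>tile p s 0. F X Y) + ((\<Sum>X\<in>tile p s 0. \<Sum>Y\<in>tile p s 1. F X Y)
     + (\<Sum>X\<in>tile p s 0. \<Sum>Y\<in>tile p s (-1). F X Y))))" by simp
  finally have tot: "(\<Sum>(j, l)\<in>{- (int p ^ s)<..<int p ^ s} \<times> {- (int p ^ s)<..<int p ^ s}. real (string_dim K (p ^ s) m n j l))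
    = (\<Sum>X\<in>tile p s 0. \<Sum>Y\<in>tile p s 0. F X Y) + ((\<Sum>X\<in>tile p s 1. \<Sum>Y\<in>tile p s 0. F X Y)
     + ((\<Sum>X\<in>tile p s (-1). \<Sum>Y\<in>tile p s 0. F X Y) + ((\<Sum>X\<in>tile p s 0. \<Sum>Y\<in>tile p s 1. F X Y)
     + (\<Sum>X\<in>tile p s 0. \<Sum>Y\<in>tile p s (-1). F X Y))))" .
  have gen: "\<bar>(x0 + (x1 + (x2 + (x3 + x4)))) - 1 / 3 * (Ms + 4 * y)\<bar> \<le> 30 * C"
    if "\<bar>x0 - d\<bar> \<le> 2 * C" "\<bar>d - 1 / 3 * Ms\<bar> \<le> 4 * C" "\<bar>x1 - V\<bar> \<le> 2 * C" "\<bar>x2 - V\<bar> \<le> 2 * C" "\<bar>x3 - V\<bar> \<le> 2 * C" "\<bar>x4 - V\<bar> \<le> 2 * C"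
      "\<bar>V - 1 / 3 * y\<bar> \<le> 4 * C" for x0 x1 x2 x3 x4 d Ms V y C :: real
    using that unfolding abs_le_iff by argo
  show ?thesis unfolding tot M_def[symmetric] w_def[symmetric]
    by (rule gen[OF even ds oddt oddt oddt oddt W]) simp_all
qed

section \<open>The density function\<close>

text \<open>\<open>g\<close> is the gap \<open>2 q + m - 1 - n\<close> with
  \<open>m = (q - 1) / 2\<close>, and the bound on \<open>n\<close> says that this gap is
  positive.\<close>

lemma kernel_dim_estimate:
  fixes K :: "'k::field itself"
  assumes ch: "CHAR('k) = p" "prime p" "p \<ge> 3" and s: "s \<ge> 1" and n: "2 * n + 3 < 5 * p ^ s"
    and g: "g = (5 * real p ^ s - 3 - 2 * real n) / 2"
  shows "\<bar>real (fs.dim (mult_kernel (p ^ s) n (sum_squares :: 'k mpoly5)))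
    - 1 / 3 * (max 0 (real p ^ s / 2 - g) ^ 3
     + 4 * (\<Sum>k<s. (real p ^ 2 - 1) / 2 * ((real p ^ 2 + 1) / 2) ^ (s - 1 - k) * max 0 (real p ^ k / 2 - g) ^ 3))\<bar>
    \<le> 30 * (real p ^ 2) ^ s"
proof -
  have odd: "odd p" using ch(2,3) primes_dvd_imp_eq[OF two_is_prime_nat ch(2)] by auto
  then have "odd (p ^ s)" by simp
  then obtain m where q: "p ^ s = 2 * m + 1" by (rule oddE)
  have "p ^ 1 \<le> p ^ s" using s ch(3) by (intro power_increasing) auto
  then have m: "m \<ge> 1" using q ch(3) by simp
  define G where "G = 2 * int p ^ s + int m - 1 - int n"
  have qi: "int p ^ s = 2 * int m + 1" using arg_cong[OF q, of int] by simp
  have qr: "real p ^ s = 2 * real m + 1" using arg_cong[OF q, of real] by simp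
  have "2 * n + 3 < 5 * (2 * m + 1)" using n unfolding q .
  then have G1: "G \<ge> 1" unfolding G_def qi by simp
  have Gg: "real_of_int G = g" unfolding G_def g qi qr by (simp add: field_simps)
  have "fs.dim (mult_kernel (p ^ s) n (sum_squares :: 'k mpoly5))
    = (\<Sum>(j, l)\<in>{- int (p ^ s)<..<int (p ^ s)} \<times> {- int (p ^ s)<..<int (p ^ s)}. string_dim K (p ^ s) m n j l)"
    unfolding dim_mult_kernel_sum_squares[OF ch(1,2) odd refl] dim_mult_kernel_split_quadric[OF q m] string_dim_def ..
  then have "real (fs.dim (mult_kernel (p ^ s) n (sum_squares :: 'k mpoly5)))
    = (\<Sum>(j, l)\<in>{- (int p ^ s)<..<int p ^ s} \<times> {- (int p ^ s)<..<int p ^ s}. real (string_dim K (p ^ s) m n j l))"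
    by (simp only: of_nat_sum case_prod_unfold of_nat_power)
  then show ?thesis using sum_string_dim_estimate[OF ch q G_def G1, where K = K] unfolding Gg by (simp only:)
qed

lemma floor_bounds:
  assumes "x \<ge> 0"
  shows "real (nat \<lfloor>x * real q\<rfloor>) \<le> x * real q" "x * real q - 1 < real (nat \<lfloor>x * real q\<rfloor>)"
proof -
  have "real (nat \<lfloor>x * real q\<rfloor>) = real_of_int \<lfloor>x * real q\<rfloor>" using assms by simp
  then show "real (nat \<lfloor>x * real q\<rfloor>) \<le> x * real q" "x * real q - 1 < real (nat \<lfloor>x * real q\<rfloor>)"
    by linarith+
qed

lemma mon_deg_empty:
  assumes "5 * (q - 1) < n"
  shows "mon_deg q n = {}"
proof (rule equals0I)
  fix e assume e: "e \<in> mon_deg q n"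
  have "e i \<le> q - 1" if "i < 5" for i
  proof -
    have "e i < q" using e that unfolding mon_deg_def by blast
    then show ?thesis by simp
  qed
  then have "(\<Sum>i<5. e i) \<le> of_nat (card {..<5 :: nat}) * (q - 1)" by (intro sum_bounded_above) simp
  moreover have "(\<Sum>i<5. e i) = n" using e unfolding mon_deg_def by blast
  ultimately show False using assms by simp
qed

text \<open>By duality the dimension in degree \<open>n\<close> is that of a kernel in degree
  \<open>n' = 5 (q - 1) - n\<close>, and inserting \<open>n'\<close> into the gap gives
  \<open>(2 n - 5 q + 7) / 2\<close>. Beyond the socle degree both the dimension and the main term
  vanish.\<close>

lemma hk_seq_above_tendsto:
  fixes K :: "'k::field itself"
  assumes ch: "CHAR('k) = p" "prime p" "p \<ge> 3" and x: "x > 5 / 2" and z: "1 / (2 * real p ^ (J + 1)) < x - 5 / 2"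
  shows "hk_seq K p x \<longlonglongrightarrow> kernel_density p J (x - 5 / 2)"
proof -
  have p1: "p > 1" using ch(3) by simp
  define n where "n s = nat \<lfloor>x * real (p ^ s)\<rfloor>" for s
  define g where "g s = (2 * real (n s) - 5 * real p ^ s + 7) / 2" for s
  have "(\<lambda>s. real (n s) / real (p ^ s) - 5 / 2 + (7 / 2) / real (p ^ s)) \<longlonglongrightarrow> x - 5 / 2 + 0"
    unfolding n_def using p1 x by (intro tendsto_add tendsto_diff tendsto_const floor_tendsto power_inverse_tendsto_0) simp_all
  moreover have "(\<lambda>s. g s / real p ^ s) = (\<lambda>s. real (n s) / real (p ^ s) - 5 / 2 + (7 / 2) / real (p ^ s))"
  proof
    fix s
    have "(2 * N - 5 * Q + 7) / 2 / Q = N / Q - 5 / 2 + (7 / 2) / Q" if "Q > 0" for N Q :: real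
      using that by (simp add: field_simps)
    from this[of "real p ^ s" "real (n s)"] show "g s / real p ^ s = real (n s) / real (p ^ s) - 5 / 2 + (7 / 2) / real (p ^ s)"
      unfolding g_def using p1 by simp
  qed
  ultimately have r: "(\<lambda>s. g s / real p ^ s) \<longlonglongrightarrow> x - 5 / 2" by simp
  have "(\<lambda>s. real (hk_piece_dim K (p ^ s) (n s)) / (real p ^ s) ^ 3) \<longlonglongrightarrow> kernel_density p J (x - 5 / 2)"
  proof (rule kernel_limit[OF p1 z r])
    show "\<forall>\<^sub>F s in sequentially. \<bar>real (hk_piece_dim K (p ^ s) (n s)) - 1 / 3 * (max 0 (real p ^ s / 2 - g s) ^ 3
     + 4 * (\<Sum>k<s. (real p ^ 2 - 1) / 2 * ((real p ^ 2 + 1) / 2) ^ (s - 1 - k) * max 0 (real p ^ k / 2 - g s) ^ 3))\<bar> \<le> 30 * (real p ^ 2) ^ s"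
      using eventually_ge_at_top[of 1]
    proof eventually_elim
      case (elim s)
      define q where "q = p ^ s"
      have q1: "q \<ge> 1" unfolding q_def using p1 by simp
      have qr: "real p ^ s = real q" unfolding q_def by simp
      have "5 / 2 * real q \<le> x * real q" using x by (intro mult_right_mono) auto
      then have "5 / 2 * real q - 1 < real (n s)" using floor_bounds(2)[of x q] x unfolding n_def q_def[symmetric] by linarith
      then have n5: "5 * q < 2 * n s + 2" by linarith
      show ?case
      proof (cases "n s \<le> 5 * (q - 1)")
        case True
        define n' where "n' = 5 * (q - 1) - n s"
        have "n s - 2 + 2 + n' = 5 * (q - 1)" "n s - 2 + 2 = n s" using True n5 q1 unfolding n'_def by linarith+
        then have D: "hk_piece_dim K q (n s) = fs.dim (mult_kernel q n' (sum_squares :: 'k mpoly5))"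
          using hk_piece_dim_dual[of "n s - 2" n' q K] by simp
        have n'r: "n' + n s + 5 = 5 * q" using True q1 unfolding n'_def by linarith
        have "2 * n' + 3 < 5 * q" using n'r n5 by linarith
        moreover have "g s = (5 * real p ^ s - 3 - 2 * real n') / 2"
        proof -
          have "real n' + real (n s) + 5 = 5 * real q" using arg_cong[OF n'r, of real] by simp
          then show ?thesis unfolding g_def qr by simp
        qed
        ultimately show ?thesis unfolding q_def[symmetric] D unfolding q_def
          by (intro kernel_dim_estimate[OF ch elim]) simp_all
      next
        case False
        then have D: "hk_piece_dim K q (n s) = 0" unfolding hk_piece_dim_def by (simp add: mon_deg_empty)
        have "5 * q \<le> n s + 4" using False q1 by linarith
        then have "5 * real q \<le> real (n s) + 4" by linarith
        moreover have "1 \<le> real q" using q1 by simp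
        ultimately have gq: "real q / 2 \<le> g s" unfolding g_def qr by (simp add: field_simps)
        have mz: "max 0 (real p ^ k / 2 - g s) = 0" if "k \<le> s" for k
        proof -
          have "real p ^ k \<le> real p ^ s" using that p1 by (intro power_increasing) auto
          then show ?thesis using gq unfolding qr by (intro max_absorb1) linarith
        qed
        have "(\<Sum>k<s. (real p ^ 2 - 1) / 2 * ((real p ^ 2 + 1) / 2) ^ (s - 1 - k) * max 0 (real p ^ k / 2 - g s) ^ 3) = 0"
          by (rule sum.neutral) (simp add: mz)
        then show ?thesis unfolding q_def[symmetric] D mz[OF order_refl] by simp
      qed
    qed
  qed
  then show ?thesis unfolding hk_seq_def n_def by simp
qed

text \<open>The Hilbert function is \<open>h(n) - h(n-2)\<close> plus the kernel in degree
  \<open>n - 2\<close>. The difference is a sum of two first differences with the same limit, which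
  doubles the coefficients \<open>1/6\<close>, \<open>-5/6\<close>, \<open>10/6\<close>.\<close>

lemma hk_seq_below_tendsto:
  fixes K :: "'k::field itself"
  assumes ch: "CHAR('k) = p" "prime p" "p \<ge> 3" and x: "0 < x" "x < 5 / 2" and z: "1 / (2 * real p ^ (J + 1)) < 5 / 2 - x"
  shows "hk_seq K p x \<longlonglongrightarrow> x ^ 3 / 3 - 5 / 3 * max 0 (x - 1) ^ 3 + 10 / 3 * max 0 (x - 2) ^ 3 + kernel_density p J (5 / 2 - x)"
proof -
  have p1: "p > 1" using ch(3) by simp
  define n where "n s = nat \<lfloor>x * real (p ^ s)\<rfloor>" for s
  have n_lim: "(\<lambda>s. real (n s) / real (p ^ s)) \<longlonglongrightarrow> x" unfolding n_def using p1 x by (intro floor_tendsto) simp_all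
  have n2: "\<forall>\<^sub>F s in sequentially. n s \<ge> 2"
    using order_tendstoD(2)[OF power_inverse_tendsto_0[OF p1, of 3] x(1)]
  proof eventually_elim
    case (elim s)
    have "real (p ^ s) > 0" using p1 by simp
    then have "3 < x * real (p ^ s)" using elim by (simp only: pos_divide_less_eq)
    then have "2 < real (n s)" using floor_bounds(2)[of x "p ^ s"] x(1) unfolding n_def by linarith
    then show ?case by linarith
  qed
  have shift: "(\<lambda>s. real (n s - i) / real (p ^ s)) \<longlonglongrightarrow> x" if "i \<le> 2" for i
  proof (rule Lim_transform_eventually)
    show "(\<lambda>s. real (n s) / real (p ^ s) - real i / real (p ^ s)) \<longlonglongrightarrow> x"
      using tendsto_diff[OF n_lim power_inverse_tendsto_0[OF p1, of "real i"]] by simp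
    show "\<forall>\<^sub>F s in sequentially. real (n s) / real (p ^ s) - real i / real (p ^ s) = real (n s - i) / real (p ^ s)"
      using n2
    proof eventually_elim
      case (elim s)
      then have "real (n s - i) = real (n s) - real i" using that by simp
      then show ?case by (simp only: diff_divide_distrib)
    qed
  qed
  have q_top: "filterlim (\<lambda>s. p ^ s) at_top sequentially"
  proof (rule filterlim_at_top_mono[OF filterlim_ident])
    show "\<forall>\<^sub>F s in sequentially. s \<le> p ^ s"
      using power_gt_expt[of p] p1 by (intro always_eventually allI less_imp_le) simp
  qed
  define B where "B c i s = shifted_binom (c * p ^ s) (n s - i) / real (p ^ s) ^ 3" for c i s
  have B: "(B c i) \<longlonglongrightarrow> max 0 (x - real c) ^ 3 / 6" if "i \<le> 2" for c i
    unfolding B_def by (rule shifted_binom_tendsto[OF shift[OF that] q_top])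
  define d where "d s = real (fs.dim (mult_kernel (p ^ s) (n s - 2) (sum_squares :: 'k mpoly5)))" for s
  define g where "g s = (5 * real p ^ s - 3 - 2 * real (n s - 2)) / 2" for s
  have bound: "2 * n s < 5 * p ^ s" for s
  proof -
    have "real (p ^ s) > 0" using p1 by simp
    then have "x * real (p ^ s) < 5 / 2 * real (p ^ s)" using x(2) by (intro mult_strict_right_mono)
    then have "real (n s) < 5 / 2 * real (p ^ s)" using floor_bounds(1)[of x "p ^ s"] x(1) unfolding n_def by linarith
    then have "real (2 * n s) < real (5 * p ^ s)" by simp
    then show ?thesis by (simp only: of_nat_less_iff)
  qed
  have "(\<lambda>s. 5 / 2 - real (n s - 2) / real (p ^ s) - (3 / 2) / real (p ^ s)) \<longlonglongrightarrow> 5 / 2 - x - 0"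
    by (intro tendsto_diff tendsto_const shift power_inverse_tendsto_0 p1) simp
  moreover have "(\<lambda>s. g s / real p ^ s) = (\<lambda>s. 5 / 2 - real (n s - 2) / real (p ^ s) - (3 / 2) / real (p ^ s))"
  proof
    fix s
    have "(5 * Q - 3 - 2 * N) / 2 / Q = 5 / 2 - N / Q - (3 / 2) / Q" if "Q > 0" for N Q :: real
      using that by (simp add: field_simps)
    from this[of "real p ^ s" "real (n s - 2)"] show "g s / real p ^ s = 5 / 2 - real (n s - 2) / real (p ^ s) - (3 / 2) / real (p ^ s)"
      unfolding g_def of_nat_power using p1 by simp
  qed
  ultimately have r: "(\<lambda>s. g s / real p ^ s) \<longlonglongrightarrow> 5 / 2 - x" by simp
  have d: "(\<lambda>s. d s / (real p ^ s) ^ 3) \<longlonglongrightarrow> kernel_density p J (5 / 2 - x)"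
  proof (rule kernel_limit[OF p1 z r])
    show "\<forall>\<^sub>F s in sequentially. \<bar>d s - 1 / 3 * (max 0 (real p ^ s / 2 - g s) ^ 3
     + 4 * (\<Sum>k<s. (real p ^ 2 - 1) / 2 * ((real p ^ 2 + 1) / 2) ^ (s - 1 - k) * max 0 (real p ^ k / 2 - g s) ^ 3))\<bar> \<le> 30 * (real p ^ 2) ^ s"
      using eventually_ge_at_top[of 1] n2
    proof eventually_elim
      case (elim s)
      have "2 * (n s - 2) + 3 < 5 * p ^ s" using bound[of s] elim(2) by linarith
      then show ?case unfolding d_def by (rule kernel_dim_estimate[OF ch elim(1)]) (rule g_def)
    qed
  qed
  show ?thesis
  proof (rule Lim_transform_eventually)
    have "(\<lambda>s. (B 0 0 s - 5 * B 1 0 s + 10 * B 2 0 s) + (B 0 1 s - 5 * B 1 1 s + 10 * B 2 1 s) + d s / (real p ^ s) ^ 3)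
      \<longlonglongrightarrow> (max 0 (x - real 0) ^ 3 / 6 - 5 * (max 0 (x - real 1) ^ 3 / 6) + 10 * (max 0 (x - real 2) ^ 3 / 6))
       + (max 0 (x - real 0) ^ 3 / 6 - 5 * (max 0 (x - real 1) ^ 3 / 6) + 10 * (max 0 (x - real 2) ^ 3 / 6))
       + kernel_density p J (5 / 2 - x)"
      by (intro tendsto_add tendsto_diff tendsto_mult tendsto_const B d) simp_all
    moreover have "(max 0 (x - real 0) ^ 3 / 6 - 5 * (max 0 (x - real 1) ^ 3 / 6) + 10 * (max 0 (x - real 2) ^ 3 / 6))
       + (max 0 (x - real 0) ^ 3 / 6 - 5 * (max 0 (x - real 1) ^ 3 / 6) + 10 * (max 0 (x - real 2) ^ 3 / 6))
       = x ^ 3 / 3 - 5 / 3 * max 0 (x - 1) ^ 3 + 10 / 3 * max 0 (x - 2) ^ 3"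
    proof -
      have "max 0 (x - real 0) = x" using x(1) by simp
      then show ?thesis by simp
    qed
    ultimately show "(\<lambda>s. (B 0 0 s - 5 * B 1 0 s + 10 * B 2 0 s) + (B 0 1 s - 5 * B 1 1 s + 10 * B 2 1 s) + d s / (real p ^ s) ^ 3)
      \<longlonglongrightarrow> x ^ 3 / 3 - 5 / 3 * max 0 (x - 1) ^ 3 + 10 / 3 * max 0 (x - 2) ^ 3 + kernel_density p J (5 / 2 - x)"
      by (simp only:)
    show "\<forall>\<^sub>F s in sequentially. (B 0 0 s - 5 * B 1 0 s + 10 * B 2 0 s) + (B 0 1 s - 5 * B 1 1 s + 10 * B 2 1 s) + d s / (real p ^ s) ^ 3
      = hk_seq K p x s"
      using n2
    proof eventually_elim
      case (elim s)
      define q where "q = p ^ s"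
      define N where "N = n s - 2"
      have nN: "n s = N + 2" "n s - 1 = Suc N" "n s = Suc (Suc N)" unfolding N_def using elim by simp_all
      have N3: "Suc (Suc N) < 3 * q" using bound[of s] unfolding nN(1) q_def[symmetric] by presburger
      have "real (hk_piece_dim K q (N + 2)) + real (card (mon_deg q N)) = real (card (mon_deg q (N + 2))) + d s"
        unfolding d_def N_def[symmetric] q_def[symmetric] of_nat_add[symmetric] hk_piece_dim_kernel ..
      moreover have "real (card (mon_deg q (N + 2))) - real (card (mon_deg q N)) =
        (shifted_binom 0 (n s) - 5 * shifted_binom q (n s) + 10 * shifted_binom (2 * q) (n s))
        + (shifted_binom 0 (n s - 1) - 5 * shifted_binom q (n s - 1) + 10 * shifted_binom (2 * q) (n s - 1))"
      proof -
        have "Suc N < 3 * q" using N3 by simp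
        from card_mon_deg_diff[OF this] card_mon_deg_diff[OF N3] show ?thesis unfolding nN(2) unfolding nN(3) add_2_eq_Suc' by linarith
      qed
      ultimately have h: "real (hk_piece_dim K q (n s)) =
        (shifted_binom 0 (n s) - 5 * shifted_binom q (n s) + 10 * shifted_binom (2 * q) (n s))
        + (shifted_binom 0 (n s - 1) - 5 * shifted_binom q (n s - 1) + 10 * shifted_binom (2 * q) (n s - 1)) + d s"
        unfolding nN(1)[symmetric] by linarith
      have "hk_seq K p x s = real (hk_piece_dim K q (n s)) / real q ^ 3" unfolding hk_seq_def n_def q_def ..
      also have "\<dots> = (B 0 0 s - 5 * B 1 0 s + 10 * B 2 0 s) + (B 0 1 s - 5 * B 1 1 s + 10 * B 2 1 s) + d s / (real p ^ s) ^ 3"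
        unfolding h B_def q_def[symmetric] of_nat_power[symmetric]
        by (simp add: add_divide_distrib diff_divide_distrib)
      finally show ?case ..
    qed
  qed
qed

lemma hk_seq_0_tendsto:
  assumes p1: "p > 1"
  shows "hk_seq K p 0 \<longlonglongrightarrow> 0"
proof (rule tendsto_0_le)
  show "(\<lambda>s. 1 / real (p ^ s)) \<longlonglongrightarrow> 0" by (rule power_inverse_tendsto_0[OF p1])
  have "norm (hk_seq K p 0 s) \<le> norm (1 / real (p ^ s)) * 1" for s
  proof -
    define Q where "Q = real (p ^ s)"
    have Q: "Q \<ge> 1" unfolding Q_def using p1 by simp
    have "mon_deg (p ^ s) 0 \<subseteq> {\<lambda>_. 0}"
    proof
      fix e assume e: "e \<in> mon_deg (p ^ s) 0"
      have "e i = 0" for i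
      proof (cases "i < 5")
        case True
        have "(\<Sum>i<5. e i) = 0" using e unfolding mon_deg_def by blast
        then have "\<forall>i\<in>{..<5}. e i = 0" by (subst (asm) sum_eq_0_iff) simp_all
        then show ?thesis using True by simp
      next
        case False
        then have "5 \<le> i" by simp
        then show ?thesis using e unfolding mon_deg_def by blast
      qed
      then show "e \<in> {\<lambda>_. 0}" by blast
    qed
    then have "card (mon_deg (p ^ s) 0) \<le> card {\<lambda>_ :: nat. 0 :: nat}" by (intro card_mono) simp_all
    then have "hk_piece_dim K (p ^ s) 0 \<le> 1" unfolding hk_piece_dim_def by simp
    then have "real (hk_piece_dim K (p ^ s) 0) / Q ^ 3 \<le> 1 / Q ^ 3" using Q by (intro divide_right_mono) simp_all
    also have "\<dots> \<le> 1 / Q" using Q power_increasing[of 1 3 Q] by (intro divide_left_mono) simp_all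
    finally show ?thesis using Q unfolding hk_seq_def Q_def[symmetric] by simp
  qed
  then show "\<forall>\<^sub>F s in sequentially. norm (hk_seq K p 0 s) \<le> norm (1 / real (p ^ s)) * 1" by simp
qed

theorem theorem5p2:
  fixes K :: "'k::field itself" and p :: nat
  assumes char: "CHAR('k) = p" and p5: "p \<ge> 5"
    and perfect: "surj (\<lambda>y::'k. y ^ p)"
  defines "f \<equiv> hk_seq K p"
  shows
    "(\<forall>x::real. 0 \<le> x \<and> x < 1 \<longrightarrow> f x \<longlonglongrightarrow> x^3/3)
   \<and> (\<forall>x::real. 1 \<le> x \<and> x < 2 \<longrightarrow> f x \<longlonglongrightarrow> x^3/3 - 5/3*(x-1)^3)
   \<and> (\<forall>x::real. 2 \<le> x \<and> x < 2 + Pj p 1 \<longrightarrow>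
        f x \<longlonglongrightarrow> x^3/3 - 5/3*(x-1)^3 + 11/3*(x-2)^3)
   \<and> (\<forall>j\<ge>1. \<forall>x::real. 2 + Pj p j \<le> x \<and> x < 2 + Pj p (j+1) \<longrightarrow>
        f x \<longlonglongrightarrow> (3-x)^3/3
          + 4/3 * (\<Sum>i=1..j. (1/real p^i + Pj p i + 2 - x)^3 * mu_m1 p * mubar_m1 p^(i-1))
          + (8/3*(x - 2 - Pj p j)^3 - 4/real p^j * (x - 2 - Pj p j)^2
              + 2/(3*real p^(3*j))) * mubar_m1 p^j)
   \<and> (\<forall>j\<ge>1. \<forall>x::real. 2 + Pj p (j+1) + 1/real p^(j+1) \<le> x \<and> x < 2 + Pj p j + 1/real p^j \<longrightarrow>
        f x \<longlonglongrightarrow> (3-x)^3/3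
          + 4/3 * (\<Sum>i=1..j. (1/real p^i + Pj p i + 2 - x)^3 * mu_m1 p * mubar_m1 p^(i-1)))
   \<and> (\<forall>x::real. 2 + Pj p 1 + 1/real p \<le> x \<and> x < 3 \<longrightarrow> f x \<longlonglongrightarrow> (3-x)^3/3)
   \<and> (\<forall>x::real. 3 \<le> x \<longrightarrow> f x \<longlonglongrightarrow> 0)"
proof -
  have "prime CHAR('k)" using char p5 by (intro prime_CHAR_semidom) simp
  then have ch: "CHAR('k) = p" "prime p" "p \<ge> 3" using char p5 by simp_all
  have odd: "odd p" using ch(2,3) primes_dvd_imp_eq[OF two_is_prime_nat ch(2)] by auto
  have p1: "p > 1" "p > 0" using p5 by simp_all
  note mu = mu_m1_eq[OF odd p5]
  note P = Pj_eq[OF p1(2)]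
  note above = hk_seq_above_tendsto[OF ch, where K = K, folded f_def]
  note below = hk_seq_below_tendsto[OF ch, where K = K, folded f_def]
  have half: "1 / (2 * real p ^ i) \<le> 1 / 2" for i using half_power_le[OF p1(1)] .
  have pos: "0 < 1 / (2 * real p ^ i)" for i using p1 by simp
  have dbl: "1 / real p ^ i = 2 * (1 / (2 * real p ^ i))" for i by simp
  have dec: "1 / (2 * real p ^ (i + 1)) < 1 / (2 * real p ^ i)" for i
  proof -
    have "real p ^ i > 0" "real p ^ i < real p ^ (i + 1)" using p1 by simp_all
    then show ?thesis by (intro divide_strict_left_mono) simp_all
  qed
  show ?thesis
  proof (intro conjI allI impI)
    fix x :: real assume x: "0 \<le> x \<and> x < 1"
    show "f x \<longlonglongrightarrow> x^3/3"
    proof (cases "x = 0")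
      case True
      then show ?thesis unfolding f_def using hk_seq_0_tendsto[OF p1(1)] by simp
    next
      case False
      have "1 / (2 * real p ^ (0 + 1)) < 5 / 2 - x" using half[of "0 + 1"] x by linarith
      from below[OF _ _ this] show ?thesis using x False by (simp add: kernel_density_eq_0)
    qed
  next
    fix x :: real assume x: "1 \<le> x \<and> x < 2"
    have "1 / (2 * real p ^ (0 + 1)) < 5 / 2 - x" using half[of "0 + 1"] x by linarith
    from below[OF _ _ this] show "f x \<longlonglongrightarrow> x^3/3 - 5/3*(x-1)^3" using x by (simp add: kernel_density_eq_0)
  next
    fix x :: real assume x: "2 \<le> x \<and> x < 2 + Pj p 1"
    then have z: "1 / (2 * real p ^ (0 + 1)) < 5 / 2 - x" unfolding P by simp
    then have x5: "x < 5 / 2" using pos[of "0 + 1"] by linarith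
    have mx: "max 0 (x - 1) = x - 1" "max 0 (x - 2) = x - 2" using x by simp_all
    \<comment> \<open>Here only the central square contributes, and \<open>1/2 - z = x - 2\<close>.
      Its third of a cube turns the coefficient \<open>10/3\<close> into
      \<open>11/3\<close>.\<close>
    have k: "kernel_density p 0 (5 / 2 - x) = (x - 2) ^ 3 / 3"
    proof -
      have "1 / 2 - (5 / 2 - x) = x - 2" by simp
      then show ?thesis using kernel_density_0[of "5 / 2 - x" p] x by simp
    qed
    have eq: "A + 10 / 3 * B + B / 3 = A + 11 / 3 * B" for A B :: real by simp
    have x0: "0 < x" using x by simp
    show "f x \<longlonglongrightarrow> x^3/3 - 5/3*(x-1)^3 + 11/3*(x-2)^3" using below[OF x0 x5 z] unfolding mx k eq .
  next
    fix j :: nat and x :: real assume "1 \<le> j" and x: "2 + Pj p j \<le> x \<and> x < 2 + Pj p (j+1)"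
    have z: "1 / (2 * real p ^ (j + 1)) < 5 / 2 - x" "5 / 2 - x \<le> 1 / (2 * real p ^ j)"
      using x unfolding P by linarith+
    have x2: "2 \<le> x" "x < 5 / 2" using z half[of j] pos[of "j + 1"] by linarith+
    have mx: "max 0 (x - 1) = x - 1" "max 0 (x - 2) = x - 2" using x2 by simp_all
    have x0: "0 < x" using x2 by simp
    show "f x \<longlonglongrightarrow> (3-x)^3/3
          + 4/3 * (\<Sum>i=1..j. (1/real p^i + Pj p i + 2 - x)^3 * mu_m1 p * mubar_m1 p^(i-1))
          + (8/3*(x - 2 - Pj p j)^3 - 4/real p^j * (x - 2 - Pj p j)^2
              + 2/(3*real p^(3*j))) * mubar_m1 p^j"
      using below[OF x0 x2(2) z(1)] unfolding mx density_below[OF p1(1) z(2)] mu .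
  next
    fix j :: nat and x :: real
    assume "1 \<le> j" and x: "2 + Pj p (j+1) + 1/real p^(j+1) \<le> x \<and> x < 2 + Pj p j + 1/real p^j"
    have z: "1 / (2 * real p ^ (j + 1)) \<le> x - 5 / 2" "x - 5 / 2 \<le> 1 / (2 * real p ^ j)"
      using x unfolding P dbl by linarith+
    \<comment> \<open>The left end of the interval is included, so the cut-off is taken one step
      further to have a strict inequality.\<close>
    have z': "1 / (2 * real p ^ (Suc j + 1)) < x - 5 / 2" using z(1) dec[of "j + 1"] by simp
    have x5: "5 / 2 < x" using z(1) pos[of "j + 1"] by linarith
    show "f x \<longlonglongrightarrow> (3-x)^3/3
          + 4/3 * (\<Sum>i=1..j. (1/real p^i + Pj p i + 2 - x)^3 * mu_m1 p * mubar_m1 p^(i-1))"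
      using above[OF x5 z'] unfolding density_above[OF p1(1) z] mu .
  next
    fix x :: real assume x: "2 + Pj p 1 + 1/real p \<le> x \<and> x < 3"
    have "1 / real p = 2 * (1 / (2 * real p ^ 1))" by simp
    then have z: "1 / (2 * real p ^ (0 + 1)) \<le> x - 5 / 2" using x unfolding P by simp
    have z2: "x - 5 / 2 \<le> 1 / (2 * real p ^ 0)" using x by simp
    have z': "1 / (2 * real p ^ (Suc 0 + 1)) < x - 5 / 2" using z dec[of "0 + 1"] by simp
    have x5: "5 / 2 < x" using z pos[of "0 + 1"] by linarith
    show "f x \<longlonglongrightarrow> (3-x)^3/3"
      using above[OF x5 z'] unfolding density_above[OF p1(1) z z2] by simp
  next
    fix x :: real assume x: "3 \<le> x"
    have z: "1 / (2 * real p ^ (0 + 1)) < x - 5 / 2" using dec[of 0] x by simp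
    show "f x \<longlonglongrightarrow> 0"
      using above[OF _ z] x by (simp add: kernel_density_eq_0)
  qed
qed

end
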